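(* Fix two disjoint rectangles $I_1,I_2\subset\mathbb T^2$ with $m(I_1)m(I_2)>0$, curves $\gamma_0,\bar\gamma_0$ with distinct marked points $z_0,\bar z_0$, and the parameters described in the context (with $\eta_1>0$ sufficiently small and $0<\eta_2<1/10$). Fix $K_2\ge1$. One can choose $K_1$ sufficiently large, then $\eta>0$ sufficiently small, and $L_0$ sufficiently large, so that there exist $b,C_1,c_1,\delta_0>0$ such that, for every $L\ge L_0$ and $n\ge1$, $$\mathbb P\left(\#Y_n\le bn\right)\le C_1e^{-c_1n}.$$ Furthermore, if $i$ is a Young time, there exist subcurves $\gamma_0^+\subset\gamma_0$ and $\bar\gamma_0^+\subset\bar\gamma_0$, containing $z_0$ and $\bar z_0$ respectively, such that $$F_\omega^{i+K_1}(\gamma_0^+)\cap I_1\ne\emptyset,\qquad F_\omega^{i+K_1}(\bar\gamma_0^+)\cap I_2\ne\emptyset .$$ Both image curves have length $2\delta_0$, and all their tangent directions lie in $B_{C_\eta/L}(0)$, for some constant $C_\eta$ independent of $L$.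
   Context: **Random standard map.** For $L>0$ and $\delta>0$ (fixed, sufficiently small) put $\sigma:=L^{-\delta}$, $f(x):=L\cos(2\pi x)$. $\Omega:=[-\sigma,\sigma]^{\mathbb N_0}$ carries the product probability measure $\mathbb P$ with uniform marginals; $\vartheta$ is the left shift. $f_\omega(x,y)=(f(x+\omega_0)-y,\;x+\omega_0)\pmod1$ on $\mathbb T^2$, $f_\omega^n=f_{\omega_{n-1}}\circ\cdots\circ f_{\omega_0}$. Put $F_\omega:=f_\omega^3$ over the shift $\vartheta^3$, so $F_\omega^n=f_\omega^{3n}$, and $A_n(\omega,z):=DF_\omega^n(z)$, $A_0=\mathrm{Id}$. $m$ is normalized Lebesgue measure on $\mathbb T^2$, $\pi_x$ is the projection to the $x$-coordinate, $d$ is the distance on $\mathbb T^2$ or $\mathbb T$, and $B_r(0)\subset\mathbb P^1$ is the ball of radius $r$ about the horizontal direction. **Reverse-tempered splitting.** $\{A_n(\omega,z)\}_{n=0}^N$ admits a $(C,\alpha,\varepsilon)$-reverse-tempered splitting if there are unit vectors $s_N,u_N$ such that for all $0\le k\le m\le N$: $\|A_ms_N\|/\|A_ks_N\|\le e^CL^3L^{3\varepsilon(N-k)}L^{-\alpha(m-k)}$, $\|A_mu_N\|/\|A_ku_N\|\ge e^{-C}L^{-3}L^{-3\varepsilon(N-k)}L^{\alpha(m-k)}$, and $\angle(A_ms_N,A_mu_N)\ge e^{-C}L^{-3}L^{-3\varepsilon(N-k)}$. **Hyperbolic times.** Fix $\ell_0,K_0>0$. An admissible curve is an embedded $C^2$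 curve $\gamma:[-\ell_0,\ell_0]\to\mathbb T^2$ parametrized by arclength with $\|\gamma''\|_\infty\le K_0$; its marked point is $z=\gamma(0)$. For constants $0<\alpha<24/25$, $C>0$, $\varepsilon,\varepsilon'>0$, $n_0\ge1$ put $\tau_0(\gamma)=0$ and let $\tau_j(\gamma)(\omega)$ be the least integer $m>\tau_{j-1}(\gamma)(\omega)$ such that $m\ge n_0$ and $\{A_n(\omega,z)\}_{n=0}^m$ admits a $(C,\alpha,\varepsilon)$-reverse-tempered splitting with most contracting direction $s_m$ (the stable vector of the splitting, a most contracted singular direction of $A_m$) satisfying $\angle(\gamma'(0),s_m)\ge L^{-\varepsilon'm}$. The constants are fixed (independently of $L$) so that the following two facts hold. (G) Growth: there are $a,b>0$ such that, for all large $L$, if $N\ge n_0$, $\{A_n(\omega,z)\}_{n=0}^N$ admits a $(C,\alpha,\varepsilon)$-reverse-tempered splitting with stable direction $s_N$, and $\gamma$ is an admissible curve with $\gamma(0)=z$ and $\angle(\gamma'(0),s_N)\ge L^{-\varepsilon'N}$, then $F_\omega^N(\gamma)$ contains a subcurve $\gamma_N$ through $F_\omega^N(z)$ with, in arclength parametrization, $\|\gamma_N''\|_\infty\le L^a$ and length at least $L^{-b}$. (T) Frequency: for every sufficiently small $\delta_1>0$ there are $c,L_1,n_1>0$ with $\mathbb P(\#\{k\ge1:\tau_k(\gamma)\le n\}\le(1-\delta_1)n)\le L^{-cn}$ for all $L\ge L_1$, $n\ge n_1$, and all admissible $\gamma$. **Simultaneous hyperbolic times.** Let $\gamma_0,\bar\gamma_0$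 be fixed admissible curves with distinct marked points $z_0,\bar z_0$; write $z_i=(x_i,y_i)=F_\omega^i(z_0)$, $\bar z_i=(\bar x_i,\bar y_i)=F_\omega^i(\bar z_0)$, and let $v_i,\bar v_i\in\mathbb P^1$ be the images under $DF_\omega^i$ of the tangent directions of $\gamma_0$ at $z_0$ and $\bar\gamma_0$ at $\bar z_0$. For $\eta>0$ let $\mathcal G_\eta:=\{x\in\mathbb T:d(x,0)<\eta\text{ or }d(x,\tfrac12)<\eta\}$. With $H_n(\gamma):=\{\tau_j(\gamma):j\ge1\}\cap\{1,\dots,n\}$, set $$\widetilde H_n:=H_n(\gamma_0)\cap H_n(\bar\gamma_0)\cap\{1\le i\le n:\ d(z_i,\bar z_i)>\eta_1,\ v_i,\bar v_i\in B_{\eta_2}(0),\ x_i,\bar x_i\notin\mathcal G_{2\eta}\}.$$ **Young times.** Given positive integers $K_1,K_2$, let $K:=K_1+K_2$, $\widetilde H:=\bigcup_n\widetilde H_n$, $r_0:=0$, $r_{j+1}:=\inf\{m\in\widetilde H:m>r_j+K\}$. For points $z,\bar z$ and integers $k<l$ let $$\mathcal A_{k,l}(\eta;z,\bar z):=\bigcap_{r=3k}^{3l-1}\{\pi_xf_\omega^r(z)+\omega_r\notin\mathcal G_\eta,\ \pi_xf_\omega^r(\bar z)+\omega_r\notin\mathcal G_\eta\},$$ $$E(z,\bar z):=\{F_\omega^{K_1}(z)\in I_1,\ F_\omega^{K_1}(\bar z)\in I_2\}\cap\mathcal A_{0,K}(\eta;z,\bar z).$$ An integer $i$ is a Young time (for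 $\omega$) if $i=r_j$ for some $j\ge1$ and $\vartheta^{3i}\omega\in E(z_i,\bar z_i)$. $Y_n$ is the set of Young times at most $n$. *)

theory Defs
  imports "HOL-Probability.Probability"
begin

section \<open>The torus\<close>

text \<open>The torus \<open>\<real>\<^sup>2/\<int>\<^sup>2\<close> is represented by the fundamental domain \<open>[0,1) \<times> [0,1)\<close>.  Curves in the torus are given by their lifts
  \<open>real \<Rightarrow> real \<times> real\<close>; a lift \<open>g\<close> describes the curve \<open>torus_proj \<circ> g\<close>.\<close>

definition torus_proj :: "real \<times> real \<Rightarrow> real \<times> real" where
  "torus_proj z = (frac (fst z), frac (snd z))"

definition torus_measure :: "(real \<times> real) measure" where
  "torus_measure = restrict_space lborel ({0..<1} \<times> {0..<1})"

definition circle_dist :: "real \<Rightarrow> real \<Rightarrow> real" where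
  "circle_dist x y = infdist (x - y) \<int>"

definition torus_dist :: "real \<times> real \<Rightarrow> real \<times> real \<Rightarrow> real" where
  "torus_dist z w = infdist (z - w) (\<int> \<times> \<int>)"

definition torus_rectangle :: "(real \<times> real) set \<Rightarrow> bool" where
  "torus_rectangle I \<longleftrightarrow> (\<exists>A B. is_interval A \<and> is_interval B \<and> I = torus_proj ` (A \<times> B))"

text \<open>The angle between the lines spanned by two nonzero vectors, a value in \<open>[0, pi/2]\<close>; this is
  the metric on the projective line.\<close>

definition line_angle :: "real \<times> real \<Rightarrow> real \<times> real \<Rightarrow> real" where
  "line_angle v w = arccos (\<bar>v \<bullet> w\<bar> / (norm v * norm w))"

definition horizontal_ball :: "real \<Rightarrow> (real \<times> real) set" where
  "horizontal_ball r = {v. v \<noteq> 0 \<and> line_angle v (1, 0) < r}"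


section \<open>The random standard map\<close>

definition noise_interval :: "real \<Rightarrow> real \<Rightarrow> real set" where
  "noise_interval \<delta> L = {- (L powr - \<delta>)..L powr - \<delta>}"

definition noise :: "real \<Rightarrow> real \<Rightarrow> (nat \<Rightarrow> real) measure" where
  "noise \<delta> L = (\<Pi>\<^sub>M n\<in>UNIV. uniform_measure
     (restrict_space lborel (noise_interval \<delta> L)) (noise_interval \<delta> L))"

lemma space_noise: "space (noise \<delta> L) = {\<omega>. \<forall>n. \<omega> n \<in> {- (L powr - \<delta>)..L powr - \<delta>}}"
  by (auto simp: noise_def noise_interval_def space_PiM space_restrict_space PiE_def Pi_def)

lemma prob_space_noise:
  assumes "L > 0"
  shows "prob_space (noise \<delta> L)"
  unfolding noise_def noise_interval_def using assms
  by (intro prob_space_PiM prob_space_uniform_measure)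
     (simp_all add: emeasure_restrict_space)

definition shift :: "nat \<Rightarrow> (nat \<Rightarrow> real) \<Rightarrow> (nat \<Rightarrow> real)" where
  "shift k \<omega> = (\<lambda>n. \<omega> (n + k))"

definition std_lift :: "real \<Rightarrow> real \<Rightarrow> real \<times> real \<Rightarrow> real \<times> real" where
  "std_lift L w z = (L * cos (2 * pi * (fst z + w)) - snd z, fst z + w)"

definition std_map :: "real \<Rightarrow> real \<Rightarrow> real \<times> real \<Rightarrow> real \<times> real" where
  "std_map L w z = torus_proj (std_lift L w z)"

primrec lift_iter :: "real \<Rightarrow> (nat \<Rightarrow> real) \<Rightarrow> nat \<Rightarrow> real \<times> real \<Rightarrow> real \<times> real" where
  "lift_iter L \<omega> 0 z = z"
| "lift_iter L \<omega> (Suc n) z = std_lift L (\<omega> n) (lift_iter L \<omega> n z)"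

primrec std_iter :: "real \<Rightarrow> (nat \<Rightarrow> real) \<Rightarrow> nat \<Rightarrow> real \<times> real \<Rightarrow> real \<times> real" where
  "std_iter L \<omega> 0 z = z"
| "std_iter L \<omega> (Suc n) z = std_map L (\<omega> n) (std_iter L \<omega> n z)"

lemma std_map_torus_proj: "std_map L w (torus_proj z) = torus_proj (std_lift L w z)"
proof -
  have "cos (2 * pi * (frac x + w)) = cos (2 * pi * (x + w))" for x
  proof -
    have "cos (2 * pi * (frac x + w)) = cos (2 * pi * (x + w) - 2 * pi * of_int \<lfloor>x\<rfloor>)"
      by (simp add: frac_def algebra_simps)
    also have "\<dots> = cos (2 * pi * (x + w))"
      by (simp add: cos_diff)
    finally show ?thesis .
  qed
  then show ?thesis
    by (simp add: std_map_def std_lift_def torus_proj_def frac_diff_simp)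
qed

text \<open>The maps \<open>lift_iter\<close> are lifts of the maps \<open>std_iter\<close> to the universal cover.\<close>

lemma std_iter_torus_proj: "std_iter L \<omega> n (torus_proj z) = torus_proj (lift_iter L \<omega> n z)"
  by (induction n) (simp_all add: std_map_torus_proj)

definition F_iter :: "real \<Rightarrow> (nat \<Rightarrow> real) \<Rightarrow> nat \<Rightarrow> real \<times> real \<Rightarrow> real \<times> real" where
  "F_iter L \<omega> n = std_iter L \<omega> (3 * n)"

definition F_lift :: "real \<Rightarrow> (nat \<Rightarrow> real) \<Rightarrow> nat \<Rightarrow> real \<times> real \<Rightarrow> real \<times> real" where
  "F_lift L \<omega> n = lift_iter L \<omega> (3 * n)"

text \<open>The derivative on the torus is that of the lift.\<close>

definition DF :: "real \<Rightarrow> (nat \<Rightarrow> real) \<Rightarrow> nat \<Rightarrow> real \<times> real \<Rightarrow> (real \<times> real \<Rightarrow> real \<times> real)" where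
  "DF L \<omega> n z = frechet_derivative (F_lift L \<omega> n) (at z)"

definition crit_nbhd :: "real \<Rightarrow> real set" where
  "crit_nbhd \<eta> = {x. circle_dist x 0 < \<eta> \<or> circle_dist x (1/2) < \<eta>}"


section \<open>Curves\<close>

text \<open>A \<open>C\<^sup>2\<close> curve on \<open>[a,b]\<close> parametrized by arclength whose second derivative is bounded
  by \<open>\<kappa>\<close>.\<close>

definition arclength_C2 :: "real \<Rightarrow> real \<Rightarrow> real \<Rightarrow> (real \<Rightarrow> real \<times> real) \<Rightarrow> bool" where
  "arclength_C2 a b \<kappa> g \<longleftrightarrow> (\<exists>g' g''.
     (\<forall>t\<in>{a..b}. (g has_vector_derivative g' t) (at t within {a..b}) \<and>
                 (g' has_vector_derivative g'' t) (at t within {a..b}) \<and>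
                 norm (g' t) = 1 \<and> norm (g'' t) \<le> \<kappa>) \<and>
     continuous_on {a..b} g'')"

definition curve_length :: "(real \<Rightarrow> real \<times> real) \<Rightarrow> real \<Rightarrow> real \<Rightarrow> real" where
  "curve_length g a b = integral {a..b} (\<lambda>t. norm (vector_derivative g (at t within {a..b})))"

text \<open>The constants \<open>\<ell>\<^sub>0\<close>, \<open>K\<^sub>0\<close>, \<open>\<alpha>\<close>, \<open>C\<close>, \<open>\<epsilon>\<close>, \<open>\<epsilon>'\<close>, \<open>n\<^sub>0\<close> in the definition of admissible
  curves and hyperbolic times.\<close>

record hyp_consts =
  ell0 :: real
  curv0 :: real
  alpha :: real
  Csplit :: real
  eps :: real
  eps_angle :: real
  nmin :: nat

definition consts_in_range :: "hyp_consts \<Rightarrow> bool" where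
  "consts_in_range c \<longleftrightarrow> ell0 c > 0 \<and> curv0 c > 0 \<and> 0 < alpha c \<and> alpha c < 24/25 \<and>
     Csplit c > 0 \<and> eps c > 0 \<and> eps_angle c > 0 \<and> nmin c \<ge> 1"

definition admissible :: "hyp_consts \<Rightarrow> (real \<Rightarrow> real \<times> real) \<Rightarrow> bool" where
  "admissible c \<gamma> \<longleftrightarrow> arclength_C2 (- ell0 c) (ell0 c) (curv0 c) \<gamma> \<and>
     inj_on (torus_proj \<circ> \<gamma>) {- ell0 c..ell0 c}"

text \<open>Curves enter below only through their values on \<open>[-\<ell>\<^sub>0, \<ell>\<^sub>0]\<close>; since \<open>\<ell>\<^sub>0 > 0\<close>, the
  derivative at the interior point \<open>0\<close> is two-sided.\<close>

definition marked_point :: "(real \<Rightarrow> real \<times> real) \<Rightarrow> real \<times> real" where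
  "marked_point \<gamma> = torus_proj (\<gamma> 0)"

definition marked_tangent :: "(real \<Rightarrow> real \<times> real) \<Rightarrow> real \<times> real" where
  "marked_tangent \<gamma> = vector_derivative \<gamma> (at 0)"


section \<open>Reverse-tempered splittings and hyperbolic times\<close>

definition rt_splitting ::
  "hyp_consts \<Rightarrow> real \<Rightarrow> (nat \<Rightarrow> real) \<Rightarrow> real \<times> real \<Rightarrow> nat \<Rightarrow> real \<times> real \<Rightarrow> real \<times> real \<Rightarrow> bool"
  where
  "rt_splitting c L \<omega> z N s u \<longleftrightarrow> norm s = 1 \<and> norm u = 1 \<and>
     (\<forall>m k. k \<le> m \<and> m \<le> N \<longrightarrow>
        norm (DF L \<omega> m z s) / norm (DF L \<omega> k z s)
          \<le> exp (Csplit c) * L ^ 3 * L powr (3 * eps c * real (N - k))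
              * L powr (- (alpha c) * real (m - k)) \<and>
        norm (DF L \<omega> m z u) / norm (DF L \<omega> k z u)
          \<ge> exp (- Csplit c) * L powr (-3) * L powr (-3 * eps c * real (N - k))
              * L powr (alpha c * real (m - k)) \<and>
        line_angle (DF L \<omega> m z s) (DF L \<omega> m z u)
          \<ge> exp (- Csplit c) * L powr (-3) * L powr (-3 * eps c * real (N - k)))"

definition most_contracted :: "(real \<times> real \<Rightarrow> real \<times> real) \<Rightarrow> real \<times> real \<Rightarrow> bool" where
  "most_contracted A s \<longleftrightarrow> norm s = 1 \<and> (\<forall>v. norm v = 1 \<longrightarrow> norm (A s) \<le> norm (A v))"

definition hyperbolic_at ::
  "hyp_consts \<Rightarrow> real \<Rightarrow> (nat \<Rightarrow> real) \<Rightarrow> (real \<Rightarrow> real \<times> real) \<Rightarrow> nat \<Rightarrow> bool" where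
  "hyperbolic_at c L \<omega> \<gamma> m \<longleftrightarrow> nmin c \<le> m \<and>
     (\<exists>s u. rt_splitting c L \<omega> (marked_point \<gamma>) m s u \<and>
            most_contracted (DF L \<omega> m (marked_point \<gamma>)) s \<and>
            line_angle (marked_tangent \<gamma>) s \<ge> L powr (- (eps_angle c) * real m))"

text \<open>The hyperbolic times \<open>\<tau>\<^sub>j\<close>; the value \<open>\<infinity>\<close> means that there are fewer than \<open>j\<close> of them.\<close>

primrec tau :: "hyp_consts \<Rightarrow> real \<Rightarrow> (nat \<Rightarrow> real) \<Rightarrow> (real \<Rightarrow> real \<times> real) \<Rightarrow> nat \<Rightarrow> enat" where
  "tau c L \<omega> \<gamma> 0 = 0"
| "tau c L \<omega> \<gamma> (Suc j) = Inf {enat m |m. enat m > tau c L \<omega> \<gamma> j \<and> hyperbolic_at c L \<omega> \<gamma> m}"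

definition growth_property :: "real \<Rightarrow> hyp_consts \<Rightarrow> bool" where
  "growth_property \<delta> c \<longleftrightarrow> (\<exists>a>0. \<exists>b>0. \<exists>L\<^sub>2>0. \<forall>L\<ge>L\<^sub>2. \<forall>\<omega>\<in>space (noise \<delta> L). \<forall>\<gamma> N s u.
     admissible c \<gamma> \<and> N \<ge> nmin c \<and> rt_splitting c L \<omega> (marked_point \<gamma>) N s u \<and>
     line_angle (marked_tangent \<gamma>) s \<ge> L powr (- (eps_angle c) * real N) \<longrightarrow>
     (\<exists>p q l \<beta>. - ell0 c \<le> p \<and> p \<le> 0 \<and> 0 \<le> q \<and> q \<le> ell0 c \<and>
        l = curve_length (F_lift L \<omega> N \<circ> \<gamma>) p q \<and> l \<ge> L powr (- b) \<and>
        arclength_C2 0 l (L powr a) \<beta> \<and>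
        (\<forall>t\<in>{p..q}. F_lift L \<omega> N (\<gamma> t) = \<beta> (curve_length (F_lift L \<omega> N \<circ> \<gamma>) p t))))"

definition frequency_property :: "real \<Rightarrow> hyp_consts \<Rightarrow> bool" where
  "frequency_property \<delta> c \<longleftrightarrow> (\<exists>d>0. \<forall>\<delta>\<^sub>1. 0 < \<delta>\<^sub>1 \<and> \<delta>\<^sub>1 < d \<longrightarrow>
     (\<exists>c\<^sub>0>0. \<exists>L\<^sub>1>0. \<exists>n\<^sub>1>0. \<forall>L\<ge>L\<^sub>1. \<forall>n\<ge>n\<^sub>1. \<forall>\<gamma>. admissible c \<gamma> \<longrightarrow>
        measure (noise \<delta> L)
          {\<omega>\<in>space (noise \<delta> L).
             real (card {k. k \<ge> 1 \<and> tau c L \<omega> \<gamma> k \<le> enat n}) \<le> (1 - \<delta>\<^sub>1) * real n}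
          \<le> L powr (- c\<^sub>0 * real n)))"


section \<open>Simultaneous hyperbolic times and Young times\<close>

definition hyp_times ::
  "hyp_consts \<Rightarrow> real \<Rightarrow> (nat \<Rightarrow> real) \<Rightarrow> (real \<Rightarrow> real \<times> real) \<Rightarrow> nat \<Rightarrow> nat set" where
  "hyp_times c L \<omega> \<gamma> n = {i. \<exists>j\<ge>1. tau c L \<omega> \<gamma> j = enat i} \<inter> {1..n}"

record pair_consts =
  curve1 :: "real \<Rightarrow> real \<times> real"
  curve2 :: "real \<Rightarrow> real \<times> real"
  rect1 :: "(real \<times> real) set"
  rect2 :: "(real \<times> real) set"
  eta1 :: real
  eta2 :: real
  eta :: real
  K1 :: nat
  K2 :: nat

definition orbit_ok ::
  "pair_consts \<Rightarrow> real \<Rightarrow> (nat \<Rightarrow> real) \<Rightarrow> nat \<Rightarrow> bool" where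
  "orbit_ok P L \<omega> i \<longleftrightarrow>
     (let z = marked_point (curve1 P); z' = marked_point (curve2 P);
          zi = F_iter L \<omega> i z; zi' = F_iter L \<omega> i z';
          vi = DF L \<omega> i z (marked_tangent (curve1 P));
          vi' = DF L \<omega> i z' (marked_tangent (curve2 P))
      in torus_dist zi zi' > eta1 P \<and>
         vi \<in> horizontal_ball (eta2 P) \<and> vi' \<in> horizontal_ball (eta2 P) \<and>
         fst zi \<notin> crit_nbhd (2 * eta P) \<and> fst zi' \<notin> crit_nbhd (2 * eta P))"

definition sim_times ::
  "hyp_consts \<Rightarrow> pair_consts \<Rightarrow> real \<Rightarrow> (nat \<Rightarrow> real) \<Rightarrow> nat \<Rightarrow> nat set" where
  "sim_times c P L \<omega> n = hyp_times c L \<omega> (curve1 P) n \<inter> hyp_times c L \<omega> (curve2 P) n \<inter>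
     {i\<in>{1..n}. orbit_ok P L \<omega> i}"

primrec renewal_time ::
  "hyp_consts \<Rightarrow> pair_consts \<Rightarrow> real \<Rightarrow> (nat \<Rightarrow> real) \<Rightarrow> nat \<Rightarrow> enat" where
  "renewal_time c P L \<omega> 0 = 0"
| "renewal_time c P L \<omega> (Suc j) =
     Inf {enat m |m. m \<in> (\<Union>n. sim_times c P L \<omega> n) \<and>
                     enat m > renewal_time c P L \<omega> j + enat (K1 P + K2 P)}"

definition avoid_event ::
  "real \<Rightarrow> real \<Rightarrow> nat \<Rightarrow> nat \<Rightarrow> real \<Rightarrow> real \<times> real \<Rightarrow> real \<times> real \<Rightarrow> (nat \<Rightarrow> real) set" where
  "avoid_event \<delta> L k l \<eta> z z' = {\<omega>\<in>space (noise \<delta> L). \<forall>r\<in>{3 * k..<3 * l}.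
     fst (std_iter L \<omega> r z) + \<omega> r \<notin> crit_nbhd \<eta> \<and> fst (std_iter L \<omega> r z') + \<omega> r \<notin> crit_nbhd \<eta>}"

definition young_event ::
  "real \<Rightarrow> pair_consts \<Rightarrow> real \<Rightarrow> real \<times> real \<Rightarrow> real \<times> real \<Rightarrow> (nat \<Rightarrow> real) set" where
  "young_event \<delta> P L z z' = {\<omega>\<in>space (noise \<delta> L).
     F_iter L \<omega> (K1 P) z \<in> rect1 P \<and> F_iter L \<omega> (K1 P) z' \<in> rect2 P} \<inter>
     avoid_event \<delta> L 0 (K1 P + K2 P) (eta P) z z'"

definition young_time ::
  "real \<Rightarrow> hyp_consts \<Rightarrow> pair_consts \<Rightarrow> real \<Rightarrow> (nat \<Rightarrow> real) \<Rightarrow> nat \<Rightarrow> bool" where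
  "young_time \<delta> c P L \<omega> i \<longleftrightarrow> (\<exists>j\<ge>1. renewal_time c P L \<omega> j = enat i) \<and>
     shift (3 * i) \<omega> \<in> young_event \<delta> P L
       (F_iter L \<omega> i (marked_point (curve1 P))) (F_iter L \<omega> i (marked_point (curve2 P)))"

definition young_times ::
  "real \<Rightarrow> hyp_consts \<Rightarrow> pair_consts \<Rightarrow> real \<Rightarrow> (nat \<Rightarrow> real) \<Rightarrow> nat \<Rightarrow> nat set" where
  "young_times \<delta> c P L \<omega> n = {i. i \<le> n \<and> young_time \<delta> c P L \<omega> i}"

text \<open>The subcurve of \<open>\<gamma>\<close> over \<open>[p,q]\<close>, which contains the marked point, is mapped by the \<open>N\<close>-th
  iterate to a curve of length \<open>len\<close> that meets \<open>I\<close> and whose tangent directions are within \<open>r\<close>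
  of the horizontal.\<close>

definition good_subcurve ::
  "hyp_consts \<Rightarrow> real \<Rightarrow> (nat \<Rightarrow> real) \<Rightarrow> (real \<Rightarrow> real \<times> real) \<Rightarrow> nat \<Rightarrow> (real \<times> real) set \<Rightarrow>
   real \<Rightarrow> real \<Rightarrow> real \<Rightarrow> real \<Rightarrow> bool" where
  "good_subcurve c L \<omega> \<gamma> N I len r p q \<longleftrightarrow>
     - ell0 c \<le> p \<and> p \<le> 0 \<and> 0 \<le> q \<and> q \<le> ell0 c \<and>
     F_iter L \<omega> N ` (torus_proj ` \<gamma> ` {p..q}) \<inter> I \<noteq> {} \<and>
     curve_length (F_lift L \<omega> N \<circ> \<gamma>) p q = len \<and>
     (\<forall>t\<in>{p..q}. vector_derivative (F_lift L \<omega> N \<circ> \<gamma>) (at t within {p..q}) \<in> horizontal_ball r)"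

end

theory Submission
  imports Defs "HOL-Real_Asymp.Real_Asymp"
begin

text \<open>Given the past, the difference of the next \<open>x\<close>-coordinates of the two orbits is
  \<open>B cos (2 \<pi> \<omega>\<^sub>n + \<phi>)\<close> minus a constant, with \<open>B\<close> proportional to \<open>L \<bar>sin (\<pi> (x\<^sub>n - x'\<^sub>n))\<bar>\<close>.
  Since the noise amplitude \<open>L powr -\<delta>\<close> is much larger than \<open>1 / L\<close>, a van der Corput estimate for
  such a phase, inserted into nonnegative trigonometric polynomials (powers of the cosine), has two
  consequences for a single noise coordinate.  Up to a small probability, a step enlarges a
  microscopic separation by a power of \<open>L\<close>, keeps a macroscopic one, turns directions into the
  horizontal cone and avoids the critical set; and the orbits hit prescribed targets with a
  probability bounded below independently of \<open>L\<close>.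

  An exponential supermartingale over the noise coordinates turns the first consequence into a bound
  for the number of bad steps.  With the frequency property, the simultaneous hyperbolic times have
  density close to one, hence linearly many renewal times \<open>r\<^sub>j\<close> occur.  Each of them starts
  a chain of target conditions that succeeds with a conditional probability bounded below, and the
  same supermartingale argument gives linearly many Young times.

  For the curves, the growth property yields an image curve of length at least \<open>L powr -b\<close> and
  curvature at most \<open>L powr a\<close>, so its directions near the marked point stay in the horizontal
  cone.  As long as it stays near an orbit avoiding the critical set, each step lengthens it by
  a factor comparable to \<open>L\<close>; for \<open>K\<^sub>1\<close> large compared with \<open>a + b\<close> it reaches macroscopic length,
  and by the intermediate value theorem it can be cut so that this length is a prescribed one.\<close>

section \<open>Distance on the circle and uniform noise\<close>

text \<open>The noise interval shrinks as \<open>L\<close> grows, so the noise does not spread a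
  coordinate by itself; only its image under a map of slope of order \<open>L\<close> wraps around
  the circle. Each oscillation estimate must beat the loss
  \<open>1 / \<sigma> \<le> L powr (1/100)\<close>, whence the bound on \<delta>. The rates in the
  conclusion do not depend on \<open>L\<close>, so the hits use the mean of a fixed cosine
  polynomial, not a power of \<open>L\<close>. Two obstacles shape the chain of targets. A second
  coordinate is the previous first coordinate plus noise, so a point of a rectangle is reached by
  aiming two consecutive first coordinates. And both orbits see the same noise: for
  \<open>x - x'\<close> near 0 or 1/2 the two cosines are nearly equal or opposite and cannot be
  steered separately. Hence the difference is held near 1/4 before the last steps, and the second
  coordinates of the two targets are chosen apart modulo 1/2. The thresholds for bad steps are tuned
  so that typically fewer than \<open>n / 100\<close> of the \<open>3 * n\<close> single steps are
  bad, each spoiling at most ten times, up to an additive constant.\<close>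

definition circle_norm :: "real \<Rightarrow> real" where
  "circle_norm x = infdist x \<int>"

lemma circle_dist_eq_norm: "circle_dist x y = circle_norm (x - y)"
  by (simp add: circle_dist_def circle_norm_def)

lemma circle_norm_le_Ints: "m \<in> \<int> \<Longrightarrow> circle_norm x \<le> \<bar>x - m\<bar>"
  unfolding circle_norm_def using infdist_le[of m "\<int>" x] by (simp add: dist_real_def)

lemma circle_norm_le_int: "circle_norm x \<le> \<bar>x - of_int m\<bar>"
  by (rule circle_norm_le_Ints) simp

lemma circle_norm_le_abs: "circle_norm x \<le> \<bar>x\<bar>"
  using circle_norm_le_int[of x 0] by simp

lemma circle_norm_nonneg [simp]: "0 \<le> circle_norm x"
  by (simp add: circle_norm_def infdist_nonneg)

lemma circle_norm_attained: obtains m :: int where "circle_norm x = \<bar>x - of_int m\<bar>"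
proof -
  have "closed (\<int>::real set)" by simp
  then obtain y where "y \<in> \<int>" "infdist x \<int> = dist x y"
    using infdist_attains_inf[of "\<int>::real set" x] by (metis Ints_0 empty_iff)
  then show ?thesis
    using that by (auto simp: circle_norm_def dist_real_def elim!: Ints_cases)
qed

lemma circle_norm_le_half: "circle_norm x \<le> 1/2"
proof -
  have "circle_norm x \<le> \<bar>x - of_int (round x)\<bar>" by (rule circle_norm_le_int)
  also have "\<dots> \<le> 1/2" using of_int_round_abs_le[of x] by (simp add: abs_minus_commute)
  finally show ?thesis .
qed

lemma circle_norm_triangle: "circle_norm (x + y) \<le> circle_norm x + circle_norm y"
proof -
  obtain m n :: int where mn: "circle_norm x = \<bar>x - of_int m\<bar>" "circle_norm y = \<bar>y - of_int n\<bar>"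
    by (metis circle_norm_attained)
  show ?thesis
    using circle_norm_le_int[of "x + y" "m + n"] mn by simp
qed

lemma circle_norm_uminus [simp]: "circle_norm (- x) = circle_norm x"
proof -
  have "circle_norm (- x) \<le> circle_norm x" for x
  proof -
    obtain m :: int where m: "circle_norm x = \<bar>x - of_int m\<bar>"
      by (metis circle_norm_attained)
    show ?thesis using circle_norm_le_int[of "-x" "-m"] m by simp
  qed
  from this[of x] this[of "-x"] show ?thesis by simp
qed

lemma circle_norm_add_Ints:
  assumes "m \<in> \<int>" shows "circle_norm (x + m) = circle_norm x"
proof -
  have "circle_norm m = 0" "circle_norm (-m) = 0"
    using circle_norm_le_Ints[OF assms, of m] by (simp_all add: order_antisym)
  then show ?thesis
    using circle_norm_triangle[of x m] circle_norm_triangle[of "x + m" "-m"] by simp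
qed

lemma circle_norm_minus_Ints:
  assumes "m \<in> \<int>" shows "circle_norm (x - m) = circle_norm x"
  using circle_norm_add_Ints[of "-m" x] assms by simp

lemma circle_norm_diff_le: "\<bar>circle_norm x - circle_norm y\<bar> \<le> \<bar>x - y\<bar>"
  using circle_norm_triangle[of y "x - y"] circle_norm_triangle[of x "y - x"]
    circle_norm_le_abs[of "x - y"] circle_norm_le_abs[of "y - x"] by (simp add: abs_le_iff)

lemma continuous_circle_norm [continuous_intros]:
  "continuous_on A f \<Longrightarrow> continuous_on A (\<lambda>x. circle_norm (f x))"
  unfolding circle_norm_def by (intro continuous_intros)

lemma circle_norm_mult_le: "circle_norm (2 * x) \<le> 2 * circle_norm x"
  using circle_norm_triangle[of x x] by simp

lemma abs_sin_diff_pi_int: "\<bar>sin (pi * (x - of_int m))\<bar> = \<bar>sin (pi * x)\<bar>"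
proof -
  have "sin (pi * (x - of_int m)) = sin (pi * x) * cos (pi * of_int m)"
    by (simp only: right_diff_distrib sin_diff) simp
  then show ?thesis by (simp add: abs_mult)
qed

text \<open>Weaker than the sharp bound \<open>2 * t\<close>, so a cubic Taylor estimate suffices:
  for \<open>y \<le> 1.6\<close> the error \<open>y^3 / 6\<close> leaves at least
  \<open>y / 3\<close>, and \<open>pi > 3\<close>.\<close>

lemma sin_ge_third:
  assumes "0 \<le> t" "t \<le> 1/2" shows "t \<le> sin (pi * t)"
proof -
  define y where "y = pi * t"
  have pi: "3 < pi" "pi < 3.2" using pi_gt3 pi_approx by simp_all
  have "pi * t \<le> 3.2 * (1/2)" using assms pi by (intro mult_mono) auto
  then have y: "0 \<le> y" "y \<le> 1.6" using assms by (auto simp: y_def)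
  have "\<bar>sin y - (\<Sum>m<3. sin_coeff m * y ^ m)\<bar> \<le> inverse (fact 3) * \<bar>y\<bar> ^ 3"
    by (rule Maclaurin_sin_bound)
  then have 1: "\<bar>sin y - y\<bar> \<le> y^3 / 6"
    using y by (simp add: numeral_eq_Suc sin_coeff_def field_simps)
  have "y^3 = y * y^2" by (simp add: power3_eq_cube power2_eq_square)
  also have "\<dots> \<le> y * (1.6)^2" using y by (intro mult_left_mono power_mono) auto
  finally have "y^3 \<le> 64/25 * y" by (simp add: power2_eq_square)
  then have "sin y \<ge> y / 3" using 1 y unfolding abs_le_iff by linarith
  moreover have "y / 3 \<ge> t" using pi assms mult_right_mono[of 3 pi t] by (simp add: y_def)
  ultimately show ?thesis by (simp add: y_def)
qed

text \<open>With \<open>abs_sin_le_circle_norm\<close> this exchanges circle distances for the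
  amplitudes \<open>\<bar>sin (pi * x)\<bar>\<close> that differences of cosines produce.\<close>

lemma circle_norm_le_abs_sin: "circle_norm x \<le> \<bar>sin (pi * x)\<bar>"
proof -
  obtain m :: int where m: "circle_norm x = \<bar>x - of_int m\<bar>" by (metis circle_norm_attained)
  have "circle_norm x \<le> sin (pi * \<bar>x - of_int m\<bar>)"
    using sin_ge_third[of "\<bar>x - of_int m\<bar>"] circle_norm_le_half[of x] m by simp
  also have "\<dots> \<le> \<bar>sin (pi * \<bar>x - of_int m\<bar>)\<bar>" by simp
  also have "\<dots> = \<bar>sin (pi * (x - of_int m))\<bar>"
    by (cases "x - of_int m \<ge> 0") (simp_all only: abs_of_nonneg abs_of_neg not_le mult_minus_right sin_minus abs_minus)
  finally show ?thesis by (simp add: abs_sin_diff_pi_int)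
qed

lemma abs_sin_le_circle_norm: "\<bar>sin (pi * x)\<bar> \<le> pi * circle_norm x"
proof -
  obtain m :: int where m: "circle_norm x = \<bar>x - of_int m\<bar>" by (metis circle_norm_attained)
  have "\<bar>sin (pi * x)\<bar> = \<bar>sin (pi * (x - of_int m))\<bar>" by (simp add: abs_sin_diff_pi_int)
  also have "\<dots> \<le> \<bar>pi * (x - of_int m)\<bar>" by (rule abs_sin_x_le_abs_x)
  finally show ?thesis by (simp add: m abs_mult)
qed

text \<open>The law of one noise coordinate, carried by the whole line so that all sets and
  functions below are plain Borel objects. \<open>measure_noise_comp\<close> transfers the estimates
  back to the coordinates of \<open>noise\<close>.\<close>

definition unif :: "real \<Rightarrow> real measure" where
  "unif \<sigma> = uniform_measure lborel {-\<sigma>..\<sigma>}"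

lemma space_unif [simp]: "space (unif \<sigma>) = UNIV" and sets_unif [simp, measurable_cong]: "sets (unif \<sigma>) = sets borel"
  by (simp_all add: unif_def)

lemma prob_space_unif: "\<sigma> > 0 \<Longrightarrow> prob_space (unif \<sigma>)"
  unfolding unif_def by (intro prob_space_uniform_measure) simp_all

lemma measure_unif_UNIV: "\<sigma> > 0 \<Longrightarrow> measure (unif \<sigma>) UNIV = 1"
  using prob_space.prob_space[OF prob_space_unif] by simp

lemma unif_eq_density:
  assumes "\<sigma> > 0"
  shows "unif \<sigma> = density lborel (\<lambda>x. ennreal (indicator {-\<sigma>..\<sigma>} x / (2*\<sigma>)))"
  unfolding unif_def uniform_measure_def using assms
  by (intro density_cong) (auto simp: indicator_def divide_ennreal ennreal_1[symmetric] simp del: ennreal_1)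

lemma measure_unif:
  assumes "\<sigma> > 0" "A \<in> sets borel"
  shows "measure (unif \<sigma>) A = measure lborel ({-\<sigma>..\<sigma>} \<inter> A) / (2*\<sigma>)"
  unfolding unif_def using assms by (subst measure_uniform_measure) auto

lemma measure_unif_interval_le:
  assumes "\<sigma> > 0" "a \<le> b"
  shows "measure (unif \<sigma>) {a..b} \<le> (b - a) / (2*\<sigma>)"
proof -
  have "measure lborel ({-\<sigma>..\<sigma>} \<inter> {a..b}) \<le> measure lborel {a..b}"
    using assms by (intro measure_mono_fmeasurable) (auto simp: fmeasurable_def)
  then show ?thesis using assms by (simp add: measure_unif divide_right_mono)
qed

lemma AE_unif: "\<sigma> > 0 \<Longrightarrow> AE w in unif \<sigma>. w \<in> {-\<sigma>..\<sigma>}"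
  unfolding unif_def by (rule AE_uniform_measureI) auto

lemma integrable_unif:
  fixes f :: "real \<Rightarrow> real"
  assumes "\<sigma> > 0" "f \<in> borel_measurable borel" "\<And>w. \<bar>f w\<bar> \<le> B"
  shows "integrable (unif \<sigma>) f"
proof -
  interpret prob_space "unif \<sigma>" by (rule prob_space_unif) fact
  show ?thesis using assms by (intro integrable_const_bound[of _ B]) auto
qed

lemma integral_unif_FTC:
  fixes f F :: "real \<Rightarrow> real"
  assumes "\<sigma> > 0" and F: "\<And>x. (F has_real_derivative f x) (at x)" and f: "continuous_on UNIV f"
  shows "(\<integral>w. f w \<partial>unif \<sigma>) = (F \<sigma> - F (-\<sigma>)) / (2*\<sigma>)"
proof -
  have fm: "f \<in> borel_measurable borel" using f by (rule borel_measurable_continuous_onI)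
  have "(\<integral>w. f w \<partial>unif \<sigma>) = (\<integral>x. (indicator {-\<sigma>..\<sigma>} x / (2*\<sigma>)) * f x \<partial>lborel)"
    unfolding unif_eq_density[OF assms(1)] using assms(1) fm
    by (subst integral_density) auto
  also have "\<dots> = (\<integral>x. (indicator {-\<sigma>..\<sigma>} x * f x) / (2*\<sigma>) \<partial>lborel)"
    by simp
  also have "\<dots> = (\<integral>x. f x * indicator {-\<sigma>..\<sigma>} x \<partial>lborel) / (2*\<sigma>)"
    by (simp add: mult.commute)
  also have "(\<integral>x. f x * indicator {-\<sigma>..\<sigma>} x \<partial>lborel) = F \<sigma> - F (-\<sigma>)"
    using assms(1) F f by (intro integral_FTC_Icc_real) (auto simp: continuous_on_eq_continuous_at)
  finally show ?thesis .
qed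

text \<open>The event is covered by the preimages of the intervals of radius \<open>r\<close> about
  integers; at most \<open>2 * \<alpha> * \<sigma> + 3\<close> integers matter, and each preimage
  has probability at most \<open>r / (\<alpha> * \<sigma>)\<close>.\<close>

lemma prob_unif_circle_norm:
  assumes "\<sigma> > 0" "\<alpha> > 0" "r \<ge> 0"
  shows "measure (unif \<sigma>) {w. circle_norm (\<alpha> * w + c) \<le> r} \<le> (2 * \<alpha> * \<sigma> + 3) * r / (\<alpha> * \<sigma>)"
proof -
  interpret prob_space "unif \<sigma>" by (rule prob_space_unif) fact
  define J where "J = {\<lfloor>c - \<alpha> * \<sigma>\<rfloor>..\<lfloor>c + \<alpha> * \<sigma>\<rfloor> + 1}"
  define I where "I m = {(of_int m - r - c) / \<alpha>..(of_int m + r - c) / \<alpha>}" for m :: int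
  have [measurable]: "{w. circle_norm (\<alpha> * w + c) \<le> r} \<in> sets borel"
    by (intro borel_closed closed_Collect_le continuous_intros)
  have cov: "{w. circle_norm (\<alpha> * w + c) \<le> r} \<inter> {-\<sigma>..\<sigma>} \<subseteq> (\<Union>m\<in>J. I m)"
  proof
    fix w assume w: "w \<in> {w. circle_norm (\<alpha> * w + c) \<le> r} \<inter> {-\<sigma>..\<sigma>}"
    obtain m :: int where m: "circle_norm (\<alpha> * w + c) = \<bar>\<alpha> * w + c - of_int m\<bar>" by (metis circle_norm_attained)
    have "\<alpha> * w \<le> \<alpha> * \<sigma>" "\<alpha> * (-\<sigma>) \<le> \<alpha> * w"
      using w assms(2) mult_left_mono[of "-\<sigma>" w \<alpha>] by auto
    then have "m \<in> J"
      using m circle_norm_le_half[of "\<alpha> * w + c"]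
      unfolding J_def atLeastAtMost_iff floor_le_iff diff_le_eq[symmetric] le_floor_iff
      by (simp only: abs_le_iff of_int_diff of_int_1) linarith
    moreover have "w \<in> I m" using m w assms(2) by (auto simp: I_def field_simps abs_le_iff)
    ultimately show "w \<in> (\<Union>m\<in>J. I m)" by auto
  qed
  have "prob {w. circle_norm (\<alpha> * w + c) \<le> r} = prob ({w. circle_norm (\<alpha> * w + c) \<le> r} \<inter> {-\<sigma>..\<sigma>})"
    using AE_unif[OF assms(1)] by (intro finite_measure_eq_AE) (auto)
  also have "\<dots> \<le> prob (\<Union>m\<in>J. I m)"
    using cov by (intro finite_measure_mono) (auto simp: I_def)
  also have "\<dots> \<le> (\<Sum>m\<in>J. prob (I m))"
    by (intro finite_measure_subadditive_finite) (auto simp: J_def I_def)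
  also have "\<dots> \<le> (\<Sum>m\<in>J. r / (\<alpha> * \<sigma>))"
  proof (rule sum_mono)
    fix m
    have "prob (I m) \<le> ((of_int m + r - c) / \<alpha> - (of_int m - r - c) / \<alpha>) / (2*\<sigma>)"
      unfolding I_def using assms by (intro measure_unif_interval_le) (auto intro!: divide_right_mono)
    also have "\<dots> = r / (\<alpha> * \<sigma>)" using assms by (simp add: field_simps)
    finally show "prob (I m) \<le> r / (\<alpha> * \<sigma>)" .
  qed
  also have "\<dots> = real (card J) * (r / (\<alpha> * \<sigma>))" by simp
  also have "\<dots> \<le> (2 * \<alpha> * \<sigma> + 3) * (r / (\<alpha> * \<sigma>))"
  proof (rule mult_right_mono)
    have "\<alpha> * \<sigma> > 0" using assms by simp
    then have "0 \<le> \<lfloor>c + \<alpha> * \<sigma>\<rfloor> + 1 + 1 - \<lfloor>c - \<alpha> * \<sigma>\<rfloor>" by linarith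
    then have "real (card J) = of_int (\<lfloor>c + \<alpha> * \<sigma>\<rfloor> + 1 + 1 - \<lfloor>c - \<alpha> * \<sigma>\<rfloor>)"
      by (simp add: J_def)
    also have "\<dots> \<le> 2 * \<alpha> * \<sigma> + 3" by linarith
    finally show "real (card J) \<le> 2 * \<alpha> * \<sigma> + 3" .
  qed (use assms in auto)
  finally show ?thesis by simp
qed

text \<open>The square root reflects the quadratic extrema of the sine: writing the level as
  \<open>sin b\<close>, the difference is twice a product of a sine and a cosine, and one factor
  must be at most \<open>sqrt \<rho>\<close>. Each factor is then a circle distance in
  \<open>w\<close>.\<close>

lemma prob_unif_sin_near:
  assumes "0 < \<sigma>" "\<sigma> \<le> 1/4" "\<rho> \<ge> 0"
  shows "measure (unif \<sigma>) {w. \<bar>sin (2 * pi * w + \<psi>) - q\<bar> \<le> \<rho>} \<le> 7 * sqrt \<rho> / \<sigma>"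
proof -
  interpret prob_space "unif \<sigma>" by (rule prob_space_unif) fact
  \<comment> \<open>Clamping to the range of the sine makes the level a value \<open>sin b\<close>
    and only brings it closer to every \<open>sin a\<close>.\<close>
  define q' where "q' = max (-1) (min 1 q)"
  define b where "b = arcsin q'"
  have b: "sin b = q'" unfolding b_def q'_def by (rule sin_arcsin) auto
  define A where "A c = {w. circle_norm (1 * w + c) \<le> sqrt \<rho>}" for c
  have [measurable]: "A c \<in> sets borel" for c
    unfolding A_def by (intro borel_closed closed_Collect_le continuous_intros)
  have PA: "prob (A c) \<le> 7/2 * sqrt \<rho> / \<sigma>" for c
  proof -
    have "prob (A c) \<le> (2 * 1 * \<sigma> + 3) * sqrt \<rho> / (1 * \<sigma>)"
      unfolding A_def using assms by (intro prob_unif_circle_norm) auto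
    also have "\<dots> = ((2 * \<sigma> + 3) * sqrt \<rho>) / \<sigma>" by simp
    also have "\<dots> \<le> (7/2 * sqrt \<rho>) / \<sigma>"
      using assms by (intro divide_right_mono mult_right_mono) auto
    finally show ?thesis .
  qed
  let ?c = "(\<psi> - b) / (2*pi)" and ?d = "(\<psi> + b) / (2*pi) + 1/2"
  have "{w. \<bar>sin (2 * pi * w + \<psi>) - q\<bar> \<le> \<rho>} \<subseteq> A ?c \<union> A ?d"
  proof
    fix w assume w: "w \<in> {w. \<bar>sin (2 * pi * w + \<psi>) - q\<bar> \<le> \<rho>}"
    define a where "a = 2 * pi * w + \<psi>"
    have "\<bar>sin a - q'\<bar> \<le> \<bar>sin a - q\<bar>"
      using sin_le_one[of a] sin_ge_minus_one[of a] unfolding q'_def by linarith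
    then have "\<bar>sin a - sin b\<bar> \<le> \<rho>" using w by (simp add: b a_def)
    then have *: "2 * (\<bar>sin ((a - b)/2)\<bar> * \<bar>cos ((a + b)/2)\<bar>) \<le> \<rho>"
      by (simp add: sin_diff_sin abs_mult)
    have "\<bar>sin ((a - b)/2)\<bar> \<le> sqrt \<rho> \<or> \<bar>cos ((a + b)/2)\<bar> \<le> sqrt \<rho>"
    proof (rule ccontr)
      assume "\<not> ?thesis"
      then have "sqrt \<rho> * sqrt \<rho> < \<bar>sin ((a - b)/2)\<bar> * \<bar>cos ((a + b)/2)\<bar>"
        using assms by (intro mult_strict_mono') auto
      with * assms show False by simp
    qed
    moreover have "(a - b)/2 = pi * (1 * w + ?c)" "(a + b)/2 + pi/2 = pi * (1 * w + ?d)"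
      by (simp_all add: a_def field_simps)
    moreover have "\<bar>cos ((a + b)/2)\<bar> = \<bar>sin ((a + b)/2 + pi/2)\<bar>"
      by (simp add: sin_add)
    ultimately have "\<bar>sin (pi * (1 * w + ?c))\<bar> \<le> sqrt \<rho> \<or> \<bar>sin (pi * (1 * w + ?d))\<bar> \<le> sqrt \<rho>"
      by metis
    then show "w \<in> A ?c \<union> A ?d"
      unfolding A_def using circle_norm_le_abs_sin order_trans by blast
  qed
  then have "prob {w. \<bar>sin (2 * pi * w + \<psi>) - q\<bar> \<le> \<rho>} \<le> prob (A ?c \<union> A ?d)"
    by (intro finite_measure_mono) auto
  also have "\<dots> \<le> prob (A ?c) + prob (A ?d)" by (rule measure_Un_le) auto
  also have "\<dots> \<le> 7 * sqrt \<rho> / \<sigma>" using PA[of ?c] PA[of ?d] by simp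
  finally show ?thesis .
qed

section \<open>One-frequency oscillatory integrals\<close>

text \<open>After splitting \<open>1 = s\<^sup>2 / (s\<^sup>2 + \<tau>\<^sup>2) + \<tau>\<^sup>2 / (s\<^sup>2 + \<tau>\<^sup>2)\<close> with
  \<open>s = sin (2 \<pi> w + \<phi>)\<close>, the first part is integrated by parts and the second is small away
  from the zeros of \<open>s\<close>.\<close>

lemma oscillatory_integral_aux:
  assumes \<sigma>: "0 < \<sigma>" "\<sigma> \<le> 1/4" and A: "A > 0" and \<tau>: "0 < \<tau>" "\<tau> \<le> 1"
  shows "\<bar>\<integral>w. cos (A * cos (2 * pi * w + \<phi>) + \<xi>) \<partial>unif \<sigma>\<bar> \<le> (2 / (A * \<tau>\<^sup>2) + 3 * sqrt \<tau>) / \<sigma>"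
proof -
  interpret prob_space "unif \<sigma>" by (rule prob_space_unif) fact
  define s c G where "s w = sin (2 * pi * w + \<phi>)" and "c w = cos (2 * pi * w + \<phi>)"
    and "G w = A * cos (2 * pi * w + \<phi>) + \<xi>" for w
  define D where "D w = (s w)\<^sup>2 + \<tau>\<^sup>2" for w
  have Dpos: "D w > 0" "D w \<noteq> 0" for w using \<tau> by (auto simp: D_def intro: add_nonneg_pos)
  have D\<tau>: "D w \<ge> \<tau>\<^sup>2" for w by (simp add: D_def)
  \<comment> \<open>\<open>h\<close> times the derivative of \<open>G\<close> is
    \<open>s\<^sup>2 / D\<close>. The factor \<open>s\<close> replaces the singular
    \<open>1 / s\<close> of the usual integration by parts, so \<open>h\<close> stays bounded at the
    critical points of the phase.\<close>
  define h where "h w = - s w / (2 * pi * A * D w)" for w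
  define h' where "h' w = - (c w / A) * (\<tau>\<^sup>2 - (s w)\<^sup>2) / (D w)\<^sup>2" for w
  have ds: "(s has_real_derivative 2 * pi * c w) (at w)" for w
    unfolding s_def c_def by (auto intro!: derivative_eq_intros)
  have dG: "(G has_real_derivative - (2 * pi * A * s w)) (at w)" for w
    unfolding s_def G_def by (auto intro!: derivative_eq_intros)
  have dh: "(h has_real_derivative h' w) (at w)" for w
  proof -
    have dD: "(D has_real_derivative 2 * s w * (2 * pi * c w)) (at w)"
      unfolding D_def by (auto intro!: derivative_eq_intros ds)
    have "((\<lambda>w. (-1 / (2 * pi * A)) * (s w / D w)) has_real_derivative
        (-1 / (2 * pi * A)) * ((2 * pi * c w * D w - s w * (2 * s w * (2 * pi * c w))) / (D w * D w))) (at w)"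
      by (intro DERIV_cmult DERIV_divide ds dD Dpos)
    moreover have "2 * pi * c w * D w - s w * (2 * s w * (2 * pi * c w)) = (2 * pi) * (c w * (\<tau>\<^sup>2 - (s w)\<^sup>2))"
      by (simp add: D_def algebra_simps power2_eq_square)
    moreover have "(-1 / (2 * pi * A)) * (((2 * pi) * (c w * (\<tau>\<^sup>2 - (s w)\<^sup>2))) / (D w * D w)) = h' w"
      using A Dpos[of w] by (simp add: h'_def power2_eq_square)
    moreover have "(\<lambda>w. (-1 / (2 * pi * A)) * (s w / D w)) = h"
      by (simp add: h_def fun_eq_iff)
    ultimately show ?thesis by metis
  qed
  have split: "cos (G w) = (cos (G w) * (- (2 * pi * A * s w)) * h w + sin (G w) * h' w)
      - sin (G w) * h' w + cos (G w) * (\<tau>\<^sup>2 / D w)" for w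
  proof -
    have "(- (2 * pi * A * s w)) * h w = (s w)\<^sup>2 / D w"
      using A Dpos[of w] by (simp add: h_def field_simps power2_eq_square)
    then have "cos (G w) * (- (2 * pi * A * s w)) * h w = cos (G w) * ((s w)\<^sup>2 / D w)"
      by (simp only: mult.assoc)
    moreover have "(s w)\<^sup>2 / D w + \<tau>\<^sup>2 / D w = 1"
      using Dpos[of w] by (simp add: D_def add_divide_distrib[symmetric])
    then have "cos (G w) * ((s w)\<^sup>2 / D w) + cos (G w) * (\<tau>\<^sup>2 / D w) = cos (G w)"
      by (simp only: distrib_left[symmetric] mult_1_right)
    ultimately show ?thesis by linarith
  qed
  have cont: "continuous_on UNIV s" "continuous_on UNIV c" "continuous_on UNIV G" "continuous_on UNIV D"
    unfolding s_def c_def G_def D_def by (auto intro!: continuous_intros)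
  have conth: "continuous_on UNIV h" "continuous_on UNIV h'"
    unfolding h_def h'_def using Dpos(2) A by (auto intro!: continuous_intros cont)
  note [measurable] = cont[THEN borel_measurable_continuous_onI] conth[THEN borel_measurable_continuous_onI]
  have bc: "\<bar>c w\<bar> \<le> 1" "\<bar>s w\<bar> \<le> 1" for w by (simp_all add: c_def s_def)
  have h_le: "\<bar>h w\<bar> \<le> 1 / (A * \<tau>\<^sup>2)" for w
  proof -
    have "\<bar>h w\<bar> = \<bar>s w\<bar> / (2 * pi * A * D w)"
      using A Dpos[of w] by (simp add: h_def abs_mult)
    also have "\<dots> \<le> 1 / (1 * A * \<tau>\<^sup>2)"
      using A \<tau> bc[of w] pi_gt3 D\<tau>[of w] by (intro frac_le mult_mono) auto
    finally show ?thesis by simp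
  qed
  have h'_le: "\<bar>h' w\<bar> \<le> 1 / (A * \<tau>\<^sup>2)" for w
  proof -
    have "\<bar>\<tau>\<^sup>2 - (s w)\<^sup>2\<bar> \<le> D w" by (simp add: D_def abs_le_iff)
    then have "\<bar>\<tau>\<^sup>2 - (s w)\<^sup>2\<bar> / (D w)\<^sup>2 \<le> D w / (D w)\<^sup>2" by (rule divide_right_mono) simp
    also have "\<dots> = 1 / D w" using Dpos[of w] by (simp add: power2_eq_square)
    also have "\<dots> \<le> 1 / \<tau>\<^sup>2" using D\<tau>[of w] \<tau> by (intro frac_le) auto
    finally have "(\<bar>c w\<bar> / A) * (\<bar>\<tau>\<^sup>2 - (s w)\<^sup>2\<bar> / (D w)\<^sup>2) \<le> (1 / A) * (1 / \<tau>\<^sup>2)"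
      using A bc[of w] by (intro mult_mono divide_right_mono) auto
    moreover have "\<bar>h' w\<bar> = (\<bar>c w\<bar> / A) * (\<bar>\<tau>\<^sup>2 - (s w)\<^sup>2\<bar> / (D w)\<^sup>2)"
      using A by (simp add: h'_def abs_mult)
    ultimately show ?thesis by simp
  qed
  \<comment> \<open>\<open>?F\<close> is the derivative of \<open>sin (G w) * h w\<close>, so its
    integral reduces to boundary terms.\<close>
  let ?F = "\<lambda>w. cos (G w) * (- (2 * pi * A * s w)) * h w + sin (G w) * h' w"
  have i2: "integrable (unif \<sigma>) (\<lambda>w. sin (G w) * h' w)"
  proof (rule integrable_unif[OF \<sigma>(1), of _ "1 / (A * \<tau>\<^sup>2)"])
    show "\<bar>sin (G w) * h' w\<bar> \<le> 1 / (A * \<tau>\<^sup>2)" for w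
      using mult_mono[of "\<bar>sin (G w)\<bar>" 1 "\<bar>h' w\<bar>" "1 / (A * \<tau>\<^sup>2)"] h'_le[of w] by (simp add: abs_mult)
  qed measurable
  have r3: "\<bar>\<tau>\<^sup>2 / D w\<bar> \<le> 1" for w using D\<tau>[of w] Dpos[of w] by simp
  have i3: "integrable (unif \<sigma>) (\<lambda>w. cos (G w) * (\<tau>\<^sup>2 / D w))"
  proof (rule integrable_unif[OF \<sigma>(1), of _ 1])
    show "\<bar>cos (G w) * (\<tau>\<^sup>2 / D w)\<bar> \<le> 1" for w
      using mult_mono[of "\<bar>cos (G w)\<bar>" 1 "\<bar>\<tau>\<^sup>2 / D w\<bar>" 1] r3[of w] by (simp add: abs_mult)
  qed measurable
  have i0: "integrable (unif \<sigma>) (\<lambda>w. cos (G w))"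
    by (rule integrable_unif[OF \<sigma>(1), of _ 1]) auto
  have i1: "integrable (unif \<sigma>) ?F"
  proof -
    have "?F = (\<lambda>w. cos (G w) + sin (G w) * h' w - cos (G w) * (\<tau>\<^sup>2 / D w))"
      using split by (auto simp: fun_eq_iff algebra_simps)
    then show ?thesis using i0 i2 i3 by auto
  qed
  have F: "(\<integral>w. ?F w \<partial>unif \<sigma>) = (sin (G \<sigma>) * h \<sigma> - sin (G (-\<sigma>)) * h (-\<sigma>)) / (2*\<sigma>)"
    by (rule integral_unif_FTC[OF \<sigma>(1)])
       (auto intro!: derivative_eq_intros dG dh continuous_intros cont conth)
  have "\<bar>sin (G w) * h w\<bar> \<le> 1 / (A * \<tau>\<^sup>2)" for w
    using mult_mono[of "\<bar>sin (G w)\<bar>" 1 "\<bar>h w\<bar>" "1 / (A * \<tau>\<^sup>2)"] h_le[of w] by (simp add: abs_mult)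
  from this[of \<sigma>] this[of "-\<sigma>"]
  have "\<bar>sin (G \<sigma>) * h \<sigma> - sin (G (-\<sigma>)) * h (-\<sigma>)\<bar> \<le> 2 / (A * \<tau>\<^sup>2)" by simp
  then have "\<bar>sin (G \<sigma>) * h \<sigma> - sin (G (-\<sigma>)) * h (-\<sigma>)\<bar> / (2*\<sigma>) \<le> (2 / (A * \<tau>\<^sup>2)) / (2*\<sigma>)"
    using \<sigma> by (intro divide_right_mono) auto
  then have F_le: "\<bar>\<integral>w. ?F w \<partial>unif \<sigma>\<bar> \<le> 1 / (A * \<tau>\<^sup>2) / \<sigma>"
    unfolding F abs_divide using \<sigma> by simp
  have "norm (\<integral>w. sin (G w) * h' w \<partial>unif \<sigma>) \<le> (\<integral>w. 1 / (A * \<tau>\<^sup>2) \<partial>unif \<sigma>)"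
  proof (rule Bochner_Integration.integral_norm_bound_integral[OF i2])
    show "norm (sin (G w) * h' w) \<le> 1 / (A * \<tau>\<^sup>2)" for w
      using mult_mono[of "\<bar>sin (G w)\<bar>" 1 "\<bar>h' w\<bar>" "1 / (A * \<tau>\<^sup>2)"] h'_le[of w] by (simp add: abs_mult)
  qed auto
  then have S_le: "\<bar>\<integral>w. sin (G w) * h' w \<partial>unif \<sigma>\<bar> \<le> 1 / (A * \<tau>\<^sup>2)" by (simp add: measure_unif_UNIV \<sigma>)
  \<comment> \<open>On \<open>Z\<close>, a neighbourhood of the zeros of \<open>s\<close>, the
    trivial bound is used. Off \<open>Z\<close> one has
    \<open>\<bar>s w\<bar> > sqrt \<tau>\<close>, so \<open>D w \<ge> \<tau>\<close> and the
    integrand is at most \<tau>.\<close>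
  define Z where "Z = {w. circle_norm (2 * w + \<phi> / pi) \<le> sqrt \<tau>}"
  have [measurable]: "Z \<in> sets borel"
    unfolding Z_def by (intro borel_closed closed_Collect_le continuous_intros)
  have "norm (\<integral>w. cos (G w) * (\<tau>\<^sup>2 / D w) \<partial>unif \<sigma>) \<le> (\<integral>w. \<tau> + indicator Z w \<partial>unif \<sigma>)"
  proof (rule Bochner_Integration.integral_norm_bound_integral[OF i3])
    fix w
    have 1: "norm (cos (G w) * (\<tau>\<^sup>2 / D w)) \<le> \<tau>\<^sup>2 / D w"
      using mult_right_mono[of "\<bar>cos (G w)\<bar>" 1 "\<tau>\<^sup>2 / D w"] Dpos[of w] by (simp add: abs_mult)
    show "norm (cos (G w) * (\<tau>\<^sup>2 / D w)) \<le> \<tau> + indicator Z w"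
    proof (cases "w \<in> Z")
      case True
      have "norm (cos (G w) * (\<tau>\<^sup>2 / D w)) \<le> \<tau> + 1"
        using 1 r3[of w, THEN abs_le_D1] \<tau> by linarith
      then show ?thesis using True by (simp only: indicator_simps)
    next
      case False
      have "sqrt \<tau> < \<bar>sin (pi * (2 * w + \<phi> / pi))\<bar>"
        using False circle_norm_le_abs_sin[of "2 * w + \<phi> / pi"] by (simp add: Z_def)
      also have "pi * (2 * w + \<phi> / pi) = 2 * pi * w + \<phi>" by (simp add: field_simps)
      finally have "sqrt \<tau> < \<bar>s w\<bar>" by (simp add: s_def)
      then have "(sqrt \<tau>)\<^sup>2 < \<bar>s w\<bar>\<^sup>2" using \<tau> by (intro power_strict_mono) auto
      then have "D w \<ge> \<tau>" using \<tau> by (simp add: D_def add_increasing2)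
      then have "\<tau>\<^sup>2 / D w \<le> \<tau>\<^sup>2 / \<tau>" using \<tau> by (intro frac_le) auto
      then have "norm (cos (G w) * (\<tau>\<^sup>2 / D w)) \<le> \<tau> + 0"
        using 1 \<tau> by (simp only: power2_eq_square nonzero_mult_div_cancel_right)
      then show ?thesis using False by (simp only: indicator_simps not_False_eq_True)
    qed
  next
    show "integrable (unif \<sigma>) (\<lambda>w. \<tau> + indicator Z w)"
      by (rule integrable_unif[OF \<sigma>(1), of _ "\<tau> + 1"]) (use \<tau> in \<open>auto simp: indicator_def\<close>)
  qed
  also have "(\<integral>w. \<tau> + indicator Z w \<partial>unif \<sigma>) = \<tau> + prob Z"
    using integrable_unif[OF \<sigma>(1), of "indicat_real Z" 1]
    by (subst Bochner_Integration.integral_add) (auto simp: measure_unif_UNIV \<sigma> indicator_def)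
  also have "prob Z \<le> (2 * 2 * \<sigma> + 3) * sqrt \<tau> / (2 * \<sigma>)"
    unfolding Z_def using \<sigma> \<tau> by (intro prob_unif_circle_norm) auto
  also have "\<dots> \<le> (4 * sqrt \<tau>) / (2 * \<sigma>)"
    using \<sigma> \<tau> by (intro divide_right_mono mult_right_mono) auto
  finally have C_le: "\<bar>\<integral>w. cos (G w) * (\<tau>\<^sup>2 / D w) \<partial>unif \<sigma>\<bar> \<le> \<tau> + 2 * sqrt \<tau> / \<sigma>" by simp
  have "(\<integral>w. cos (G w) \<partial>unif \<sigma>) = (\<integral>w. ?F w \<partial>unif \<sigma>) - (\<integral>w. sin (G w) * h' w \<partial>unif \<sigma>)
     + (\<integral>w. cos (G w) * (\<tau>\<^sup>2 / D w) \<partial>unif \<sigma>)"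
  proof -
    have "(\<integral>w. cos (G w) \<partial>unif \<sigma>) = (\<integral>w. ?F w - sin (G w) * h' w + cos (G w) * (\<tau>\<^sup>2 / D w) \<partial>unif \<sigma>)"
      by (intro Bochner_Integration.integral_cong refl split)
    also have "\<dots> = (\<integral>w. ?F w - sin (G w) * h' w \<partial>unif \<sigma>) + (\<integral>w. cos (G w) * (\<tau>\<^sup>2 / D w) \<partial>unif \<sigma>)"
      by (intro Bochner_Integration.integral_add Bochner_Integration.integrable_diff i1 i2 i3)
    also have "(\<integral>w. ?F w - sin (G w) * h' w \<partial>unif \<sigma>) = (\<integral>w. ?F w \<partial>unif \<sigma>) - (\<integral>w. sin (G w) * h' w \<partial>unif \<sigma>)"
      by (intro Bochner_Integration.integral_diff i1 i2)
    finally show ?thesis .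
  qed
  then have "\<bar>\<integral>w. cos (G w) \<partial>unif \<sigma>\<bar> \<le> 1 / (A * \<tau>\<^sup>2) / \<sigma> + 1 / (A * \<tau>\<^sup>2) + (\<tau> + 2 * sqrt \<tau> / \<sigma>)"
    using F_le S_le C_le by linarith
  also have "\<dots> \<le> 1 / (A * \<tau>\<^sup>2) / \<sigma> + 1 / (A * \<tau>\<^sup>2) / \<sigma> + (sqrt \<tau> / \<sigma> + 2 * sqrt \<tau> / \<sigma>)"
  proof -
    have div: "x \<le> x / \<sigma>" if "x \<ge> 0" for x
      using that \<sigma> mult_right_mono[of \<sigma> 1 x] by (simp add: field_simps)
    have "\<tau> \<le> sqrt \<tau>" using \<tau> by (simp add: real_le_rsqrt power2_eq_square mult_left_le)
    also have "\<dots> \<le> sqrt \<tau> / \<sigma>" using \<tau> by (intro div) simp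
    finally have e: "\<tau> \<le> sqrt \<tau> / \<sigma>" .
    have "1 / (A * \<tau>\<^sup>2) \<le> 1 / (A * \<tau>\<^sup>2) / \<sigma>" using A by (intro div) simp
    then show ?thesis by (intro add_mono order_refl e)
  qed
  also have "\<dots> = (2 / (A * \<tau>\<^sup>2) + 3 * sqrt \<tau>) / \<sigma>" by (simp add: add_divide_distrib)
  finally show ?thesis by (simp add: G_def)
qed

lemma oscillatory_integral:
  assumes \<sigma>: "0 < \<sigma>" "\<sigma> \<le> 1/4" and A: "A \<ge> 1"
  shows "\<bar>\<integral>w. cos (A * cos (2 * pi * w + \<phi>) + \<xi>) \<partial>unif \<sigma>\<bar> \<le> 5 * A powr (-1/5) / \<sigma>"
proof -
  \<comment> \<open>This choice balances \<open>1 / (A * \<tau>\<^sup>2)\<close> against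
    \<open>sqrt \<tau>\<close>: both become \<open>A powr (-1/5)\<close>.\<close>
  define \<tau> where "\<tau> = A powr (-2/5)"
  have "A powr (-2/5) \<le> A powr 0" using A by (intro powr_mono) auto
  then have \<tau>: "0 < \<tau>" "\<tau> \<le> 1" using A by (auto simp: \<tau>_def)
  have "\<bar>\<integral>w. cos (A * cos (2 * pi * w + \<phi>) + \<xi>) \<partial>unif \<sigma>\<bar> \<le> (2 / (A * \<tau>\<^sup>2) + 3 * sqrt \<tau>) / \<sigma>"
    using \<sigma> A \<tau> by (intro oscillatory_integral_aux) auto
  also have "sqrt \<tau> = A powr (-1/5)"
    using A by (simp add: \<tau>_def powr_half_sqrt[symmetric] powr_powr)
  also have "2 / (A * \<tau>\<^sup>2) = 2 * A powr (-1/5)"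
  proof -
    have "\<tau>\<^sup>2 = A powr (-4/5)"
      using A by (simp add: \<tau>_def powr_power)
    then have "A * \<tau>\<^sup>2 = A powr 1 * A powr (-4/5)" using A by simp
    also have "\<dots> = A powr (1/5)" by (subst powr_add[symmetric]) simp
    finally show ?thesis by (simp add: powr_minus_divide)
  qed
  finally show ?thesis by simp
qed

section \<open>Powers of the cosine and phases of the noise\<close>

text \<open>The Fourier coefficient of \<open>cos y ^ (2 * M)\<close> at frequency
  \<open>2 * (j - M)\<close>. The coefficients are nonnegative with sum one, so averaging errors
  over the harmonics costs no factor depending on \<open>M\<close>.\<close>

definition cos_pow_coeff :: "nat \<Rightarrow> nat \<Rightarrow> real" where
  "cos_pow_coeff M j = real (2 * M choose j) / 4 ^ M"

abbreviation "cos_mean M \<equiv> cos_pow_coeff M M"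

lemma cos_pow_coeff_nonneg [simp]: "0 \<le> cos_pow_coeff M j"
  by (simp add: cos_pow_coeff_def)

lemma sum_cos_pow_coeff: "(\<Sum>j\<le>2*M. cos_pow_coeff M j) = 1"
proof -
  have "(\<Sum>j\<le>2*M. real (2 * M choose j)) = real (\<Sum>j\<le>2*M. 2 * M choose j)" by simp
  also have "\<dots> = 4 ^ M" by (subst choose_row_sum) (simp add: power_mult)
  finally show ?thesis by (simp add: cos_pow_coeff_def sum_divide_distrib[symmetric])
qed

lemma of_real_cos_power:
  "complex_of_real (cos y ^ (2 * M)) = (\<Sum>j\<le>2*M. of_real (cos_pow_coeff M j) * cis (2 * (real j - real M) * y))"
proof -
  have c: "complex_of_real (cos y) = (cis y + cis (- y)) / 2"
    by (simp add: complex_eq_iff)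
  have "complex_of_real (cos y ^ (2 * M)) = (cis y + cis (- y)) ^ (2 * M) / 2 ^ (2 * M)"
    by (simp only: of_real_power c power_divide)
  also have "(2::complex) ^ (2 * M) = 4 ^ M" by (simp add: power_mult)
  also have "(cis y + cis (- y)) ^ (2 * M) = (\<Sum>j\<le>2*M. of_nat (2 * M choose j) * cis y ^ j * cis (- y) ^ (2 * M - j))"
    by (rule binomial_ring)
  also have "\<dots> = (\<Sum>j\<le>2*M. of_nat (2 * M choose j) * cis (2 * (real j - real M) * y))"
  proof (rule sum.cong)
    fix j assume "j \<in> {..2*M}"
    then have "real j * y + real (2 * M - j) * - y = 2 * (real j - real M) * y"
      by (simp add: of_nat_diff algebra_simps)
    moreover have "cis y ^ j * cis (- y) ^ (2 * M - j) = cis (real j * y + real (2 * M - j) * - y)"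
      by (simp only: Complex.DeMoivre cis_mult)
    ultimately have "cis y ^ j * cis (- y) ^ (2 * M - j) = cis (2 * (real j - real M) * y)"
      by metis
    then show "of_nat (2 * M choose j) * cis y ^ j * cis (- y) ^ (2 * M - j)
        = of_nat (2 * M choose j) * cis (2 * (real j - real M) * y)" by (simp only: mult.assoc)
  qed simp
  finally show ?thesis by (simp add: sum_divide_distrib cos_pow_coeff_def)
qed

lemma cos_power_mult:
  "cos y ^ (2 * M) * cos y' ^ (2 * M) = (\<Sum>j\<le>2*M. \<Sum>l\<le>2*M. cos_pow_coeff M j * cos_pow_coeff M l *
     cos (2 * (real j - real M) * y + 2 * (real l - real M) * y'))"
proof -
  have "complex_of_real (cos y ^ (2 * M) * cos y' ^ (2 * M)) =
    (\<Sum>j\<le>2*M. \<Sum>l\<le>2*M. of_real (cos_pow_coeff M j * cos_pow_coeff M l) *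
     cis (2 * (real j - real M) * y + 2 * (real l - real M) * y'))"
    unfolding of_real_mult of_real_cos_power sum_product
    by (intro sum.cong refl) (simp only: cis_mult[symmetric] of_real_mult ac_simps)
  then have "Re (complex_of_real (cos y ^ (2 * M) * cos y' ^ (2 * M))) =
    (\<Sum>j\<le>2*M. \<Sum>l\<le>2*M. cos_pow_coeff M j * cos_pow_coeff M l *
     cos (2 * (real j - real M) * y + 2 * (real l - real M) * y'))"
    by (simp add: Re_sum)
  then show ?thesis by simp
qed

lemma cos_power_eq:
  "cos y ^ (2 * M) = (\<Sum>j\<le>2*M. cos_pow_coeff M j * cos (2 * (real j - real M) * y))"
proof -
  have "Re (complex_of_real (cos y ^ (2 * M))) = (\<Sum>j\<le>2*M. cos_pow_coeff M j * cos (2 * (real j - real M) * y))"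
    unfolding of_real_cos_power by (simp add: Re_sum)
  then show ?thesis by simp
qed

lemma oscillatory_integral_le:
  assumes \<sigma>: "0 < \<sigma>" "\<sigma> \<le> 1/4" and A: "B \<le> \<bar>A\<bar>" "1 \<le> B"
  shows "\<bar>\<integral>w. cos (A * cos (2 * pi * w + \<phi>) + \<xi>) \<partial>unif \<sigma>\<bar> \<le> 5 * B powr (-1/5) / \<sigma>"
proof -
  have "\<exists>\<phi>'. \<forall>w. A * cos (2 * pi * w + \<phi>) = \<bar>A\<bar> * cos (2 * pi * w + \<phi>')"
  proof (cases "A \<ge> 0")
    case False
    then have "\<forall>w. A * cos (2 * pi * w + \<phi>) = \<bar>A\<bar> * cos (2 * pi * w + (\<phi> + pi))"
      by (simp add: add.assoc[symmetric])
    then show ?thesis by blast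
  qed auto
  then obtain \<phi>' where "\<forall>w. A * cos (2 * pi * w + \<phi>) = \<bar>A\<bar> * cos (2 * pi * w + \<phi>')" by blast
  then have "\<bar>\<integral>w. cos (A * cos (2 * pi * w + \<phi>) + \<xi>) \<partial>unif \<sigma>\<bar> \<le> 5 * \<bar>A\<bar> powr (-1/5) / \<sigma>"
    using oscillatory_integral[OF \<sigma>, of "\<bar>A\<bar>" \<phi>' \<xi>] A by simp
  also have "\<dots> \<le> 5 * B powr (-1/5) / \<sigma>"
    using \<sigma> A by (intro divide_right_mono mult_left_mono powr_mono2') auto
  finally show ?thesis .
qed

text \<open>Every nonconstant harmonic of the cosine power sees an oscillation of amplitude at least
  \<open>2 * pi * B\<close>, hence has a small integral; the constant one contributes
  \<open>cos_mean M\<close>.\<close>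

lemma cos_power_average:
  assumes \<sigma>: "0 < \<sigma>" "\<sigma> \<le> 1/4" and B: "1 \<le> B"
  shows "\<bar>(\<integral>w. cos (pi * (B * cos (2 * pi * w + \<phi>) - q)) ^ (2 * M) \<partial>unif \<sigma>) - cos_mean M\<bar>
    \<le> 5 * B powr (-1/5) / \<sigma>"
proof -
  interpret prob_space "unif \<sigma>" by (rule prob_space_unif) fact
  let ?E = "5 * B powr (-1/5) / \<sigma>"
  define I where "I j = (\<integral>w. cos (2 * (real j - real M) * (pi * (B * cos (2 * pi * w + \<phi>) - q))) \<partial>unif \<sigma>)" for j
  have int: "integrable (unif \<sigma>) (\<lambda>w. cos (2 * (real j - real M) * (pi * (B * cos (2 * pi * w + \<phi>) - q))))" for j
    by (rule integrable_unif[OF \<sigma>(1), of _ 1]) auto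
  have IM: "I M = 1" by (simp add: I_def measure_unif_UNIV \<sigma>)
  have Ij: "\<bar>I j\<bar> \<le> ?E" if "j \<noteq> M" for j
  proof -
    define A where "A = 2 * (real j - real M) * pi * B"
    have "\<bar>real j - real M\<bar> \<ge> 1" using that by linarith
    then have "2 * pi * B * 1 \<le> 2 * pi * B * \<bar>real j - real M\<bar>"
      using B by (intro mult_left_mono) auto
    moreover have "\<bar>A\<bar> = 2 * pi * B * \<bar>real j - real M\<bar>" using B by (simp only: A_def abs_mult) simp
    moreover have "1 * B \<le> 2 * pi * B" using B pi_gt3 by (intro mult_right_mono) auto
    ultimately have "B \<le> \<bar>A\<bar>" by linarith
    have "I j = (\<integral>w. cos (A * cos (2 * pi * w + \<phi>) + (- (2 * (real j - real M) * pi * q))) \<partial>unif \<sigma>)"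
      unfolding I_def A_def by (intro Bochner_Integration.integral_cong arg_cong[of _ _ cos]) (auto simp: algebra_simps)
    then show ?thesis
      by (simp only: oscillatory_integral_le[OF \<sigma> \<open>B \<le> \<bar>A\<bar>\<close> B])
  qed
  have "(\<integral>w. cos (pi * (B * cos (2 * pi * w + \<phi>) - q)) ^ (2 * M) \<partial>unif \<sigma>) = (\<Sum>j\<le>2*M. cos_pow_coeff M j * I j)"
    unfolding cos_power_eq I_def using int by (subst Bochner_Integration.integral_sum) auto
  also have "\<dots> - cos_mean M = (\<Sum>j\<in>{..2*M} - {M}. cos_pow_coeff M j * I j)"
    by (subst sum.remove[of _ M]) (auto simp: IM)
  also have "\<bar>\<dots>\<bar> \<le> (\<Sum>j\<in>{..2*M} - {M}. cos_pow_coeff M j * ?E)"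
  proof (intro order_trans[OF sum_abs] sum_mono)
    fix j assume "j \<in> {..2*M} - {M}"
    then show "\<bar>cos_pow_coeff M j * I j\<bar> \<le> cos_pow_coeff M j * ?E"
      unfolding abs_mult abs_of_nonneg[OF cos_pow_coeff_nonneg] by (intro mult_left_mono Ij) auto
  qed
  also have "\<dots> \<le> (\<Sum>j\<le>2*M. cos_pow_coeff M j * ?E)"
    using \<sigma> by (intro sum_mono2) auto
  also have "\<dots> = ?E" by (simp add: sum_distrib_right[symmetric] sum_cos_pow_coeff del: times_divide_eq_right)
  finally show ?thesis .
qed

text \<open>Phasor addition: both sides are the real part of
  \<open>(p * cis \<alpha> + r * cis \<beta>) * cis w\<close>, and the modulus of the bracket is
  computed after factoring out \<open>cis \<alpha>\<close>.\<close>

lemma cos_superposition: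
  fixes p r :: real
  obtains R \<psi> where "R \<ge> 0" "R\<^sup>2 = (p + r * cos (\<beta> - \<alpha>))\<^sup>2 + (r * sin (\<beta> - \<alpha>))\<^sup>2"
    "\<And>w. p * cos (w + \<alpha>) + r * cos (w + \<beta>) = R * cos (w + \<psi>)"
proof -
  define Z where "Z = of_real p * cis \<alpha> + of_real r * cis \<beta>"
  have "Z * cis w = of_real p * cis (w + \<alpha>) + of_real r * cis (w + \<beta>)" for w
    by (simp only: Z_def cis_mult[symmetric] ring_distribs mult_ac)
  then have "Re (Z * cis w) = p * cos (w + \<alpha>) + r * cos (w + \<beta>)" for w by simp
  moreover have "Z * cis w = rcis (cmod Z) (w + Arg Z)" for w
    by (metis add.commute cis_rcis_eq mult.right_neutral rcis_cmod_Arg rcis_mult)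
  ultimately have "p * cos (w + \<alpha>) + r * cos (w + \<beta>) = cmod Z * cos (w + Arg Z)" for w
    by (metis Re_rcis)
  moreover have "(cmod Z)\<^sup>2 = (p + r * cos (\<beta> - \<alpha>))\<^sup>2 + (r * sin (\<beta> - \<alpha>))\<^sup>2"
  proof -
    have "cis \<beta> = cis \<alpha> * cis (\<beta> - \<alpha>)" by (simp add: cis_mult)
    then have "Z = cis \<alpha> * (of_real p + of_real r * cis (\<beta> - \<alpha>))"
      by (simp add: Z_def ring_distribs mult_ac)
    then have "cmod Z = cmod (of_real p + of_real r * cis (\<beta> - \<alpha>))" by (simp add: norm_mult)
    then show ?thesis by (simp add: cmod_power2)
  qed
  ultimately show ?thesis using that[of "cmod Z" "Arg Z", OF norm_ge_zero] by blast
qed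

text \<open>The harmonic with integer frequencies \<open>p\<close> and \<open>r\<close> superposes
  to one cosine of amplitude proportional to \<open>R\<close>. If \<open>r = 0\<close> then
  \<open>R = \<bar>p\<bar> \<ge> 1\<close>; otherwise the part of \<open>R\<close> transversal to
  the first phase is at least \<kappa>. The doubled difference is needed because the cosines cancel
  also at \<open>x - x' = 1/2\<close>.\<close>

lemma cos_power_average2:
  assumes \<sigma>: "0 < \<sigma>" "\<sigma> \<le> 1/4" and \<kappa>: "0 < \<kappa>" "\<kappa> \<le> 1" "\<kappa> \<le> circle_norm (2 * (x - x'))" and L: "1 \<le> L * \<kappa>"
  shows "\<bar>(\<integral>w. cos (pi * (L * cos (2 * pi * (x + w)) - a)) ^ (2 * M) * cos (pi * (L * cos (2 * pi * (x' + w)) - b)) ^ (2 * M) \<partial>unif \<sigma>)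
     - (cos_mean M)\<^sup>2\<bar> \<le> 5 * (L * \<kappa>) powr (-1/5) / \<sigma>"
proof -
  interpret prob_space "unif \<sigma>" by (rule prob_space_unif) fact
  let ?E = "5 * (L * \<kappa>) powr (-1/5) / \<sigma>"
  have Lpos: "L > 0" using L \<kappa> by (metis less_le_trans mult_nonpos_nonneg not_less order_less_imp_le zero_less_one)
  define Y where "Y w = pi * (L * cos (2 * pi * (x + w)) - a)" for w
  define Y' where "Y' w = pi * (L * cos (2 * pi * (x' + w)) - b)" for w
  define f where "f j l w = cos (2 * (real j - real M) * Y w + 2 * (real l - real M) * Y' w)" for j l w
  define I where "I j l = (\<integral>w. f j l w \<partial>unif \<sigma>)" for j l
  have int: "integrable (unif \<sigma>) (f j l)" for j l
    unfolding f_def Y_def Y'_def by (rule integrable_unif[OF \<sigma>(1), of _ 1]) auto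
  have IM: "I M M = 1" by (simp add: I_def f_def measure_unif_UNIV \<sigma>)
  have Ij: "\<bar>I j l\<bar> \<le> ?E" if "(j, l) \<noteq> (M, M)" for j l
  proof -
    define p r where "p = real j - real M" and "r = real l - real M"
    obtain R \<psi> where R: "R \<ge> 0" "R\<^sup>2 = (p + r * cos (2*pi*x' - 2*pi*x))\<^sup>2 + (r * sin (2*pi*x' - 2*pi*x))\<^sup>2"
      "\<And>w. p * cos (w + 2*pi*x) + r * cos (w + 2*pi*x') = R * cos (w + \<psi>)"
      by (rule cos_superposition) blast
    have "\<kappa>\<^sup>2 \<le> R\<^sup>2"
    proof (cases "l = M")
      case True
      then have "\<bar>p\<bar> \<ge> 1" using that by (auto simp: p_def)
      then have "1\<^sup>2 \<le> \<bar>p\<bar>\<^sup>2" by (intro power_mono) auto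
      moreover have "\<kappa>\<^sup>2 \<le> 1" using \<kappa> by (simp add: power_le_one)
      ultimately show ?thesis using True R(2) by (simp add: r_def)
    next
      case False
      then have r: "\<bar>r\<bar> \<ge> 1" by (auto simp: r_def)
      have "sin (2*pi*x' - 2*pi*x) = - sin (pi * (2 * (x - x')))"
        by (simp add: sin_minus[symmetric] algebra_simps del: sin_minus)
      then have "\<kappa> \<le> \<bar>sin (2*pi*x' - 2*pi*x)\<bar>"
        using circle_norm_le_abs_sin[of "2 * (x - x')"] \<kappa> by simp
      then have "1 * \<kappa> \<le> \<bar>r\<bar> * \<bar>sin (2*pi*x' - 2*pi*x)\<bar>"
        using r \<kappa> by (intro mult_mono) auto
      then have "\<kappa>\<^sup>2 \<le> (r * sin (2*pi*x' - 2*pi*x))\<^sup>2"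
        using \<kappa> by (intro abs_le_square_iff[THEN iffD1]) (simp add: abs_mult)
      then show ?thesis using R(2) by (simp add: add_increasing)
    qed
    then have "\<kappa> \<le> R" using R(1) by (rule power2_le_imp_le)
    define A where "A = 2 * pi * L * R"
    have "L * \<kappa> \<le> L * R" using \<open>\<kappa> \<le> R\<close> Lpos by simp
    also have "1 * (L * R) \<le> (2 * pi) * (L * R)" using Lpos R(1) pi_gt3 by (intro mult_right_mono) auto
    finally have A: "L * \<kappa> \<le> \<bar>A\<bar>" using Lpos R(1) by (simp add: A_def abs_mult mult.assoc)
    have "2 * p * Y w + 2 * r * Y' w = A * cos (2 * pi * w + \<psi>) + (- (2 * pi * (p * a + r * b)))" for w
    proof -
      have "2 * p * Y w + 2 * r * Y' w = 2 * pi * L * (p * cos (2 * pi * w + 2*pi*x) + r * cos (2 * pi * w + 2*pi*x')) - 2 * pi * (p * a + r * b)"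
        by (simp add: Y_def Y'_def algebra_simps)
      then show ?thesis by (simp add: R(3) A_def)
    qed
    then have "I j l = (\<integral>w. cos (A * cos (2 * pi * w + \<psi>) + (- (2 * pi * (p * a + r * b)))) \<partial>unif \<sigma>)"
      unfolding I_def f_def by (simp add: p_def r_def)
    then show ?thesis
      by (simp only: oscillatory_integral_le[OF \<sigma> A L])
  qed
  let ?S = "{..2*M} \<times> {..2*M}"
  define c where "c = (\<lambda>(j, l). cos_pow_coeff M j * cos_pow_coeff M l)"
  have sc: "(\<Sum>jl\<in>?S. c jl) = 1"
    by (simp add: c_def sum.cartesian_product[symmetric] sum_product[symmetric] sum_cos_pow_coeff)
  have "(\<integral>w. cos (Y w) ^ (2 * M) * cos (Y' w) ^ (2 * M) \<partial>unif \<sigma>) = (\<integral>w. (\<Sum>jl\<in>?S. c jl * f (fst jl) (snd jl) w) \<partial>unif \<sigma>)"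
    unfolding cos_power_mult sum.cartesian_product
    by (intro Bochner_Integration.integral_cong sum.cong) (auto simp: c_def f_def)
  also have "\<dots> = (\<Sum>jl\<in>?S. c jl * I (fst jl) (snd jl))"
    using int by (subst Bochner_Integration.integral_sum) (auto simp: I_def)
  also have "\<dots> - (cos_mean M)\<^sup>2 = (\<Sum>jl\<in>?S - {(M, M)}. c jl * I (fst jl) (snd jl))"
    by (subst sum.remove[of _ "(M, M)"]) (auto simp: IM c_def power2_eq_square)
  also have "\<bar>\<dots>\<bar> \<le> (\<Sum>jl\<in>?S - {(M, M)}. c jl * ?E)"
  proof (intro order_trans[OF sum_abs] sum_mono)
    fix jl assume jl: "jl \<in> ?S - {(M, M)}"
    have "0 \<le> c jl" by (auto simp: c_def split: prod.split)
    with jl show "\<bar>c jl * I (fst jl) (snd jl)\<bar> \<le> c jl * ?E"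
      by (subst abs_mult, subst abs_of_nonneg[OF \<open>0 \<le> c jl\<close>]) (intro mult_left_mono Ij, auto)
  qed
  also have "\<dots> \<le> (\<Sum>jl\<in>?S. c jl * ?E)"
    using \<sigma> by (intro sum_mono2) (auto simp: c_def)
  also have "\<dots> = ?E" using sc by (simp add: sum_distrib_right[symmetric] del: times_divide_eq_right)
  finally show ?thesis by (simp add: Y_def Y'_def)
qed

lemma cos_mean_ge: assumes "M > 0" shows "1 / (2 * real M) \<le> cos_mean M"
  using central_binomial_lower_bound[OF assms] assms by (simp add: cos_pow_coeff_def field_simps)

lemma cos_mean_Suc: "cos_mean (Suc M) = cos_mean M * (2 * real M + 1) / (2 * real M + 2)"
proof -
  have 1: "real (2*M+2) * real (2*M+1 choose M) = real (2*M+2 choose (M+1)) * real (M+1)"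
    using Suc_times_binomial_eq[of "2*M+1" M] by (metis (no_types, lifting) Suc_eq_plus1 add_2_eq_Suc' add_Suc_right of_nat_mult one_add_one)
  have 2: "real (2*M+1) * real (2*M choose M) = real (2*M+1 choose (M+1)) * real (M+1)"
    using Suc_times_binomial_eq[of "2*M" M] by (metis Suc_eq_plus1 of_nat_mult)
  have 3: "(2*M+1 choose M) = (2*M+1 choose (M+1))"
    using binomial_symmetric[of M "2*M+1"] by simp
  define a e where "a = real (2*M choose M)" and "e = real (2*M+2 choose (M+1))"
  have "e * real (M+1) * real (M+1) = real (2*M+2) * (real (2*M+1) * a)"
    using 1 2 3 unfolding e_def a_def by (simp only: mult.assoc) (metis mult.assoc)
  then have "(e * (real M + 1)) * (real M + 1) = (2 * (2 * real M + 1) * a) * (real M + 1)"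
    by (simp add: algebra_simps)
  then have "e * (real M + 1) = 2 * (2 * real M + 1) * a"
    by (subst (asm) mult_right_cancel) auto
  then have e: "e = 2 * (2 * real M + 1) * a / (real M + 1)"
    by (simp add: eq_divide_eq)
  have "cos_mean (Suc M) = e / (4 * 4 ^ M)"
    by (simp add: cos_pow_coeff_def e_def del: binomial_Suc_Suc)
  also have "\<dots> = (a / 4 ^ M) * (2 * real M + 1) / (2 * real M + 2)"
  proof -
    have "2 * n * a / k / (4 * P) = a / P * n / (2 * k)" if "k \<noteq> 0" "P \<noteq> 0" for n k P :: real
      using that by (simp add: field_simps)
    from this[of "real M + 1" "4 ^ M" "2 * real M + 1"] show ?thesis unfolding e by simp
  qed
  finally show ?thesis by (simp add: cos_pow_coeff_def a_def)
qed

text \<open>The factor \<open>2 * M + 1\<close> closes the induction: by the recursion the left side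
  is multiplied by \<open>(2 * M + 1) * (2 * M + 3) / (2 * M + 2)\<^sup>2\<close>, which is at most
  1. This replaces Stirling's formula in the decay of the mean.\<close>

lemma cos_mean_sqr_le: "(cos_mean M)\<^sup>2 * (2 * real M + 1) \<le> 1"
proof (induction M)
  case 0 then show ?case by (simp add: cos_pow_coeff_def)
next
  case (Suc M)
  have "(cos_mean (Suc M))\<^sup>2 * (2 * real (Suc M) + 1) =
      ((cos_mean M)\<^sup>2 * (2 * real M + 1)) * ((2 * real M + 1) * (2 * real M + 3) / (2 * real M + 2)\<^sup>2)"
    by (simp add: cos_mean_Suc power2_eq_square field_simps)
  also have "\<dots> \<le> 1 * 1"
  proof (intro mult_mono)
    have "(2 * real M + 1) * (2 * real M + 3) \<le> (2 * real M + 2)\<^sup>2"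
      by (simp add: power2_eq_square algebra_simps)
    then show "(2 * real M + 1) * (2 * real M + 3) / (2 * real M + 2)\<^sup>2 \<le> 1"
      by (simp add: divide_le_eq_1 del: power2_sum)
  qed (use Suc in auto)
  finally show ?case by simp
qed

lemma cos_mean_small:
  assumes "\<epsilon> > 0" obtains M where "cos_mean M \<le> \<epsilon>"
proof -
  obtain M :: nat where M: "1 / \<epsilon>\<^sup>2 < real M" using reals_Archimedean2 by blast
  have "(cos_mean M)\<^sup>2 * (1 / \<epsilon>\<^sup>2) \<le> (cos_mean M)\<^sup>2 * (2 * real M + 1)"
    using M by (intro mult_left_mono) auto
  also have "\<dots> \<le> 1" by (rule cos_mean_sqr_le)
  finally have "(cos_mean M)\<^sup>2 \<le> \<epsilon>\<^sup>2" using assms by (simp add: field_simps)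
  then show ?thesis using that assms by (meson less_imp_le power2_le_imp_le)
qed

text \<open>Exponential beats polynomial decay: off a target of radius \<open>r\<close> the cosine
  power is at most \<open>(1 - r\<^sup>2) ^ M\<close>, which must lie below the squared mean, itself
  at least \<open>1 / (4 * M\<^sup>2)\<close>.\<close>

lemma exists_power_small:
  assumes "0 \<le> Q" "Q < (1::real)" obtains M :: nat where "M > 0" "Q ^ M \<le> 1 / (8 * (real M)\<^sup>2)"
proof -
  define q where "q = sqrt Q"
  have q: "0 \<le> q" "q < 1" "q\<^sup>2 = Q" using assms by (simp_all add: q_def)
  have "(\<lambda>n. real n * q ^ n) \<longlonglongrightarrow> 0" using q by (intro powser_times_n_limit_0) simp
  then have "eventually (\<lambda>n. real n * q ^ n < 1/4) sequentially"
    by (rule order_tendstoD) simp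
  then have "eventually (\<lambda>n. real n * q ^ n < 1/4 \<and> n > 0) sequentially"
    using eventually_gt_at_top[of 0] by (rule eventually_conj)
  then obtain M where M: "real M * q ^ M < 1/4" "M > 0" by (auto simp: eventually_sequentially)
  have "(real M * q ^ M)\<^sup>2 \<le> (1/4)\<^sup>2" using M q by (intro power_mono) auto
  moreover have "(real M * q ^ M)\<^sup>2 = (real M)\<^sup>2 * Q ^ M"
    by (simp add: power_mult_distrib q(3)[symmetric] power_mult[symmetric] mult.commute[of M])
  ultimately have "(real M)\<^sup>2 * Q ^ M \<le> 1 / 8" by (simp add: power2_eq_square[of "1/4"])
  then show ?thesis using that[of M] M by (simp add: field_simps)
qed

lemma cos_sqr_circle_norm: "(cos (pi * y))\<^sup>2 \<le> 1 - (circle_norm y)\<^sup>2"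
proof -
  have "(circle_norm y)\<^sup>2 \<le> \<bar>sin (pi * y)\<bar>\<^sup>2" using circle_norm_le_abs_sin by (intro power_mono) auto
  then show ?thesis using sin_cos_squared_add[of "pi * y"] unfolding power2_abs by linarith
qed

text \<open>At distance of order \<open>1 / M\<close> from an integer the squared sine is at most
  \<open>1 / (2 * M)\<close>, so Bernoulli's inequality leaves at least one half.\<close>

lemma cos_power_ge_half:
  assumes "M > 0" "circle_norm y \<le> 1 / (5 * real M)" shows "1/2 \<le> cos (pi * y) ^ (2 * M)"
proof -
  have "\<bar>sin (pi * y)\<bar> \<le> pi * (1 / (5 * real M))"
    using abs_sin_le_circle_norm[of y] assms(2) by (meson mult_left_mono order_trans pi_ge_zero)
  also have "\<dots> \<le> 3.5 * (1 / (5 * real M))"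
    using pi_approx assms by (intro mult_right_mono) auto
  finally have "\<bar>sin (pi * y)\<bar>\<^sup>2 \<le> (7 / (10 * real M))\<^sup>2"
    by (intro power_mono) auto
  also have "\<dots> \<le> 1 / (2 * real M)"
    using assms(1) by (simp add: power2_eq_square field_simps)
  finally have s: "(sin (pi * y))\<^sup>2 \<le> 1 / (2 * real M)" by simp
  have "1 / (2 * real M) \<le> 1" using assms(1) by (simp add: field_simps)
  have "1/2 = 1 + real M * (- (1 / (2 * real M)))" using assms(1) by (simp add: field_simps)
  also have "\<dots> \<le> (1 + - (1 / (2 * real M))) ^ M"
    using \<open>1 / (2 * real M) \<le> 1\<close> by (intro Bernoulli_inequality) simp
  also have "\<dots> \<le> ((cos (pi * y))\<^sup>2) ^ M"
    using s sin_cos_squared_add[of "pi * y"] \<open>1 / (2 * real M) \<le> 1\<close> by (intro power_mono; linarith)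
  finally show ?thesis by (simp add: power_mult)
qed

lemma measurable_circle_norm [measurable]: "circle_norm \<in> borel_measurable borel"
  by (rule borel_measurable_continuous_onI) (intro continuous_intros)

text \<open>\<open>2 * cos (pi * u) ^ (2 * M)\<close> majorizes the indicator of the window of
  radius \<open>1 / (5 * M)\<close>; its average is about \<open>2 * cos_mean M\<close>, which is
  small for large \<open>M\<close>. The window depends on \<epsilon> only.\<close>

lemma prob_unif_phase_small:
  assumes "\<epsilon> > 0"
  obtains h where "h > 0" "\<And>\<sigma> B \<phi> q. 0 < \<sigma> \<Longrightarrow> \<sigma> \<le> 1/4 \<Longrightarrow> 1 \<le> B \<Longrightarrow>
     measure (unif \<sigma>) {w. circle_norm (B * cos (2 * pi * w + \<phi>) - q) \<le> h} \<le> \<epsilon> + 10 * B powr (-1/5) / \<sigma>"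
proof -
  \<comment> \<open>The bound \<open>1/2\<close> forces \<open>M > 0\<close>, since
    \<open>cos_mean 0 = 1\<close>.\<close>
  obtain M where M: "cos_mean M \<le> min (1/2) (\<epsilon>/2)"
    using cos_mean_small[of "min (1/2) (\<epsilon>/2)"] assms by auto
  have "M > 0" using M by (cases M) (auto simp: cos_pow_coeff_def)
  show thesis
  proof (rule that[of "1 / (5 * real M)"])
    show "1 / (5 * real M) > 0" using \<open>M > 0\<close> by simp
    fix \<sigma> B \<phi> q :: real assume \<sigma>: "0 < \<sigma>" "\<sigma> \<le> 1/4" and B: "1 \<le> B"
    interpret prob_space "unif \<sigma>" by (rule prob_space_unif) fact
    define u where "u w = B * cos (2 * pi * w + \<phi>) - q" for w
    have [measurable]: "u \<in> borel_measurable borel" unfolding u_def by measurable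
    let ?A = "{w. circle_norm (u w) \<le> 1 / (5 * real M)}"
    have "prob ?A = (\<integral>w. indicator ?A w \<partial>unif \<sigma>)" by simp
    also have "\<dots> \<le> (\<integral>w. 2 * cos (pi * u w) ^ (2 * M) \<partial>unif \<sigma>)"
    proof (rule Bochner_Integration.integral_mono)
      show "integrable (unif \<sigma>) (indicat_real ?A)"
        by (rule integrable_unif[OF \<sigma>(1), of _ 1]) (auto simp: indicator_def)
      show "integrable (unif \<sigma>) (\<lambda>w. 2 * cos (pi * u w) ^ (2 * M))"
        by (rule integrable_unif[OF \<sigma>(1), of _ 2]) (auto simp: power_abs abs_mult power_le_one)
      show "indicat_real ?A w \<le> 2 * cos (pi * u w) ^ (2 * M)" for w
        using cos_power_ge_half[OF \<open>M > 0\<close>, of "u w"] by (auto simp: indicator_def power_mult)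
    qed
    also have "\<dots> = 2 * (\<integral>w. cos (pi * u w) ^ (2 * M) \<partial>unif \<sigma>)" by simp
    also have "(\<integral>w. cos (pi * u w) ^ (2 * M) \<partial>unif \<sigma>) \<le> cos_mean M + 5 * B powr (-1/5) / \<sigma>"
      using cos_power_average[OF \<sigma> B, of \<phi> q M] unfolding u_def by linarith
    also have "\<dots> \<le> \<epsilon> / 2 + 5 * B powr (-1/5) / \<sigma>" using M by simp
    finally show "prob {w. circle_norm (B * cos (2 * pi * w + \<phi>) - q) \<le> 1 / (5 * real M)} \<le> \<epsilon> + 10 * B powr (-1/5) / \<sigma>"
      by (simp add: u_def)
  qed
qed

text \<open>Here the cosine power minus \<open>(1 - r\<^sup>2) ^ M\<close> minorizes the indicator
  of the target. For a suitable \<open>M\<close> its mean is positive, and this gives a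
  \<open>p\<close> depending on \<open>r\<close> alone.\<close>

lemma prob_unif_phase_hit:
  assumes "0 < r" "r \<le> 1/2"
  obtains p where "p > 0" "\<And>\<sigma> B \<phi> q. 0 < \<sigma> \<Longrightarrow> \<sigma> \<le> 1/4 \<Longrightarrow> 1 \<le> B \<Longrightarrow>
     measure (unif \<sigma>) {w. circle_norm (B * cos (2 * pi * w + \<phi>) - q) < r} \<ge> p - 5 * B powr (-1/5) / \<sigma>"
proof -
  have r2: "0 \<le> 1 - r\<^sup>2" "1 - r\<^sup>2 < 1" using assms by (auto simp: power_le_one)
  obtain M where M: "M > 0" "(1 - r\<^sup>2) ^ M \<le> 1 / (8 * (real M)\<^sup>2)" using exists_power_small[OF r2] by blast
  have "1 / (8 * (real M)\<^sup>2) \<le> 1 / (4 * real M)"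
    using M(1) by (simp add: field_simps power2_eq_square)
  then have "(1 - r\<^sup>2) ^ M < cos_mean M" using M cos_mean_ge[OF M(1)] by (smt (verit) divide_less_cancel field_sum_of_halves of_nat_0_less_iff frac_less2)
  show thesis
  proof (rule that[of "cos_mean M - (1 - r\<^sup>2) ^ M"])
    show "cos_mean M - (1 - r\<^sup>2) ^ M > 0" using \<open>(1 - r\<^sup>2) ^ M < cos_mean M\<close> by simp
    fix \<sigma> B \<phi> q :: real assume \<sigma>: "0 < \<sigma>" "\<sigma> \<le> 1/4" and B: "1 \<le> B"
    interpret prob_space "unif \<sigma>" by (rule prob_space_unif) fact
    define u where "u w = B * cos (2 * pi * w + \<phi>) - q" for w
    have [measurable]: "u \<in> borel_measurable borel" unfolding u_def by measurable
    let ?A = "{w. circle_norm (u w) < r}"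
    have iA: "integrable (unif \<sigma>) (indicat_real ?A)"
      by (rule integrable_unif[OF \<sigma>(1), of _ 1]) (auto simp: indicator_def)
    have "cos_mean M - 5 * B powr (-1/5) / \<sigma> \<le> (\<integral>w. cos (pi * u w) ^ (2 * M) \<partial>unif \<sigma>)"
      using cos_power_average[OF \<sigma> B, of \<phi> q M] unfolding u_def by linarith
    also have "\<dots> \<le> (\<integral>w. indicator ?A w + (1 - r\<^sup>2) ^ M \<partial>unif \<sigma>)"
    proof (rule Bochner_Integration.integral_mono)
      show "integrable (unif \<sigma>) (\<lambda>w. cos (pi * u w) ^ (2 * M))"
        by (rule integrable_unif[OF \<sigma>(1), of _ 1]) (auto simp: power_abs abs_mult power_le_one)
      show "integrable (unif \<sigma>) (\<lambda>w. indicat_real ?A w + (1 - r\<^sup>2) ^ M)" using iA by simp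
      fix w
      show "cos (pi * u w) ^ (2 * M) \<le> indicat_real ?A w + (1 - r\<^sup>2) ^ M"
      proof (cases "w \<in> ?A")
        case True
        have "((cos (pi * u w))\<^sup>2) ^ M \<le> 1" by (rule power_le_one) (auto simp: abs_square_le_1)
        moreover have "(1 - r\<^sup>2) ^ M \<ge> 0" using r2 by simp
        ultimately show ?thesis using True by (simp add: power_mult)
      next
        case False
        then have "r\<^sup>2 \<le> (circle_norm (u w))\<^sup>2" using assms by (intro power_mono) auto
        then have "(cos (pi * u w))\<^sup>2 \<le> 1 - r\<^sup>2" using cos_sqr_circle_norm[of "u w"] by linarith
        then have "((cos (pi * u w))\<^sup>2) ^ M \<le> (1 - r\<^sup>2) ^ M" by (intro power_mono) auto
        then show ?thesis using False by (simp add: power_mult)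
      qed
    qed
    also have "\<dots> = prob ?A + (1 - r\<^sup>2) ^ M"
      using iA \<sigma> by (subst Bochner_Integration.integral_add) (auto simp: measure_unif_UNIV)
    finally show "prob {w. circle_norm (B * cos (2 * pi * w + \<phi>) - q) < r} \<ge> cos_mean M - (1 - r\<^sup>2) ^ M - 5 * B powr (-1/5) / \<sigma>"
      by (simp add: u_def)
  qed
qed

text \<open>The minorant of \<open>prob_unif_phase_hit\<close> with a product of two cosine powers:
  outside the box at least one factor is at most \<open>(1 - r\<^sup>2) ^ M\<close>, while the
  average is close to the square of \<open>cos_mean M\<close>.\<close>

lemma prob_unif_box_hit:
  assumes "0 < r" "r \<le> 1/2"
  obtains p where "p > 0" "\<And>\<sigma> L \<kappa> x x' a b. 0 < \<sigma> \<Longrightarrow> \<sigma> \<le> 1/4 \<Longrightarrow> 0 < \<kappa> \<Longrightarrow> \<kappa> \<le> 1 \<Longrightarrow>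
     \<kappa> \<le> circle_norm (2 * (x - x')) \<Longrightarrow> 1 \<le> L * \<kappa> \<Longrightarrow>
     measure (unif \<sigma>) {w. circle_norm (L * cos (2 * pi * (x + w)) - a) < r \<and> circle_norm (L * cos (2 * pi * (x' + w)) - b) < r}
      \<ge> p - 5 * (L * \<kappa>) powr (-1/5) / \<sigma>"
proof -
  have r2: "0 \<le> 1 - r\<^sup>2" "1 - r\<^sup>2 < 1" using assms by (auto simp: power_le_one)
  obtain M where M: "M > 0" "(1 - r\<^sup>2) ^ M \<le> 1 / (8 * (real M)\<^sup>2)" using exists_power_small[OF r2] by blast
  have "(1 / (2 * real M))\<^sup>2 \<le> (cos_mean M)\<^sup>2" using cos_mean_ge[OF M(1)] by (intro power_mono) auto
  moreover have "1 / (8 * (real M)\<^sup>2) < (1 / (2 * real M))\<^sup>2"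
    using M(1) by (simp add: power2_eq_square field_simps)
  ultimately have less: "(1 - r\<^sup>2) ^ M < (cos_mean M)\<^sup>2" using M(2) by linarith
  show thesis
  proof (rule that[of "(cos_mean M)\<^sup>2 - (1 - r\<^sup>2) ^ M"])
    show "(cos_mean M)\<^sup>2 - (1 - r\<^sup>2) ^ M > 0" using less by simp
    fix \<sigma> L \<kappa> x x' a b :: real assume \<sigma>: "0 < \<sigma>" "\<sigma> \<le> 1/4"
      and \<kappa>: "0 < \<kappa>" "\<kappa> \<le> 1" "\<kappa> \<le> circle_norm (2 * (x - x'))" and L: "1 \<le> L * \<kappa>"
    interpret prob_space "unif \<sigma>" by (rule prob_space_unif) fact
    define u v where "u w = L * cos (2 * pi * (x + w)) - a" and "v w = L * cos (2 * pi * (x' + w)) - b" for w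
    have [measurable]: "u \<in> borel_measurable borel" "v \<in> borel_measurable borel" unfolding u_def v_def by measurable
    let ?A = "{w. circle_norm (u w) < r \<and> circle_norm (v w) < r}"
    have iA: "integrable (unif \<sigma>) (indicat_real ?A)"
      by (rule integrable_unif[OF \<sigma>(1), of _ 1]) (auto simp: indicator_def)
    have "(cos_mean M)\<^sup>2 - 5 * (L * \<kappa>) powr (-1/5) / \<sigma> \<le> (\<integral>w. cos (pi * u w) ^ (2 * M) * cos (pi * v w) ^ (2 * M) \<partial>unif \<sigma>)"
      using cos_power_average2[OF \<sigma> \<kappa> L, of a M b] unfolding u_def v_def by linarith
    also have "\<dots> \<le> (\<integral>w. indicator ?A w + (1 - r\<^sup>2) ^ M \<partial>unif \<sigma>)"
    proof (rule Bochner_Integration.integral_mono)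
      have le1: "0 \<le> cos y ^ (2 * M)" "cos y ^ (2 * M) \<le> 1" for y :: real
        unfolding power_mult by (simp, rule power_le_one) (auto simp: abs_square_le_1)
      have le2: "cos (pi * y) ^ (2 * M) \<le> (1 - r\<^sup>2) ^ M" if "\<not> circle_norm y < r" for y
      proof -
        have "r\<^sup>2 \<le> (circle_norm y)\<^sup>2" using that assms by (intro power_mono) auto
        then have "(cos (pi * y))\<^sup>2 \<le> 1 - r\<^sup>2" using cos_sqr_circle_norm[of y] by linarith
        then show ?thesis unfolding power_mult by (intro power_mono) auto
      qed
      have b: "0 \<le> cos (pi * u w) ^ (2 * M) * cos (pi * v w) ^ (2 * M)" "cos (pi * u w) ^ (2 * M) * cos (pi * v w) ^ (2 * M) \<le> 1" for w
        using le1 by (auto intro!: mult_le_one mult_nonneg_nonneg)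
      show "integrable (unif \<sigma>) (\<lambda>w. cos (pi * u w) ^ (2 * M) * cos (pi * v w) ^ (2 * M))"
        by (rule integrable_unif[OF \<sigma>(1), of _ 1]) (use b in \<open>auto simp: abs_of_nonneg\<close>)
      show "integrable (unif \<sigma>) (\<lambda>w. indicat_real ?A w + (1 - r\<^sup>2) ^ M)" using iA by simp
      fix w
      show "cos (pi * u w) ^ (2 * M) * cos (pi * v w) ^ (2 * M) \<le> indicat_real ?A w + (1 - r\<^sup>2) ^ M"
      proof (cases "w \<in> ?A")
        case True
        moreover have "(1 - r\<^sup>2) ^ M \<ge> 0" using r2 by simp
        ultimately show ?thesis using b(2)[of w] by (simp only: indicator_simps)
      next
        case False
        then have "cos (pi * u w) ^ (2 * M) * cos (pi * v w) ^ (2 * M) \<le> (1 - r\<^sup>2) ^ M"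
        proof (cases "circle_norm (u w) < r")
          case True
          then show ?thesis using False le2[of "v w"] le1[of "pi * u w"] le1[of "pi * v w"]
            mult_mono[of "cos (pi * u w) ^ (2 * M)" 1 "cos (pi * v w) ^ (2 * M)" "(1 - r\<^sup>2) ^ M"] by auto
        next
          case False
          then show ?thesis using le2[of "u w"] le1[of "pi * u w"] le1[of "pi * v w"] r2
            mult_mono[of "cos (pi * u w) ^ (2 * M)" "(1 - r\<^sup>2) ^ M" "cos (pi * v w) ^ (2 * M)" 1] by auto
        qed
        then show ?thesis using False by (simp only: indicator_simps not_False_eq_True)
      qed
    qed
    also have "\<dots> = prob ?A + (1 - r\<^sup>2) ^ M"
      using iA \<sigma> by (subst Bochner_Integration.integral_add) (auto simp: measure_unif_UNIV)
    finally show "prob {w. circle_norm (L * cos (2 * pi * (x + w)) - a) < r \<and> circle_norm (L * cos (2 * pi * (x' + w)) - b) < r}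
      \<ge> (cos_mean M)\<^sup>2 - (1 - r\<^sup>2) ^ M - 5 * (L * \<kappa>) powr (-1/5) / \<sigma>"
      by (simp add: u_def v_def)
  qed
qed

section \<open>One step of the random map\<close>

text \<open>The price of the small noise: each division by \<sigma> costs at most
  \<open>L powr (1/100)\<close>.\<close>

lemma inverse_powr_le:
  fixes L \<delta> :: real
  assumes "L \<ge> 1" "\<delta> < 1/100" shows "1 / L powr (-\<delta>) \<le> L powr (1/100)"
proof -
  have "1 / L powr (-\<delta>) = L powr \<delta>" by (subst powr_minus_divide) simp
  also have "\<dots> \<le> L powr (1/100)" using assms by (intro powr_mono) auto
  finally show ?thesis .
qed

lemma eventually_noise_small:
  assumes "\<delta> > 0" "\<epsilon> > 0" shows "\<forall>\<^sub>F L in at_top. L powr (-\<delta>) \<le> (\<epsilon>::real)"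
proof -
  have "((\<lambda>L::real. L powr (-\<delta>)) \<longlongrightarrow> 0) at_top"
    using assms(1) by (intro tendsto_neg_powr filterlim_ident) auto
  then have "\<forall>\<^sub>F L in at_top. L powr (-\<delta>) < \<epsilon>" using assms(2) by (rule order_tendstoD)
  then show ?thesis by eventually_elim simp
qed

lemma cos_diff_superposition:
  assumes "L \<ge> 0"
  obtains \<phi> where "\<And>w. L * cos (2 * pi * (x + w)) - L * cos (2 * pi * (x' + w))
      = 2 * L * \<bar>sin (pi * (x - x'))\<bar> * cos (2 * pi * w + \<phi>)"
proof -
  have *: "L * cos (2 * pi * (x + w)) - L * cos (2 * pi * (x' + w))
      = 2 * L * sin (pi * (x - x')) * cos (2 * pi * w + (pi * (x + x') + pi / 2))" for w
  proof -
    have "cos (2 * pi * (x + w)) - cos (2 * pi * (x' + w)) =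
      - 2 * sin (2 * pi * w + pi * (x + x')) * sin (pi * (x - x'))"
    proof -
      have "(2 * pi * (x + w) + 2 * pi * (x' + w)) / 2 = 2 * pi * w + pi * (x + x')"
        "(2 * pi * (x' + w) - 2 * pi * (x + w)) / 2 = - (pi * (x - x'))"
        by (simp_all add: field_simps)
      then show ?thesis by (simp only: cos_diff_cos sin_minus)
    qed
    moreover have "cos (2 * pi * w + (pi * (x + x') + pi / 2)) = - sin (2 * pi * w + pi * (x + x'))"
      by (simp add: add.assoc[symmetric] cos_add)
    ultimately show ?thesis by (simp add: right_diff_distrib[symmetric])
  qed
  show ?thesis
  proof (cases "sin (pi * (x - x')) \<ge> 0")
    case True
    then have "L * cos (2 * pi * (x + w)) - L * cos (2 * pi * (x' + w))
      = 2 * L * \<bar>sin (pi * (x - x'))\<bar> * cos (2 * pi * w + (pi * (x + x') + pi / 2))" for w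
      by (simp only: * abs_of_nonneg)
    then show ?thesis using that by blast
  next
    case False
    then have "L * cos (2 * pi * (x + w)) - L * cos (2 * pi * (x' + w))
      = 2 * L * \<bar>sin (pi * (x - x'))\<bar> * cos (2 * pi * w + (pi * (x + x') + pi / 2 + pi))" for w
      by (simp only: * abs_of_neg not_le add.assoc[symmetric] cos_periodic_pi mult_minus_left mult_minus_right)
    then show ?thesis using that by blast
  qed
qed

text \<open>Uniformity in all \<open>B > 0\<close> needs two regimes. For
  \<open>B \<ge> L powr (1/16)\<close> the phase wraps and the error \<open>B powr (-1/5)\<close> is
  at most \<open>L powr (-1/80)\<close>, just enough against the noise loss
  \<open>L powr (1/100)\<close>. For smaller \<open>B\<close> at most \<open>2 * B + 5\<close>
  integers can be approached, each with probability of order \<open>L powr (-1/8 + 1/100)\<close>,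
  and \<open>1/16 + 1/100 < 1/8\<close>.\<close>

lemma eventually_phase_growth:
  assumes \<delta>: "0 < \<delta>" "\<delta> < 1/100" and \<epsilon>: "\<epsilon> > 0"
  obtains h where "h > 0" "h \<le> 1/4" "\<forall>\<^sub>F L in at_top. \<forall>B>0. \<forall>\<phi> q.
     measure (unif (L powr -\<delta>)) {w. circle_norm (B * cos (2 * pi * w + \<phi>) - q) < min h (B * L powr (-1/4))} \<le> \<epsilon>"
proof -
  obtain h0 where h0: "h0 > 0" "\<And>\<sigma> B \<phi> q. 0 < \<sigma> \<Longrightarrow> \<sigma> \<le> 1/4 \<Longrightarrow> 1 \<le> B \<Longrightarrow>
     measure (unif \<sigma>) {w. circle_norm (B * cos (2 * pi * w + \<phi>) - q) \<le> h0} \<le> \<epsilon>/2 + 10 * B powr (-1/5) / \<sigma>"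
    using prob_unif_phase_small[of "\<epsilon>/2"] \<epsilon> by auto
  define h where "h = min h0 (1/4)"
  have ev1: "\<forall>\<^sub>F L::real in at_top. 10 * (L powr (1/16)) powr (-1/5) * L powr (1/100) \<le> \<epsilon>/2"
  proof -
    have "((\<lambda>L::real. 10 * (L powr (1/16)) powr (-1/5) * L powr (1/100)) \<longlongrightarrow> 0) at_top" by real_asymp
    then have "\<forall>\<^sub>F L::real in at_top. 10 * (L powr (1/16)) powr (-1/5) * L powr (1/100) < \<epsilon>/2"
      using \<epsilon> by (intro order_tendstoD) auto
    then show ?thesis by eventually_elim simp
  qed
  have ev2: "\<forall>\<^sub>F L::real in at_top. (2 * L powr (1/16) + 5) * (7 * sqrt (L powr (-1/4)) * L powr (1/100)) \<le> \<epsilon>"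
  proof -
    have "((\<lambda>L::real. (2 * L powr (1/16) + 5) * (7 * sqrt (L powr (-1/4)) * L powr (1/100))) \<longlongrightarrow> 0) at_top" by real_asymp
    then have "\<forall>\<^sub>F L::real in at_top. (2 * L powr (1/16) + 5) * (7 * sqrt (L powr (-1/4)) * L powr (1/100)) < \<epsilon>"
      using \<epsilon> by (intro order_tendstoD) auto
    then show ?thesis by eventually_elim simp
  qed
  have "\<forall>\<^sub>F L::real in at_top. \<forall>B>0. \<forall>\<phi> q.
     measure (unif (L powr -\<delta>)) {w. circle_norm (B * cos (2 * pi * w + \<phi>) - q) < min h (B * L powr (-1/4))} \<le> \<epsilon>"
    using ev1 ev2 eventually_ge_at_top[of 1] eventually_noise_small[OF \<delta>(1), of "1/4", simplified]
  proof eventually_elim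
    case (elim L)
    define \<sigma> where "\<sigma> = L powr -\<delta>"
    have \<sigma>: "0 < \<sigma>" "\<sigma> \<le> 1/4" "1 / \<sigma> \<le> L powr (1/100)"
      using elim inverse_powr_le[OF _ \<delta>(2), of L] by (auto simp: \<sigma>_def)
    interpret prob_space "unif \<sigma>" by (rule prob_space_unif) fact
    have div: "a / \<sigma> \<le> a * L powr (1/100)" if "a \<ge> 0" for a
      using mult_left_mono[OF \<sigma>(3) that] by simp
    show ?case
    proof (intro allI impI)
      fix B \<phi> q :: real assume B: "B > 0"
      define A where "A = {w. circle_norm (B * cos (2 * pi * w + \<phi>) - q) < min h (B * L powr (-1/4))}"
      have "prob A \<le> \<epsilon>"
      proof (cases "B \<ge> L powr (1/16)")
        case True
        have "1 \<le> L powr (1/16)" using elim by (simp add: ge_one_powr_ge_zero)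
        have "prob A \<le> prob {w. circle_norm (B * cos (2 * pi * w + \<phi>) - q) \<le> h0}"
          by (intro finite_measure_mono) (auto simp: A_def h_def)
        also have "\<dots> \<le> \<epsilon>/2 + 10 * B powr (-1/5) / \<sigma>"
          using \<sigma> True \<open>1 \<le> L powr (1/16)\<close> by (intro h0) auto
        also have "\<dots> \<le> \<epsilon>/2 + 10 * B powr (-1/5) * L powr (1/100)" using div[of "10 * B powr (-1/5)"] by simp
        also have "\<dots> \<le> \<epsilon>/2 + 10 * (L powr (1/16)) powr (-1/5) * L powr (1/100)"
          using True elim by (intro add_left_mono mult_right_mono mult_left_mono powr_mono2') auto
        finally show ?thesis using elim by linarith
      next
        case False
        \<comment> \<open>All integers that can be nearest to a value of \<open>B * cos - q\<close>;
          nearness to one of them is nearness of a sine to a fixed level.\<close>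
        define J where "J = {\<lfloor>-q - B - 1\<rfloor>..\<lceil>-q + B + 1\<rceil>}"
        define S where "S m = {w. \<bar>sin (2 * pi * w + (\<phi> + pi/2)) - (q + of_int m) / B\<bar> \<le> L powr (-1/4)}" for m :: int
        have [measurable]: "S m \<in> sets borel" for m unfolding S_def by measurable
        have "A \<subseteq> (\<Union>m\<in>J. S m)"
        proof
          fix w assume w: "w \<in> A"
          define c where "c = cos (2 * pi * w + \<phi>)"
          obtain m :: int where m: "circle_norm (B * c - q) = \<bar>B * c - q - of_int m\<bar>" by (metis circle_norm_attained)
          have 1: "\<bar>B * c - q - of_int m\<bar> < B * L powr (-1/4)" using w m by (simp add: A_def c_def)
          have "\<bar>B * c\<bar> \<le> B" using B by (simp add: abs_mult c_def mult_left_le)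
          moreover have "\<bar>B * c - q - of_int m\<bar> \<le> 1/2" using m circle_norm_le_half by metis
          ultimately have "-q - B - 1 \<le> of_int m" "of_int m \<le> -q + B + 1"
            by (simp_all only: abs_le_iff) linarith+
          then have "m \<in> J" unfolding J_def atLeastAtMost_iff by linarith
          moreover have "c - (q + of_int m) / B = (B * c - q - of_int m) / B" using B by (simp add: field_simps)
          then have "\<bar>c - (q + of_int m) / B\<bar> = \<bar>B * c - q - of_int m\<bar> / B" using B by simp
          then have "\<bar>c - (q + of_int m) / B\<bar> \<le> L powr (-1/4)" using 1 B by (simp add: pos_divide_le_eq mult.commute)
          then have "w \<in> S m" by (simp add: S_def c_def sin_add cos_add)
          ultimately show "w \<in> (\<Union>m\<in>J. S m)" by blast
        qed
        then have "prob A \<le> prob (\<Union>m\<in>J. S m)" by (intro finite_measure_mono) (auto simp: J_def)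
        also have "\<dots> \<le> (\<Sum>m\<in>J. prob (S m))"
          by (intro finite_measure_subadditive_finite) (auto simp: J_def)
        also have "\<dots> \<le> (\<Sum>m\<in>J. 7 * sqrt (L powr (-1/4)) * L powr (1/100))"
        proof (rule sum_mono)
          fix m
          have "prob (S m) \<le> 7 * sqrt (L powr (-1/4)) / \<sigma>"
            unfolding S_def using \<sigma> by (intro prob_unif_sin_near) auto
          also have "\<dots> \<le> 7 * sqrt (L powr (-1/4)) * L powr (1/100)" by (intro div) auto
          finally show "prob (S m) \<le> 7 * sqrt (L powr (-1/4)) * L powr (1/100)" .
        qed
        also have "\<dots> = real (card J) * (7 * sqrt (L powr (-1/4)) * L powr (1/100))" by simp
        also have "\<dots> \<le> (2 * L powr (1/16) + 5) * (7 * sqrt (L powr (-1/4)) * L powr (1/100))"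
        proof (rule mult_right_mono)
          have "0 \<le> \<lceil>-q + B + 1\<rceil> + 1 - \<lfloor>-q - B - 1\<rfloor>" using B by linarith
          then have "real (card J) = of_int (\<lceil>-q + B + 1\<rceil> + 1 - \<lfloor>-q - B - 1\<rfloor>)" by (simp add: J_def)
          also have "\<dots> \<le> 2 * B + 5" by linarith
          also have "\<dots> \<le> 2 * L powr (1/16) + 5" using False by simp
          finally show "real (card J) \<le> 2 * L powr (1/16) + 5" .
        qed auto
        finally show ?thesis using elim by linarith
      qed
      then show "measure (unif (L powr -\<delta>)) {w. circle_norm (B * cos (2 * pi * w + \<phi>) - q) < min h (B * L powr (-1/4))} \<le> \<epsilon>"
        by (simp add: A_def \<sigma>_def)
    qed
  qed
  moreover have "h > 0" "h \<le> 1/4" using h0 by (auto simp: h_def)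
  ultimately show ?thesis using that by blast
qed

definition next_x :: "real \<Rightarrow> real \<Rightarrow> real \<Rightarrow> real \<Rightarrow> real" where
  "next_x L x y w = L * cos (2 * pi * (x + w)) - y"

lemma measurable_next_x [measurable]: "next_x L x y \<in> borel_measurable borel"
  by (rule borel_measurable_continuous_onI) (unfold next_x_def[abs_def], intro continuous_intros)

lemma next_x_diff:
  assumes "L \<ge> 0"
  obtains \<phi> where "\<And>w. next_x L x y w - next_x L x' y' w = 2 * L * \<bar>sin (pi * (x - x'))\<bar> * cos (2 * pi * w + \<phi>) - (y - y')"
proof -
  obtain \<phi> where \<phi>: "\<And>w. L * cos (2 * pi * (x + w)) - L * cos (2 * pi * (x' + w))
      = 2 * L * \<bar>sin (pi * (x - x'))\<bar> * cos (2 * pi * w + \<phi>)"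
    using cos_diff_superposition[OF assms] by blast
  then have "next_x L x y w - next_x L x' y' w = 2 * L * \<bar>sin (pi * (x - x'))\<bar> * cos (2 * pi * w + \<phi>) - (y - y')" for w
    using \<phi>[of w] unfolding next_x_def by linarith
  then show ?thesis using that by blast
qed

text \<open>The threshold covers both scales: a small difference is multiplied by about
  \<open>L powr (3/4)\<close>, and the new difference is only asked to reach a constant
  \<open>h\<close> once this product exceeds it.\<close>

lemma eventually_separation:
  assumes \<delta>: "0 < \<delta>" "\<delta> < 1/100" and \<epsilon>: "\<epsilon> > 0"
  obtains h where "h > 0" "h \<le> 1/4" "\<forall>\<^sub>F L in at_top. \<forall>x y x' y'.
     measure (unif (L powr -\<delta>)) {w. circle_norm (next_x L x y w - next_x L x' y' w)
        < min h (2 * L * \<bar>sin (pi * (x - x'))\<bar> * L powr (-1/4))} \<le> \<epsilon>"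
proof -
  obtain h where h: "h > 0" "h \<le> 1/4" "\<forall>\<^sub>F L in at_top. \<forall>B>0. \<forall>\<phi> q.
     measure (unif (L powr -\<delta>)) {w. circle_norm (B * cos (2 * pi * w + \<phi>) - q) < min h (B * L powr (-1/4))} \<le> \<epsilon>"
    using eventually_phase_growth[OF assms] by blast
  from h(3) eventually_gt_at_top[of 0] have "\<forall>\<^sub>F L in at_top. \<forall>x y x' y'.
     measure (unif (L powr -\<delta>)) {w. circle_norm (next_x L x y w - next_x L x' y' w)
        < min h (2 * L * \<bar>sin (pi * (x - x'))\<bar> * L powr (-1/4))} \<le> \<epsilon>"
  proof eventually_elim
    case (elim L)
    show ?case
    proof (intro allI)
      fix x y x' y'
      obtain \<phi> where \<phi>: "\<And>w. next_x L x y w - next_x L x' y' w = 2 * L * \<bar>sin (pi * (x - x'))\<bar> * cos (2 * pi * w + \<phi>) - (y - y')"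
        using next_x_diff[of L x y x' y'] elim by auto
      show "measure (unif (L powr -\<delta>)) {w. circle_norm (next_x L x y w - next_x L x' y' w)
        < min h (2 * L * \<bar>sin (pi * (x - x'))\<bar> * L powr (-1/4))} \<le> \<epsilon>"
      \<comment> \<open>With amplitude zero the threshold is at most 0, so the event is empty; the
        phase estimate requires a positive amplitude.\<close>
      proof (cases "sin (pi * (x - x')) = 0")
        case True
        then have "{w. circle_norm (next_x L x y w - next_x L x' y' w)
          < min h (2 * L * \<bar>sin (pi * (x - x'))\<bar> * L powr (-1/4))} = {}"
          by (auto simp: not_less intro: min.coboundedI2)
        then show ?thesis using \<epsilon> by (simp only: measure_empty)
      next
        case False
        then show ?thesis using elim unfolding \<phi> by (intro elim(1)[rule_format]) auto
      qed
    qed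
  qed
  with h show ?thesis using that by blast
qed

text \<open>Doubling sends both critical points 0 and 1/2 to integers, so one phase of amplitude
  \<open>2 * L\<close> handles the two at once.\<close>

lemma eventually_not_critical:
  assumes \<delta>: "0 < \<delta>" "\<delta> < 1/100" and \<epsilon>: "\<epsilon> > 0"
  obtains h where "h > 0" "\<forall>\<^sub>F L in at_top. \<forall>x y.
     measure (unif (L powr -\<delta>)) {w. circle_norm (2 * next_x L x y w) \<le> h} \<le> \<epsilon>"
proof -
  obtain h where h: "h > 0" "\<And>\<sigma> B \<phi> q. 0 < \<sigma> \<Longrightarrow> \<sigma> \<le> 1/4 \<Longrightarrow> 1 \<le> B \<Longrightarrow>
     measure (unif \<sigma>) {w. circle_norm (B * cos (2 * pi * w + \<phi>) - q) \<le> h} \<le> \<epsilon>/2 + 10 * B powr (-1/5) / \<sigma>"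
    using prob_unif_phase_small[of "\<epsilon>/2"] \<epsilon> by auto
  have ev1: "\<forall>\<^sub>F L::real in at_top. 10 * (2 * L) powr (-1/5) * L powr (1/100) \<le> \<epsilon>/2"
  proof -
    have "((\<lambda>L::real. 10 * (2 * L) powr (-1/5) * L powr (1/100)) \<longlongrightarrow> 0) at_top" by real_asymp
    then have "\<forall>\<^sub>F L::real in at_top. 10 * (2 * L) powr (-1/5) * L powr (1/100) < \<epsilon>/2"
      using \<epsilon> by (intro order_tendstoD) auto
    then show ?thesis by eventually_elim simp
  qed
  have "\<forall>\<^sub>F L in at_top. \<forall>x y. measure (unif (L powr -\<delta>)) {w. circle_norm (2 * next_x L x y w) \<le> h} \<le> \<epsilon>"
    using ev1 eventually_ge_at_top[of 1] eventually_noise_small[OF \<delta>(1), of "1/4", simplified]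
  proof eventually_elim
    case (elim L)
    show ?case
    proof (intro allI)
      fix x y :: real
      have "2 * next_x L x y w = (2 * L) * cos (2 * pi * w + 2 * pi * x) - 2 * y" for w
        by (simp add: next_x_def algebra_simps)
      then have "measure (unif (L powr -\<delta>)) {w. circle_norm (2 * next_x L x y w) \<le> h} \<le> \<epsilon>/2 + 10 * (2 * L) powr (-1/5) / L powr -\<delta>"
        using elim by (simp only:) (intro h(2), auto)
      also have "10 * (2 * L) powr (-1/5) / L powr -\<delta> \<le> 10 * (2 * L) powr (-1/5) * L powr (1/100)"
        using mult_left_mono[OF inverse_powr_le[OF _ \<delta>(2), of L], of "10 * (2 * L) powr (-1/5)"] elim by simp
      finally show "measure (unif (L powr -\<delta>)) {w. circle_norm (2 * next_x L x y w) \<le> h} \<le> \<epsilon>" using elim by linarith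
    qed
  qed
  with h(1) show ?thesis using that by blast
qed

text \<open>The vector \<open>(a, b)\<close> is sent by the derivative of the map to \<open>(next_v L x a b w, a)\<close>.\<close>

definition next_v :: "real \<Rightarrow> real \<Rightarrow> real \<Rightarrow> real \<Rightarrow> real \<Rightarrow> real" where
  "next_v L x a b w = - (2 * pi * L * sin (2 * pi * (x + w))) * a - b"

lemma measurable_next_v [measurable]: "next_v L x a b \<in> borel_measurable borel"
  by (rule borel_measurable_continuous_onI) (unfold next_v_def[abs_def], intro continuous_intros)

text \<open>The event excludes \<open>a = 0\<close>; then it forces \<open>sin\<close> to lie within
  \<open>1 / (L * t)\<close> of the level at which the first component of the image vanishes, an
  event of probability of order \<open>L powr (-1/2)\<close> up to the noise loss.\<close>

lemma eventually_cone:
  assumes \<delta>: "0 < \<delta>" "\<delta> < 1/100" and \<epsilon>: "\<epsilon> > 0" and t: "t > 0"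
  shows "\<forall>\<^sub>F L in at_top. \<forall>x a b. measure (unif (L powr -\<delta>)) {w. \<bar>a\<bar> > t * \<bar>next_v L x a b w\<bar>} \<le> \<epsilon>"
proof -
  have ev1: "\<forall>\<^sub>F L::real in at_top. 7 * sqrt (1 / (L * t)) * L powr (1/100) \<le> \<epsilon>"
  proof -
    have "((\<lambda>L::real. sqrt (1 / L) * L powr (1/100)) \<longlongrightarrow> 0) at_top" by real_asymp
    then have "((\<lambda>L::real. (7 * sqrt (1 / t)) * (sqrt (1 / L) * L powr (1/100))) \<longlongrightarrow> 0) at_top"
      by (rule tendsto_mult_right_zero)
    then have "((\<lambda>L::real. 7 * sqrt (1 / (L * t)) * L powr (1/100)) \<longlongrightarrow> 0) at_top"
      by (simp add: real_sqrt_divide real_sqrt_mult mult.commute)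
    then have "\<forall>\<^sub>F L::real in at_top. 7 * sqrt (1 / (L * t)) * L powr (1/100) < \<epsilon>"
      using \<epsilon> by (intro order_tendstoD) auto
    then show ?thesis by eventually_elim simp
  qed
  show ?thesis
    using ev1 eventually_ge_at_top[of 1] eventually_noise_small[OF \<delta>(1), of "1/4", simplified]
  proof eventually_elim
    case (elim L)
    show ?case
    proof (intro allI)
      fix x a b :: real
      have \<sigma>: "0 < L powr -\<delta>" using elim by simp
      interpret prob_space "unif (L powr -\<delta>)" by (rule prob_space_unif) fact
      define q where "q = - b / (2 * pi * L * a)"
      have "{w. \<bar>a\<bar> > t * \<bar>next_v L x a b w\<bar>} \<subseteq> {w. \<bar>sin (2 * pi * w + 2 * pi * x) - q\<bar> \<le> 1 / (L * t)}"
      proof safe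
        fix w assume w: "\<bar>a\<bar> > t * \<bar>next_v L x a b w\<bar>"
        have a: "a \<noteq> 0" using w t by (auto simp: mult_less_0_iff)
        define s where "s = sin (2 * pi * w + 2 * pi * x)"
        have "next_v L x a b w = - (2 * pi * L * a) * (s - q)"
          using elim a by (simp add: next_v_def s_def q_def field_simps)
        then have "t * ((2 * pi * L * \<bar>a\<bar>) * \<bar>s - q\<bar>) < \<bar>a\<bar>"
          using w elim by (simp add: abs_mult)
        then have "\<bar>a\<bar> * (t * (2 * pi * L) * \<bar>s - q\<bar>) < \<bar>a\<bar> * 1" by (simp add: ac_simps)
        then have 1: "t * (2 * pi * L) * \<bar>s - q\<bar> < 1" using a by simp
        have "t * L * \<bar>s - q\<bar> \<le> t * (2 * pi * L) * \<bar>s - q\<bar>"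
          using t elim pi_gt3 by (intro mult_right_mono mult_left_mono) auto
        then have "t * L * \<bar>s - q\<bar> < 1" using 1 by linarith
        then show "\<bar>s - q\<bar> \<le> 1 / (L * t)" using t elim by (simp add: field_simps)
      qed
      then have "prob {w. \<bar>a\<bar> > t * \<bar>next_v L x a b w\<bar>} \<le> prob {w. \<bar>sin (2 * pi * w + 2 * pi * x) - q\<bar> \<le> 1 / (L * t)}"
        by (intro finite_measure_mono) auto
      also have "\<dots> \<le> 7 * sqrt (1 / (L * t)) / L powr -\<delta>"
        using elim t by (intro prob_unif_sin_near) auto
      also have "\<dots> \<le> 7 * sqrt (1 / (L * t)) * L powr (1/100)"
        using mult_left_mono[OF inverse_powr_le[OF _ \<delta>(2), of L], of "7 * sqrt (1 / (L * t))"] elim t by simp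
      finally show "prob {w. \<bar>a\<bar> > t * \<bar>next_v L x a b w\<bar>} \<le> \<epsilon>" using elim by linarith
    qed
  qed
qed

text \<open>A separation of \<open>L powr (-1/2)\<close> already gives the phase an amplitude
  \<open>L powr (1/2)\<close>. The goal 1/4 is the difference farthest from both resonances 0 and
  1/2.\<close>

lemma eventually_quarter_hit:
  assumes \<delta>: "0 < \<delta>" "\<delta> < 1/100"
  obtains p where "p > 0" "\<forall>\<^sub>F L in at_top. \<forall>x y x' y'. L powr (-1/2) \<le> circle_norm (x - x') \<longrightarrow>
     p \<le> measure (unif (L powr -\<delta>)) {w. circle_norm (next_x L x y w - next_x L x' y' w - 1/4) < 1/8}"
proof -
  obtain p where p: "p > 0" "\<And>\<sigma> B \<phi> q. 0 < \<sigma> \<Longrightarrow> \<sigma> \<le> 1/4 \<Longrightarrow> 1 \<le> B \<Longrightarrow>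
     measure (unif \<sigma>) {w. circle_norm (B * cos (2 * pi * w + \<phi>) - q) < 1/8} \<ge> p - 5 * B powr (-1/5) / \<sigma>"
    using prob_unif_phase_hit[of "1/8"] by auto
  have ev1: "\<forall>\<^sub>F L::real in at_top. 5 * (L powr (1/2)) powr (-1/5) * L powr (1/100) \<le> p/2"
  proof -
    have "((\<lambda>L::real. 5 * (L powr (1/2)) powr (-1/5) * L powr (1/100)) \<longlongrightarrow> 0) at_top" by real_asymp
    then have "\<forall>\<^sub>F L::real in at_top. 5 * (L powr (1/2)) powr (-1/5) * L powr (1/100) < p/2"
      using p by (intro order_tendstoD) auto
    then show ?thesis by eventually_elim simp
  qed
  have "\<forall>\<^sub>F L in at_top. \<forall>x y x' y'. L powr (-1/2) \<le> circle_norm (x - x') \<longrightarrow>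
     p/2 \<le> measure (unif (L powr -\<delta>)) {w. circle_norm (next_x L x y w - next_x L x' y' w - 1/4) < 1/8}"
    using ev1 eventually_ge_at_top[of 1] eventually_noise_small[OF \<delta>(1), of "1/4", simplified]
  proof eventually_elim
    case (elim L)
    show ?case
    proof (intro allI impI)
      fix x y x' y' :: real assume d: "L powr (-1/2) \<le> circle_norm (x - x')"
      obtain \<phi> where \<phi>: "\<And>w. next_x L x y w - next_x L x' y' w = 2 * L * \<bar>sin (pi * (x - x'))\<bar> * cos (2 * pi * w + \<phi>) - (y - y')"
        using next_x_diff[of L x y x' y'] elim by auto
      define B where "B = 2 * L * \<bar>sin (pi * (x - x'))\<bar>"
      have "L powr (-1/2) \<le> \<bar>sin (pi * (x - x'))\<bar>" using d circle_norm_le_abs_sin[of "x - x'"] by linarith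
      then have "L * L powr (-1/2) \<le> 2 * L * \<bar>sin (pi * (x - x'))\<bar>" using elim
        by (intro mult_mono) auto
      moreover have "L * L powr (-1/2) = L powr (1/2)"
        using elim powr_add[of L 1 "-1/2"] by simp
      ultimately have B: "L powr (1/2) \<le> B" by (simp add: B_def)
      have "1 \<le> L powr (1/2)" using elim by (simp add: ge_one_powr_ge_zero)
      have *: "{w. circle_norm (next_x L x y w - next_x L x' y' w - 1/4) < 1/8} =
          {w. circle_norm (B * cos (2 * pi * w + \<phi>) - (y - y' + 1/4)) < 1/8}"
        by (simp add: \<phi> B_def algebra_simps)
      have "p - 5 * B powr (-1/5) / L powr -\<delta> \<le> measure (unif (L powr -\<delta>)) {w. circle_norm (next_x L x y w - next_x L x' y' w - 1/4) < 1/8}"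
        unfolding * using elim B \<open>1 \<le> L powr (1/2)\<close> by (intro p(2)) auto
      moreover have "5 * B powr (-1/5) / L powr -\<delta> \<le> 5 * B powr (-1/5) * L powr (1/100)"
        using mult_left_mono[OF inverse_powr_le[OF _ \<delta>(2), of L], of "5 * B powr (-1/5)"] elim by simp
      moreover have "\<dots> \<le> 5 * (L powr (1/2)) powr (-1/5) * L powr (1/100)"
        using B elim by (intro mult_right_mono mult_left_mono powr_mono2') auto
      ultimately show "p/2 \<le> measure (unif (L powr -\<delta>)) {w. circle_norm (next_x L x y w - next_x L x' y' w - 1/4) < 1/8}"
        using elim by linarith
    qed
  qed
  with p(1) show ?thesis using that[of "p/2"] by simp
qed

lemma eventually_box_hit:
  assumes \<delta>: "0 < \<delta>" "\<delta> < 1/100" and r: "0 < r" "r \<le> 1/2" and \<kappa>: "0 < \<kappa>" "\<kappa> \<le> 1"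
  obtains p where "p > 0" "\<forall>\<^sub>F L in at_top. \<forall>x y x' y' a b. \<kappa> \<le> circle_norm (2 * (x - x')) \<longrightarrow>
     p \<le> measure (unif (L powr -\<delta>)) {w. circle_norm (next_x L x y w - a) < r \<and> circle_norm (next_x L x' y' w - b) < r}"
proof -
  obtain p where p: "p > 0" "\<And>\<sigma> L \<kappa> x x' a b. 0 < \<sigma> \<Longrightarrow> \<sigma> \<le> 1/4 \<Longrightarrow> 0 < \<kappa> \<Longrightarrow> \<kappa> \<le> 1 \<Longrightarrow>
     \<kappa> \<le> circle_norm (2 * (x - x')) \<Longrightarrow> 1 \<le> L * \<kappa> \<Longrightarrow>
     measure (unif \<sigma>) {w. circle_norm (L * cos (2 * pi * (x + w)) - a) < r \<and> circle_norm (L * cos (2 * pi * (x' + w)) - b) < r}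
      \<ge> p - 5 * (L * \<kappa>) powr (-1/5) / \<sigma>"
    using prob_unif_box_hit[OF r] by blast
  have ev1: "\<forall>\<^sub>F L::real in at_top. 5 * (L * \<kappa>) powr (-1/5) * L powr (1/100) \<le> p/2"
  proof -
    have "((\<lambda>L::real. L powr (-1/5) * L powr (1/100)) \<longlongrightarrow> 0) at_top" by real_asymp
    then have "((\<lambda>L::real. (5 * \<kappa> powr (-1/5)) * (L powr (-1/5) * L powr (1/100))) \<longlongrightarrow> 0) at_top"
      by (rule tendsto_mult_right_zero)
    moreover have "\<forall>\<^sub>F L::real in at_top. (5 * \<kappa> powr (-1/5)) * (L powr (-1/5) * L powr (1/100)) = 5 * (L * \<kappa>) powr (-1/5) * L powr (1/100)"
      using eventually_gt_at_top[of 0] by eventually_elim (use \<kappa> in \<open>simp add: powr_mult\<close>)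
    ultimately have "((\<lambda>L::real. 5 * (L * \<kappa>) powr (-1/5) * L powr (1/100)) \<longlongrightarrow> 0) at_top"
      by (rule Lim_transform_eventually)
    then have "\<forall>\<^sub>F L::real in at_top. 5 * (L * \<kappa>) powr (-1/5) * L powr (1/100) < p/2"
      using p by (intro order_tendstoD) auto
    then show ?thesis by eventually_elim simp
  qed
  have "\<forall>\<^sub>F L in at_top. \<forall>x y x' y' a b. \<kappa> \<le> circle_norm (2 * (x - x')) \<longrightarrow>
     p/2 \<le> measure (unif (L powr -\<delta>)) {w. circle_norm (next_x L x y w - a) < r \<and> circle_norm (next_x L x' y' w - b) < r}"
    using ev1 eventually_ge_at_top[of "1/\<kappa>"] eventually_ge_at_top[of 1] eventually_noise_small[OF \<delta>(1), of "1/4", simplified]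
  proof eventually_elim
    case (elim L)
    show ?case
    proof (intro allI impI)
      fix x y x' y' a b :: real assume d: "\<kappa> \<le> circle_norm (2 * (x - x'))"
      have *: "{w. circle_norm (next_x L x y w - a) < r \<and> circle_norm (next_x L x' y' w - b) < r} =
          {w. circle_norm (L * cos (2 * pi * (x + w)) - (y + a)) < r \<and> circle_norm (L * cos (2 * pi * (x' + w)) - (y' + b)) < r}"
        by (simp add: next_x_def diff_diff_eq)
      have "p - 5 * (L * \<kappa>) powr (-1/5) / L powr -\<delta> \<le> measure (unif (L powr -\<delta>)) {w. circle_norm (next_x L x y w - a) < r \<and> circle_norm (next_x L x' y' w - b) < r}"
        unfolding * using elim d \<kappa> by (intro p(2)) (auto simp: field_simps)
      moreover have "5 * (L * \<kappa>) powr (-1/5) / L powr -\<delta> \<le> 5 * (L * \<kappa>) powr (-1/5) * L powr (1/100)"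
        using mult_left_mono[OF inverse_powr_le[OF _ \<delta>(2), of L], of "5 * (L * \<kappa>) powr (-1/5)"] elim by simp
      ultimately show "p/2 \<le> measure (unif (L powr -\<delta>)) {w. circle_norm (next_x L x y w - a) < r \<and> circle_norm (next_x L x' y' w - b) < r}"
        using elim by linarith
    qed
  qed
  with p(1) show ?thesis using that[of "p/2"] by simp
qed

section \<open>Adapted events along the noise coordinates\<close>

context sequence_space
begin

lemma case_nat_in_space: "s \<in> space M \<Longrightarrow> \<omega> \<in> space S \<Longrightarrow> case_nat s \<omega> \<in> space S"
  by (auto simp: space_PiM PiE_iff split: nat.split)

lemma fun_upd_in_space: "s \<in> space M \<Longrightarrow> \<omega> \<in> space S \<Longrightarrow> fun_upd \<omega> k s \<in> space S"
  by (auto simp: space_PiM PiE_iff)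

text \<open>The supermartingale inequality without conditional expectations:
  \<open>fun_upd \<omega> k w\<close> freezes the past and averages over coordinate
  \<open>k\<close>, and adaptedness makes the later coordinates irrelevant. The induction splits off
  coordinate 0 and applies the hypothesis to the shifted factors, so \<open>g\<close> must be
  arbitrary.\<close>

lemma nn_integral_adapted_prod_le_1:
  fixes g :: "nat \<Rightarrow> (nat \<Rightarrow> 'a) \<Rightarrow> ennreal"
  assumes meas: "\<And>k. g k \<in> borel_measurable S"
    and adapted: "\<And>k \<omega> \<omega>'. \<omega> \<in> space S \<Longrightarrow> \<omega>' \<in> space S \<Longrightarrow> (\<And>j. j \<le> k \<Longrightarrow> \<omega> j = \<omega>' j) \<Longrightarrow> g k \<omega> = g k \<omega>'"
    and le_1: "\<And>k \<omega>. \<omega> \<in> space S \<Longrightarrow> (\<integral>\<^sup>+w. g k (fun_upd \<omega> k w) \<partial>M) \<le> 1"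
  shows "(\<integral>\<^sup>+\<omega>. (\<Prod>k<N. g k \<omega>) \<partial>S) \<le> 1"
  using assms
proof (induction N arbitrary: g)
  case 0
  show ?case by (simp add: P.emeasure_space_1)
next
  case (Suc N)
  note [measurable] = Suc.prems(1)
  \<comment> \<open>\<open>g 0\<close> depends on coordinate 0 alone, so it may be evaluated at any
    reference sequence with that coordinate replaced; this takes it out of the inner
    integral.\<close>
  obtain s0 \<omega>0 where s0: "s0 \<in> space M" and \<omega>0: "\<omega>0 \<in> space S"
    using M.not_empty P.not_empty by blast
  have "(\<integral>\<^sup>+\<omega>. (\<Prod>k<Suc N. g k \<omega>) \<partial>S) = (\<integral>\<^sup>+\<omega>. (\<Prod>k<Suc N. g k \<omega>) \<partial>distr (M \<Otimes>\<^sub>M S) S (\<lambda>(s, \<omega>). case_nat s \<omega>))"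
    by (simp only: PiM_iter)
  also have "\<dots> = (\<integral>\<^sup>+x. (\<Prod>k<Suc N. g k (case_nat (fst x) (snd x))) \<partial>(M \<Otimes>\<^sub>M S))"
    by (subst nn_integral_distr) (auto simp: case_prod_beta')
  also have "\<dots> = (\<integral>\<^sup>+s. \<integral>\<^sup>+\<omega>. (\<Prod>k<Suc N. g k (case_nat s \<omega>)) \<partial>S \<partial>M)"
    by (subst P.nn_integral_fst[symmetric]) auto
  also have "\<dots> \<le> (\<integral>\<^sup>+s. g 0 (fun_upd (case_nat s0 \<omega>0) 0 s) \<partial>M)"
  proof (rule nn_integral_mono)
    fix s assume s: "s \<in> space M"
    have [measurable]: "(\<lambda>\<omega>. case_nat s \<omega>) \<in> measurable S S" using s by measurable
    have g0: "g 0 (case_nat s \<omega>) = g 0 (fun_upd (case_nat s0 \<omega>0) 0 s)" if "\<omega> \<in> space S" for \<omega>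
      using s s0 \<omega>0 that by (intro Suc.prems(2) case_nat_in_space fun_upd_in_space) auto
    have "(\<integral>\<^sup>+\<omega>. (\<Prod>k<Suc N. g k (case_nat s \<omega>)) \<partial>S)
        = (\<integral>\<^sup>+\<omega>. g 0 (fun_upd (case_nat s0 \<omega>0) 0 s) * (\<Prod>k<N. g (Suc k) (case_nat s \<omega>)) \<partial>S)"
      by (intro nn_integral_cong) (simp only: prod.lessThan_Suc_shift g0 o_def)
    also have "\<dots> = g 0 (fun_upd (case_nat s0 \<omega>0) 0 s) * (\<integral>\<^sup>+\<omega>. (\<Prod>k<N. g (Suc k) (case_nat s \<omega>)) \<partial>S)"
      by (rule nn_integral_cmult) measurable
    also have "\<dots> \<le> g 0 (fun_upd (case_nat s0 \<omega>0) 0 s) * 1"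
    proof (intro mult_left_mono Suc.IH)
      fix k \<omega> assume \<omega>: "\<omega> \<in> space S"
      have "(\<integral>\<^sup>+w. g (Suc k) (case_nat s (fun_upd \<omega> k w)) \<partial>M) = (\<integral>\<^sup>+w. g (Suc k) (fun_upd (case_nat s \<omega>) (Suc k) w) \<partial>M)"
        by (intro nn_integral_cong arg_cong[of _ _ "g (Suc k)"]) (auto simp: fun_eq_iff split: nat.split)
      also have "\<dots> \<le> 1" using s \<omega> by (intro Suc.prems(3) case_nat_in_space)
      finally show "(\<integral>\<^sup>+w. g (Suc k) (case_nat s (fun_upd \<omega> k w)) \<partial>M) \<le> 1" .
    next
      fix k \<omega> \<omega>' assume "\<omega> \<in> space S" "\<omega>' \<in> space S" "\<And>j. j \<le> k \<Longrightarrow> \<omega> j = \<omega>' j"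
      then show "g (Suc k) (case_nat s \<omega>) = g (Suc k) (case_nat s \<omega>')"
        using s by (intro Suc.prems(2) case_nat_in_space) (auto split: nat.split)
    next
      fix k show "(\<lambda>\<omega>. g (Suc k) (case_nat s \<omega>)) \<in> borel_measurable S" by measurable
    qed simp
    finally show "(\<integral>\<^sup>+\<omega>. (\<Prod>k<Suc N. g k (case_nat s \<omega>)) \<partial>S) \<le> g 0 (fun_upd (case_nat s0 \<omega>0) 0 s)" by simp
  qed
  also have "\<dots> \<le> 1" using s0 \<omega>0 by (intro Suc.prems(3) case_nat_in_space)
  finally show ?case .
qed

lemma nn_integral_two_valued:
  assumes [measurable]: "Measurable.pred M Q" and ab: "0 \<le> a" "0 \<le> b"
  shows "(\<integral>\<^sup>+w. ennreal (if Q w then a else b) \<partial>M) = ennreal (b + (a - b) * measure M {w \<in> space M. Q w})"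
proof -
  have "(\<integral>\<^sup>+w. ennreal (if Q w then a else b) \<partial>M) = ennreal (\<integral>w. (if Q w then a else b) \<partial>M)"
    by (intro nn_integral_eq_integral M.integrable_const_bound[of _ "max a b"]) (use ab in auto)
  also have "(\<integral>w. (if Q w then a else b) \<partial>M) = (\<integral>w. b + (a - b) * indicator {w \<in> space M. Q w} w \<partial>M)"
    by (intro Bochner_Integration.integral_cong) (auto simp: indicator_def)
  also have "\<dots> = b + (a - b) * measure M {w \<in> space M. Q w}"
  proof -
    have "integrable M (indicat_real {w \<in> space M. Q w})"
      by (intro M.integrable_const_bound[of _ 1]) (auto simp: indicator_def)
    then show ?thesis by (subst Bochner_Integration.integral_add) (auto simp: M.prob_space)
  qed
  finally show ?thesis .
qed

text \<open>Markov's inequality for the product of the adapted factors.\<close>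

lemma prob_le_of_adapted_prod:
  fixes g :: "nat \<Rightarrow> (nat \<Rightarrow> 'a) \<Rightarrow> real"
  assumes "\<And>k. g k \<in> borel_measurable S" "\<And>k \<omega>. 0 \<le> g k \<omega>"
    and "\<And>k \<omega> \<omega>'. \<omega> \<in> space S \<Longrightarrow> \<omega>' \<in> space S \<Longrightarrow> (\<And>j. j \<le> k \<Longrightarrow> \<omega> j = \<omega>' j) \<Longrightarrow> g k \<omega> = g k \<omega>'"
    and "\<And>k \<omega>. \<omega> \<in> space S \<Longrightarrow> (\<integral>\<^sup>+w. ennreal (g k (fun_upd \<omega> k w)) \<partial>M) \<le> 1"
    and A: "A \<in> sets S" "c > 0" "\<And>\<omega>. \<omega> \<in> A \<Longrightarrow> c \<le> (\<Prod>k<N. g k \<omega>)"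
  shows "measure S A \<le> 1 / c"
proof -
  have "ennreal (c * measure S A) = (\<integral>\<^sup>+\<omega>. ennreal c * indicator A \<omega> \<partial>S)"
    using A by (simp add: nn_integral_cmult_indicator P.emeasure_eq_measure ennreal_mult)
  also have "\<dots> \<le> (\<integral>\<^sup>+\<omega>. (\<Prod>k<N. ennreal (g k \<omega>)) \<partial>S)"
    using A assms(2) by (intro nn_integral_mono) (auto simp: indicator_def prod_ennreal intro!: ennreal_leI)
  also have "\<dots> \<le> 1"
  proof (rule nn_integral_adapted_prod_le_1)
    show "(\<lambda>\<omega>. ennreal (g k \<omega>)) \<in> borel_measurable S" for k using assms(1)[of k] by measurable
    show "ennreal (g k \<omega>) = ennreal (g k \<omega>')"
      if "\<omega> \<in> space S" "\<omega>' \<in> space S" "\<And>j. j \<le> k \<Longrightarrow> \<omega> j = \<omega>' j" for k \<omega> \<omega>'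
      by (simp only: assms(3)[OF that])
  qed (rule assms(4))
  finally have "c * measure S A \<le> 1" by simp
  then show ?thesis using A(2) by (simp add: field_simps)
qed

text \<open>A Chernoff bound in which the events need no independence, only a uniform conditional
  bound. A fraction \<open>1 / 300\<close> of bad steps makes the product at least
  \<open>(1/2) ^ N * exp (2 * N)\<close>, which exceeds \<open>exp N\<close>.\<close>

lemma prob_many_rare_events:
  fixes bad :: "nat \<Rightarrow> (nat \<Rightarrow> 'a) \<Rightarrow> bool"
  assumes [measurable]: "\<And>k. Measurable.pred S (bad k)"
    and adapted: "\<And>k \<omega> \<omega>'. \<omega> \<in> space S \<Longrightarrow> \<omega>' \<in> space S \<Longrightarrow> (\<And>j. j \<le> k \<Longrightarrow> \<omega> j = \<omega>' j) \<Longrightarrow> bad k \<omega> = bad k \<omega>'"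
    and rare: "\<And>k \<omega>. \<omega> \<in> space S \<Longrightarrow> measure M {w \<in> space M. bad k (fun_upd \<omega> k w)} \<le> exp (- 600)"
  shows "measure S {\<omega> \<in> space S. real N \<le> 300 * real (card {k. k < N \<and> bad k \<omega>})} \<le> exp (- real N)"
proof -
  \<comment> \<open>The two values make the conditional mean at most one: the bad part contributes
    at most \<open>exp 600 / 2 * exp (- 600) = 1/2\<close>.\<close>
  define g where "g k \<omega> = (if bad k \<omega> then exp 600 / 2 else 1/2 :: real)" for k \<omega>
  have card_meas: "(\<lambda>\<omega>. real (card {k. k < N \<and> bad k \<omega>})) \<in> borel_measurable S"
  proof -
    have "real (card {k. k < N \<and> bad k \<omega>}) = (\<Sum>k<N. if bad k \<omega> then 1 else 0)" for \<omega>
      by (simp add: sum.If_cases Int_def conj_commute)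
    then show ?thesis by simp
  qed
  have "measure S {\<omega> \<in> space S. real N \<le> 300 * real (card {k. k < N \<and> bad k \<omega>})} \<le> 1 / exp (real N)"
  proof (rule prob_le_of_adapted_prod[of g])
    show "g k \<in> borel_measurable S" for k unfolding g_def by measurable
    show "0 \<le> g k \<omega>" for k \<omega> by (simp add: g_def)
    show "g k \<omega> = g k \<omega>'" if "\<omega> \<in> space S" "\<omega>' \<in> space S" "\<And>j. j \<le> k \<Longrightarrow> \<omega> j = \<omega>' j" for k \<omega> \<omega>'
      using adapted[OF that] by (simp add: g_def)
    show "(\<integral>\<^sup>+w. ennreal (g k (fun_upd \<omega> k w)) \<partial>M) \<le> 1" if \<omega>: "\<omega> \<in> space S" for k \<omega>
    proof -
      have [measurable]: "Measurable.pred M (\<lambda>w. bad k (fun_upd \<omega> k w))"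
        using \<omega> by (intro measurable_compose[OF _ assms(1)] measurable_PiM_single')
          (auto simp: space_PiM PiE_iff intro: measurable_If)
      define m where "m = measure M {w \<in> space M. bad k (fun_upd \<omega> k w)}"
      have "(exp 600 / 2 - 1 / 2) * m \<le> (exp 600 / 2 - 1/2) * exp (- 600)"
        unfolding m_def by (intro mult_left_mono rare \<omega>) simp
      also have "\<dots> = 1/2 - exp (- 600) / 2"
        by (simp add: algebra_simps exp_minus)
      also have "\<dots> \<le> 1/2" by simp
      finally have "1/2 + (exp 600 / 2 - 1/2) * m \<le> 1" by simp
      moreover have "(\<integral>\<^sup>+w. ennreal (g k (fun_upd \<omega> k w)) \<partial>M) = ennreal (1/2 + (exp 600 / 2 - 1/2) * m)"
        unfolding g_def m_def by (rule nn_integral_two_valued) auto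
      ultimately show ?thesis by (simp only: ennreal_le_1)
    qed
    show "{\<omega> \<in> space S. real N \<le> 300 * real (card {k. k < N \<and> bad k \<omega>})} \<in> sets S"
      using card_meas by measurable
    show "exp (real N) > 0" by simp
    fix \<omega> assume "\<omega> \<in> {\<omega> \<in> space S. real N \<le> 300 * real (card {k. k < N \<and> bad k \<omega>})}"
    then have N: "real N \<le> 300 * real (card {k. k < N \<and> bad k \<omega>})" by simp
    have "(\<Prod>k<N. g k \<omega>) = (\<Prod>k<N. (1/2) * (if bad k \<omega> then exp 600 else 1))"
      by (intro prod.cong) (auto simp: g_def)
    also have "\<dots> = (1/2) ^ N * (\<Prod>k<N. if bad k \<omega> then exp 600 else 1)"
      by (simp only: prod.distrib) simp
    also have "(\<Prod>k<N. if bad k \<omega> then exp 600 else (1::real)) = exp 600 ^ card {k. k < N \<and> bad k \<omega>}"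
      by (simp add: prod.If_cases Int_def conj_commute)
    also have "\<dots> = exp (600 * real (card {k. k < N \<and> bad k \<omega>}))"
      by (simp add: exp_of_nat_mult[symmetric] mult.commute)
    finally have eq: "(\<Prod>k<N. g k \<omega>) = (1/2) ^ N * exp (600 * real (card {k. k < N \<and> bad k \<omega>}))" .
    have "exp (-1) \<le> (1/2::real)" using exp_ge_add_one_self[of 1] by (simp add: exp_minus field_simps)
    then have "exp (-1) ^ N \<le> (1/2::real) ^ N" by (intro power_mono) auto
    then have "exp (- real N) * exp (2 * real N) \<le> (1/2) ^ N * exp (600 * real (card {k. k < N \<and> bad k \<omega>}))"
      using N by (intro mult_mono) (auto simp: exp_of_nat_mult[symmetric])
    then show "exp (real N) \<le> (\<Prod>k<N. g k \<omega>)" by (simp add: eq exp_add[symmetric])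
  qed
  then show ?thesis by (simp add: exp_minus field_simps)
qed

text \<open>At each trial time \<open>k\<close> a chain of conditions on the next \<open>T\<close> coordinates starts.  The weight
  \<open>V r\<close> bounds the conditional expectation of \<open>exp (- [success])\<close> after \<open>r\<close> satisfied conditions.\<close>

lemma prob_few_successes:
  fixes R :: "nat \<Rightarrow> (nat \<Rightarrow> 'a) \<Rightarrow> bool" and G :: "nat \<Rightarrow> nat \<Rightarrow> (nat \<Rightarrow> 'a) \<Rightarrow> bool"
  assumes [measurable]: "\<And>k. Measurable.pred S (R k)" "\<And>k j. Measurable.pred S (G k j)"
    and R_adapted: "\<And>k \<omega> \<omega>'. \<omega> \<in> space S \<Longrightarrow> \<omega>' \<in> space S \<Longrightarrow> (\<And>j. j < k \<Longrightarrow> \<omega> j = \<omega>' j) \<Longrightarrow> R k \<omega> = R k \<omega>'"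
    and G_adapted: "\<And>k i \<omega> \<omega>'. \<omega> \<in> space S \<Longrightarrow> \<omega>' \<in> space S \<Longrightarrow> k \<le> i \<Longrightarrow> (\<And>j. j \<le> i \<Longrightarrow> \<omega> j = \<omega>' j) \<Longrightarrow> G k i \<omega> = G k i \<omega>'"
    and spaced: "\<And>k k' \<omega>. \<omega> \<in> space S \<Longrightarrow> R k \<omega> \<Longrightarrow> R k' \<omega> \<Longrightarrow> k < k' \<Longrightarrow> k + T \<le> k'"
    and p: "0 < p" "p \<le> 1"
    and hit: "\<And>k i \<omega>. \<omega> \<in> space S \<Longrightarrow> R k \<omega> \<Longrightarrow> k \<le> i \<Longrightarrow> i < k + T \<Longrightarrow> (\<And>j. k \<le> j \<Longrightarrow> j < i \<Longrightarrow> G k j \<omega>)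
       \<Longrightarrow> p \<le> measure M {w \<in> space M. G k i ((fun_upd \<omega> i w))}"
  defines "v \<equiv> 1 - (1 - exp (-1)) * p ^ T"
  shows "measure S {\<omega> \<in> space S. x \<le> real (card {k. k + T \<le> N \<and> R k \<omega>}) \<and>
      real (card {k. k + T \<le> N \<and> R k \<omega> \<and> (\<forall>i\<in>{k..<k+T}. G k i \<omega>)}) \<le> y} \<le> exp y * v powr x"
proof -
  \<comment> \<open>The exact expectation if each of the remaining \<open>T - r\<close> conditions
    held with conditional probability exactly \<open>p\<close>; hence the recursion
    \<open>V_rec\<close>.\<close>
  define V where "V r = 1 - (1 - exp (-1)) * p ^ (T - r)" for r
  have e1: "0 < exp (-1 :: real)" "exp (-1) < (1 :: real)" by simp_all
  have V_bounds: "exp (-1) \<le> V r" "V r < 1" "0 < V r" "V r \<noteq> 0" for r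
  proof -
    have pr: "0 < p ^ (T - r)" "p ^ (T - r) \<le> 1" using p by (auto intro: power_le_one)
    have "(1 - exp (-1)) * p ^ (T - r) \<le> (1 - exp (-1)) * 1" using pr e1 by (intro mult_left_mono) auto
    then show "exp (-1) \<le> V r" unfolding V_def by (simp only: mult_1_right)
    then show "0 < V r" "V r \<noteq> 0" using e1 by linarith+
    show "V r < 1" using pr e1 by (simp add: V_def)
  qed
  have V_rec: "p * V (Suc r) + (1 - p) = V r" if "r < T" for r
  proof -
    have "p ^ (T - r) = p * p ^ (T - Suc r)" using that by (simp add: power_Suc[symmetric] Suc_diff_Suc del: power_Suc)
    then show ?thesis by (simp add: V_def algebra_simps)
  qed
  have V0: "V 0 = v" and VT: "V T = exp (-1)" by (simp_all add: V_def v_def)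
  define act where "act k j \<omega> \<longleftrightarrow> k + T \<le> N \<and> R k \<omega> \<and> k \<le> j \<and> j < k + T \<and> (\<forall>i\<in>{k..<j}. G k i \<omega>)" for k j \<omega>
  \<comment> \<open>The ratio of the new weight to the old one. After a failure the weight is 1 and
    the trial becomes inactive, so the factors telescope.\<close>
  define h where "h k j \<omega> = (if act k j \<omega> then (if G k j \<omega> then V (Suc (j - k)) / V (j - k) else 1 / V (j - k)) else 1)" for k j \<omega>
  define g where "g j \<omega> = (\<Prod>k\<le>j. h k j \<omega>)" for j \<omega>
  have [measurable]: "Measurable.pred S (act k j)" for k j unfolding act_def by measurable
  \<comment> \<open>The spacing makes the windows of trials disjoint, so at each time at most one
    factor of \<open>g j\<close> differs from 1.\<close>
  have act_unique: "k = k'" if "act k j \<omega>" "act k' j \<omega>" "\<omega> \<in> space S" for k k' j \<omega>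
    using that spaced[of \<omega> k k'] spaced[of \<omega> k' k] unfolding act_def by (cases k k' rule: linorder_cases) auto
  have act_adapted: "act k i \<omega> = act k i \<omega>'" if "\<omega> \<in> space S" "\<omega>' \<in> space S" "\<And>j. j < i \<Longrightarrow> \<omega> j = \<omega>' j" for k i \<omega> \<omega>'
  proof (cases "k \<le> i")
    case True
    have "R k \<omega> = R k \<omega>'" using True that by (intro R_adapted) auto
    moreover have "G k j \<omega> = G k j \<omega>'" if "j \<in> {k..<i}" for j
      using \<open>j \<in> {k..<i}\<close> \<open>\<omega> \<in> space S\<close> \<open>\<omega>' \<in> space S\<close> \<open>\<And>j. j < i \<Longrightarrow> \<omega> j = \<omega>' j\<close> by (intro G_adapted) auto
    ultimately show ?thesis by (auto simp: act_def)
  qed (auto simp: act_def)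
  have "measure S {\<omega> \<in> space S. x \<le> real (card {k. k + T \<le> N \<and> R k \<omega>}) \<and>
      real (card {k. k + T \<le> N \<and> R k \<omega> \<and> (\<forall>i\<in>{k..<k+T}. G k i \<omega>)}) \<le> y} \<le> 1 / (exp (- y) * v powr (- x))"
  proof (rule prob_le_of_adapted_prod[of g])
    show "g j \<in> borel_measurable S" for j unfolding g_def h_def by measurable
    show "0 \<le> g j \<omega>" for j \<omega> unfolding g_def h_def using V_bounds by (intro prod_nonneg) (auto intro: less_imp_le)
    show "g i \<omega> = g i \<omega>'" if w: "\<omega> \<in> space S" "\<omega>' \<in> space S" "\<And>j. j \<le> i \<Longrightarrow> \<omega> j = \<omega>' j" for i \<omega> \<omega>'
    proof -
      have "h k i \<omega> = h k i \<omega>'" if "k \<le> i" for k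
        using act_adapted[of \<omega> \<omega>' i k] G_adapted[of \<omega> \<omega>' k i] w that by (simp add: h_def)
      then show ?thesis by (auto simp: g_def intro: prod.cong)
    qed
    show "(\<integral>\<^sup>+w. ennreal (g j ((fun_upd \<omega> j w))) \<partial>M) \<le> 1" if \<omega>: "\<omega> \<in> space S" for j \<omega>
    proof (cases "\<exists>k. act k j \<omega>")
      case False
      have "g j ((fun_upd \<omega> j w)) = 1" if "w \<in> space M" for w
      proof -
        have "\<not> act k j ((fun_upd \<omega> j w))" for k
          using False act_adapted[of \<omega> "(fun_upd \<omega> j w)" j k] \<omega> that fun_upd_in_space by auto
        then show ?thesis by (simp add: g_def h_def)
      qed
      then have "(\<integral>\<^sup>+w. ennreal (g j ((fun_upd \<omega> j w))) \<partial>M) = (\<integral>\<^sup>+w. 1 \<partial>M)"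
        by (intro nn_integral_cong) simp
      then show ?thesis by (simp add: M.emeasure_space_1)
    next
      case True
      then obtain k where k: "act k j \<omega>" by blast
      define r where "r = j - k"
      have kj: "k \<le> j" "j < k + T" "r < T" using k by (auto simp: act_def r_def)
      define a b where "a = V (Suc r) / V r" and "b = 1 / V r"
      have ab: "0 \<le> a" "0 \<le> b" "a \<le> b" using V_bounds[of r] V_bounds[of "Suc r"]
        by (auto simp: a_def b_def intro!: divide_right_mono)
      have g: "g j ((fun_upd \<omega> j w)) = (if G k j ((fun_upd \<omega> j w)) then a else b)" if w: "w \<in> space M" for w
      proof -
        have eq: "act k' j ((fun_upd \<omega> j w)) = act k' j \<omega>" for k'
          using act_adapted[of "(fun_upd \<omega> j w)" \<omega> j k'] \<omega> w fun_upd_in_space by auto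
        have "h k' j ((fun_upd \<omega> j w)) = 1" if "k' \<noteq> k" for k'
          using that act_unique[OF _ k \<omega>] by (auto simp: h_def eq)
        then have "g j ((fun_upd \<omega> j w)) = h k j ((fun_upd \<omega> j w))"
          unfolding g_def using kj by (subst prod.remove[of _ k]) auto
        then show ?thesis using k by (simp add: h_def eq a_def b_def r_def)
      qed
      have [measurable]: "Measurable.pred M (\<lambda>w. G k j ((fun_upd \<omega> j w)))"
        using \<omega> by (intro measurable_compose[OF _ assms(2)] measurable_PiM_single')
          (auto simp: space_PiM PiE_iff intro: measurable_If)
      define m where "m = measure M {w \<in> space M. G k j ((fun_upd \<omega> j w))}"
      have "p \<le> m" unfolding m_def using k \<omega> by (intro hit) (auto simp: act_def)
      \<comment> \<open>Since \<open>a \<le> b\<close>, the mean decreases with the probability of a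
        hit, and at the value \<open>p\<close> it is exactly 1 by \<open>V_rec\<close>.\<close>
      have "b + (a - b) * m \<le> b + (a - b) * p"
        using ab \<open>p \<le> m\<close> by (intro add_left_mono mult_left_mono_neg) auto
      also have "\<dots> = (p * V (Suc r) + (1 - p)) / V r" using V_bounds[of r] by (simp add: a_def b_def field_simps)
      also have "\<dots> = 1" using V_bounds[of r] kj by (simp add: V_rec)
      finally have "b + (a - b) * m \<le> 1" .
      moreover have "(\<integral>\<^sup>+w. ennreal (g j ((fun_upd \<omega> j w))) \<partial>M) = (\<integral>\<^sup>+w. ennreal (if G k j ((fun_upd \<omega> j w)) then a else b) \<partial>M)"
        by (intro nn_integral_cong) (simp add: g)
      moreover have "\<dots> = ennreal (b + (a - b) * m)"
        unfolding m_def using ab by (intro nn_integral_two_valued) auto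
      ultimately show ?thesis by (simp only: ennreal_le_1)
    qed
    have [measurable]: "(\<lambda>\<omega>. real (card {k. k + T \<le> N \<and> Q k \<omega>})) \<in> borel_measurable S"
      if [measurable]: "\<And>k. Measurable.pred S (Q k)" for Q :: "nat \<Rightarrow> (nat \<Rightarrow> 'a) \<Rightarrow> bool"
    proof -
      have "{k. k + T \<le> N \<and> Q k \<omega>} = {..N} \<inter> {k. k + T \<le> N \<and> Q k \<omega>}" for \<omega> by auto
      then have "real (card {k. k + T \<le> N \<and> Q k \<omega>}) = (\<Sum>k\<le>N. if k + T \<le> N \<and> Q k \<omega> then 1 else 0)" for \<omega>
        by (simp add: sum.If_cases)
      then show ?thesis by simp
    qed
    show "{\<omega> \<in> space S. x \<le> real (card {k. k + T \<le> N \<and> R k \<omega>}) \<and>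
      real (card {k. k + T \<le> N \<and> R k \<omega> \<and> (\<forall>i\<in>{k..<k+T}. G k i \<omega>)}) \<le> y} \<in> sets S"
      by measurable
    have v: "0 < v" "v < 1" using V_bounds[of 0] by (simp_all add: V0)
    then show "exp (- y) * v powr (- x) > 0" by simp
    fix \<omega> assume \<omega>: "\<omega> \<in> {\<omega> \<in> space S. x \<le> real (card {k. k + T \<le> N \<and> R k \<omega>}) \<and>
      real (card {k. k + T \<le> N \<and> R k \<omega> \<and> (\<forall>i\<in>{k..<k+T}. G k i \<omega>)}) \<le> y}"
    define A where "A = {k. k + T \<le> N \<and> R k \<omega>}"
    define B where "B = {k. k + T \<le> N \<and> R k \<omega> \<and> (\<forall>i\<in>{k..<k+T}. G k i \<omega>)}"
    have fin: "finite A" by (rule finite_subset[of _ "{..N}"]) (auto simp: A_def)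
    have BA: "B = A \<inter> {k. \<forall>i\<in>{k..<k+T}. G k i \<omega>}" by (auto simp: A_def B_def)
    have partial: "(\<Prod>j\<in>{k..<k+m}. h k j \<omega>) = (if \<forall>i\<in>{k..<k+m}. G k i \<omega> then V m / V 0 else 1 / V 0)"
      if "k \<in> A" "m \<le> T" for k m
      using that(2)
    proof (induction m)
      case 0 then show ?case using V_bounds[of 0] by simp
    next
      case (Suc m)
      have act: "act k (k+m) \<omega> \<longleftrightarrow> (\<forall>i\<in>{k..<k+m}. G k i \<omega>)"
        using Suc.prems that(1) by (auto simp: act_def A_def)
      have "(\<Prod>j\<in>{k..<k+Suc m}. h k j \<omega>) = (\<Prod>j\<in>{k..<k+m}. h k j \<omega>) * h k (k+m) \<omega>" by simp
      then show ?case using Suc V_bounds[of m]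
        by (auto simp: h_def act atLeastLessThanSuc)
    qed
    \<comment> \<open>A trial counted in \<open>A\<close> has its whole window below
      \<open>N\<close>, so its factors telescope completely; any other start contributes 1.\<close>
    have full: "(\<Prod>j<N. h k j \<omega>) = (if k \<in> B then exp (-1) else 1) * (if k \<in> A then 1 / v else 1)" for k
    proof (cases "k \<in> A")
      case True
      have "(\<Prod>j<N. h k j \<omega>) = (\<Prod>j\<in>{k..<k+T}. h k j \<omega>)"
        using True by (intro prod.mono_neutral_right) (auto simp: A_def h_def act_def)
      then show ?thesis using True partial[OF True order_refl] by (auto simp: BA V0 VT)
    next
      case False
      then have "h k j \<omega> = 1" for j by (auto simp: h_def act_def A_def)
      then show ?thesis using False by (auto simp: BA)
    qed
    have "(\<Prod>j<N. g j \<omega>) = (\<Prod>j<N. \<Prod>k\<le>N. h k j \<omega>)"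
      unfolding g_def by (intro prod.cong refl prod.mono_neutral_left) (auto simp: h_def act_def)
    also have "\<dots> = (\<Prod>k\<le>N. \<Prod>j<N. h k j \<omega>)" by (rule prod.swap)
    also have "\<dots> = (\<Prod>k\<le>N. (if k \<in> B then exp (-1) else 1)) * (\<Prod>k\<le>N. if k \<in> A then 1 / v else 1)"
      by (simp only: full prod.distrib)
    also have "(\<Prod>k\<le>N. (if k \<in> B then exp (-1) else 1)) = exp (-1) ^ card B"
    proof -
      have "{..N} \<inter> B = B" by (auto simp: B_def)
      then show ?thesis by (simp add: prod.If_cases)
    qed
    also have "(\<Prod>k\<le>N. if k \<in> A then 1 / v else 1) = (1 / v) ^ card A"
    proof -
      have "{..N} \<inter> A = A" by (auto simp: A_def)
      then show ?thesis by (simp add: prod.If_cases)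
    qed
    also have "exp (-1) ^ card B = exp (- real (card B))" by (simp add: exp_of_nat_mult[symmetric])
    also have "(1 / v) ^ card A = v powr (- real (card A))"
      using v by (simp add: powr_minus powr_realpow inverse_eq_divide power_divide)
    finally have eq: "(\<Prod>j<N. g j \<omega>) = exp (- real (card B)) * v powr (- real (card A))" .
    have "v powr (- x) \<le> v powr (- real (card A))"
      using \<omega> v by (intro powr_mono') (auto simp: A_def)
    then show "exp (- y) * v powr (- x) \<le> (\<Prod>j<N. g j \<omega>)"
      unfolding eq using \<omega> by (intro mult_mono) (auto simp: B_def)
  qed
  also have "1 / (exp (- y) * v powr (- x)) = exp y * v powr x"
    by (simp add: exp_minus powr_minus field_simps)
  finally show ?thesis .
qed

end

section \<open>The coordinates of \<open>noise\<close> and measurability in the noise\<close>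

abbreviation noise_comp :: "real \<Rightarrow> real \<Rightarrow> real measure" where
  "noise_comp \<delta> L \<equiv> uniform_measure (restrict_space lborel (noise_interval \<delta> L)) (noise_interval \<delta> L)"

lemma noise_eq_PiM: "noise \<delta> L = (\<Pi>\<^sub>M n\<in>UNIV. noise_comp \<delta> L)"
  by (simp add: noise_def)

lemma prob_space_noise_comp: "L > 0 \<Longrightarrow> prob_space (noise_comp \<delta> L)"
  by (intro prob_space_uniform_measure) (simp_all add: noise_interval_def emeasure_restrict_space)

lemma sequence_space_noise_comp: "L > 0 \<Longrightarrow> sequence_space (noise_comp \<delta> L)"
  unfolding sequence_space_def product_prob_space_def product_prob_space_axioms_def product_sigma_finite_def
  using prob_space_noise_comp prob_space_imp_sigma_finite by blast

lemma measure_noise_comp: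
  assumes "L > 0" "{w. P w} \<in> sets borel"
  shows "measure (noise_comp \<delta> L) {w \<in> space (noise_comp \<delta> L). P w} = measure (unif (L powr -\<delta>)) {w. P w}"
proof -
  define I where "I = noise_interval \<delta> L"
  have I: "I = {- (L powr -\<delta>)..L powr -\<delta>}" by (simp add: I_def noise_interval_def)
  have "L powr -\<delta> > 0" using assms(1) by simp
  then have e: "emeasure (restrict_space lborel I) I = ennreal (2 * L powr -\<delta>)"
    by (simp add: I emeasure_restrict_space)
  have PI: "{w \<in> I. P w} = I \<inter> {w. P w}" by auto
  have m: "{w \<in> I. P w} \<in> sets (restrict_space lborel I)"
    unfolding PI using assms(2) by (auto simp: sets_restrict_space)
  have "measure (noise_comp \<delta> L) {w \<in> space (noise_comp \<delta> L). P w} = measure (uniform_measure (restrict_space lborel I) I) {w \<in> I. P w}"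
    by (simp add: space_restrict_space I_def)
  also have "\<dots> = measure (restrict_space lborel I) (I \<inter> {w \<in> I. P w}) / measure (restrict_space lborel I) I"
    using m e \<open>L powr -\<delta> > 0\<close> by (intro measure_uniform_measure) auto
  also have "measure (restrict_space lborel I) I = 2 * L powr -\<delta>"
    using e \<open>L powr -\<delta> > 0\<close> by (simp add: measure_def)
  also have "measure (restrict_space lborel I) (I \<inter> {w \<in> I. P w}) = measure lborel (I \<inter> {w. P w})"
    by (subst measure_restrict_space) (auto simp: I intro!: arg_cong[of _ _ "measure lborel"])
  also have "\<dots> / (2 * L powr -\<delta>) = measure (unif (L powr -\<delta>)) {w. P w}"
    using assms(2) \<open>L powr -\<delta> > 0\<close> by (simp add: measure_unif I)
  finally show ?thesis .
qed

text \<open>The product sigma-algebra on sequences is the Borel algebra of the product topology.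
  Measurability in the noise thus follows from continuity or closedness, which is what conditions
  with quantified vectors require.\<close>

lemma measurable_noise_borel: "(\<lambda>\<omega>. \<omega>) \<in> measurable (noise \<delta> L) (borel :: (nat \<Rightarrow> real) measure)"
proof -
  have c: "(\<lambda>w. w) \<in> measurable (noise_comp \<delta> L) borel"
  proof -
    have "(\<lambda>w. w) \<in> measurable (restrict_space lborel (noise_interval \<delta> L)) borel"
      by (rule measurable_restrict_space1) simp
    then show ?thesis by simp
  qed
  have "(\<lambda>\<omega>. \<omega> i) \<in> measurable (noise \<delta> L) borel" for i
    unfolding noise_eq_PiM by (rule measurable_compose[OF _ c], rule measurable_component_singleton) simp
  then have "(\<lambda>\<omega>. \<omega>) \<in> measurable (noise \<delta> L) (\<Pi>\<^sub>M i\<in>(UNIV::nat set). borel)"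
    by (intro measurable_PiM_single') (auto simp: space_PiM)
  then show ?thesis
    using measurable_cong_sets[OF refl sets_PiM_equal_borel] by blast
qed

lemma measurable_noise_continuous:
  fixes f :: "(nat \<Rightarrow> real) \<Rightarrow> 'a::topological_space"
  shows "continuous_on UNIV f \<Longrightarrow> f \<in> measurable (noise \<delta> L) borel"
  by (rule measurable_compose[OF measurable_noise_borel borel_measurable_continuous_onI])

lemma pred_noise_closed:
  fixes A :: "(nat \<Rightarrow> real) set"
  assumes "closed A" shows "Measurable.pred (noise \<delta> L) (\<lambda>\<omega>. \<omega> \<in> A)"
  using measurable_sets[OF measurable_noise_borel borel_closed[OF assms]]
  by (simp add: pred_def vimage_def Int_def conj_commute)

section \<open>Orbits and their derivatives\<close>

text \<open>Coordinates of the lifted orbit: they are continuous in the noise, which reduction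
  modulo one would destroy. Torus quantities are recovered through
  \<open>circle_norm\<close>.\<close>

definition orbit_x :: "real \<Rightarrow> (nat \<Rightarrow> real) \<Rightarrow> nat \<Rightarrow> real \<times> real \<Rightarrow> real" where
  "orbit_x L \<omega> n z = fst (lift_iter L \<omega> n z)"

definition orbit_y :: "real \<Rightarrow> (nat \<Rightarrow> real) \<Rightarrow> nat \<Rightarrow> real \<times> real \<Rightarrow> real" where
  "orbit_y L \<omega> n z = snd (lift_iter L \<omega> n z)"

lemma orbit_Suc:
  "orbit_x L \<omega> (Suc n) z = next_x L (orbit_x L \<omega> n z) (orbit_y L \<omega> n z) (\<omega> n)"
  "orbit_y L \<omega> (Suc n) z = orbit_x L \<omega> n z + \<omega> n"
  by (simp_all add: orbit_x_def orbit_y_def std_lift_def next_x_def)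

lemma lift_iter_cong: "(\<And>j. j < n \<Longrightarrow> \<omega> j = \<omega>' j) \<Longrightarrow> lift_iter L \<omega> n z = lift_iter L \<omega>' n z"
  by (induction n) auto

lemma orbit_cong:
  assumes "\<And>j. j < n \<Longrightarrow> \<omega> j = \<omega>' j"
  shows "orbit_x L \<omega> n z = orbit_x L \<omega>' n z" "orbit_y L \<omega> n z = orbit_y L \<omega>' n z"
  using lift_iter_cong[OF assms] by (simp_all add: orbit_x_def orbit_y_def)

text \<open>The chain rule as an explicit recursion; \<open>DF_eq\<close> identifies it with
  \<open>DF\<close> at multiples of three. Nonvanishing, continuity in the noise and dependence on
  finitely many coordinates are read off from it.\<close>

primrec lift_deriv :: "real \<Rightarrow> (nat \<Rightarrow> real) \<Rightarrow> nat \<Rightarrow> real \<times> real \<Rightarrow> real \<times> real \<Rightarrow> real \<times> real" where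
  "lift_deriv L \<omega> 0 z v = v"
| "lift_deriv L \<omega> (Suc n) z v = (next_v L (orbit_x L \<omega> n z) (fst (lift_deriv L \<omega> n z v)) (snd (lift_deriv L \<omega> n z v)) (\<omega> n),
     fst (lift_deriv L \<omega> n z v))"

lemma has_derivative_std_lift:
  "(std_lift L w has_derivative (\<lambda>v. (next_v L (fst z) (fst v) (snd v) w, fst v))) (at z)"
  unfolding std_lift_def next_v_def
  by (auto intro!: derivative_eq_intros simp: fun_eq_iff algebra_simps)

lemma has_derivative_lift_iter: "(lift_iter L \<omega> n has_derivative lift_deriv L \<omega> n z) (at z)"
proof (induction n)
  case 0
  have "lift_iter L \<omega> 0 = (\<lambda>z. z)" "lift_deriv L \<omega> 0 z = (\<lambda>v. v)" by (auto simp: fun_eq_iff)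
  then show ?case by simp
next
  case (Suc n)
  have "lift_iter L \<omega> (Suc n) = std_lift L (\<omega> n) \<circ> lift_iter L \<omega> n" by (auto simp: fun_eq_iff)
  moreover have "lift_deriv L \<omega> (Suc n) z = (\<lambda>v. (next_v L (fst (lift_iter L \<omega> n z)) (fst v) (snd v) (\<omega> n), fst v)) \<circ> lift_deriv L \<omega> n z"
    by (auto simp: fun_eq_iff orbit_x_def)
  ultimately show ?case
    using diff_chain_at[OF Suc has_derivative_std_lift[of L "\<omega> n" "lift_iter L \<omega> n z"]] by (simp only:)
qed

lemma DF_eq: "DF L \<omega> n z = lift_deriv L \<omega> (3 * n) z"
  unfolding DF_def F_lift_def using frechet_derivative_at[OF has_derivative_lift_iter] by metis

lemma lift_deriv_cong: "(\<And>j. j < n \<Longrightarrow> \<omega> j = \<omega>' j) \<Longrightarrow> lift_deriv L \<omega> n z v = lift_deriv L \<omega>' n z v"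
proof (induction n)
  case (Suc n)
  then show ?case using orbit_cong(1)[of n \<omega> \<omega>'] by auto
qed auto

lemma lift_deriv_nonzero: "v \<noteq> 0 \<Longrightarrow> lift_deriv L \<omega> n z v \<noteq> 0"
proof (induction n)
  case (Suc n)
  then show ?case by (auto simp: next_v_def zero_prod_def prod_eq_iff)
qed auto

lemma continuous_omega [continuous_intros]: "continuous_on A (\<lambda>\<omega>::nat\<Rightarrow>real. \<omega> n)"
  by (rule continuous_on_subset[OF continuous_on_product_coordinates]) auto

lemma continuous_omega_fst [continuous_intros]: "continuous_on A (\<lambda>p::(nat\<Rightarrow>real) \<times> 'a::topological_space. fst p n)"
  by (rule continuous_on_compose2[OF continuous_omega continuous_on_fst[OF continuous_on_id]]) auto

lemma continuous_lift_iter: "continuous_on UNIV (\<lambda>\<omega>. lift_iter L \<omega> n z)"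
proof (induction n)
  case (Suc n)
  then show ?case unfolding lift_iter.simps std_lift_def by (intro continuous_intros)
qed auto

lemma continuous_orbit: "continuous_on UNIV (\<lambda>\<omega>. orbit_x L \<omega> n z)" "continuous_on UNIV (\<lambda>\<omega>. orbit_y L \<omega> n z)"
  unfolding orbit_x_def orbit_y_def by (intro continuous_intros continuous_lift_iter)+

text \<open>Continuity is joint in noise and vector because in \<open>closed_hyperbolic_at\<close>
  the vectors of the splitting vary along with the noise.\<close>

lemma continuous_lift_deriv: "continuous_on UNIV (\<lambda>p. lift_deriv L (fst p) n z (snd p))"
proof (induction n)
  case 0 then show ?case by (simp add: continuous_on_snd continuous_on_id)
next
  case (Suc n)
  have "continuous_on UNIV (\<lambda>p::(nat \<Rightarrow> real) \<times> (real \<times> real). orbit_x L (fst p) n z)"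
    by (rule continuous_on_compose2[OF continuous_orbit(1) continuous_on_fst[OF continuous_on_id]]) auto
  with Suc show ?case unfolding lift_deriv.simps next_v_def by (intro continuous_intros)
qed

lemma continuous_lift_deriv_omega: "continuous_on UNIV (\<lambda>\<omega>. lift_deriv L \<omega> n z v)"
proof -
  have "continuous_on UNIV (\<lambda>\<omega>. lift_deriv L (fst (\<omega>, v)) n z (snd (\<omega>, v)))"
    by (rule continuous_on_compose2[OF continuous_lift_deriv]) (auto intro!: continuous_intros)
  then show ?thesis by simp
qed

lemma measurable_orbit [measurable]:
  "(\<lambda>\<omega>. orbit_x L \<omega> n z) \<in> borel_measurable (noise \<delta> L')" "(\<lambda>\<omega>. orbit_y L \<omega> n z) \<in> borel_measurable (noise \<delta> L')"
  "(\<lambda>\<omega>. fst (lift_deriv L \<omega> n z v)) \<in> borel_measurable (noise \<delta> L')"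
  "(\<lambda>\<omega>. snd (lift_deriv L \<omega> n z v)) \<in> borel_measurable (noise \<delta> L')"
  "(\<lambda>\<omega>. \<omega> n) \<in> borel_measurable (noise \<delta> L')"
  by (intro measurable_noise_continuous continuous_orbit continuous_intros continuous_lift_deriv_omega)+

text \<open>Invariance under integer translations of the start: marked points lie in the fundamental
  domain, whereas curves are lifts that may start elsewhere.\<close>

lemma orbit_x_cos_cong:
  assumes "fst z' - fst z \<in> \<int>" "snd z' - snd z \<in> \<int>"
  shows "orbit_x L \<omega> n z' - orbit_x L \<omega> n z \<in> \<int>" "orbit_y L \<omega> n z' - orbit_y L \<omega> n z \<in> \<int>"
proof -
  have "orbit_x L \<omega> n z' - orbit_x L \<omega> n z \<in> \<int> \<and> orbit_y L \<omega> n z' - orbit_y L \<omega> n z \<in> \<int>"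
  proof (induction n)
    case 0 then show ?case using assms by (simp add: orbit_x_def orbit_y_def)
  next
    case (Suc n)
    then obtain m where m: "orbit_x L \<omega> n z' - orbit_x L \<omega> n z = of_int m" by (auto elim: Ints_cases)
    then have "2 * pi * (orbit_x L \<omega> n z' + \<omega> n) = 2 * pi * (orbit_x L \<omega> n z + \<omega> n) + 2 * pi * of_int m"
      by (simp add: algebra_simps)
    then have "cos (2 * pi * (orbit_x L \<omega> n z' + \<omega> n)) = cos (2 * pi * (orbit_x L \<omega> n z + \<omega> n))"
      by (simp only: cos_add) simp
    moreover have "orbit_y L \<omega> n z - orbit_y L \<omega> n z' \<in> \<int>" using Suc by (metis Ints_minus minus_diff_eq)
    ultimately show ?case using Suc by (simp add: orbit_Suc next_x_def)
  qed
  then show "orbit_x L \<omega> n z' - orbit_x L \<omega> n z \<in> \<int>" "orbit_y L \<omega> n z' - orbit_y L \<omega> n z \<in> \<int>" by auto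
qed

lemma lift_deriv_periodic:
  assumes "fst z' - fst z \<in> \<int>" "snd z' - snd z \<in> \<int>"
  shows "lift_deriv L \<omega> n z' v = lift_deriv L \<omega> n z v"
proof (induction n)
  case (Suc n)
  obtain m where m: "orbit_x L \<omega> n z' - orbit_x L \<omega> n z = of_int m"
    using orbit_x_cos_cong(1)[OF assms, of L \<omega> n] by (meson Ints_cases)
  then have "2 * pi * (orbit_x L \<omega> n z' + \<omega> n) = 2 * pi * (orbit_x L \<omega> n z + \<omega> n) + 2 * pi * of_int m"
    by (simp add: algebra_simps)
  then have "sin (2 * pi * (orbit_x L \<omega> n z' + \<omega> n)) = sin (2 * pi * (orbit_x L \<omega> n z + \<omega> n))"
    by (simp only: sin_add) simp
  then show ?case by (simp add: Suc next_v_def)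
qed simp

section \<open>The torus and directions\<close>

lemma frac_diff_Ints: "frac (x::real) - x \<in> \<int>" "x - frac x \<in> \<int>"
  by (simp_all add: frac_def)

lemma circle_norm_le_torus_dist: "circle_norm (fst z - fst w) \<le> torus_dist z w" "circle_norm (snd z - snd w) \<le> torus_dist z w"
proof -
  have ne: "(\<int> :: real set) \<times> (\<int> :: real set) \<noteq> {}" by (auto intro: Ints_0)
  have "circle_norm (fst z - fst w) \<le> dist (z - w) p \<and> circle_norm (snd z - snd w) \<le> dist (z - w) p" if "p \<in> \<int> \<times> \<int>" for p
  proof -
    have "circle_norm (fst z - fst w) \<le> \<bar>fst z - fst w - fst p\<bar>" "circle_norm (snd z - snd w) \<le> \<bar>snd z - snd w - snd p\<bar>"
      using that by (auto intro: circle_norm_le_Ints)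
    moreover have "\<bar>fst z - fst w - fst p\<bar> \<le> dist (z - w) p" "\<bar>snd z - snd w - snd p\<bar> \<le> dist (z - w) p"
      using dist_fst_le[of "z - w" p] dist_snd_le[of "z - w" p] by (simp_all add: dist_real_def)
    ultimately show ?thesis by linarith
  qed
  then show "circle_norm (fst z - fst w) \<le> torus_dist z w" "circle_norm (snd z - snd w) \<le> torus_dist z w"
    unfolding torus_dist_def infdist_notempty[OF ne] by (auto intro!: cINF_greatest[OF ne])
qed

lemma torus_dist_le: "torus_dist z w \<le> circle_norm (fst z - fst w) + circle_norm (snd z - snd w)"
proof -
  obtain m n :: int where mn: "circle_norm (fst z - fst w) = \<bar>fst z - fst w - of_int m\<bar>" "circle_norm (snd z - snd w) = \<bar>snd z - snd w - of_int n\<bar>"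
    by (metis circle_norm_attained)
  have "torus_dist z w \<le> dist (z - w) (of_int m, of_int n)"
    unfolding torus_dist_def by (rule infdist_le) auto
  also have "\<dots> \<le> \<bar>fst z - fst w - of_int m\<bar> + \<bar>snd z - snd w - of_int n\<bar>"
    by (simp add: dist_prod_def dist_real_def) (rule sqrt_sum_squares_le_sum_abs)
  finally show ?thesis using mn by simp
qed

lemma crit_nbhd_eq: "crit_nbhd \<eta> = {x. circle_norm (2 * x) < 2 * \<eta>}"
proof (rule set_eqI, rule iffI)
  fix x assume "x \<in> crit_nbhd \<eta>"
  then consider "circle_norm x < \<eta>" | "circle_norm (x - 1/2) < \<eta>" by (auto simp: crit_nbhd_def circle_dist_eq_norm)
  then show "x \<in> {x. circle_norm (2 * x) < 2 * \<eta>}"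
  proof cases
    case 1 then show ?thesis using circle_norm_mult_le[of x] by simp
  next
    case 2
    have "circle_norm (2 * x) = circle_norm (2 * (x - 1/2))"
      using circle_norm_minus_Ints[of 1 "2 * x"] by (simp add: algebra_simps)
    then show ?thesis using 2 circle_norm_mult_le[of "x - 1/2"] by simp
  qed
next
  fix x assume x: "x \<in> {x. circle_norm (2 * x) < 2 * \<eta>}"
  obtain m :: int where m: "circle_norm (2 * x) = \<bar>2 * x - of_int m\<bar>" by (metis circle_norm_attained)
  show "x \<in> crit_nbhd \<eta>"
  proof (cases "even m")
    case True
    then obtain k where "m = 2 * k" by (auto elim: evenE)
    then show ?thesis using x m circle_norm_le_int[of x k] by (auto simp: crit_nbhd_def circle_dist_eq_norm)
  next
    case False
    then obtain k where "m = 2 * k + 1" by (auto elim: oddE)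
    then show ?thesis using x m circle_norm_le_int[of "x - 1/2" k] by (auto simp: crit_nbhd_def circle_dist_eq_norm)
  qed
qed

lemma line_angle_horizontal:
  assumes "a \<noteq> 0" shows "line_angle (a, b) (1, 0) = arctan (\<bar>b\<bar> / \<bar>a\<bar>)"
proof -
  have "norm (a, b) = sqrt (a\<^sup>2 + b\<^sup>2)" by (simp add: norm_prod_def)
  also have "a\<^sup>2 + b\<^sup>2 = a\<^sup>2 * (1 + (\<bar>b\<bar> / \<bar>a\<bar>)\<^sup>2)" using assms by (simp add: power_divide distrib_left)
  also have "sqrt \<dots> = \<bar>a\<bar> * sqrt (1 + (\<bar>b\<bar> / \<bar>a\<bar>)\<^sup>2)" by (simp only: real_sqrt_mult real_sqrt_abs)
  finally have "\<bar>(a, b) \<bullet> (1, 0)\<bar> / (norm (a, b) * norm (1::real, 0::real)) = 1 / sqrt (1 + (\<bar>b\<bar> / \<bar>a\<bar>)\<^sup>2)"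
    using assms by (simp add: norm_prod_def)
  also have "\<dots> = cos (arctan (\<bar>b\<bar> / \<bar>a\<bar>))" by (simp add: cos_arctan)
  finally have "line_angle (a, b) (1, 0) = arccos (cos (arctan (\<bar>b\<bar> / \<bar>a\<bar>)))" by (simp only: line_angle_def)
  also have "\<dots> = arctan (\<bar>b\<bar> / \<bar>a\<bar>)"
  proof (rule arccos_cos)
    show "arctan (\<bar>b\<bar> / \<bar>a\<bar>) \<le> pi" using arctan_ubound[of "\<bar>b\<bar> / \<bar>a\<bar>"] pi_gt_zero by linarith
  qed (simp add: zero_le_arctan_iff)
  finally show ?thesis .
qed

lemma horizontal_ballI:
  assumes "a \<noteq> 0" "\<bar>b\<bar> \<le> t * \<bar>a\<bar>" "t < r" shows "(a, b) \<in> horizontal_ball r"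
proof -
  have "\<bar>b\<bar> / \<bar>a\<bar> \<le> t" using assms by (simp add: pos_divide_le_eq)
  then have "arctan (\<bar>b\<bar> / \<bar>a\<bar>) < r" using arctan_le_self[of "\<bar>b\<bar> / \<bar>a\<bar>"] assms(3) by simp
  then show ?thesis using assms(1) by (simp add: horizontal_ball_def line_angle_horizontal zero_prod_def)
qed

text \<open>Crude bounds suffice: \<open>tan (1/10)\<close> is at most 1/5 since
  \<open>cos (1/10) \<ge> 1/2\<close>. Slope 1/2 leaves the room that \<open>cone_perturb\<close>
  uses.\<close>

lemma horizontal_ballD:
  assumes "(a, b) \<in> horizontal_ball r" "r < 1/10" shows "a \<noteq> 0" "\<bar>b\<bar> \<le> \<bar>a\<bar> / 2"
proof -
  have r: "line_angle (a, b) (1, 0) < 1/10" using assms by (simp add: horizontal_ball_def)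
  show a: "a \<noteq> 0"
  proof
    assume "a = 0"
    then have "line_angle (a, b) (1, 0) = pi / 2" by (simp add: line_angle_def)
    then show False using r pi_gt3 by simp
  qed
  have "cos (pi / 3) \<le> cos (1/10)" using pi_gt3 by (intro cos_monotone_0_pi_le) auto
  then have c: "1/2 \<le> cos (1/10 :: real)" by (simp add: cos_60)
  have "sin (1/10 :: real) \<le> 1/10" by (rule sin_x_le_x) simp
  then have "tan (1/10 :: real) \<le> (1/10) / (1/2)" unfolding tan_def using c by (intro frac_le) auto
  moreover have "tan (arctan (\<bar>b\<bar> / \<bar>a\<bar>)) < tan (1/10)"
    using r a arctan_lbound[of "\<bar>b\<bar> / \<bar>a\<bar>"] pi_gt3 by (intro tan_monotone) (auto simp: line_angle_horizontal)
  ultimately have "\<bar>b\<bar> / \<bar>a\<bar> < 1/2" by (simp add: tan_arctan)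
  then show "\<bar>b\<bar> \<le> \<bar>a\<bar> / 2" using a by (simp add: field_simps)
qed

lemma admissible_tangent:
  assumes "admissible c \<gamma>" "ell0 c > 0"
  shows "(\<gamma> has_vector_derivative marked_tangent \<gamma>) (at 0)" "norm (marked_tangent \<gamma>) = 1"
proof -
  obtain g' g'' where g: "\<forall>t\<in>{- ell0 c..ell0 c}. (\<gamma> has_vector_derivative g' t) (at t within {- ell0 c..ell0 c}) \<and>
      (g' has_vector_derivative g'' t) (at t within {- ell0 c..ell0 c}) \<and> norm (g' t) = 1 \<and> norm (g'' t) \<le> curv0 c"
    using assms(1) unfolding admissible_def arclength_C2_def by blast
  have "(\<gamma> has_vector_derivative g' 0) (at 0 within {- ell0 c..ell0 c})" "norm (g' 0) = 1" using g assms(2) by auto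
  moreover have "at 0 within {- ell0 c..ell0 c} = at 0"
    using assms(2) by (intro at_within_interior) (simp add: interior_atLeastAtMost_real)
  ultimately show "(\<gamma> has_vector_derivative marked_tangent \<gamma>) (at 0)" "norm (marked_tangent \<gamma>) = 1"
    by (auto simp: marked_tangent_def vector_derivative_at)
qed

lemma tendsto_lift_deriv:
  assumes "w \<longlonglongrightarrow> \<omega>" "S \<longlonglongrightarrow> s"
  shows "(\<lambda>n. lift_deriv L (w n) k z (S n)) \<longlonglongrightarrow> lift_deriv L \<omega> k z s"
  using continuous_on_tendsto_compose[OF continuous_lift_deriv tendsto_Pair[OF assms]] by simp

lemma tendsto_line_angle:
  assumes "f \<longlonglongrightarrow> a" "g \<longlonglongrightarrow> b" "a \<noteq> 0" "b \<noteq> 0"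
  shows "(\<lambda>n. line_angle (f n) (g n)) \<longlonglongrightarrow> line_angle a b"
proof -
  have "(\<lambda>n. \<bar>f n \<bullet> g n\<bar> / (norm (f n) * norm (g n))) \<longlonglongrightarrow> \<bar>a \<bullet> b\<bar> / (norm a * norm b)"
    using assms by (intro tendsto_intros) auto
  moreover have range: "\<bar>v \<bullet> w\<bar> / (norm v * norm w) \<in> {-1..1}" for v w :: "real \<times> real"
  proof -
    have "\<bar>v \<bullet> w\<bar> / (norm v * norm w) \<le> 1"
      using Cauchy_Schwarz_ineq2[of v w] by (auto simp: divide_le_eq_1 zero_less_mult_iff)
    moreover have "0 \<le> \<bar>v \<bullet> w\<bar> / (norm v * norm w)" by simp
    ultimately show ?thesis unfolding atLeastAtMost_iff by linarith
  qed
  ultimately show ?thesis unfolding line_angle_def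
    by (intro continuous_on_tendsto_compose[OF continuous_on_arccos']) auto
qed

text \<open>The splitting vectors range over a compact set and all inequalities are non-strict, so a
  subsequence of splittings converges to a splitting. Quotients and angles pass to the limit because
  the derivative never annihilates a nonzero vector.\<close>

lemma closed_hyperbolic_at:
  assumes "marked_tangent \<gamma> \<noteq> 0"
  shows "closed {\<omega>. hyperbolic_at c L \<omega> \<gamma> m}"
  unfolding closed_sequential_limits
proof (intro allI impI, elim conjE)
  fix w :: "nat \<Rightarrow> nat \<Rightarrow> real" and \<omega> assume w: "\<forall>n. w n \<in> {\<omega>. hyperbolic_at c L \<omega> \<gamma> m}" "w \<longlonglongrightarrow> \<omega>"
  define z where "z = marked_point \<gamma>"
  define K where "K = (sphere 0 1 :: (real \<times> real) set) \<times> (sphere 0 1 :: (real \<times> real) set)"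
  have "\<forall>n. \<exists>s u. rt_splitting c L (w n) z m s u \<and> most_contracted (DF L (w n) m z) s \<and>
      line_angle (marked_tangent \<gamma>) s \<ge> L powr (- (eps_angle c) * real m)"
    using w(1) by (auto simp: hyperbolic_at_def z_def)
  then obtain S U where SU: "\<And>n. rt_splitting c L (w n) z m (S n) (U n)" "\<And>n. most_contracted (DF L (w n) m z) (S n)"
      "\<And>n. line_angle (marked_tangent \<gamma>) (S n) \<ge> L powr (- (eps_angle c) * real m)"
    by metis
  have "seq_compact K" unfolding K_def by (intro compact_imp_seq_compact compact_Times compact_sphere)
  moreover have "\<forall>n. (S n, U n) \<in> K" using SU(1) by (auto simp: K_def rt_splitting_def)
  ultimately obtain su r where su: "su \<in> K" "strict_mono (r::nat\<Rightarrow>nat)" "((\<lambda>n. (S n, U n)) \<circ> r) \<longlonglongrightarrow> su"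
    using seq_compactE[of K "\<lambda>n. (S n, U n)"] by metis
  define s u where "s = fst su" and "u = snd su"
  have S: "(\<lambda>n. S (r n)) \<longlonglongrightarrow> s" and U: "(\<lambda>n. U (r n)) \<longlonglongrightarrow> u"
    using tendsto_fst[OF su(3)] tendsto_snd[OF su(3)] by (simp_all add: s_def u_def o_def)
  have su1: "norm s = 1" "norm u = 1" "s \<noteq> 0" "u \<noteq> 0" using su(1) by (auto simp: K_def s_def u_def)
  have W: "(\<lambda>n. w (r n)) \<longlonglongrightarrow> \<omega>" using LIMSEQ_subseq_LIMSEQ[OF w(2) su(2)] by (simp add: o_def)
  have DS: "(\<lambda>n. DF L (w (r n)) k z (S (r n))) \<longlonglongrightarrow> DF L \<omega> k z s"
    and DU: "(\<lambda>n. DF L (w (r n)) k z (U (r n))) \<longlonglongrightarrow> DF L \<omega> k z u" for k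
    unfolding DF_eq using tendsto_lift_deriv[OF W S] tendsto_lift_deriv[OF W U] by auto
  have nz: "DF L \<omega> k z s \<noteq> 0" "DF L \<omega> k z u \<noteq> 0" for k
    unfolding DF_eq using lift_deriv_nonzero su1 by auto
  have "rt_splitting c L \<omega> z m s u"
    unfolding rt_splitting_def
  proof (intro conjI allI impI, simp_all only: su1, elim conjE)
    fix i k assume ki: "k \<le> i" "i \<le> m"
    have lim: "(\<lambda>n. norm (DF L (w (r n)) i z (S (r n))) / norm (DF L (w (r n)) k z (S (r n)))) \<longlonglongrightarrow> norm (DF L \<omega> i z s) / norm (DF L \<omega> k z s)"
      using nz by (intro tendsto_intros DS) auto
    show "norm (DF L \<omega> i z s) / norm (DF L \<omega> k z s) \<le> exp (Csplit c) * L ^ 3 * L powr (3 * eps c * real (m - k)) * L powr (- alpha c * real (i - k))"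
      by (rule LIMSEQ_le_const2[OF lim]) (use SU(1) ki in \<open>auto simp: rt_splitting_def\<close>)
  next
    fix i k assume "k \<le> i \<and> i \<le> m"
    then have ki: "k \<le> i" "i \<le> m" by auto
    have lim: "(\<lambda>n. norm (DF L (w (r n)) i z (U (r n))) / norm (DF L (w (r n)) k z (U (r n)))) \<longlonglongrightarrow> norm (DF L \<omega> i z u) / norm (DF L \<omega> k z u)"
      using nz by (intro tendsto_intros DU) auto
    show "exp (- Csplit c) * L powr (- 3) * L powr (- 3 * eps c * real (m - k)) * L powr (alpha c * real (i - k)) \<le> norm (DF L \<omega> i z u) / norm (DF L \<omega> k z u)"
      by (rule LIMSEQ_le_const[OF lim]) (use SU(1) ki in \<open>auto simp: rt_splitting_def\<close>)
  next
    fix i k assume "k \<le> i \<and> i \<le> m"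
    then have ki: "k \<le> i" "i \<le> m" by auto
    have lim: "(\<lambda>n. line_angle (DF L (w (r n)) i z (S (r n))) (DF L (w (r n)) i z (U (r n)))) \<longlonglongrightarrow> line_angle (DF L \<omega> i z s) (DF L \<omega> i z u)"
      using nz by (intro tendsto_line_angle DS DU) auto
    show "exp (- Csplit c) * L powr (- 3) * L powr (- 3 * eps c * real (m - k)) \<le> line_angle (DF L \<omega> i z s) (DF L \<omega> i z u)"
      by (rule LIMSEQ_le_const[OF lim]) (use SU(1) ki in \<open>auto simp: rt_splitting_def\<close>)
  qed
  moreover have "most_contracted (DF L \<omega> m z) s"
    unfolding most_contracted_def
  proof (intro conjI allI impI su1)
    fix v :: "real \<times> real" assume v: "norm v = 1"
    have "(\<lambda>n. DF L (w (r n)) m z v) \<longlonglongrightarrow> DF L \<omega> m z v"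
      unfolding DF_eq using tendsto_lift_deriv[OF W tendsto_const] by auto
    then show "norm (DF L \<omega> m z s) \<le> norm (DF L \<omega> m z v)"
      by (rule LIMSEQ_le[OF tendsto_norm[OF DS] tendsto_norm]) (intro exI[of _ 0] allI impI, use SU(2) v in \<open>simp add: most_contracted_def del: split_paired_All\<close>)
  qed
  moreover have "line_angle (marked_tangent \<gamma>) s \<ge> L powr (- (eps_angle c) * real m)"
    by (rule LIMSEQ_le_const[OF tendsto_line_angle[OF tendsto_const S assms su1(3)]]) (use SU(3) in auto)
  moreover have "nmin c \<le> m" using w(1) by (auto simp: hyperbolic_at_def)
  ultimately show "\<omega> \<in> {\<omega>. hyperbolic_at c L \<omega> \<gamma> m}" unfolding hyperbolic_at_def z_def by blast
qed

lemma hyperbolic_at_cong: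
  assumes "\<And>j. j < 3 * m \<Longrightarrow> \<omega> j = \<omega>' j"
  shows "hyperbolic_at c L \<omega> \<gamma> m = hyperbolic_at c L \<omega>' \<gamma> m"
proof -
  have DF: "DF L \<omega> k z = DF L \<omega>' k z" if "k \<le> m" for k z
    unfolding DF_eq by (rule ext, rule lift_deriv_cong) (use that assms in auto)
  have "rt_splitting c L \<omega> z m s u = rt_splitting c L \<omega>' z m s u" for z s u
    unfolding rt_splitting_def using DF by (auto dest: order_trans)
  then show ?thesis unfolding hyperbolic_at_def using DF[of m] by auto
qed

section \<open>Greedy renewal sequences\<close>

lemma Inf_enat_mem: "A \<noteq> {} \<Longrightarrow> Inf A \<in> (A :: enat set)"
  using wellorder_InfI by blast

text \<open>Covers both enumerations at once: the hyperbolic times with \<open>K = 0\<close> and the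
  renewal times with \<open>K = K1 P + K2 P\<close>.\<close>

locale greedy_sequence =
  fixes A :: "nat set" and K :: nat and T :: "nat \<Rightarrow> enat"
  assumes T_0: "T 0 = 0"
    and T_Suc: "T (Suc j) = Inf {enat m |m. m \<in> A \<and> enat m > T j + enat K}"
begin

definition hits :: "nat \<Rightarrow> bool" where "hits i \<longleftrightarrow> (\<exists>j\<ge>1. T j = enat i)"

text \<open>The infimum of the empty set is \<infinity>, so a finite value is attained.\<close>

lemma T_Suc_mem:
  assumes "T (Suc j) = enat i" shows "i \<in> A" "T j + enat K < enat i"
proof -
  let ?B = "{enat m |m. m \<in> A \<and> enat m > T j + enat K}"
  have "?B \<noteq> {}"
  proof
    assume e: "?B = {}"
    have "T (Suc j) = \<infinity>" unfolding T_Suc e by (simp add: Inf_enat_def)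
    with assms show False by simp
  qed
  then have "T (Suc j) \<in> ?B" unfolding T_Suc by (rule Inf_enat_mem)
  then show "i \<in> A" "T j + enat K < enat i" using assms by auto
qed

lemma T_less_Suc: "T j < \<infinity> \<Longrightarrow> T j < T (Suc j)"
proof (cases "T (Suc j)")
  case (enat i)
  then show ?thesis using T_Suc_mem(2)[OF enat] by (metis enat le_iff_add le_less_trans)
qed auto

lemma T_mono: "j \<le> j' \<Longrightarrow> T j \<le> T j'"
proof (induction j' rule: nat_induct_at_least[of j, consumes 1])
  case (Suc j')
  show ?case
  proof (cases "T j' < \<infinity>")
    case True then show ?thesis using Suc.IH T_less_Suc[of j'] by auto
  next
    case False
    then have "T j' = \<infinity>" by simp
    then have e: "{enat m |m. m \<in> A \<and> enat m > T j' + enat K} = {}" by simp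
    have "T (Suc j') = \<infinity>" unfolding T_Suc e by (simp add: Inf_enat_def)
    then show ?thesis by simp
  qed
qed auto

lemma T_ge: "enat j \<le> T j"
proof (induction j)
  case (Suc j)
  show ?case
  proof (cases "T j < \<infinity>")
    case True
    then show ?thesis using Suc T_less_Suc[of j] by (metis Suc_ile_eq le_less_trans)
  next
    case False
    then show ?thesis using T_mono[of j "Suc j"] by auto
  qed
qed (simp add: T_0 zero_enat_def)

text \<open>Describes membership through earlier hits only, without the index \<open>j\<close>.
  Measurability and adaptedness of renewal times then follow by strong induction. The condition
  \<open>K < i\<close> comes from the starting value \<open>T 0 = 0\<close>.\<close>

lemma hits_iff: "hits i \<longleftrightarrow> i \<in> A \<and> K < i \<and> (\<forall>i'<i. hits i' \<longrightarrow> i' + K < i)"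
proof
  assume "hits i"
  then obtain j where j: "T (Suc j) = enat i" unfolding hits_def by (metis Suc_le_D One_nat_def)
  note m = T_Suc_mem[OF j]
  have "enat K < enat i" using m(2) by (metis add.commute le_iff_add le_less_trans)
  moreover have "i' + K < i" if i': "i' < i" "hits i'" for i'
  proof -
    obtain j' where j': "j' \<ge> 1" "T j' = enat i'" using i'(2) by (auto simp: hits_def)
    have "j' \<le> j"
    proof (rule ccontr)
      assume "\<not> j' \<le> j"
      then have "T (Suc j) \<le> T j'" by (intro T_mono) auto
      then show False using j j' i' by simp
    qed
    then have "enat i' + enat K \<le> T j + enat K" using T_mono[of j' j] j' by (intro add_right_mono) auto
    then have "enat i' + enat K < enat i" using m(2) by (rule le_less_trans)
    then show ?thesis by simp
  qed
  ultimately show "i \<in> A \<and> K < i \<and> (\<forall>i'<i. hits i' \<longrightarrow> i' + K < i)" using m by auto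
next
  assume i: "i \<in> A \<and> K < i \<and> (\<forall>i'<i. hits i' \<longrightarrow> i' + K < i)"
  \<comment> \<open>The largest index in \<open>J\<close> enumerates the last hit before
    \<open>i\<close>, or is 0; the next value of \<open>T\<close> must then be
    \<open>i\<close>.\<close>
  define J where "J = {j. T j < enat i}"
  have "J \<subseteq> {..<i}"
  proof
    fix j assume "j \<in> J"
    then have "enat j < enat i" unfolding J_def using le_less_trans[OF T_ge] by blast
    then show "j \<in> {..<i}" by simp
  qed
  then have fin: "finite J" by (rule finite_subset) simp
  have "0 \<in> J" using i by (auto simp: J_def T_0 zero_enat_def)
  define j where "j = Max J"
  have jJ: "j \<in> J" unfolding j_def using fin \<open>0 \<in> J\<close> by (intro Max_in) auto
  have SjJ: "Suc j \<notin> J" using Max_ge[OF fin, of "Suc j"] by (auto simp: j_def)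
  have "T j + enat K < enat i"
  proof (cases "j = 0")
    case True then show ?thesis using i by (simp add: T_0)
  next
    case False
    obtain i' where i': "T j = enat i'" using jJ by (cases "T j") (auto simp: J_def)
    then have "hits i'" "i' < i" using False jJ by (auto simp: hits_def J_def intro!: exI[of _ j])
    then show ?thesis using i i' by simp
  qed
  then have "T (Suc j) \<le> enat i" unfolding T_Suc using i by (intro Inf_lower) auto
  moreover have "enat i \<le> T (Suc j)" using SjJ by (simp add: J_def)
  ultimately show "hits i" unfolding hits_def by (intro exI[of _ "Suc j"]) auto
qed

text \<open>An element of \<open>A\<close> that is passed over lies at most \<open>K\<close> after a
  hit or is itself at most \<open>K\<close>.\<close>

lemma card_le_hits: "card (A \<inter> {1..n}) \<le> K + (K + 1) * card {i. hits i \<and> i \<le> n}"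
proof -
  let ?R = "{i. hits i \<and> i \<le> n}"
  have fin: "finite ?R" by (rule finite_subset[of _ "{..n}"]) auto
  have "A \<inter> {1..n} \<subseteq> {1..K} \<union> (\<Union>i\<in>?R. {i..i+K})"
  proof
    fix a assume a: "a \<in> A \<inter> {1..n}"
    show "a \<in> {1..K} \<union> (\<Union>i\<in>?R. {i..i+K})"
    proof (cases "hits a \<or> a \<le> K")
      case False
      then obtain i' where "i' < a" "hits i'" "\<not> i' + K < a" using a hits_iff[of a] by auto
      then show ?thesis using a by auto
    qed (use a in auto)
  qed
  then have "card (A \<inter> {1..n}) \<le> card ({1..K} \<union> (\<Union>i\<in>?R. {i..i+K}))"
    using fin by (intro card_mono) auto
  also have "\<dots> \<le> card {1..K} + card (\<Union>i\<in>?R. {i..i+K})" by (rule card_Un_le)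
  also have "card (\<Union>i\<in>?R. {i..i+K}) \<le> (\<Sum>i\<in>?R. card {i..i+K})" using fin by (rule card_UN_le)
  also have "\<dots> = (K + 1) * card ?R" by simp
  finally show ?thesis by simp
qed

end

text \<open>With gap 0 the greedy choice skips no positive element, and
  \<open>nmin c \<ge> 1\<close> rules out time 0.\<close>

lemma tau_hits:
  assumes "nmin c \<ge> 1"
  shows "(\<exists>j\<ge>1. tau c L \<omega> \<gamma> j = enat i) \<longleftrightarrow> hyperbolic_at c L \<omega> \<gamma> i"
proof -
  interpret greedy_sequence "{m. hyperbolic_at c L \<omega> \<gamma> m}" 0 "tau c L \<omega> \<gamma>"
    by unfold_locales (auto simp: zero_enat_def[symmetric] conj_commute)
  have "hyperbolic_at c L \<omega> \<gamma> i \<Longrightarrow> i \<ge> 1" using assms by (simp add: hyperbolic_at_def)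
  then show ?thesis using hits_iff[of i] unfolding hits_def by auto
qed

text \<open>The frequency property counts indices \<open>k\<close>, the density argument counts
  times; strict growth of \<open>tau\<close> below \<infinity> gives the bijection.\<close>

lemma card_tau:
  assumes "nmin c \<ge> 1"
  shows "card {k. k \<ge> 1 \<and> tau c L \<omega> \<gamma> k \<le> enat n} = card {i. hyperbolic_at c L \<omega> \<gamma> i \<and> i \<le> n}"
proof -
  interpret greedy_sequence "{m. hyperbolic_at c L \<omega> \<gamma> m}" 0 "tau c L \<omega> \<gamma>"
    by unfold_locales (auto simp: zero_enat_def[symmetric] conj_commute)
  have inj: "tau c L \<omega> \<gamma> j \<noteq> tau c L \<omega> \<gamma> k" if "j < k" "tau c L \<omega> \<gamma> k \<le> enat n" for j k
  proof -
    have "tau c L \<omega> \<gamma> j \<le> enat n" using T_mono[of j k] that by (auto intro: order_trans)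
    then have "tau c L \<omega> \<gamma> j < tau c L \<omega> \<gamma> (Suc j)" by (intro T_less_Suc) (cases "tau c L \<omega> \<gamma> j"; simp)
    also have "\<dots> \<le> tau c L \<omega> \<gamma> k" using that by (intro T_mono) auto
    finally show ?thesis by simp
  qed
  have "bij_betw (\<lambda>k. the_enat (tau c L \<omega> \<gamma> k)) {k. k \<ge> 1 \<and> tau c L \<omega> \<gamma> k \<le> enat n} {i. hyperbolic_at c L \<omega> \<gamma> i \<and> i \<le> n}"
  proof (rule bij_betwI')
    fix j k assume jk: "j \<in> {k. k \<ge> 1 \<and> tau c L \<omega> \<gamma> k \<le> enat n}" "k \<in> {k. k \<ge> 1 \<and> tau c L \<omega> \<gamma> k \<le> enat n}"
    then obtain a b where ab: "tau c L \<omega> \<gamma> j = enat a" "tau c L \<omega> \<gamma> k = enat b"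
      by (metis enat_ile mem_Collect_eq)
    then show "(the_enat (tau c L \<omega> \<gamma> j) = the_enat (tau c L \<omega> \<gamma> k)) = (j = k)"
      using inj[of j k] inj[of k j] jk by (cases j k rule: linorder_cases) auto
  next
    fix k assume k: "k \<in> {k. k \<ge> 1 \<and> tau c L \<omega> \<gamma> k \<le> enat n}"
    then obtain a where a: "tau c L \<omega> \<gamma> k = enat a" by (metis enat_ile mem_Collect_eq)
    then have "hyperbolic_at c L \<omega> \<gamma> a" using k tau_hits[OF assms, of L \<omega> \<gamma> a] by auto
    then show "the_enat (tau c L \<omega> \<gamma> k) \<in> {i. hyperbolic_at c L \<omega> \<gamma> i \<and> i \<le> n}" using a k by simp
  next
    fix i assume i: "i \<in> {i. hyperbolic_at c L \<omega> \<gamma> i \<and> i \<le> n}"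
    then obtain j where "j \<ge> 1" "tau c L \<omega> \<gamma> j = enat i" using tau_hits[OF assms, of L \<omega> \<gamma> i] by auto
    then show "\<exists>x\<in>{k. k \<ge> 1 \<and> tau c L \<omega> \<gamma> k \<le> enat n}. i = the_enat (tau c L \<omega> \<gamma> x)"
      using i by (intro bexI[of _ j]) auto
  qed
  then show ?thesis by (rule bij_betw_same_card)
qed

definition sim_hyperbolic :: "hyp_consts \<Rightarrow> pair_consts \<Rightarrow> real \<Rightarrow> (nat \<Rightarrow> real) \<Rightarrow> nat \<Rightarrow> bool" where
  "sim_hyperbolic c P L \<omega> i \<longleftrightarrow> hyperbolic_at c L \<omega> (curve1 P) i \<and> hyperbolic_at c L \<omega> (curve2 P) i \<and> orbit_ok P L \<omega> i"

definition is_renewal :: "hyp_consts \<Rightarrow> pair_consts \<Rightarrow> real \<Rightarrow> (nat \<Rightarrow> real) \<Rightarrow> nat \<Rightarrow> bool" where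
  "is_renewal c P L \<omega> i \<longleftrightarrow> (\<exists>j\<ge>1. renewal_time c P L \<omega> j = enat i)"

lemma UN_sim_times:
  assumes "nmin c \<ge> 1"
  shows "(\<Union>n. sim_times c P L \<omega> n) = {i. sim_hyperbolic c P L \<omega> i}"
proof -
  have 1: "hyperbolic_at c L \<omega> \<gamma> i \<Longrightarrow> Suc 0 \<le> i" for \<gamma> i using assms by (simp add: hyperbolic_at_def)
  show ?thesis
    unfolding sim_times_def hyp_times_def tau_hits[OF assms] by (auto simp: sim_hyperbolic_def dest: 1)
qed

lemma renewal_greedy:
  assumes "nmin c \<ge> 1"
  shows "greedy_sequence {i. sim_hyperbolic c P L \<omega> i} (K1 P + K2 P) (renewal_time c P L \<omega>)"
  by unfold_locales (simp_all add: UN_sim_times[OF assms])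

lemma is_renewal_iff:
  assumes "nmin c \<ge> 1"
  shows "is_renewal c P L \<omega> i \<longleftrightarrow> sim_hyperbolic c P L \<omega> i \<and> K1 P + K2 P < i \<and>
    (\<forall>i'<i. is_renewal c P L \<omega> i' \<longrightarrow> i' + (K1 P + K2 P) < i)"
proof -
  interpret greedy_sequence "{i. sim_hyperbolic c P L \<omega> i}" "K1 P + K2 P" "renewal_time c P L \<omega>"
    by (rule renewal_greedy[OF assms])
  show ?thesis using hits_iff[of i] unfolding hits_def is_renewal_def by simp
qed

lemma card_sim_hyperbolic_le:
  assumes "nmin c \<ge> 1"
  shows "card {i. sim_hyperbolic c P L \<omega> i \<and> 1 \<le> i \<and> i \<le> n} \<le> (K1 P + K2 P) + (K1 P + K2 P + 1) * card {i. is_renewal c P L \<omega> i \<and> i \<le> n}"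
proof -
  interpret greedy_sequence "{i. sim_hyperbolic c P L \<omega> i}" "K1 P + K2 P" "renewal_time c P L \<omega>"
    by (rule renewal_greedy[OF assms])
  have "{i. sim_hyperbolic c P L \<omega> i \<and> 1 \<le> i \<and> i \<le> n} = {i. sim_hyperbolic c P L \<omega> i} \<inter> {1..n}" by auto
  then show ?thesis using card_le_hits[of n] unfolding hits_def is_renewal_def by simp
qed

section \<open>Separation of the two orbits\<close>

text \<open>Both coordinates are needed: the second difference remembers the previous first one, so
  separation lost in the first coordinate for one step is not lost altogether.\<close>

definition sep :: "real \<Rightarrow> real \<times> real \<Rightarrow> real \<times> real \<Rightarrow> (nat \<Rightarrow> real) \<Rightarrow> nat \<Rightarrow> real" where
  "sep L z z' \<omega> n = max (circle_norm (orbit_x L \<omega> n z - orbit_x L \<omega> n z')) (circle_norm (orbit_y L \<omega> n z - orbit_y L \<omega> n z'))"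

definition sep_bad :: "real \<Rightarrow> real \<times> real \<Rightarrow> real \<times> real \<Rightarrow> real \<Rightarrow> nat \<Rightarrow> (nat \<Rightarrow> real) \<Rightarrow> bool" where
  "sep_bad L z z' h k \<omega> \<longleftrightarrow> circle_norm (orbit_x L \<omega> (Suc k) z - orbit_x L \<omega> (Suc k) z')
     < min h (2 * L * \<bar>sin (pi * (orbit_x L \<omega> k z - orbit_x L \<omega> k z'))\<bar> * L powr (-1/4))"

definition cone_bad :: "real \<Rightarrow> real \<times> real \<Rightarrow> real \<times> real \<Rightarrow> real \<Rightarrow> nat \<Rightarrow> (nat \<Rightarrow> real) \<Rightarrow> bool" where
  "cone_bad L z v t k \<omega> \<longleftrightarrow> \<bar>snd (lift_deriv L \<omega> (Suc k) z v)\<bar> > t * \<bar>fst (lift_deriv L \<omega> (Suc k) z v)\<bar>"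

definition crit_bad :: "real \<Rightarrow> real \<times> real \<Rightarrow> real \<Rightarrow> nat \<Rightarrow> (nat \<Rightarrow> real) \<Rightarrow> bool" where
  "crit_bad L z h k \<omega> \<longleftrightarrow> circle_norm (2 * orbit_x L \<omega> (Suc k) z) \<le> h"

lemma diff_y_Suc: "orbit_y L \<omega> (Suc n) z - orbit_y L \<omega> (Suc n) z' = orbit_x L \<omega> n z - orbit_x L \<omega> n z'"
  by (simp add: orbit_Suc)

lemma abs_cos_diff_le:
  assumes "L \<ge> 0"
  shows "\<bar>next_x L x y w - next_x L x' y' w + (y - y')\<bar> \<le> 2 * L * \<bar>sin (pi * (x - x'))\<bar>"
proof -
  obtain \<phi> where "next_x L x y w - next_x L x' y' w = 2 * L * \<bar>sin (pi * (x - x'))\<bar> * cos (2 * pi * w + \<phi>) - (y - y')"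
    using next_x_diff[OF assms, of x y x' y'] by metis
  then have "\<bar>next_x L x y w - next_x L x' y' w + (y - y')\<bar> = 2 * L * \<bar>sin (pi * (x - x'))\<bar> * \<bar>cos (2 * pi * w + \<phi>)\<bar>"
    using assms by (simp add: abs_mult)
  also have "\<dots> \<le> 2 * L * \<bar>sin (pi * (x - x'))\<bar> * 1"
    using assms by (intro mult_left_mono) auto
  finally show ?thesis by simp
qed

text \<open>The inverse of a step is Lipschitz: the old first difference is the new second one, and
  the old second difference is the cosine difference minus the new first one. The constant is
  \<open>8 = 7 + 1\<close> with \<open>2 * pi \<le> 7\<close>.\<close>

lemma sep_le_Suc:
  assumes "L \<ge> 1" shows "sep L z z' \<omega> n \<le> 8 * L * sep L z z' \<omega> (Suc n)"
proof -
  define s where "s = sep L z z' \<omega> (Suc n)"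
  define dx where "dx = orbit_x L \<omega> n z - orbit_x L \<omega> n z'"
  define dy where "dy = orbit_y L \<omega> n z - orbit_y L \<omega> n z'"
  define dx1 where "dx1 = orbit_x L \<omega> (Suc n) z - orbit_x L \<omega> (Suc n) z'"
  have x: "circle_norm dx \<le> s" unfolding s_def sep_def diff_y_Suc dx_def by simp
  have x1: "circle_norm dx1 \<le> s" unfolding s_def sep_def dx1_def by simp
  have s0: "0 \<le> s" using x circle_norm_nonneg order_trans by blast
  have "\<bar>dx1 + dy\<bar> \<le> 2 * L * \<bar>sin (pi * dx)\<bar>"
    using abs_cos_diff_le[of L] assms by (simp add: dx1_def dy_def dx_def orbit_Suc)
  also have "\<dots> \<le> 2 * L * (pi * circle_norm dx)"
    using assms abs_sin_le_circle_norm by (intro mult_left_mono) auto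
  also have "\<dots> \<le> 2 * L * (3.5 * s)"
    using assms pi_approx x by (intro mult_left_mono mult_mono) auto
  finally have "\<bar>dx1 + dy\<bar> \<le> 7 * L * s" by simp
  moreover have "circle_norm dy \<le> circle_norm (dx1 + dy) + circle_norm dx1"
    using circle_norm_triangle[of "dx1 + dy" "- dx1"] by simp
  ultimately have "circle_norm dy \<le> 7 * L * s + s"
    using circle_norm_le_abs[of "dx1 + dy"] x1 by linarith
  moreover have "s \<le> L * s" using assms s0 mult_right_mono[of 1 L s] by simp
  ultimately have "circle_norm dy \<le> 8 * L * s" by linarith
  moreover have "s \<le> 8 * L * s" using assms s0 mult_right_mono[of 1 "8 * L" s] by simp
  ultimately show ?thesis using x unfolding sep_def[of _ _ _ _ n] s_def dx_def dy_def by simp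
qed

text \<open>If the phase amplitude \<open>B\<close> is at least half the separation, a good step
  keeps a part \<open>L powr (-1/4)\<close> of it. Otherwise the second coordinates carry the
  separation, and a cosine difference below half of it cannot cancel it in the new first
  coordinate.\<close>

lemma dx_Suc_ge:
  assumes L: "L \<ge> 1" and g: "\<not> sep_bad L z z' h k \<omega>"
  shows "min h (L powr (-1/4) * sep L z z' \<omega> k / 2) \<le> circle_norm (orbit_x L \<omega> (Suc k) z - orbit_x L \<omega> (Suc k) z')"
proof -
  define s where "s = sep L z z' \<omega> k"
  define dx where "dx = orbit_x L \<omega> k z - orbit_x L \<omega> k z'"
  define dy where "dy = orbit_y L \<omega> k z - orbit_y L \<omega> k z'"
  define dx1 where "dx1 = orbit_x L \<omega> (Suc k) z - orbit_x L \<omega> (Suc k) z'"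
  define B where "B = 2 * L * \<bar>sin (pi * dx)\<bar>"
  have s: "s = max (circle_norm dx) (circle_norm dy)" by (simp add: s_def sep_def dx_def dy_def)
  have "0 \<le> s" unfolding s by (simp add: le_max_iff_disj)
  have g': "min h (B * L powr (-1/4)) \<le> circle_norm dx1"
    using g by (simp only: sep_bad_def B_def dx_def dx1_def not_less)
  have p1: "L powr (-1/4) \<le> 1" using L powr_mono[of "-1/4" 0 L] by simp
  show ?thesis
  proof (cases "B \<ge> s / 2")
    case True
    then have "L powr (-1/4) * s / 2 \<le> B * L powr (-1/4)"
      using mult_left_mono[OF True, of "L powr (-1/4)"] by (simp add: mult.commute)
    then show ?thesis using g' by (simp add: s_def[symmetric] dx1_def[symmetric])
  next
    case False
    have "1 * circle_norm dx \<le> (2 * L) * \<bar>sin (pi * dx)\<bar>"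
      using L circle_norm_le_abs_sin[of dx] by (intro mult_mono) auto
    then have "circle_norm dx \<le> B" by (simp add: B_def)
    then have "circle_norm dx < s" using False \<open>0 \<le> s\<close> by linarith
    then have dy: "circle_norm dy = s" unfolding s by auto
    have "\<bar>dx1 + dy\<bar> \<le> B"
      using abs_cos_diff_le[of L] L by (simp add: dx1_def dy_def dx_def orbit_Suc B_def)
    moreover have "circle_norm dy \<le> circle_norm (dx1 + dy) + circle_norm dx1"
      using circle_norm_triangle[of "dx1 + dy" "- dx1"] by simp
    ultimately have "s / 2 \<le> circle_norm dx1"
      using circle_norm_le_abs[of "dx1 + dy"] dy False by linarith
    moreover have "L powr (-1/4) * s / 2 \<le> s / 2"
      using mult_right_mono[OF p1 \<open>0 \<le> s\<close>] by simp
    ultimately show ?thesis by (simp add: s_def[symmetric] dx1_def[symmetric])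
  qed
qed

text \<open>The first good step may lose \<open>L powr (-1/4)\<close> while moving the separation
  into the first coordinate; the second gains \<open>L powr (3/4)\<close>. The net factor is
  \<open>sqrt L\<close>, and the third step merely carries the first difference into the second
  coordinate.\<close>

lemma sep_growth:
  assumes L: "L \<ge> 1" and h: "h > 0" and g: "\<not> sep_bad L z z' h k \<omega>" "\<not> sep_bad L z z' h (Suc k) \<omega>"
  shows "min h (sqrt L * sep L z z' \<omega> k) \<le> sep L z z' \<omega> (k + 3)"
proof -
  define s where "s = sep L z z' \<omega> k"
  define d1 where "d1 = circle_norm (orbit_x L \<omega> (Suc k) z - orbit_x L \<omega> (Suc k) z')"
  have s0: "0 \<le> s" by (simp add: s_def sep_def le_max_iff_disj)
  have d1: "min h (L powr (-1/4) * s / 2) \<le> d1" unfolding s_def d1_def by (rule dx_Suc_ge[OF L g(1)])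
  have 3: "L * L powr (-1/4) = L powr (3/4)" using L powr_add[of L 1 "-1/4"] by simp
  have p34: "1 \<le> L powr (3/4)" using L by (simp add: ge_one_powr_ge_zero)
  have "d1 * (2 * L powr (3/4)) \<le> 2 * L * \<bar>sin (pi * (orbit_x L \<omega> (Suc k) z - orbit_x L \<omega> (Suc k) z'))\<bar> * L powr (-1/4)"
    using mult_right_mono[OF circle_norm_le_abs_sin, of "2 * (L * L powr (-1/4))" "orbit_x L \<omega> (Suc k) z - orbit_x L \<omega> (Suc k) z'"] L
    unfolding 3[symmetric] d1_def by (simp add: ac_simps)
  then have d2: "min h (d1 * (2 * L powr (3/4))) \<le> circle_norm (orbit_x L \<omega> (Suc (Suc k)) z - orbit_x L \<omega> (Suc (Suc k)) z')"
    using g(2) by (auto simp: sep_bad_def)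
  have "min h (sqrt L * s) \<le> d1 * (2 * L powr (3/4))"
  proof (cases "h \<le> L powr (-1/4) * s / 2")
    case True
    then have "h \<le> d1" using d1 by simp
    then have "h * 1 \<le> d1 * (2 * L powr (3/4))" using p34 h by (intro mult_mono) auto
    then show ?thesis by simp
  next
    case False
    then have "(L powr (-1/4) * s / 2) * (2 * L powr (3/4)) \<le> d1 * (2 * L powr (3/4))"
      using d1 by (intro mult_right_mono) auto
    moreover have ab: "L powr (-1/4) * L powr (3/4) = sqrt L"
      using L by (simp add: powr_add[symmetric] powr_half_sqrt)
    have "(L powr (-1/4) * s / 2) * (2 * L powr (3/4)) = (L powr (-1/4) * L powr (3/4)) * s" by simp
    then have "(L powr (-1/4) * s / 2) * (2 * L powr (3/4)) = sqrt L * s" unfolding ab .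
    ultimately have "sqrt L * s \<le> d1 * (2 * L powr (3/4))" by linarith
    then show ?thesis by (rule min.coboundedI2)
  qed
  then have "min h (sqrt L * s) \<le> min h (d1 * (2 * L powr (3/4)))" by simp
  also note d2
  also have "circle_norm (orbit_x L \<omega> (Suc (Suc k)) z - orbit_x L \<omega> (Suc (Suc k)) z') \<le> sep L z z' \<omega> (k + 3)"
    unfolding sep_def eval_nat_numeral add_Suc_right add_0_right diff_y_Suc by simp
  finally show ?thesis by (simp add: s_def)
qed

text \<open>Three inverse steps cost \<open>(8 * L) ^ 3 = 512 * L ^ 3 \<le> L ^ 4\<close>, that is,
  eight levels of \<open>sqrt L\<close>.\<close>

lemma sep_loss:
  assumes "L \<ge> 512" shows "sep L z z' \<omega> k / sqrt L ^ 8 \<le> sep L z z' \<omega> (k + 3)"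
proof -
  have L: "L \<ge> 1" using assms by simp
  have "sep L z z' \<omega> k \<le> 8 * L * (8 * L * (8 * L * sep L z z' \<omega> (Suc (Suc (Suc k)))))"
    using L by (intro order_trans[OF sep_le_Suc] mult_left_mono sep_le_Suc) auto
  also have "\<dots> = 512 * L ^ 3 * sep L z z' \<omega> (k + 3)"
    by (simp add: eval_nat_numeral)
  also have "\<dots> \<le> L * L ^ 3 * sep L z z' \<omega> (k + 3)"
    using assms by (intro mult_right_mono) (auto simp: sep_def le_max_iff_disj)
  also have "L * L ^ 3 = sqrt L ^ 8"
  proof -
    have "sqrt L ^ 8 = ((sqrt L)\<^sup>2) ^ 4" by (simp add: power_mult[symmetric])
    also have "\<dots> = L ^ 4" using L by simp
    finally show ?thesis by (simp add: eval_nat_numeral)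
  qed
  finally show ?thesis using L by (simp add: pos_divide_le_eq mult.commute)
qed

text \<open>The level \<open>lev i\<close> bounds the logarithm to base \<open>sqrt L\<close> of the inverse separation at time \<open>3 i\<close>.\<close>

primrec lev :: "(nat \<Rightarrow> bool) \<Rightarrow> nat \<Rightarrow> nat" where
  "lev bad 0 = 1"
| "lev bad (Suc i) = (if bad i then lev bad i + 8 else lev bad i - 1)"

text \<open>The left side is a potential: a good index at positive level trades one unit of level
  for one unit of count, and a bad index adds at most eight levels and one count.\<close>

lemma lev_count: "card {i. i < n \<and> 0 < lev bad i} + lev bad n \<le> 1 + 9 * card {i. i < n \<and> bad i}"
proof (induction n)
  case (Suc n)
  have 1: "{i. i < Suc n \<and> Q i} = (if Q n then insert n {i. i < n \<and> Q i} else {i. i < n \<and> Q i})" for Q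
    by (auto simp: less_Suc_eq)
  show ?case using Suc by (auto simp: 1)
qed simp

text \<open>The initial level 1 suffices because any fixed initial distance exceeds
  \<open>h / sqrt L\<close> for large \<open>L\<close>.\<close>

lemma sep_ge_lev:
  assumes L: "L \<ge> 512" and h: "h > 0" and init: "h / sqrt L \<le> sep L z z' \<omega> 0"
  shows "h / sqrt L ^ lev (\<lambda>i. sep_bad L z z' h (3*i) \<omega> \<or> sep_bad L z z' h (Suc (3*i)) \<omega>) i \<le> sep L z z' \<omega> (3 * i)"
proof (induction i)
  case 0 then show ?case using init by simp
next
  case (Suc i)
  let ?bad = "\<lambda>i. sep_bad L z z' h (3*i) \<omega> \<or> sep_bad L z z' h (Suc (3*i)) \<omega>"
  have q: "1 \<le> sqrt L" using L by simp
  have e: "3 * Suc i = 3 * i + 3" by simp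
  show ?case
  proof (cases "?bad i")
    case True
    have "h / sqrt L ^ (lev ?bad i + 8) = (h / sqrt L ^ lev ?bad i) / sqrt L ^ 8" by (simp add: power_add)
    also have "\<dots> \<le> sep L z z' \<omega> (3 * i) / sqrt L ^ 8" using Suc q by (intro divide_right_mono) auto
    also have "\<dots> \<le> sep L z z' \<omega> (3 * i + 3)" by (rule sep_loss[OF L])
    finally show ?thesis using True by (simp add: add.commute)
  next
    case False
    then have g: "min h (sqrt L * sep L z z' \<omega> (3 * i)) \<le> sep L z z' \<omega> (3 * i + 3)"
      using L h by (intro sep_growth) auto
    have "h / sqrt L ^ (lev ?bad i - 1) \<le> min h (sqrt L * sep L z z' \<omega> (3 * i))"
    proof (cases "lev ?bad i")
      case 0
      then have "h \<le> sep L z z' \<omega> (3 * i)" using Suc by simp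
      then have "1 * h \<le> sqrt L * sep L z z' \<omega> (3 * i)" using q h by (intro mult_mono) auto
      then show ?thesis using 0 by simp
    next
      case (Suc m)
      have "sqrt L * (h / sqrt L ^ Suc m) \<le> sqrt L * sep L z z' \<omega> (3 * i)"
        using Suc.IH Suc q by (intro mult_left_mono) auto
      then have "h / sqrt L ^ m \<le> sqrt L * sep L z z' \<omega> (3 * i)" using q by simp
      moreover have "h / sqrt L ^ m \<le> h / 1" using q h by (intro divide_left_mono) (auto intro: one_le_power)
      ultimately show ?thesis using Suc by simp
    qed
    from order_trans[OF this g] show ?thesis using False by (simp add: add.commute)
  qed
qed

definition step_bad :: "real \<Rightarrow> real \<times> real \<Rightarrow> real \<times> real \<Rightarrow> real \<times> real \<Rightarrow> real \<times> real \<Rightarrow> real \<Rightarrow> real \<Rightarrow> real \<Rightarrow> nat \<Rightarrow> (nat \<Rightarrow> real) \<Rightarrow> bool" where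
  "step_bad L z z' v v' h t hc k \<omega> \<longleftrightarrow> sep_bad L z z' h k \<omega> \<or> cone_bad L z v t k \<omega> \<or> cone_bad L z' v' t k \<omega> \<or>
     crit_bad L z hc k \<omega> \<or> crit_bad L z' hc k \<omega>"

lemma bad_cong:
  assumes "\<And>j. j \<le> k \<Longrightarrow> \<omega> j = \<omega>' j"
  shows "sep_bad L z z' h k \<omega> = sep_bad L z z' h k \<omega>'" "cone_bad L z v t k \<omega> = cone_bad L z v t k \<omega>'"
    "crit_bad L z hc k \<omega> = crit_bad L z hc k \<omega>'"
  using orbit_cong(1)[of "Suc k" \<omega> \<omega>' L] orbit_cong(1)[of k \<omega> \<omega>' L] lift_deriv_cong[of "Suc k" \<omega> \<omega>' L] assms
  by (simp_all only: sep_bad_def cone_bad_def crit_bad_def less_Suc_eq_le less_imp_le)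

lemma measurable_bad [measurable]:
  "Measurable.pred (noise \<delta> L') (sep_bad L z z' h k)" "Measurable.pred (noise \<delta> L') (cone_bad L z v t k)"
  "Measurable.pred (noise \<delta> L') (crit_bad L z hc k)" 
  unfolding sep_bad_def[abs_def] cone_bad_def[abs_def] crit_bad_def[abs_def]
  by measurable

lemma orbit_fun_upd:
  "orbit_x L (fun_upd \<omega> k w) (Suc k) z = next_x L (orbit_x L \<omega> k z) (orbit_y L \<omega> k z) w"
  "orbit_x L (fun_upd \<omega> k w) k z = orbit_x L \<omega> k z"
  "orbit_y L (fun_upd \<omega> k w) k z = orbit_y L \<omega> k z"
  "lift_deriv L (fun_upd \<omega> k w) k z v = lift_deriv L \<omega> k z v"
proof -
  show x: "orbit_x L (fun_upd \<omega> k w) k z = orbit_x L \<omega> k z" and y: "orbit_y L (fun_upd \<omega> k w) k z = orbit_y L \<omega> k z"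
    by (auto intro!: orbit_cong)
  show "lift_deriv L (fun_upd \<omega> k w) k z v = lift_deriv L \<omega> k z v" by (auto intro!: lift_deriv_cong)
  show "orbit_x L (fun_upd \<omega> k w) (Suc k) z = next_x L (orbit_x L \<omega> k z) (orbit_y L \<omega> k z) w"
    by (simp add: orbit_Suc x y)
qed

lemma measure_noise_comp_Un_le:
  assumes L: "L > 0" and A: "{w. P w} \<in> sets borel" and B: "{w. Q w} \<in> sets borel"
    and "measure (unif (L powr -\<delta>)) {w. P w} \<le> a" "measure (unif (L powr -\<delta>)) {w. Q w} \<le> b"
  shows "measure (unif (L powr -\<delta>)) {w. P w \<or> Q w} \<le> a + b"
proof -
  have "{w. P w \<or> Q w} = {w. P w} \<union> {w. Q w}" by auto
  then show ?thesis using measure_Un_le[of "{w. P w}" "unif (L powr -\<delta>)" "{w. Q w}"] assms by simp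
qed

lemma eventually_step_bad_rare:
  assumes \<delta>: "0 < \<delta>" "\<delta> < 1/100" and "0 < t" and \<epsilon>: "\<epsilon> > 0"
    and h: "\<forall>\<^sub>F L in at_top. \<forall>x y x' y'. measure (unif (L powr -\<delta>)) {w. circle_norm (next_x L x y w - next_x L x' y' w)
        < min h (2 * L * \<bar>sin (pi * (x - x'))\<bar> * L powr (-1/4))} \<le> \<epsilon>/5"
    and hc: "\<forall>\<^sub>F L in at_top. \<forall>x y. measure (unif (L powr -\<delta>)) {w. circle_norm (2 * next_x L x y w) \<le> hc} \<le> \<epsilon>/5"
  shows "\<forall>\<^sub>F L in at_top. \<forall>z z' v v' k \<omega>. measure (noise_comp \<delta> L) {w \<in> space (noise_comp \<delta> L). step_bad L z z' v v' h t hc k (fun_upd \<omega> k w)} \<le> \<epsilon>"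
  using h hc eventually_cone[OF \<delta>, of "\<epsilon>/5" t, OF _ \<open>0 < t\<close>, simplified, OF \<epsilon>] eventually_gt_at_top[of 0]
proof eventually_elim
  case (elim L)
  show ?case
  proof (intro allI)
    fix z z' v v' k \<omega>
    let ?x = "orbit_x L \<omega> k z" and ?y = "orbit_y L \<omega> k z" and ?x' = "orbit_x L \<omega> k z'" and ?y' = "orbit_y L \<omega> k z'"
    let ?d = "lift_deriv L \<omega> k z v" and ?d' = "lift_deriv L \<omega> k z' v'"
    let ?P1 = "\<lambda>w. circle_norm (next_x L ?x ?y w - next_x L ?x' ?y' w) < min h (2 * L * \<bar>sin (pi * (?x - ?x'))\<bar> * L powr (-1/4))"
    let ?P2 = "\<lambda>w. \<bar>fst ?d\<bar> > t * \<bar>next_v L ?x (fst ?d) (snd ?d) w\<bar>"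
    let ?P3 = "\<lambda>w. \<bar>fst ?d'\<bar> > t * \<bar>next_v L ?x' (fst ?d') (snd ?d') w\<bar>"
    let ?P4 = "\<lambda>w. circle_norm (2 * next_x L ?x ?y w) \<le> hc" and ?P5 = "\<lambda>w. circle_norm (2 * next_x L ?x' ?y' w) \<le> hc"
    have eq: "step_bad L z z' v v' h t hc k (fun_upd \<omega> k w) \<longleftrightarrow> ?P1 w \<or> ?P2 w \<or> ?P3 w \<or> ?P4 w \<or> ?P5 w" for w
      by (simp add: step_bad_def sep_bad_def cone_bad_def crit_bad_def orbit_fun_upd)
    have m: "{w. ?P1 w} \<in> sets borel" "{w. ?P2 w} \<in> sets borel" "{w. ?P3 w} \<in> sets borel" "{w. ?P4 w} \<in> sets borel" "{w. ?P5 w} \<in> sets borel"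
      by measurable
    have "measure (unif (L powr -\<delta>)) {w. ?P1 w \<or> ?P2 w \<or> ?P3 w \<or> ?P4 w \<or> ?P5 w} \<le> \<epsilon>/5 + (\<epsilon>/5 + (\<epsilon>/5 + (\<epsilon>/5 + \<epsilon>/5)))"
      using elim m by (intro measure_noise_comp_Un_le) (auto simp: Collect_disj_eq)
    then show "measure (noise_comp \<delta> L) {w \<in> space (noise_comp \<delta> L). step_bad L z z' v v' h t hc k (fun_upd \<omega> k w)} \<le> \<epsilon>"
      using elim m unfolding eq by (subst measure_noise_comp) (auto simp: Collect_disj_eq)
  qed
qed

section \<open>Measurability and adaptedness of the renewal times\<close>

lemma infdist_add_Ints:
  fixes x g :: "real \<times> real"
  assumes "g \<in> \<int> \<times> \<int>" shows "infdist (x + g) (\<int> \<times> \<int>) = infdist x (\<int> \<times> \<int>)"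
proof -
  have ne: "(\<int> :: real set) \<times> (\<int> :: real set) \<noteq> {}" by (auto intro: Ints_0)
  have le: "infdist (x + g) (\<int> \<times> \<int>) \<le> infdist x (\<int> \<times> \<int>)" if "g \<in> \<int> \<times> \<int>" for x g :: "real \<times> real"
    unfolding infdist_notempty[OF ne, of x]
  proof (rule cINF_greatest[OF ne])
    fix p :: "real \<times> real" assume "p \<in> \<int> \<times> \<int>"
    then have "p + g \<in> \<int> \<times> \<int>" using that by auto
    then have "infdist (x + g) (\<int> \<times> \<int>) \<le> dist (x + g) (p + g)" by (rule infdist_le)
    then show "infdist (x + g) (\<int> \<times> \<int>) \<le> dist x p" by (simp add: dist_norm)
  qed
  have "- g \<in> \<int> \<times> \<int>" using assms by auto
  from le[OF this, of "x + g"] le[OF assms, of x] show ?thesis by simp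
qed

lemma torus_dist_torus_proj: "torus_dist (torus_proj a) (torus_proj b) = torus_dist a b"
proof -
  define g where "g = (torus_proj a - a) - (torus_proj b - b)"
  have "torus_proj a - a \<in> \<int> \<times> \<int>" for a by (cases a) (simp add: torus_proj_def frac_diff_Ints)
  from this[of a] this[of b] have "g \<in> \<int> \<times> \<int>"
    unfolding g_def by (cases "torus_proj a - a"; cases "torus_proj b - b") (auto intro: Ints_diff)
  from infdist_add_Ints[OF this, of "a - b"] show ?thesis
    by (simp add: torus_dist_def g_def)
qed

lemma torus_proj_idem [simp]: "torus_proj (torus_proj z) = torus_proj z"
  by (simp add: torus_proj_def)

lemma torus_proj_marked_point [simp]: "torus_proj (marked_point \<gamma>) = marked_point \<gamma>"
  by (simp add: marked_point_def)

lemma std_iter_eq: "torus_proj z = z \<Longrightarrow> std_iter L \<omega> n z = torus_proj (lift_iter L \<omega> n z)"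
  using std_iter_torus_proj[of L \<omega> n z] by simp

lemma std_iter_shift: "std_iter L (shift k \<omega>) r (std_iter L \<omega> k z) = std_iter L \<omega> (k + r) z"
  by (induction r) (simp_all add: shift_def add.commute)

lemma circle_norm_frac_mult: "circle_norm (2 * (frac x + w)) = circle_norm (2 * (x + w))"
proof -
  have "2 * (frac x + w) = 2 * (x + w) + of_int (- (2 * \<lfloor>x\<rfloor>))" by (simp add: frac_def)
  then show ?thesis by (simp only: circle_norm_add_Ints Ints_of_int)
qed

lemma horizontal_ball_iff:
  assumes "0 < r" "r < 1/10" shows "(a, b) \<in> horizontal_ball r \<longleftrightarrow> a \<noteq> 0 \<and> \<bar>b\<bar> / \<bar>a\<bar> < tan r"
proof (cases "a = 0")
  case True
  then show ?thesis using horizontal_ballD(1)[of a b r] assms by auto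
next
  case False
  have "r < pi/2" "- (pi/2) < r" using assms pi_gt3 by auto
  then have "arctan (\<bar>b\<bar> / \<bar>a\<bar>) < r \<longleftrightarrow> \<bar>b\<bar> / \<bar>a\<bar> < tan r"
    by (metis arctan_less_iff arctan_tan)
  then show ?thesis using False by (simp add: horizontal_ball_def line_angle_horizontal zero_prod_def)
qed

text \<open>Restated on the lift, where distance, derivative and first coordinate are continuous in
  the noise and depend on its first \<open>3 * i\<close> coordinates.\<close>

lemma orbit_ok_iff:
  "orbit_ok P L \<omega> i \<longleftrightarrow>
    torus_dist (lift_iter L \<omega> (3*i) (marked_point (curve1 P))) (lift_iter L \<omega> (3*i) (marked_point (curve2 P))) > eta1 P \<and>
    lift_deriv L \<omega> (3*i) (marked_point (curve1 P)) (marked_tangent (curve1 P)) \<in> horizontal_ball (eta2 P) \<and>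
    lift_deriv L \<omega> (3*i) (marked_point (curve2 P)) (marked_tangent (curve2 P)) \<in> horizontal_ball (eta2 P) \<and>
    4 * eta P \<le> circle_norm (2 * orbit_x L \<omega> (3*i) (marked_point (curve1 P))) \<and>
    4 * eta P \<le> circle_norm (2 * orbit_x L \<omega> (3*i) (marked_point (curve2 P)))"
proof -
  have F: "F_iter L \<omega> i (marked_point \<gamma>) = torus_proj (lift_iter L \<omega> (3*i) (marked_point \<gamma>))" for \<gamma>
    unfolding F_iter_def by (rule std_iter_eq) simp
  have "fst (torus_proj p) \<notin> crit_nbhd (2 * eta P) \<longleftrightarrow> 4 * eta P \<le> circle_norm (2 * fst p)" for p
    using circle_norm_frac_mult[of "fst p" 0] by (simp add: crit_nbhd_eq torus_proj_def not_less)
  then show ?thesis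
    by (simp add: orbit_ok_def Let_def F torus_dist_torus_proj DF_eq orbit_x_def)
qed

lemma orbit_ok_cong:
  assumes "\<And>j. j < 3 * i \<Longrightarrow> \<omega> j = \<omega>' j" shows "orbit_ok P L \<omega> i = orbit_ok P L \<omega>' i"
  using lift_iter_cong[OF assms] lift_deriv_cong[OF assms] by (simp add: orbit_ok_iff orbit_x_def)

lemma sim_hyperbolic_cong:
  assumes "\<And>j. j < 3 * i \<Longrightarrow> \<omega> j = \<omega>' j" shows "sim_hyperbolic c P L \<omega> i = sim_hyperbolic c P L \<omega>' i"
  unfolding sim_hyperbolic_def using hyperbolic_at_cong[OF assms] orbit_ok_cong[OF assms] by simp

lemma is_renewal_cong:
  assumes "nmin c \<ge> 1"
  shows "(\<And>j. j < 3 * i \<Longrightarrow> \<omega> j = \<omega>' j) \<Longrightarrow> is_renewal c P L \<omega> i = is_renewal c P L \<omega>' i"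
proof (induction i rule: less_induct)
  case (less i)
  have "is_renewal c P L \<omega> i' = is_renewal c P L \<omega>' i'" if "i' < i" for i'
    using that by (intro less.IH less.prems) auto
  then show ?case
    unfolding is_renewal_iff[OF assms, of P L _ i] using sim_hyperbolic_cong[of i \<omega> \<omega>' c P L, OF less.prems] by auto
qed

lemma measurable_torus_dist:
  "(\<lambda>\<omega>. torus_dist (lift_iter L \<omega> n z) (lift_iter L \<omega> n z')) \<in> borel_measurable (noise \<delta> L')"
  unfolding torus_dist_def
  by (intro measurable_noise_continuous continuous_intros continuous_lift_iter)

lemma measurable_orbit_ok:
  assumes "0 < eta2 P" "eta2 P < 1/10"
  shows "Measurable.pred (noise \<delta> L') (\<lambda>\<omega>. orbit_ok P L \<omega> i)"
proof -
  have h: "v \<in> horizontal_ball (eta2 P) \<longleftrightarrow> fst v \<noteq> 0 \<and> \<bar>snd v\<bar> / \<bar>fst v\<bar> < tan (eta2 P)" for v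
    using horizontal_ball_iff[OF assms, of "fst v" "snd v"] by simp
  note [measurable] = measurable_torus_dist
  show ?thesis unfolding orbit_ok_iff h by measurable
qed

lemma measurable_hyperbolic_at:
  assumes "marked_tangent \<gamma> \<noteq> 0"
  shows "Measurable.pred (noise \<delta> L') (\<lambda>\<omega>. hyperbolic_at c L \<omega> \<gamma> m)"
  using pred_noise_closed[OF closed_hyperbolic_at[OF assms]] by simp

lemma measurable_is_renewal:
  assumes "nmin c \<ge> 1" "0 < eta2 P" "eta2 P < 1/10" "marked_tangent (curve1 P) \<noteq> 0" "marked_tangent (curve2 P) \<noteq> 0"
  shows "Measurable.pred (noise \<delta> L') (\<lambda>\<omega>. is_renewal c P L \<omega> i)"
proof (induction i rule: less_induct)
  case (less i)
  have "Measurable.pred (noise \<delta> L') (\<lambda>\<omega>. sim_hyperbolic c P L \<omega> i)"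
    unfolding sim_hyperbolic_def using measurable_hyperbolic_at[OF assms(4)] measurable_hyperbolic_at[OF assms(5)] measurable_orbit_ok[OF assms(2,3)]
    by (intro pred_intros_logic) auto
  have "Measurable.pred (noise \<delta> L') (\<lambda>\<omega>. \<forall>i'\<in>{..<i}. is_renewal c P L \<omega> i' \<longrightarrow> i' + (K1 P + K2 P) < i)"
    using less by (intro pred_intros_finite pred_intros_logic) auto
  then have "Measurable.pred (noise \<delta> L') (\<lambda>\<omega>. \<forall>i'<i. is_renewal c P L \<omega> i' \<longrightarrow> i' + (K1 P + K2 P) < i)"
    unfolding Ball_def lessThan_iff .
  show ?case unfolding is_renewal_iff[OF assms(1), of P L _ i]
    by (intro pred_intros_logic) (fact | simp)+
qed

section \<open>The chain of conditions following a renewal time\<close>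

text \<open>A schedule for the noise coordinate \<open>j\<close> of a trial started at
  \<open>k\<close>, with targets due at time \<open>k + N\<close>. The first step brings the
  separation into the first coordinates, the middle steps hold their difference near 1/4, the last
  but one aims at \<open>snd\<close> of the targets because its outcome becomes the second
  coordinate one step later, and the last aims at \<open>fst\<close>. Later steps only avoid the
  critical set.\<close>

definition chain_ok :: "real \<Rightarrow> real \<times> real \<Rightarrow> real \<times> real \<Rightarrow> real \<Rightarrow> real \<Rightarrow> nat \<Rightarrow> real \<times> real \<Rightarrow> real \<times> real \<Rightarrow> real \<Rightarrow>
    nat \<Rightarrow> nat \<Rightarrow> (nat \<Rightarrow> real) \<Rightarrow> bool" where
  "chain_ok L z z' h hc N p p' r k j \<omega> \<longleftrightarrow> \<not> crit_bad L z hc j \<omega> \<and> \<not> crit_bad L z' hc j \<omega> \<and>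
    (j = k \<longrightarrow> \<not> sep_bad L z z' h j \<omega>) \<and>
    (k < j \<and> j + 3 \<le> k + N \<longrightarrow> circle_norm (orbit_x L \<omega> (Suc j) z - orbit_x L \<omega> (Suc j) z' - 1/4) < 1/8) \<and>
    (j + 2 = k + N \<longrightarrow> circle_norm (orbit_x L \<omega> (Suc j) z - snd p) < r \<and> circle_norm (orbit_x L \<omega> (Suc j) z' - snd p') < r) \<and>
    (j + 1 = k + N \<longrightarrow> circle_norm (orbit_x L \<omega> (Suc j) z - fst p) < r \<and> circle_norm (orbit_x L \<omega> (Suc j) z' - fst p') < r)"

lemma chain_okD:
  assumes "chain_ok L z z' h hc N p p' r k j \<omega>"
  shows "\<not> crit_bad L z hc j \<omega>" "\<not> crit_bad L z' hc j \<omega>" "j = k \<Longrightarrow> \<not> sep_bad L z z' h j \<omega>"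
    "k < j \<Longrightarrow> j + 3 \<le> k + N \<Longrightarrow> circle_norm (orbit_x L \<omega> (Suc j) z - orbit_x L \<omega> (Suc j) z' - 1/4) < 1/8"
    "j + 2 = k + N \<Longrightarrow> circle_norm (orbit_x L \<omega> (Suc j) z - snd p) < r"
    "j + 2 = k + N \<Longrightarrow> circle_norm (orbit_x L \<omega> (Suc j) z' - snd p') < r"
    "j + 1 = k + N \<Longrightarrow> circle_norm (orbit_x L \<omega> (Suc j) z - fst p) < r"
    "j + 1 = k + N \<Longrightarrow> circle_norm (orbit_x L \<omega> (Suc j) z' - fst p') < r"
  using assms unfolding chain_ok_def by blast+

lemma chain_ok_cong:
  assumes "\<And>i. i \<le> j \<Longrightarrow> \<omega> i = \<omega>' i"
  shows "chain_ok L z z' h hc N p p' r k j \<omega> = chain_ok L z z' h hc N p p' r k j \<omega>'"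
proof -
  have e: "sep_bad L z z' h j \<omega> = sep_bad L z z' h j \<omega>'" "crit_bad L z hc j \<omega> = crit_bad L z hc j \<omega>'"
    "crit_bad L z' hc j \<omega> = crit_bad L z' hc j \<omega>'"
    "orbit_x L \<omega> (Suc j) z = orbit_x L \<omega>' (Suc j) z" "orbit_x L \<omega> (Suc j) z' = orbit_x L \<omega>' (Suc j) z'"
    by (intro bad_cong orbit_cong assms; simp)+
  show ?thesis unfolding chain_ok_def e ..
qed

lemma measurable_chain_ok: "Measurable.pred (noise \<delta> L') (chain_ok L z z' h hc N p p' r k j)"
  unfolding chain_ok_def[abs_def] by measurable

text \<open>Doubling puts the centre 1/4 at 1/2, farthest from the integers, and doubles the
  deviation to less than 1/4.\<close>

lemma circle_norm_double_ge:
  assumes "circle_norm (d - 1/4) < 1/8" shows "1/4 \<le> circle_norm (2 * d)"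
proof -
  obtain m :: int where m: "circle_norm (1/2) = \<bar>1/2 - of_int m\<bar>" by (metis circle_norm_attained)
  have "real_of_int m \<le> 0 \<or> 1 \<le> real_of_int m" by (cases "m \<le> 0") auto
  then have "(1/2::real) \<le> \<bar>1/2 - of_int m\<bar>" by linarith
  then have "1/2 \<le> circle_norm (2 * d + - (2 * (d - 1/4)))" using m by simp
  also have "\<dots> \<le> circle_norm (2 * d) + circle_norm (2 * (d - 1/4))"
    using circle_norm_triangle[of "2 * d" "- (2 * (d - 1/4))"] by (simp only: circle_norm_uminus)
  finally show ?thesis using circle_norm_mult_le[of "d - 1/4"] assms by linarith
qed

lemma measure_conj_not_ge:
  assumes "prob_space M" "{w. Q w} \<in> sets M" "{w. A w} \<in> sets M" "{w. B w} \<in> sets M"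
    and "a \<le> measure M {w. Q w}" "measure M {w. A w} \<le> b" "measure M {w. B w} \<le> b"
  shows "a - 2 * b \<le> measure M {w. \<not> A w \<and> \<not> B w \<and> Q w}"
proof -
  interpret prob_space M by fact
  have m: "{w. \<not> A w \<and> \<not> B w \<and> Q w} \<in> sets M"
  proof -
    have "{w. \<not> A w \<and> \<not> B w \<and> Q w} = {w. Q w} - {w. A w} - {w. B w}" by auto
    then show ?thesis using assms by auto
  qed
  have "measure M {w. Q w} \<le> measure M ({w. \<not> A w \<and> \<not> B w \<and> Q w} \<union> ({w. A w} \<union> {w. B w}))"
    using assms m by (intro finite_measure_mono) auto
  also have "\<dots> \<le> measure M {w. \<not> A w \<and> \<not> B w \<and> Q w} + (measure M {w. A w} + measure M {w. B w})"
    using assms m by (intro order_trans[OF measure_Un_le] add_left_mono measure_Un_le) auto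
  finally show ?thesis using assms by linarith
qed

lemma eventually_chain_hit:
  assumes \<delta>: "0 < \<delta>" "\<delta> < 1/100" and N: "N \<ge> 6" and s: "s > 0" and h: "h > 0"
    and r: "0 < r" "r \<le> 1/2" and \<kappa>: "\<kappa> > 0" "4 * r + \<kappa> \<le> circle_norm (2 * (snd p - snd p'))"
    and sep: "\<forall>\<^sub>F L in at_top. \<forall>x y x' y'. measure (unif (L powr -\<delta>)) {w. circle_norm (next_x L x y w - next_x L x' y' w)
        < min h (2 * L * \<bar>sin (pi * (x - x'))\<bar> * L powr (-1/4))} \<le> 1/4"
  obtains q hc where "0 < q" "q \<le> 1" "hc > 0"
    "\<forall>\<^sub>F L in at_top. \<forall>z z' k j \<omega>. k \<le> j \<and> s \<le> sep L z z' \<omega> k \<and> (\<forall>i. k \<le> i \<and> i < j \<longrightarrow> chain_ok L z z' h hc N p p' r k i \<omega>) \<longrightarrow>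
       q \<le> measure (noise_comp \<delta> L) {w \<in> space (noise_comp \<delta> L). chain_ok L z z' h hc N p p' r k j (fun_upd \<omega> j w)}"
proof -
  obtain q1 where q1: "q1 > 0" "\<forall>\<^sub>F L in at_top. \<forall>x y x' y'. L powr (-1/2) \<le> circle_norm (x - x') \<longrightarrow>
     q1 \<le> measure (unif (L powr -\<delta>)) {w. circle_norm (next_x L x y w - next_x L x' y' w - 1/4) < 1/8}"
    using eventually_quarter_hit[OF \<delta>] by blast
  have \<kappa>1: "0 < min (1/4) \<kappa>" "min (1/4) \<kappa> \<le> 1" using \<kappa> by auto
  obtain q2 where q2: "q2 > 0" "\<forall>\<^sub>F L in at_top. \<forall>x y x' y' a b. min (1/4) \<kappa> \<le> circle_norm (2 * (x - x')) \<longrightarrow>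
     q2 \<le> measure (unif (L powr -\<delta>)) {w. circle_norm (next_x L x y w - a) < r \<and> circle_norm (next_x L x' y' w - b) < r}"
    using eventually_box_hit[OF \<delta> r \<kappa>1] by blast
  \<comment> \<open>All scheduled events have probability at least \<open>q\<close>. The radius
    \<open>hc\<close> is chosen afterwards, so that the two critical events together cost at most
    \<open>q / 2\<close>.\<close>
  define q where "q = min (min q1 q2) (1/2)"
  have q: "0 < q" "q \<le> q1" "q \<le> q2" "q \<le> 1/2" using q1 q2 by (auto simp: q_def)
  obtain hc where hc: "hc > 0" "\<forall>\<^sub>F L in at_top. \<forall>x y. measure (unif (L powr -\<delta>)) {w. circle_norm (2 * next_x L x y w) \<le> hc} \<le> q/4"
    using eventually_not_critical[OF \<delta>, of "q/4"] q by auto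
  have ev1: "\<forall>\<^sub>F L::real in at_top. L powr (-1/2) \<le> min h (1/8)"
    using eventually_noise_small[of "1/2" "min h (1/8)"] h by simp
  have ev2: "\<forall>\<^sub>F L::real in at_top. L powr (-1/4) \<le> s/2"
    using eventually_noise_small[of "1/4" "s/2"] s by simp
  have "\<forall>\<^sub>F L in at_top. \<forall>z z' k j \<omega>. k \<le> j \<and> s \<le> sep L z z' \<omega> k \<and> (\<forall>i. k \<le> i \<and> i < j \<longrightarrow> chain_ok L z z' h hc N p p' r k i \<omega>) \<longrightarrow>
       q/2 \<le> measure (noise_comp \<delta> L) {w \<in> space (noise_comp \<delta> L). chain_ok L z z' h hc N p p' r k j (fun_upd \<omega> j w)}"
    using q1(2) q2(2) hc(2) sep ev1 ev2 eventually_ge_at_top[of 1]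
  proof eventually_elim
    case (elim L)
    show ?case
    proof (intro allI impI, elim conjE)
      fix z z' k j \<omega>
      assume kj: "k \<le> j" and sk: "s \<le> sep L z z' \<omega> k" and prev: "\<forall>i. k \<le> i \<and> i < j \<longrightarrow> chain_ok L z z' h hc N p p' r k i \<omega>"
      let ?x = "orbit_x L \<omega> j z" and ?y = "orbit_y L \<omega> j z" and ?x' = "orbit_x L \<omega> j z'" and ?y' = "orbit_y L \<omega> j z'"
      let ?nx = "next_x L ?x ?y" and ?nx' = "next_x L ?x' ?y'"
      define S where "S w \<longleftrightarrow> circle_norm (?nx w - ?nx' w) < min h (2 * L * \<bar>sin (pi * (?x - ?x'))\<bar> * L powr (-1/4))" for w
      define Q where "Q w \<longleftrightarrow> (j = k \<longrightarrow> \<not> S w) \<and>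
        (k < j \<and> j + 3 \<le> k + N \<longrightarrow> circle_norm (?nx w - ?nx' w - 1/4) < 1/8) \<and>
        (j + 2 = k + N \<longrightarrow> circle_norm (?nx w - snd p) < r \<and> circle_norm (?nx' w - snd p') < r) \<and>
        (j + 1 = k + N \<longrightarrow> circle_norm (?nx w - fst p) < r \<and> circle_norm (?nx' w - fst p') < r)" for w
      have eq: "chain_ok L z z' h hc N p p' r k j (fun_upd \<omega> j w) \<longleftrightarrow>
        \<not> circle_norm (2 * ?nx w) \<le> hc \<and> \<not> circle_norm (2 * ?nx' w) \<le> hc \<and> Q w" for w
        unfolding chain_ok_def crit_bad_def sep_bad_def orbit_fun_upd Q_def S_def ..
      have L0: "L powr -\<delta> > 0" "L > 0" using elim by auto
      interpret U: prob_space "unif (L powr -\<delta>)" by (rule prob_space_unif[OF L0(1)])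
      have mS[measurable]: "Measurable.pred borel S" unfolding S_def[abs_def] by measurable
      have mQ: "{w. Q w} \<in> sets borel" unfolding Q_def by measurable
      have mc: "{w. circle_norm (2 * ?nx w) \<le> hc} \<in> sets borel" "{w. circle_norm (2 * ?nx' w) \<le> hc} \<in> sets borel" by measurable
      have "q \<le> measure (unif (L powr -\<delta>)) {w. Q w}"
      proof -
        consider "j = k" | "k < j" "j + 3 \<le> k + N" | "j + 2 = k + N" | "j + 1 = k + N" | "k + N \<le> j"
          using kj by linarith
        then show ?thesis
        proof cases
          case 1
          then have "{w. Q w} = UNIV - {w. S w}" using N by (auto simp: Q_def)
          moreover have "U.prob {w. S w} \<le> 1/4" using elim by (simp add: S_def)
          moreover have "U.prob (UNIV - {w. S w}) = 1 - U.prob {w. S w}" using U.prob_compl[of "{w. S w}"] by simp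
          ultimately show ?thesis using q by simp
        next
          case 2
          \<comment> \<open>Right after the first step the separation is only known to be of order
            \<open>L powr (-1/4)\<close>, still enough for the phase to wrap; later it is near
            1/4.\<close>
          have d: "L powr (-1/2) \<le> circle_norm (?x - ?x')"
          proof (cases "j = Suc k")
            case True
            have "chain_ok L z z' h hc N p p' r k k \<omega>" using prev True by simp
            then have "\<not> sep_bad L z z' h k \<omega>" by (rule chain_okD(3)) simp
            then have m: "min h (L powr (-1/4) * sep L z z' \<omega> k / 2) \<le> circle_norm (?x - ?x')"
              using dx_Suc_ge[of L z z' h k \<omega>] elim True by simp
            have "L powr (-1/4) * (s/2) \<le> L powr (-1/4) * (sep L z z' \<omega> k / 2)"
              using sk by (intro mult_left_mono) auto
            moreover have "L powr (-1/4) * L powr (-1/4) \<le> L powr (-1/4) * (s/2)"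
              using elim by (intro mult_left_mono) auto
            moreover have "L powr (-1/4) * L powr (-1/4) = L powr (-1/2)" by (simp add: powr_add[symmetric])
            ultimately have "L powr (-1/2) \<le> L powr (-1/4) * sep L z z' \<omega> k / 2" by simp
            then have "L powr (-1/2) \<le> min h (L powr (-1/4) * sep L z z' \<omega> k / 2)" using elim by simp
            then show ?thesis using m by (rule order_trans)
          next
            case False
            obtain i where i: "j = Suc i" using 2 by (cases j) auto
            have "chain_ok L z z' h hc N p p' r k i \<omega>" using prev 2 i False by simp
            from chain_okD(4)[OF this] have "circle_norm (?x - ?x' - 1/4) < 1/8" using 2 i False by simp
            then have "1/4 \<le> circle_norm (2 * (?x - ?x'))" by (rule circle_norm_double_ge)
            then have "1/8 \<le> circle_norm (?x - ?x')" using circle_norm_mult_le[of "?x - ?x'"] by linarith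
            then show ?thesis using elim by simp
          qed
          have "Q = (\<lambda>w. circle_norm (?nx w - ?nx' w - 1/4) < 1/8)" using 2 by (auto simp: Q_def fun_eq_iff)
          then show ?thesis using elim(1)[rule_format, OF d, of ?y ?y'] q by simp
        next
          case 3
          obtain i where i: "j = Suc i" using 3 N by (cases j) auto
          have "chain_ok L z z' h hc N p p' r k i \<omega>" using prev 3 i N by simp
          from chain_okD(4)[OF this] have "circle_norm (?x - ?x' - 1/4) < 1/8" using 3 i N by simp
          then have d: "1/4 \<le> circle_norm (2 * (?x - ?x'))" by (rule circle_norm_double_ge)
          have "Q = (\<lambda>w. circle_norm (?nx w - snd p) < r \<and> circle_norm (?nx' w - snd p') < r)" using 3 N by (auto simp: Q_def fun_eq_iff)
          moreover have "q2 \<le> measure (unif (L powr -\<delta>)) {w. circle_norm (?nx w - snd p) < r \<and> circle_norm (?nx' w - snd p') < r}"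
            by (rule elim(2)[rule_format]) (use d in simp)
          ultimately show ?thesis using q by simp
        next
          \<comment> \<open>The current first coordinates lie within \<open>r\<close> of
            \<open>snd p\<close> and \<open>snd p'\<close>, whose doubled distance exceeds
            \<open>4 * r\<close> by \<kappa>; so the last step can aim the two orbits
            separately.\<close>
          case 4
          obtain i where i: "j = Suc i" using 4 N by (cases j) auto
          have "chain_ok L z z' h hc N p p' r k i \<omega>" using prev 4 i N by simp
          from chain_okD(5,6)[OF this] have c: "circle_norm (?x - snd p) < r" "circle_norm (?x' - snd p') < r" using 4 i by simp_all
          have "2 * (snd p - snd p') = 2 * (?x - ?x') + (2 * - (?x - snd p) + 2 * (?x' - snd p'))" by (simp add: algebra_simps)
          then have "circle_norm (2 * (snd p - snd p')) \<le> circle_norm (2 * (?x - ?x')) + (circle_norm (2 * - (?x - snd p)) + circle_norm (2 * (?x' - snd p')))"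
            using circle_norm_triangle[of "2 * (?x - ?x')" "2 * - (?x - snd p) + 2 * (?x' - snd p')"] circle_norm_triangle[of "2 * - (?x - snd p)" "2 * (?x' - snd p')"] by simp
          moreover have "circle_norm (2 * - (?x - snd p)) \<le> 2 * r" "circle_norm (2 * (?x' - snd p')) \<le> 2 * r"
            using circle_norm_mult_le[of "- (?x - snd p)"] circle_norm_mult_le[of "?x' - snd p'"] c circle_norm_uminus[of "?x - snd p"] by linarith+
          ultimately have "\<kappa> \<le> circle_norm (2 * (?x - ?x'))" using \<kappa> by linarith
          then have d: "min (1/4) \<kappa> \<le> circle_norm (2 * (?x - ?x'))" by simp
          have "Q = (\<lambda>w. circle_norm (?nx w - fst p) < r \<and> circle_norm (?nx' w - fst p') < r)" using 4 N by (auto simp: Q_def fun_eq_iff)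
          moreover have "q2 \<le> measure (unif (L powr -\<delta>)) {w. circle_norm (?nx w - fst p) < r \<and> circle_norm (?nx' w - fst p') < r}"
            by (rule elim(2)[rule_format]) (rule d)
          ultimately show ?thesis using q by simp
        next
          case 5
          then have "{w. Q w} = UNIV" using N by (auto simp: Q_def)
          then show ?thesis using q measure_unif_UNIV[OF L0(1)] by simp
        qed
      qed
      moreover have cr: "measure (unif (L powr -\<delta>)) {w. circle_norm (2 * ?nx w) \<le> hc} \<le> q/4"
        "measure (unif (L powr -\<delta>)) {w. circle_norm (2 * ?nx' w) \<le> hc} \<le> q/4"
        using elim(3) by blast+
      ultimately have "q - 2 * (q/4) \<le> measure (unif (L powr -\<delta>)) {w. \<not> circle_norm (2 * ?nx w) \<le> hc \<and> \<not> circle_norm (2 * ?nx' w) \<le> hc \<and> Q w}"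
        using mQ mc by (intro measure_conj_not_ge U.prob_space_axioms) (simp_all only: sets_unif)
      moreover have "{w. \<not> circle_norm (2 * ?nx w) \<le> hc \<and> \<not> circle_norm (2 * ?nx' w) \<le> hc \<and> Q w} \<in> sets borel"
      proof -
        have "{w. \<not> circle_norm (2 * ?nx w) \<le> hc \<and> \<not> circle_norm (2 * ?nx' w) \<le> hc \<and> Q w} =
          {w. Q w} - {w. circle_norm (2 * ?nx w) \<le> hc} - {w. circle_norm (2 * ?nx' w) \<le> hc}" by blast
        then show ?thesis using mQ mc by simp
      qed
      ultimately show "q/2 \<le> measure (noise_comp \<delta> L) {w \<in> space (noise_comp \<delta> L). chain_ok L z z' h hc N p p' r k j (fun_upd \<omega> j w)}"
        unfolding eq by (subst measure_noise_comp[OF L0(2)]) simp_all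
    qed
  qed
  then show ?thesis using that[of "q/2" hc] q hc(1) by auto
qed

text \<open>The chain is stated without the noise shift, which is absorbed by margins: the avoided
  radius \<open>4 * eta P\<close> drops by at most \<open>2 * eta P\<close> when
  \<open>\<omega> r\<close> is added, and the second coordinate misses its target by at most
  \<open>r\<close> plus the noise, hence the radius \<open>2 * r\<close>.\<close>

lemma young_time_of_chain:
  assumes ren: "is_renewal c P L \<omega> i" and ok: "orbit_ok P L \<omega> i" and \<omega>: "\<omega> \<in> space (noise \<delta> L)"
    and K1: "K1 P \<ge> 2"
    and chain: "\<And>j. 3 * i \<le> j \<Longrightarrow> j < 3 * i + 3 * (K1 P + K2 P) \<Longrightarrow>
      chain_ok L (marked_point (curve1 P)) (marked_point (curve2 P)) h hc (3 * K1 P) p p' r (3 * i) j \<omega>"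
    and R1: "\<And>x y. circle_norm (x - fst p) < 2 * r \<Longrightarrow> circle_norm (y - snd p) < 2 * r \<Longrightarrow> torus_proj (x, y) \<in> rect1 P"
    and R2: "\<And>x y. circle_norm (x - fst p') < 2 * r \<Longrightarrow> circle_norm (y - snd p') < 2 * r \<Longrightarrow> torus_proj (x, y) \<in> rect2 P"
    and small: "L powr -\<delta> \<le> eta P" "4 * eta P \<le> hc" "L powr -\<delta> \<le> r" "r > 0"
  shows "young_time \<delta> c P L \<omega> i"
proof -
  let ?z = "marked_point (curve1 P)" and ?z' = "marked_point (curve2 P)"
  have w: "\<bar>\<omega> n\<bar> \<le> L powr -\<delta>" for n
  proof -
    have "- (L powr -\<delta>) \<le> \<omega> n \<and> \<omega> n \<le> L powr -\<delta>" using \<omega> by (simp add: space_noise)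
    then show ?thesis unfolding abs_le_iff by linarith
  qed
  have sh: "shift (3 * i) \<omega> \<in> space (noise \<delta> L)" using \<omega> by (auto simp: space_noise shift_def)
  have it: "std_iter L (shift (3 * i) \<omega>) n (F_iter L \<omega> i (marked_point \<gamma>)) = torus_proj (lift_iter L \<omega> (3 * i + n) (marked_point \<gamma>))" for n \<gamma>
    unfolding F_iter_def std_iter_shift by (rule std_iter_eq) simp
  have avoid: "fst (torus_proj (lift_iter L \<omega> (3 * i + n) z)) + shift (3 * i) \<omega> n \<notin> crit_nbhd (eta P)"
    if z: "z = ?z \<or> z = ?z'" and n: "n < 3 * (K1 P + K2 P)" for n z
  proof -
    have c: "4 * eta P \<le> circle_norm (2 * orbit_x L \<omega> (3 * i + n) z)"
    proof (cases n)
      \<comment> \<open>The chain controls the orbit only from its first step on; the starting point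
        is covered by the renewal condition.\<close>
      case 0 then show ?thesis using ok z by (auto simp: orbit_ok_iff)
    next
      case (Suc m)
      have "hc < circle_norm (2 * orbit_x L \<omega> (Suc (3 * i + m)) z)"
        using chain_okD(1,2)[OF chain[of "3 * i + m"]] Suc n z by (auto simp: crit_bad_def)
      then show ?thesis using Suc small by simp
    qed
    define x where "x = orbit_x L \<omega> (3 * i + n) z"
    define w' where "w' = \<omega> (3 * i + n)"
    have "\<bar>circle_norm (2 * (x + w')) - circle_norm (2 * x)\<bar> \<le> \<bar>2 * (x + w') - 2 * x\<bar>" by (rule circle_norm_diff_le)
    then have "\<bar>circle_norm (2 * (x + w')) - circle_norm (2 * x)\<bar> \<le> 2 * eta P"
      using w[of "3 * i + n"] small by (simp add: w'_def)
    then have "2 * eta P \<le> circle_norm (2 * (x + w'))" using c unfolding x_def[symmetric] by linarith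
    moreover have "fst (torus_proj (lift_iter L \<omega> (3 * i + n) z)) + shift (3 * i) \<omega> n = frac x + w'"
      by (simp add: torus_proj_def shift_def x_def w'_def orbit_x_def add.commute)
    ultimately show ?thesis by (simp only: crit_nbhd_eq mem_Collect_eq circle_norm_frac_mult not_less)
  qed
  have target: "torus_proj (lift_iter L \<omega> (3 * i + 3 * K1 P) z) \<in> R"
    if z: "(z = ?z \<and> p0 = p \<and> R = rect1 P) \<or> (z = ?z' \<and> p0 = p' \<and> R = rect2 P)" for z p0 R
  proof -
    define N where "N = 3 * i + 3 * K1 P - 2"
    have N: "Suc (Suc N) = 3 * i + 3 * K1 P" "3 * i \<le> N" using K1 by (auto simp: N_def)
    have ch: "chain_ok L ?z ?z' h hc (3 * K1 P) p p' r (3 * i) N \<omega>" "chain_ok L ?z ?z' h hc (3 * K1 P) p p' r (3 * i) (Suc N) \<omega>"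
      using N K1 by (auto intro!: chain)
    have x: "circle_norm (orbit_x L \<omega> (Suc N) z - snd p0) < r" "circle_norm (orbit_x L \<omega> (Suc (Suc N)) z - fst p0) < r"
      using z N chain_okD(5,6)[OF ch(1)] chain_okD(7,8)[OF ch(2)] by auto
    have "\<bar>circle_norm (orbit_y L \<omega> (Suc (Suc N)) z - snd p0) - circle_norm (orbit_x L \<omega> (Suc N) z - snd p0)\<bar> \<le> \<bar>\<omega> (Suc N)\<bar>"
      using circle_norm_diff_le[of "orbit_y L \<omega> (Suc (Suc N)) z - snd p0" "orbit_x L \<omega> (Suc N) z - snd p0"] by (simp add: orbit_Suc)
    then have y: "circle_norm (orbit_y L \<omega> (Suc (Suc N)) z - snd p0) < 2 * r"
      using w[of "Suc N"] small x by linarith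
    have "torus_proj (orbit_x L \<omega> (Suc (Suc N)) z, orbit_y L \<omega> (Suc (Suc N)) z) \<in> R"
    proof -
      have x2: "circle_norm (orbit_x L \<omega> (Suc (Suc N)) z - fst p0) < 2 * r" using x small by linarith
      from z show ?thesis using R1[OF _ _] R2[OF _ _] x2 y by (elim disjE conjE) (simp_all only:)
    qed
    then show ?thesis using N by (simp add: orbit_x_def orbit_y_def)
  qed
  have t1: "F_iter L (shift (3 * i) \<omega>) (K1 P) (F_iter L \<omega> i ?z) \<in> rect1 P"
    unfolding F_iter_def[of L "shift (3 * i) \<omega>"] it using target[of ?z p "rect1 P"] by simp
  have t2: "F_iter L (shift (3 * i) \<omega>) (K1 P) (F_iter L \<omega> i ?z') \<in> rect2 P"
    unfolding F_iter_def[of L "shift (3 * i) \<omega>"] it using target[of ?z' p' "rect2 P"] by simp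
  have a1: "fst (std_iter L (shift (3 * i) \<omega>) n (F_iter L \<omega> i ?z)) + shift (3 * i) \<omega> n \<notin> crit_nbhd (eta P)"
    "fst (std_iter L (shift (3 * i) \<omega>) n (F_iter L \<omega> i ?z')) + shift (3 * i) \<omega> n \<notin> crit_nbhd (eta P)"
    if "n \<in> {3 * 0..<3 * (K1 P + K2 P)}" for n
    unfolding it using that by (intro avoid; simp)+
  have "shift (3 * i) \<omega> \<in> young_event \<delta> P L (F_iter L \<omega> i ?z) (F_iter L \<omega> i ?z')"
    unfolding young_event_def avoid_event_def using sh t1 t2 a1 by blast
  then show ?thesis using ren by (simp add: young_time_def is_renewal_def)
qed

section \<open>Targets inside the rectangles\<close>

text \<open>A line is a null set; a non-measurable subset has \<open>measure\<close> 0 by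
  convention, so no measurability hypothesis is required.\<close>

lemma measure_torus_line:
  assumes "I \<subseteq> {c} \<times> UNIV \<or> I \<subseteq> UNIV \<times> {c}" shows "measure torus_measure I = 0"
proof (cases "I \<in> sets torus_measure")
  case True
  have n: "{c} \<times> UNIV \<in> null_sets (lborel :: (real \<times> real) measure)" "UNIV \<times> {c} \<in> null_sets (lborel :: (real \<times> real) measure)"
    unfolding null_sets_def lborel_prod[symmetric] by (auto simp: lborel.emeasure_pair_measure_Times)
  have "{0..<1} \<times> {0..<1::real} \<in> sets (borel :: (real \<times> real) measure)"
    unfolding borel_prod[symmetric] by (intro pair_measureI) auto
  then have sub: "I \<subseteq> {0..<1} \<times> {0..<1}" "I \<in> sets lborel" "{0..<1} \<times> {0..<1::real} \<in> sets (lborel :: (real \<times> real) measure)"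
    using True sets.sets_into_space[OF True] by (auto simp: torus_measure_def sets_restrict_space space_restrict_space)
  have "emeasure torus_measure I = emeasure lborel I"
    unfolding torus_measure_def using sub by (intro emeasure_restrict_space) auto
  also have "\<dots> = 0" using n assms null_sets_subset[of _ lborel I] sub by auto
  finally show ?thesis by (simp add: measure_def)
next
  case False
  then show ?thesis by (simp add: measure_notin_sets)
qed

text \<open>An interval may be a single point; positive measure excludes this for both
  factors.\<close>

lemma torus_rectangle_contains:
  assumes "torus_rectangle I" "measure torus_measure I > 0"
  obtains a a' b b' where "a < a'" "b < b'" "\<And>x y. a < x \<Longrightarrow> x < a' \<Longrightarrow> b < y \<Longrightarrow> y < b' \<Longrightarrow> torus_proj (x, y) \<in> I"
proof -
  obtain A B where AB: "is_interval A" "is_interval B" "I = torus_proj ` (A \<times> B)" using assms(1) by (auto simp: torus_rectangle_def)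
  have two: "\<exists>s t. s \<in> S \<and> t \<in> S \<and> s < t" if "\<not> (\<exists>u. S \<subseteq> {u})" for S :: "real set"
  proof -
    from that obtain s where "s \<in> S" by blast
    moreover from that this obtain t where "t \<in> S" "t \<noteq> s" by blast
    ultimately show ?thesis by (metis linorder_neqE)
  qed
  have "\<not> (\<exists>u. A \<subseteq> {u})"
  proof
    assume "\<exists>u. A \<subseteq> {u}"
    then obtain u where "A \<subseteq> {u}" by blast
    then have "I \<subseteq> {frac u} \<times> UNIV" using AB(3) by (auto simp: torus_proj_def)
    then show False using measure_torus_line[of I "frac u"] assms(2) by simp
  qed
  then obtain a a' where a: "a \<in> A" "a' \<in> A" "a < a'" using two by blast
  have "\<not> (\<exists>u. B \<subseteq> {u})"
  proof
    assume "\<exists>u. B \<subseteq> {u}"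
    then obtain u where "B \<subseteq> {u}" by blast
    then have "I \<subseteq> UNIV \<times> {frac u}" using AB(3) by (auto simp: torus_proj_def)
    then show False using measure_torus_line[of I "frac u"] assms(2) by simp
  qed
  then obtain b b' where b: "b \<in> B" "b' \<in> B" "b < b'" using two by blast
  have "torus_proj (x, y) \<in> I" if "a < x" "x < a'" "b < y" "y < b'" for x y
  proof -
    have "x \<in> A" using mem_is_interval_1_I[OF AB(1) a(1,2)] that by auto
    moreover have "y \<in> B" using mem_is_interval_1_I[OF AB(2) b(1,2)] that by auto
    ultimately show ?thesis using AB(3) by auto
  qed
  then show ?thesis using that a b by blast
qed

lemma torus_proj_minus_int: "torus_proj (x - of_int m, y - of_int n) = torus_proj (x, y)"
  by (simp add: torus_proj_def frac_def)

lemma torus_target: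
  assumes "a < a'" "b < b'" and I: "\<And>x y. a < x \<Longrightarrow> x < a' \<Longrightarrow> b < y \<Longrightarrow> y < b' \<Longrightarrow> torus_proj (x, y) \<in> I"
    and c: "a + \<rho> \<le> cx" "cx + \<rho> \<le> a'" "b + \<rho> \<le> cy" "cy + \<rho> \<le> b'"
    and "circle_norm (x - cx) < \<rho>" "circle_norm (y - cy) < \<rho>"
  shows "torus_proj (x, y) \<in> I"
proof -
  obtain m n :: int where mn: "circle_norm (x - cx) = \<bar>x - cx - of_int m\<bar>" "circle_norm (y - cy) = \<bar>y - cy - of_int n\<bar>"
    by (metis circle_norm_attained)
  then have "torus_proj (x - of_int m, y - of_int n) \<in> I" using assms by (intro I; linarith)
  then show ?thesis by (simp add: torus_proj_minus_int)
qed

text \<open>The rectangles may sit at the same height, or at heights differing by 1/2, so centres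
  need not be admissible targets; if necessary the second one is moved vertically inside its
  rectangle.\<close>

lemma rectangle_targets:
  assumes "torus_rectangle I" "measure torus_measure I > 0" "torus_rectangle J" "measure torus_measure J > 0"
  obtains p p' r \<kappa> where "0 < r" "r \<le> 1/2" "0 < \<kappa>" "4 * r + \<kappa> \<le> circle_norm (2 * (snd p - snd p'))"
    "\<And>x y. circle_norm (x - fst p) < 2 * r \<Longrightarrow> circle_norm (y - snd p) < 2 * r \<Longrightarrow> torus_proj (x, y) \<in> I"
    "\<And>x y. circle_norm (x - fst p') < 2 * r \<Longrightarrow> circle_norm (y - snd p') < 2 * r \<Longrightarrow> torus_proj (x, y) \<in> J"
proof -
  obtain a a' b b' where I: "a < a'" "b < b'" "\<And>x y. a < x \<Longrightarrow> x < a' \<Longrightarrow> b < y \<Longrightarrow> y < b' \<Longrightarrow> torus_proj (x, y) \<in> I"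
    using torus_rectangle_contains[OF assms(1,2)] by metis
  obtain d d' e e' where J: "d < d'" "e < e'" "\<And>x y. d < x \<Longrightarrow> x < d' \<Longrightarrow> e < y \<Longrightarrow> y < e' \<Longrightarrow> torus_proj (x, y) \<in> J"
    using torus_rectangle_contains[OF assms(3,4)] by metis
  define cy where "cy = (b + b') / 2"
  \<comment> \<open>Small enough that \<open>2 * s\<close> lies strictly between 0 and 1, hence is
    no integer, and that the shifted centre stays well inside the interval.\<close>
  define s where "s = min (1/8) ((e' - e) / 8)"
  have "0 < s" using J by (auto simp: s_def)
  moreover have "s \<le> 1/8" "s \<le> (e' - e) / 8" unfolding s_def by (rule min.cobounded1, rule min.cobounded2)
  ultimately have s: "0 < s" "s \<le> 1/8" "s \<le> (e' - e) / 8" by auto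
  obtain cy' where cy': "cy' = (e + e') / 2 \<or> cy' = (e + e') / 2 + s" "circle_norm (2 * (cy - cy')) > 0"
  proof (cases "circle_norm (2 * (cy - (e + e') / 2)) > 0")
    case True then show ?thesis using that by blast
  next
    case False
    then have z: "circle_norm (2 * (cy - (e + e') / 2)) = 0" using circle_norm_nonneg[of "2 * (cy - (e + e') / 2)"] by linarith
    obtain m :: int where "circle_norm (2 * s) = \<bar>2 * s - of_int m\<bar>" by (metis circle_norm_attained)
    moreover have "2 * s \<noteq> of_int m"
    proof
      assume m: "2 * s = of_int m"
      then have "0 < real_of_int m" "real_of_int m < 1" using s by linarith+
      then show False by simp
    qed
    ultimately have "circle_norm (2 * s) > 0" by simp
    also have "2 * s = 2 * (cy - (e + e') / 2) + - (2 * (cy - ((e + e') / 2 + s)))" by (simp add: algebra_simps)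
    also have "circle_norm \<dots> \<le> circle_norm (2 * (cy - (e + e') / 2)) + circle_norm (2 * (cy - ((e + e') / 2 + s)))"
      using circle_norm_triangle[of "2 * (cy - (e + e') / 2)" "- (2 * (cy - ((e + e') / 2 + s)))"] by (simp only: circle_norm_uminus)
    finally have "circle_norm (2 * (cy - ((e + e') / 2 + s))) > 0" using z by linarith
    then show ?thesis using that by blast
  qed
  define \<kappa>0 where "\<kappa>0 = circle_norm (2 * (cy - cy'))"
  define \<rho> where "\<rho> = min (min ((a' - a) / 4) ((b' - b) / 4)) (min ((d' - d) / 4) ((e' - e) / 4))"
  define r where "r = min (1/2) (min (\<rho> / 2) (\<kappa>0 / 8))"
  have \<rho>: "0 < \<rho>" "\<rho> \<le> (a' - a) / 4" "\<rho> \<le> (b' - b) / 4" "\<rho> \<le> (d' - d) / 4" "\<rho> \<le> (e' - e) / 4"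
  proof -
    show "0 < \<rho>" using I J by (auto simp: \<rho>_def)
    show "\<rho> \<le> (a' - a) / 4" "\<rho> \<le> (b' - b) / 4" "\<rho> \<le> (d' - d) / 4" "\<rho> \<le> (e' - e) / 4"
      unfolding \<rho>_def by linarith+
  qed
  have \<kappa>0: "0 < \<kappa>0" using cy'(2) by (simp add: \<kappa>0_def)
  have r: "0 < r" "r \<le> 1/2" "2 * r \<le> \<rho>" "4 * r \<le> \<kappa>0 / 2" using \<rho> \<kappa>0 by (auto simp: r_def min_def)
  show ?thesis
  proof (rule that[of r "\<kappa>0 / 2" "((a + a') / 2, cy)" "((d + d') / 2, cy')"])
    show "4 * r + \<kappa>0 / 2 \<le> circle_norm (2 * (snd ((a + a') / 2, cy) - snd ((d + d') / 2, cy')))"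
      using r by (simp add: \<kappa>0_def)
    show "torus_proj (x, y) \<in> I" if "circle_norm (x - fst ((a + a') / 2, cy)) < 2 * r" "circle_norm (y - snd ((a + a') / 2, cy)) < 2 * r" for x y
    proof (rule torus_target[OF I])
      show "a + \<rho> \<le> (a + a') / 2" "(a + a') / 2 + \<rho> \<le> a'" "b + \<rho> \<le> cy" "cy + \<rho> \<le> b'"
        using \<rho> I(1,2) by (simp_all add: cy_def field_simps)
    qed (use that r in auto)
    show "torus_proj (x, y) \<in> J" if "circle_norm (x - fst ((d + d') / 2, cy')) < 2 * r" "circle_norm (y - snd ((d + d') / 2, cy')) < 2 * r" for x y
    proof (rule torus_target[OF J])
      show "d + \<rho> \<le> (d + d') / 2" "(d + d') / 2 + \<rho> \<le> d'" using \<rho> J(1,2) by (simp_all add: field_simps)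
      show "e + \<rho> \<le> cy'" "cy' + \<rho> \<le> e'" using \<rho> J(1,2) s cy'(1) by (auto simp: field_simps)
    qed (use that r in auto)
  qed (use r \<kappa>0 in auto)
qed

section \<open>The number of Young times\<close>

lemma marked_points_separated:
  assumes "marked_point \<gamma> \<noteq> marked_point \<gamma>'"
  shows "0 < max (circle_norm (fst (marked_point \<gamma>) - fst (marked_point \<gamma>'))) (circle_norm (snd (marked_point \<gamma>) - snd (marked_point \<gamma>')))"
proof (rule ccontr)
  assume "\<not> ?thesis"
  then have z: "circle_norm (fst (marked_point \<gamma>) - fst (marked_point \<gamma>')) = 0" "circle_norm (snd (marked_point \<gamma>) - snd (marked_point \<gamma>')) = 0"
    by (simp_all add: less_max_iff_disj not_less order_antisym)
  have eq: "frac x = frac y" if "circle_norm (frac x - frac y) = 0" for x y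
  proof -
    obtain m :: int where "circle_norm (frac x - frac y) = \<bar>frac x - frac y - of_int m\<bar>" by (metis circle_norm_attained)
    then have m: "frac x - frac y = of_int m" using that by simp
    have "\<bar>frac x - frac y\<bar> < 1" using frac_lt_1[of x] frac_lt_1[of y] frac_ge_0[of x] frac_ge_0[of y] by linarith
    then have "m = 0" unfolding m by linarith
    then show ?thesis using m by simp
  qed
  show False using assms z eq by (auto simp: marked_point_def torus_proj_def)
qed

text \<open>The step numbered \<open>3 * i - 1\<close> produces position and direction at time
  \<open>3 * i\<close>. The half width \<open>eta2 P / 2\<close> turns its non-strict cone bound
  into the strict one.\<close>

lemma orbit_ok_of_good_step:
  assumes i: "i \<ge> 1" and P: "0 < eta2 P" "4 * eta P \<le> hc" and v: "marked_tangent (curve1 P) \<noteq> 0" "marked_tangent (curve2 P) \<noteq> 0"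
    and sep: "eta1 P < sep L (marked_point (curve1 P)) (marked_point (curve2 P)) \<omega> (3 * i)"
    and good: "\<not> step_bad L (marked_point (curve1 P)) (marked_point (curve2 P)) (marked_tangent (curve1 P)) (marked_tangent (curve2 P)) h (eta2 P / 2) hc (3 * i - 1) \<omega>"
  shows "orbit_ok P L \<omega> i"
proof -
  have Suc: "Suc (3 * i - 1) = 3 * i" using i by simp
  have ball: "lift_deriv L \<omega> (3 * i) z w \<in> horizontal_ball (eta2 P)" if w: "w \<noteq> 0" and c: "\<not> cone_bad L z w (eta2 P / 2) (3 * i - 1) \<omega>" for z w
  proof -
    obtain a b where ab: "lift_deriv L \<omega> (3 * i) z w = (a, b)" by (cases "lift_deriv L \<omega> (3 * i) z w")
    have le: "\<bar>b\<bar> \<le> eta2 P / 2 * \<bar>a\<bar>" using c unfolding cone_bad_def Suc ab by simp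
    have "a \<noteq> 0"
    proof
      assume "a = 0"
      then have "lift_deriv L \<omega> (3 * i) z w = 0" using le ab by (simp add: zero_prod_def)
      then show False using lift_deriv_nonzero[OF w] by blast
    qed
    then show ?thesis unfolding ab using le P by (intro horizontal_ballI[of _ _ "eta2 P / 2"]) auto
  qed
  have "eta1 P < torus_dist (lift_iter L \<omega> (3*i) (marked_point (curve1 P))) (lift_iter L \<omega> (3*i) (marked_point (curve2 P)))"
    using sep circle_norm_le_torus_dist[of "lift_iter L \<omega> (3*i) (marked_point (curve1 P))" "lift_iter L \<omega> (3*i) (marked_point (curve2 P))"]
    unfolding sep_def orbit_x_def orbit_y_def less_max_iff_disj by linarith
  then show ?thesis
    using good ball v P unfolding orbit_ok_iff step_bad_def crit_bad_def Suc by auto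
qed

text \<open>A failing time has positive level, equals \<open>n\<close>, or follows a bad step.
  Levels account for \<open>1 + 9\<close> per bad step, the step just before for one more.\<close>

lemma card_orbit_not_ok:
  assumes L: "L \<ge> 512" and h: "h > 0" and P: "0 < eta2 P" "4 * eta P \<le> hc" "eta1 P < h"
    and v: "marked_tangent (curve1 P) \<noteq> 0" "marked_tangent (curve2 P) \<noteq> 0"
    and init: "h / sqrt L \<le> sep L (marked_point (curve1 P)) (marked_point (curve2 P)) \<omega> 0"
  shows "card {i. 1 \<le> i \<and> i \<le> n \<and> \<not> orbit_ok P L \<omega> i} \<le> 2 + 10 * card {k. k < 3 * n \<and>
     step_bad L (marked_point (curve1 P)) (marked_point (curve2 P)) (marked_tangent (curve1 P)) (marked_tangent (curve2 P)) h (eta2 P / 2) hc k \<omega>}"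
proof -
  let ?z = "marked_point (curve1 P)" and ?z' = "marked_point (curve2 P)"
  let ?sb = "\<lambda>k. step_bad L ?z ?z' (marked_tangent (curve1 P)) (marked_tangent (curve2 P)) h (eta2 P / 2) hc k \<omega>"
  define bad where "bad = (\<lambda>i. sep_bad L ?z ?z' h (3*i) \<omega> \<or> sep_bad L ?z ?z' h (Suc (3*i)) \<omega>)"
  define B where "B = {k. k < 3 * n \<and> ?sb k}"
  have fB: "finite B" by (rule finite_subset[of _ "{..<3*n}"]) (auto simp: B_def)
  have lev: "h / sqrt L ^ lev bad i \<le> sep L ?z ?z' \<omega> (3 * i)" for i
    unfolding bad_def by (rule sep_ge_lev[OF L h init])
  have sub: "{i. 1 \<le> i \<and> i \<le> n \<and> \<not> orbit_ok P L \<omega> i} \<subseteq> {i. i < n \<and> 0 < lev bad i} \<union> {n} \<union> (\<lambda>k. (k + 1) div 3) ` B"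
  proof
    fix i assume i: "i \<in> {i. 1 \<le> i \<and> i \<le> n \<and> \<not> orbit_ok P L \<omega> i}"
    show "i \<in> {i. i < n \<and> 0 < lev bad i} \<union> {n} \<union> (\<lambda>k. (k + 1) div 3) ` B"
    proof (cases "?sb (3 * i - 1)")
      case True
      then have "3 * i - 1 \<in> B" using i by (auto simp: B_def)
      moreover have "i = (3 * i - 1 + 1) div 3" using i by simp
      ultimately show ?thesis by blast
    next
      case False
      have "lev bad i \<noteq> 0"
      proof
        assume "lev bad i = 0"
        then have "eta1 P < sep L ?z ?z' \<omega> (3 * i)" using lev[of i] P by simp
        then have "orbit_ok P L \<omega> i" using i P v False by (intro orbit_ok_of_good_step) auto
        then show False using i by simp
      qed
      then show ?thesis using i by auto
    qed
  qed
  have "card {i. i < n \<and> bad i} \<le> card B"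
  proof -
    have "{i. i < n \<and> bad i} \<subseteq> (\<lambda>k. k div 3) ` B"
    proof
      fix i assume i: "i \<in> {i. i < n \<and> bad i}"
      then have "3 * i \<in> B \<or> Suc (3 * i) \<in> B" by (auto simp: B_def bad_def step_bad_def)
      moreover have "i = (3 * i) div 3" "i = (Suc (3 * i)) div 3" by simp_all
      ultimately show "i \<in> (\<lambda>k. k div 3) ` B" by blast
    qed
    then have "card {i. i < n \<and> bad i} \<le> card ((\<lambda>k. k div 3) ` B)" using fB by (intro card_mono) auto
    also have "\<dots> \<le> card B" using fB by (rule card_image_le)
    finally show ?thesis .
  qed
  then have "card {i. i < n \<and> 0 < lev bad i} \<le> 1 + 9 * card B" using lev_count[of n bad] by linarith
  moreover have "card {i. 1 \<le> i \<and> i \<le> n \<and> \<not> orbit_ok P L \<omega> i} \<le> card ({i. i < n \<and> 0 < lev bad i} \<union> {n} \<union> (\<lambda>k. (k + 1) div 3) ` B)"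
    using sub fB by (intro card_mono) auto
  moreover have "card ({i. i < n \<and> 0 < lev bad i} \<union> {n} \<union> (\<lambda>k. (k + 1) div 3) ` B) \<le> card {i. i < n \<and> 0 < lev bad i} + 1 + card B"
    using card_Un_le[of "{i. i < n \<and> 0 < lev bad i} \<union> {n}" "(\<lambda>k. (k + 1) div 3) ` B"] card_Un_le[of "{i. i < n \<and> 0 < lev bad i}" "{n}"] card_image_le[OF fB, of "\<lambda>k. (k + 1) div 3"]
    by simp
  ultimately show ?thesis unfolding B_def by linarith
qed

lemma measurable_card [measurable]:
  assumes [measurable]: "\<And>k. Measurable.pred M (Q k)"
  shows "(\<lambda>\<omega>. real (card {k::nat. k \<le> n \<and> Q k \<omega>})) \<in> borel_measurable M"
proof -
  have "{k. k \<le> n \<and> Q k \<omega>} = {..n} \<inter> {k. Q k \<omega>}" for \<omega> by auto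
  then have "real (card {k. k \<le> n \<and> Q k \<omega>}) = (\<Sum>k\<le>n. if Q k \<omega> then 1 else 0)" for \<omega>
    by (simp add: sum.If_cases)
  then show ?thesis by simp
qed

text \<open>Outside four exceptional events the losses add up: at most \<open>2 + n / 10\<close>
  times fail \<open>orbit_ok\<close>, and each curve misses at most \<open>n / 10\<close> hyperbolic
  times. The many simultaneous times force at least \<open>n / (4 * (K + 1))\<close> renewals, each
  starting a trial.\<close>

lemma few_young_times_bound:
  fixes \<delta> L :: real and c :: hyp_consts and P :: pair_consts and n :: nat
  defines "z \<equiv> marked_point (curve1 P)" and "z' \<equiv> marked_point (curve2 P)" and "K \<equiv> K1 P + K2 P"
  assumes L: "L \<ge> 512" and K1: "K1 P \<ge> 2" and c: "nmin c \<ge> 1" and h: "h > 0" "eta1 P < h" and e1: "0 < eta1 P"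
    and e2: "0 < eta2 P" "eta2 P < 1/10" and hc: "4 * eta P \<le> hc1" "4 * eta P \<le> hc2"
    and v: "marked_tangent (curve1 P) \<noteq> 0" "marked_tangent (curve2 P) \<noteq> 0"
    and \<sigma>: "L powr -\<delta> \<le> eta P" "L powr -\<delta> \<le> r" "r > 0"
    and rare: "\<And>z z' v v' k \<omega>. measure (noise_comp \<delta> L) {w \<in> space (noise_comp \<delta> L). step_bad L z z' v v' h (eta2 P / 2) hc1 k (fun_upd \<omega> k w)} \<le> exp (- 600)"
    and hit: "\<And>z z' k j \<omega>. k \<le> j \<Longrightarrow> eta1 P / 2 \<le> sep L z z' \<omega> k \<Longrightarrow> (\<And>i. k \<le> i \<Longrightarrow> i < j \<Longrightarrow> chain_ok L z z' h hc2 (3 * K1 P) p p' r k i \<omega>) \<Longrightarrow>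
       q \<le> measure (noise_comp \<delta> L) {w \<in> space (noise_comp \<delta> L). chain_ok L z z' h hc2 (3 * K1 P) p p' r k j (fun_upd \<omega> j w)}"
    and q: "0 < q" "q \<le> 1"
    and R1: "\<And>x y. circle_norm (x - fst p) < 2 * r \<Longrightarrow> circle_norm (y - snd p) < 2 * r \<Longrightarrow> torus_proj (x, y) \<in> rect1 P"
    and R2: "\<And>x y. circle_norm (x - fst p') < 2 * r \<Longrightarrow> circle_norm (y - snd p') < 2 * r \<Longrightarrow> torus_proj (x, y) \<in> rect2 P"
    and init: "\<And>\<omega>. h / sqrt L \<le> sep L z z' \<omega> 0"
    and freq: "\<And>\<gamma>. \<gamma> \<in> {curve1 P, curve2 P} \<Longrightarrow> measure (noise \<delta> L) {\<omega>\<in>space (noise \<delta> L).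
             real (card {k. k \<ge> 1 \<and> tau c L \<omega> \<gamma> k \<le> enat n}) \<le> (1 - \<delta>1) * real n} \<le> F"
    and \<delta>1: "\<delta>1 \<le> 1/10" and n: "20 \<le> n" "8 * K \<le> n"
  defines "b \<equiv> - ln (1 - (1 - exp (-1)) * q ^ (3 * K)) / (8 * (real K + 1))"
  shows "measure (noise \<delta> L) {\<omega>\<in>space (noise \<delta> L). real (card (young_times \<delta> c P L \<omega> n)) \<le> b * real n}
    \<le> exp (- 3 * real n) + (F + (F + exp (- b * real n)))"
proof -
  define T where "T = 3 * K"
  define V where "V = 1 - (1 - exp (-1)) * q ^ T"
  define bad where "bad = step_bad L z z' (marked_tangent (curve1 P)) (marked_tangent (curve2 P)) h (eta2 P / 2) hc1"
  \<comment> \<open>Trials are indexed by single noise coordinates; an iterate of \<open>F\<close>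
    uses three of them.\<close>
  define R where "R k \<omega> \<longleftrightarrow> 3 dvd k \<and> is_renewal c P L \<omega> (k div 3)" for k \<omega>
  define G where "G = chain_ok L z z' h hc2 (3 * K1 P) p p' r"
  have L0: "L > 0" using L by simp
  interpret C: sequence_space "noise_comp \<delta> L" by (rule sequence_space_noise_comp[OF L0])
  have S: "noise \<delta> L = C.S" by (rule noise_eq_PiM)
  interpret N: prob_space "noise \<delta> L" by (rule prob_space_noise[OF L0])
  have V: "0 < V" "V < 1"
  proof -
    have qT: "0 < q ^ T" "q ^ T \<le> 1" using q by (auto intro: power_le_one)
    have "(1 - exp (-1 :: real)) * q ^ T \<le> 1 - exp (-1)" using qT by (intro mult_left_le) auto
    moreover have "exp (-1 :: real) > 0" by simp
    ultimately show "0 < V" unfolding V_def by linarith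
    show "V < 1" unfolding V_def using qT by simp
  qed
  \<comment> \<open>The constant \<open>b\<close> is made so that
    \<open>V powr x = exp (- 2 * y)\<close>; then \<open>exp y * V powr x = exp (- y)\<close>, which
    still decays.\<close>
  define y where "y = b * real n"
  define x where "x = real n / (4 * (real K + 1))"
  have yx: "2 * y = - ln V * x"
    by (simp add: y_def x_def b_def V_def T_def field_simps)
  define B0 where "B0 = {\<omega> \<in> space (noise \<delta> L). real (3 * n) \<le> 300 * real (card {k. k < 3 * n \<and> bad k \<omega>})}"
  define BF where "BF \<gamma> = {\<omega>\<in>space (noise \<delta> L). real (card {k. k \<ge> 1 \<and> tau c L \<omega> \<gamma> k \<le> enat n}) \<le> (1 - \<delta>1) * real n}" for \<gamma>
  \<comment> \<open>The horizon \<open>3 * n + T\<close> lets every trial started by time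
    \<open>n\<close> run to its end; a Young time is counted where its trial starts.\<close>
  define B3 where "B3 = {\<omega> \<in> space (noise \<delta> L). x \<le> real (card {k. k + T \<le> 3 * n + T \<and> R k \<omega>}) \<and>
      real (card {k. k + T \<le> 3 * n + T \<and> R k \<omega> \<and> (\<forall>i\<in>{k..<k+T}. G k i \<omega>)}) \<le> y}"
  have [measurable]: "Measurable.pred (noise \<delta> L) (bad k)" for k
    unfolding bad_def step_bad_def[abs_def] by measurable
  have [measurable]: "Measurable.pred (noise \<delta> L) (R k)" for k
    unfolding R_def using measurable_is_renewal[OF c e2 v] by (cases "3 dvd k") simp_all
  have [measurable]: "Measurable.pred (noise \<delta> L) (G k i)" for k i
    unfolding G_def by (rule measurable_chain_ok)
  have B0: "B0 \<in> sets (noise \<delta> L)" "N.prob B0 \<le> exp (- 3 * real n)"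
  proof -
    have eq: "{k. k < 3 * n \<and> bad k \<omega>} = {k. k \<le> 3 * n \<and> (k < 3 * n \<and> bad k \<omega>)}" for \<omega> by auto
    show "B0 \<in> sets (noise \<delta> L)" unfolding B0_def eq by measurable
    have "measure C.S {\<omega> \<in> space C.S. real (3 * n) \<le> 300 * real (card {k. k < 3 * n \<and> bad k \<omega>})} \<le> exp (- real (3 * n))"
    proof (rule C.prob_many_rare_events)
      show "Measurable.pred C.S (bad k)" for k unfolding S[symmetric] by measurable
      show "bad k \<omega> = bad k \<omega>'" if "\<And>j. j \<le> k \<Longrightarrow> \<omega> j = \<omega>' j" for k \<omega> \<omega>'
        unfolding bad_def step_bad_def using bad_cong[OF that] by simp
      show "measure (noise_comp \<delta> L) {w \<in> space (noise_comp \<delta> L). bad k (fun_upd \<omega> k w)} \<le> exp (- 600)" for k \<omega>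
        unfolding bad_def by (rule rare)
    qed
    then show "N.prob B0 \<le> exp (- 3 * real n)" unfolding B0_def S by simp
  qed
  have BF: "BF \<gamma> \<in> sets (noise \<delta> L)" "N.prob (BF \<gamma>) \<le> F" if "\<gamma> \<in> {curve1 P, curve2 P}" for \<gamma>
  proof -
    have [measurable]: "Measurable.pred (noise \<delta> L) (\<lambda>\<omega>. hyperbolic_at c L \<omega> \<gamma> m)" for m
      using that v by (intro measurable_hyperbolic_at) auto
    have eq: "{i. hyperbolic_at c L \<omega> \<gamma> i \<and> i \<le> n} = {i. i \<le> n \<and> hyperbolic_at c L \<omega> \<gamma> i}" for \<omega> by auto
    show "BF \<gamma> \<in> sets (noise \<delta> L)" unfolding BF_def card_tau[OF c] eq by measurable
    show "N.prob (BF \<gamma>) \<le> F" unfolding BF_def by (rule freq[OF that])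
  qed
  have B3: "B3 \<in> sets (noise \<delta> L)" "N.prob B3 \<le> exp (- b * real n)"
  proof -
    have eq: "{k. k + T \<le> 3 * n + T \<and> Q k} = {k. k \<le> 3 * n \<and> Q k}" for Q by auto
    show "B3 \<in> sets (noise \<delta> L)" unfolding B3_def eq by measurable
    have "measure C.S {\<omega> \<in> space C.S. x \<le> real (card {k. k + T \<le> 3 * n + T \<and> R k \<omega>}) \<and>
      real (card {k. k + T \<le> 3 * n + T \<and> R k \<omega> \<and> (\<forall>i\<in>{k..<k+T}. G k i \<omega>)}) \<le> y} \<le> exp y * (1 - (1 - exp (-1)) * q ^ T) powr x"
    proof (rule C.prob_few_successes)
      show "Measurable.pred C.S (R k)" for k unfolding S[symmetric] by measurable
      show "Measurable.pred C.S (G k j)" for k j unfolding S[symmetric] by measurable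
      show "R k \<omega> = R k \<omega>'" if "\<And>j. j < k \<Longrightarrow> \<omega> j = \<omega>' j" for k \<omega> \<omega>'
      proof (cases "3 dvd k")
        case True
        then have "3 * (k div 3) = k" by simp
        then have "is_renewal c P L \<omega> (k div 3) = is_renewal c P L \<omega>' (k div 3)"
          using that by (intro is_renewal_cong[OF c]) simp
        then show ?thesis by (simp add: R_def)
      qed (simp add: R_def)
      show "G k i \<omega> = G k i \<omega>'" if "\<And>j. j \<le> i \<Longrightarrow> \<omega> j = \<omega>' j" for k i \<omega> \<omega>'
        unfolding G_def by (rule chain_ok_cong[OF that])
      show "k + T \<le> k'" if R: "R k \<omega>" "R k' \<omega>" "k < k'" for k k' \<omega>
      proof -
        obtain i i' where i: "k = 3 * i" "k' = 3 * i'" using R by (auto simp: R_def elim!: dvdE)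
        then have "is_renewal c P L \<omega> i" "is_renewal c P L \<omega> i'" "i < i'" using R by (auto simp: R_def)
        then have "i + K < i'" using is_renewal_iff[OF c, of P L \<omega> i'] by (auto simp: K_def)
        then show ?thesis using i by (simp add: T_def)
      qed
      show "0 < q" "q \<le> 1" by (rule q)+
      show "q \<le> measure (noise_comp \<delta> L) {w \<in> space (noise_comp \<delta> L). G k i (fun_upd \<omega> i w)}"
        if R: "R k \<omega>" and ki: "k \<le> i" and prev: "\<And>j. k \<le> j \<Longrightarrow> j < i \<Longrightarrow> G k j \<omega>" for k i \<omega>
        unfolding G_def
      proof (rule hit[OF ki])
        obtain m where m: "k = 3 * m" using R by (auto simp: R_def elim!: dvdE)
        then have "orbit_ok P L \<omega> m" using R is_renewal_iff[OF c, of P L \<omega> m] by (simp add: R_def sim_hyperbolic_def)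
        \<comment> \<open>The torus distance is at most the sum of the coordinate distances, so the
          larger one exceeds half of \<open>eta1 P\<close>.\<close>
        then have "eta1 P < circle_norm (orbit_x L \<omega> k z - orbit_x L \<omega> k z') + circle_norm (orbit_y L \<omega> k z - orbit_y L \<omega> k z')"
          using torus_dist_le[of "lift_iter L \<omega> k z" "lift_iter L \<omega> k z'"]
          unfolding orbit_ok_iff m orbit_x_def orbit_y_def z_def z'_def by linarith
        then show "eta1 P / 2 \<le> sep L z z' \<omega> k" unfolding sep_def by linarith
      qed (use prev in \<open>simp add: G_def\<close>)
    qed
    also have "(1 - (1 - exp (-1)) * q ^ T) powr x = exp (x * ln V)"
      using V by (simp add: powr_def V_def)
    also have "x * ln V = - 2 * y" using yx by (simp add: mult.commute)
    also have "exp y * exp (- 2 * y) = exp (- b * real n)" by (simp add: exp_add[symmetric] y_def)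
    finally show "N.prob B3 \<le> exp (- b * real n)" unfolding B3_def S .
  qed
  have sub: "{\<omega>\<in>space (noise \<delta> L). real (card (young_times \<delta> c P L \<omega> n)) \<le> b * real n} \<subseteq> B0 \<union> (BF (curve1 P) \<union> (BF (curve2 P) \<union> B3))"
  proof
    fix \<omega> assume \<omega>: "\<omega> \<in> {\<omega>\<in>space (noise \<delta> L). real (card (young_times \<delta> c P L \<omega> n)) \<le> b * real n}"
    then have \<omega>S: "\<omega> \<in> space (noise \<delta> L)" by simp
    show "\<omega> \<in> B0 \<union> (BF (curve1 P) \<union> (BF (curve2 P) \<union> B3))"
    proof (rule ccontr)
      assume "\<not> ?thesis"
      then have nB: "\<omega> \<notin> B0" "\<omega> \<notin> BF (curve1 P)" "\<omega> \<notin> BF (curve2 P)" "\<omega> \<notin> B3" by auto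
      define Nb where "Nb = card {k. k < 3 * n \<and> bad k \<omega>}"
      have Nb: "real Nb < real n / 100" using nB(1) \<omega>S by (simp add: B0_def Nb_def)
      define F0 where "F0 = {i. 1 \<le> i \<and> i \<le> n \<and> \<not> orbit_ok P L \<omega> i}"
      have "card F0 \<le> 2 + 10 * Nb"
        unfolding F0_def Nb_def bad_def z_def z'_def
        by (rule card_orbit_not_ok[OF L h(1) e2(1) hc(1) h(2) v init[unfolded z_def z'_def]])
      then have F0: "real (card F0) \<le> 2 + real n / 10" using Nb by linarith
      define H where "H \<gamma> = {i. 1 \<le> i \<and> i \<le> n \<and> \<not> hyperbolic_at c L \<omega> \<gamma> i}" for \<gamma>
      have H: "real (card (H \<gamma>)) \<le> real n / 10" if "\<omega> \<notin> BF \<gamma>" for \<gamma>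
      proof -
        have 1: "{1..n} = H \<gamma> \<union> {i. hyperbolic_at c L \<omega> \<gamma> i \<and> i \<le> n}"
          using c by (auto simp: H_def hyperbolic_at_def)
        have fin: "finite (H \<gamma>)" "finite {i. hyperbolic_at c L \<omega> \<gamma> i \<and> i \<le> n}"
          by (auto intro: finite_subset[of _ "{..n}"] simp: H_def)
        have "n = card (H \<gamma>) + card {i. hyperbolic_at c L \<omega> \<gamma> i \<and> i \<le> n}"
          using card_Un_disjoint[OF fin] 1[symmetric] by (auto simp: H_def)
        moreover have "(1 - \<delta>1) * real n < real (card {i. hyperbolic_at c L \<omega> \<gamma> i \<and> i \<le> n})"
          using that \<omega>S unfolding BF_def card_tau[OF c] by simp
        ultimately have "real (card (H \<gamma>)) < \<delta>1 * real n" by (simp add: algebra_simps)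
        also have "\<dots> \<le> 1/10 * real n" using \<delta>1 by (intro mult_right_mono) auto
        finally show ?thesis by simp
      qed
      define Sm where "Sm = {i. sim_hyperbolic c P L \<omega> i \<and> 1 \<le> i \<and> i \<le> n}"
      have "{1..n} \<subseteq> Sm \<union> (F0 \<union> (H (curve1 P) \<union> H (curve2 P)))"
        by (auto simp: Sm_def F0_def H_def sim_hyperbolic_def)
      moreover have "finite (Sm \<union> (F0 \<union> (H (curve1 P) \<union> H (curve2 P))))"
        by (rule finite_subset[of _ "{..n}"]) (auto simp: Sm_def F0_def H_def)
      ultimately have "card {1..n} \<le> card (Sm \<union> (F0 \<union> (H (curve1 P) \<union> H (curve2 P))))" by (intro card_mono)
      also have "\<dots> \<le> card Sm + (card F0 + (card (H (curve1 P)) + card (H (curve2 P))))"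
        by (intro order_trans[OF card_Un_le] add_left_mono card_Un_le)
      finally have "real n \<le> real (card Sm) + (real (card F0) + (real (card (H (curve1 P))) + real (card (H (curve2 P)))))"
        by simp
      \<comment> \<open>Three losses of \<open>n / 10\<close> leave seven tenths;
        \<open>n \<ge> 20\<close> absorbs the constant 2.\<close>
      then have Sm: "real n * (6/10) \<le> real (card Sm)" using F0 H[OF nB(2)] H[OF nB(3)] n by simp
      define CR where "CR = card {i. is_renewal c P L \<omega> i \<and> i \<le> n}"
      have "card Sm \<le> K + (K + 1) * CR"
        unfolding Sm_def K_def CR_def by (rule card_sim_hyperbolic_le[OF c])
      then have "real (card Sm) \<le> real K + (real K + 1) * real CR"
        by (metis (mono_tags, lifting) of_nat_1 of_nat_add of_nat_le_iff of_nat_mult)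
      then have "real n / 4 \<le> (real K + 1) * real CR" using Sm n by linarith
      then have CR: "x \<le> real CR" by (simp add: x_def field_simps)
      have "{k. k + T \<le> 3 * n + T \<and> R k \<omega>} = (\<lambda>i. 3 * i) ` {i. is_renewal c P L \<omega> i \<and> i \<le> n}"
        by (auto simp: R_def elim!: dvdE)
      then have "card {k. k + T \<le> 3 * n + T \<and> R k \<omega>} = CR"
        unfolding CR_def by (simp add: card_image inj_on_def)
      then have "y < real (card {k. k + T \<le> 3 * n + T \<and> R k \<omega> \<and> (\<forall>i\<in>{k..<k+T}. G k i \<omega>)})"
        using nB(4) \<omega>S CR by (simp add: B3_def)
      also have "card {k. k + T \<le> 3 * n + T \<and> R k \<omega> \<and> (\<forall>i\<in>{k..<k+T}. G k i \<omega>)} \<le> card (young_times \<delta> c P L \<omega> n)"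
      proof (rule card_inj_on_le[of "\<lambda>k. k div 3"])
        show "inj_on (\<lambda>k. k div 3) {k. k + T \<le> 3 * n + T \<and> R k \<omega> \<and> (\<forall>i\<in>{k..<k+T}. G k i \<omega>)}"
          by (auto simp: inj_on_def R_def elim!: dvdE)
        show "finite (young_times \<delta> c P L \<omega> n)"
          by (rule finite_subset[of _ "{..n}"]) (auto simp: young_times_def)
        show "(\<lambda>k. k div 3) ` {k. k + T \<le> 3 * n + T \<and> R k \<omega> \<and> (\<forall>i\<in>{k..<k+T}. G k i \<omega>)} \<subseteq> young_times \<delta> c P L \<omega> n"
        proof (rule image_subsetI)
          fix k assume k: "k \<in> {k. k + T \<le> 3 * n + T \<and> R k \<omega> \<and> (\<forall>i\<in>{k..<k+T}. G k i \<omega>)}"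
          then obtain i where i: "k = 3 * i" by (auto simp: R_def elim!: dvdE)
          then have ren: "is_renewal c P L \<omega> i" and "i \<le> n" using k by (auto simp: R_def)
          then have ok: "orbit_ok P L \<omega> i" using is_renewal_iff[OF c, of P L \<omega> i] by (simp add: sim_hyperbolic_def)
          have "young_time \<delta> c P L \<omega> i"
          proof (rule young_time_of_chain[OF ren ok \<omega>S K1 _ R1 R2 \<sigma>(1) hc(2) \<sigma>(2,3)])
            fix j assume "3 * i \<le> j" "j < 3 * i + 3 * (K1 P + K2 P)"
            then show "chain_ok L (marked_point (curve1 P)) (marked_point (curve2 P)) h hc2 (3 * K1 P) p p' r (3 * i) j \<omega>"
              using k i by (auto simp: G_def T_def K_def z_def z'_def)
          qed
          then show "k div 3 \<in> young_times \<delta> c P L \<omega> n" using i \<open>i \<le> n\<close> by (simp add: young_times_def)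
        qed
      qed
      finally show False using \<omega> by (simp add: y_def)
    qed
  qed
  have BF': "BF (curve1 P) \<in> sets (noise \<delta> L)" "BF (curve2 P) \<in> sets (noise \<delta> L)" "N.prob (BF (curve1 P)) \<le> F" "N.prob (BF (curve2 P)) \<le> F"
    using BF by auto
  have "N.prob {\<omega>\<in>space (noise \<delta> L). real (card (young_times \<delta> c P L \<omega> n)) \<le> b * real n} \<le> N.prob (B0 \<union> (BF (curve1 P) \<union> (BF (curve2 P) \<union> B3)))"
    using sub B0 BF' B3 by (intro N.finite_measure_mono) auto
  also have "\<dots> \<le> N.prob B0 + (N.prob (BF (curve1 P)) + (N.prob (BF (curve2 P)) + N.prob B3))"
    using B0 BF' B3 by (intro order_trans[OF measure_Un_le] add_left_mono order_trans[OF measure_Un_le[of "BF (curve1 P)"]] measure_Un_le) auto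
  also have "\<dots> \<le> exp (- 3 * real n) + (F + (F + exp (- b * real n)))"
    using B0 BF' B3 by (intro add_mono) auto
  finally show ?thesis .
qed

section \<open>Expansion of curves away from the critical set\<close>

locale moving_curve =
  fixes L :: real and \<omega> :: "nat \<Rightarrow> real" and l :: real and \<gamma> g' :: "real \<Rightarrow> real \<times> real"
  assumes l: "l > 0"
    and deriv: "\<And>t. t \<in> {-l..l} \<Longrightarrow> (\<gamma> has_vector_derivative g' t) (at t within {-l..l})"
    and cont_g': "continuous_on {-l..l} g'"
    and unit: "\<And>t. t \<in> {-l..l} \<Longrightarrow> norm (g' t) = 1"
begin

text \<open>The tangent of the image curve after \<open>m\<close> single steps, see
  \<open>curve_derivative\<close>; its norm integrates to the length.\<close>

definition V :: "nat \<Rightarrow> real \<Rightarrow> real \<times> real" where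
  "V m t = lift_deriv L \<omega> m (\<gamma> t) (g' t)"

definition X :: "nat \<Rightarrow> real \<Rightarrow> real" where
  "X m t = orbit_x L \<omega> m (\<gamma> t)"

lemma V_Suc: "fst (V (Suc m) t) = next_v L (X m t) (fst (V m t)) (snd (V m t)) (\<omega> m)" "snd (V (Suc m) t) = fst (V m t)"
  by (simp_all add: V_def X_def)

lemma V_nonzero: "t \<in> {-l..l} \<Longrightarrow> V m t \<noteq> 0"
  unfolding V_def using unit[of t] by (intro lift_deriv_nonzero) auto

lemma curve_derivative:
  assumes "t \<in> {-l..l}" "S \<subseteq> {-l..l}"
  shows "((lift_iter L \<omega> m \<circ> \<gamma>) has_vector_derivative V m t) (at t within S)"
proof -
  have "(lift_iter L \<omega> m has_derivative lift_deriv L \<omega> m (\<gamma> t)) (at (\<gamma> t) within \<gamma> ` {-l..l})"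
    using has_derivative_lift_iter by (rule has_derivative_at_withinI)
  from vector_derivative_diff_chain_within[OF deriv[OF assms(1)] this]
  show ?thesis unfolding V_def using assms(2) by (rule has_vector_derivative_within_subset)
qed

lemma continuous_curve: "continuous_on {-l..l} (\<lambda>t. lift_iter L \<omega> m (\<gamma> t))"
proof -
  have "continuous_on {-l..l} (lift_iter L \<omega> m \<circ> \<gamma>)"
    using curve_derivative by (intro continuous_on_vector_derivative) blast
  then show ?thesis by (simp add: o_def)
qed

lemma continuous_V: "continuous_on {-l..l} (V m)"
proof (induction m)
  case 0 then show ?case using cont_g' by (simp add: V_def[abs_def])
next
  case (Suc m)
  have eq: "V (Suc m) = (\<lambda>t. (next_v L (fst (lift_iter L \<omega> m (\<gamma> t))) (fst (V m t)) (snd (V m t)) (\<omega> m), fst (V m t)))"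
    by (auto simp: fun_eq_iff prod_eq_iff V_Suc X_def orbit_x_def)
  show ?case unfolding eq next_v_def by (intro continuous_intros continuous_curve Suc)
qed

lemma continuous_norm_V: "S \<subseteq> {-l..l} \<Longrightarrow> continuous_on S (\<lambda>t. norm (V m t))"
  by (intro continuous_on_norm continuous_on_subset[OF continuous_V])

lemma integrable_norm_V: "{p..q} \<subseteq> {-l..l} \<Longrightarrow> (\<lambda>t. norm (V m t)) integrable_on {p..q}"
  by (intro integrable_continuous_real continuous_norm_V)

lemma vector_derivative_curve:
  assumes "p < q" "{p..q} \<subseteq> {-l..l}" "t \<in> {p..q}"
  shows "vector_derivative (lift_iter L \<omega> m \<circ> \<gamma>) (at t within {p..q}) = V m t"
  using assms curve_derivative[of t "{p..q}" m]
  by (intro vector_derivative_within_cbox[of p q, unfolded box_real]) auto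

lemma curve_length_eq:
  assumes "p \<le> q" "{p..q} \<subseteq> {-l..l}"
  shows "curve_length (lift_iter L \<omega> m \<circ> \<gamma>) p q = integral {p..q} (\<lambda>t. norm (V m t))"
proof (cases "p = q")
  case True then show ?thesis by (simp add: curve_length_def)
next
  case False
  then show ?thesis unfolding curve_length_def
    using assms vector_derivative_curve[of p q] by (intro integral_cong) auto
qed

lemma displacement_le:
  assumes "p \<le> q" "{p..q} \<subseteq> {-l..l}"
  shows "\<bar>X m q - X m p\<bar> \<le> integral {p..q} (\<lambda>t. norm (V m t))"
proof -
  have "((\<lambda>t. V m t) has_integral ((lift_iter L \<omega> m \<circ> \<gamma>) q - (lift_iter L \<omega> m \<circ> \<gamma>) p)) {p..q}"
    using assms by (intro fundamental_theorem_of_calculus curve_derivative) auto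
  then have i: "V m integrable_on {p..q}" "integral {p..q} (V m) = (lift_iter L \<omega> m \<circ> \<gamma>) q - (lift_iter L \<omega> m \<circ> \<gamma>) p"
    by (auto intro: has_integral_integrable integral_unique)
  have "norm (integral {p..q} (V m)) \<le> integral {p..q} (\<lambda>t. norm (V m t))"
    by (rule integral_norm_bound_integral[OF i(1) integrable_norm_V[OF assms(2)]]) simp
  then have "norm (lift_iter L \<omega> m (\<gamma> q) - lift_iter L \<omega> m (\<gamma> p)) \<le> integral {p..q} (\<lambda>t. norm (V m t))"
    by (simp only: i(2) o_apply)
  then show ?thesis
    using dist_fst_le[of "lift_iter L \<omega> m (\<gamma> q)" "lift_iter L \<omega> m (\<gamma> p)"]
    by (simp add: X_def orbit_x_def dist_norm)
qed

lemma integral_subinterval_le: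
  assumes "{p..q} \<subseteq> {p'..q'}" "{p'..q'} \<subseteq> {-l..l}"
  shows "integral {p..q} (\<lambda>t. norm (V m t)) \<le> integral {p'..q'} (\<lambda>t. norm (V m t))"
  using assms by (intro integral_subset_le integrable_norm_V) auto

text \<open>Off the critical set \<open>\<bar>sin (2 * pi * (x + w))\<bar>\<close> is at least
  \<eta>, so the first component gains \<open>2 * pi * L * \<eta> \<ge> 6 * L * \<eta>\<close>. The
  second component takes back at most one \<open>L * \<eta>\<close>, leaving 5; a vector in the cone
  has norm at most twice its first component, which gives the factor 2.\<close>

lemma step_expansion:
  assumes \<eta>: "0 < \<eta>" "1 \<le> L * \<eta>" and c: "\<bar>snd (V m t)\<bar> \<le> \<bar>fst (V m t)\<bar>" and a: "\<eta> \<le> circle_norm (2 * (X m t + \<omega> m))"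
  shows "5 * L * \<eta> * \<bar>snd (V (Suc m) t)\<bar> \<le> \<bar>fst (V (Suc m) t)\<bar>" "\<bar>snd (V (Suc m) t)\<bar> \<le> \<bar>fst (V (Suc m) t)\<bar>"
    "2 * L * \<eta> * norm (V m t) \<le> norm (V (Suc m) t)"
proof -
  have L: "L > 0" using \<eta> by (metis less_le_trans mult_nonpos_nonneg not_less order_less_imp_le zero_less_one)
  define A B where "A = fst (V m t)" and "B = snd (V m t)"
  define s where "s = sin (2 * pi * (X m t + \<omega> m))"
  have "\<eta> \<le> \<bar>s\<bar>" using a circle_norm_le_abs_sin[of "2 * (X m t + \<omega> m)"] by (simp add: s_def mult.left_commute mult.assoc)
  then have "2 * 3 * L * \<eta> * \<bar>A\<bar> \<le> 2 * pi * L * \<bar>s\<bar> * \<bar>A\<bar>"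
    using L \<eta> pi_gt3 by (intro mult_right_mono mult_mono) auto
  moreover have "\<bar>next_v L (X m t) A B (\<omega> m)\<bar> \<ge> \<bar>2 * pi * L * s * A\<bar> - \<bar>B\<bar>"
    unfolding next_v_def s_def[symmetric] by simp
  moreover have "\<bar>2 * pi * L * s * A\<bar> = 2 * pi * L * \<bar>s\<bar> * \<bar>A\<bar>" using L by (simp add: abs_mult)
  moreover have "\<bar>B\<bar> \<le> L * \<eta> * \<bar>A\<bar>" using c \<eta> mult_right_mono[of 1 "L * \<eta>" "\<bar>A\<bar>"] by (simp add: A_def B_def)
  ultimately have ge: "5 * L * \<eta> * \<bar>A\<bar> \<le> \<bar>next_v L (X m t) A B (\<omega> m)\<bar>" by linarith
  then show 1: "5 * L * \<eta> * \<bar>snd (V (Suc m) t)\<bar> \<le> \<bar>fst (V (Suc m) t)\<bar>" by (simp add: V_Suc A_def B_def)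
  have "1 * \<bar>snd (V (Suc m) t)\<bar> \<le> 5 * L * \<eta> * \<bar>snd (V (Suc m) t)\<bar>" using \<eta> by (intro mult_right_mono) auto
  then show "\<bar>snd (V (Suc m) t)\<bar> \<le> \<bar>fst (V (Suc m) t)\<bar>" using 1 by simp
  have "norm (V m t) \<le> \<bar>A\<bar> + \<bar>B\<bar>"
    using norm_Pair_le[of A B] by (simp add: A_def B_def)
  also have "\<dots> \<le> 2 * \<bar>A\<bar>" using c by (simp add: A_def B_def)
  finally have "2 * L * \<eta> * norm (V m t) \<le> 2 * L * \<eta> * (2 * \<bar>A\<bar>)" using L \<eta> by (intro mult_left_mono) auto
  also have "\<dots> \<le> 5 * L * \<eta> * \<bar>A\<bar>" using L \<eta> by simp
  also have "\<dots> \<le> \<bar>fst (V (Suc m) t)\<bar>" using ge by (simp add: V_Suc A_def B_def)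
  also have "\<dots> \<le> norm (V (Suc m) t)" using norm_fst_le[of "fst (V (Suc m) t)" "snd (V (Suc m) t)"] by simp
  finally show "2 * L * \<eta> * norm (V m t) \<le> norm (V (Suc m) t)" .
qed

text \<open>Avoidance is known only along the marked orbit, with margin \<open>2 * \<eta>\<close>.
  While the image has length at most \<open>\<eta> / 2\<close>, every other doubled coordinate is
  within \<eta> of the marked one, so margin \<eta> remains on the whole piece.\<close>

lemma interval_expansion:
  assumes \<eta>: "0 < \<eta>" "1 \<le> L * \<eta>" and pq: "p \<le> 0" "0 \<le> q" "{p..q} \<subseteq> {-l..l}"
    and c: "\<And>t. t \<in> {p..q} \<Longrightarrow> \<bar>snd (V m t)\<bar> \<le> \<bar>fst (V m t)\<bar>"
    and a: "\<And>r. r < n \<Longrightarrow> 2 * \<eta> \<le> circle_norm (2 * (X (m + r) 0 + \<omega> (m + r)))"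
    and s: "\<And>r. r < n \<Longrightarrow> integral {p..q} (\<lambda>t. norm (V (m + r) t)) \<le> \<eta> / 2"
  shows "r \<le> n \<Longrightarrow> (\<forall>t\<in>{p..q}. \<bar>snd (V (m + r) t)\<bar> \<le> \<bar>fst (V (m + r) t)\<bar> \<and> (0 < r \<longrightarrow> 5 * L * \<eta> * \<bar>snd (V (m + r) t)\<bar> \<le> \<bar>fst (V (m + r) t)\<bar>)) \<and>
    (2 * L * \<eta>) ^ r * integral {p..q} (\<lambda>t. norm (V m t)) \<le> integral {p..q} (\<lambda>t. norm (V (m + r) t)) \<and>
    (\<forall>r'<r. integral {p..q} (\<lambda>t. norm (V (m + r') t)) \<le> integral {p..q} (\<lambda>t. norm (V (m + r) t)))"
proof (induction r)
  case 0 then show ?case using c by simp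
next
  case (Suc r)
  then have r: "r < n" by simp
  let ?I = "\<lambda>r. integral {p..q} (\<lambda>t. norm (V (m + r) t))"
  have IH: "\<And>t. t \<in> {p..q} \<Longrightarrow> \<bar>snd (V (m + r) t)\<bar> \<le> \<bar>fst (V (m + r) t)\<bar>"
    "(2 * L * \<eta>) ^ r * ?I 0 \<le> ?I r" "\<And>r'. r' < r \<Longrightarrow> ?I r' \<le> ?I r"
    using Suc by auto
  have av: "\<eta> \<le> circle_norm (2 * (X (m + r) t + \<omega> (m + r)))" if t: "t \<in> {p..q}" for t
  proof -
    have "\<bar>X (m + r) t - X (m + r) 0\<bar> \<le> ?I r"
    proof (cases "0 \<le> t")
      case True
      then have "\<bar>X (m + r) t - X (m + r) 0\<bar> \<le> integral {0..t} (\<lambda>t. norm (V (m + r) t))"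
        using t pq by (intro displacement_le) auto
      also have "\<dots> \<le> ?I r" using t pq by (intro integral_subinterval_le) auto
      finally show ?thesis .
    next
      case False
      then have "\<bar>X (m + r) 0 - X (m + r) t\<bar> \<le> integral {t..0} (\<lambda>t. norm (V (m + r) t))"
        using t pq by (intro displacement_le) auto
      also have "\<dots> \<le> ?I r" using t pq by (intro integral_subinterval_le) auto
      finally show ?thesis by (simp add: abs_minus_commute)
    qed
    then have d: "\<bar>X (m + r) t - X (m + r) 0\<bar> \<le> \<eta> / 2" using s[OF r] by linarith
    have "\<bar>circle_norm (2 * (X (m + r) t + \<omega> (m + r))) - circle_norm (2 * (X (m + r) 0 + \<omega> (m + r)))\<bar> \<le> \<bar>2 * (X (m + r) t + \<omega> (m + r)) - 2 * (X (m + r) 0 + \<omega> (m + r))\<bar>"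
      by (rule circle_norm_diff_le)
    also have "2 * (X (m + r) t + \<omega> (m + r)) - 2 * (X (m + r) 0 + \<omega> (m + r)) = 2 * (X (m + r) t - X (m + r) 0)" by simp
    also have "\<bar>\<dots>\<bar> = 2 * \<bar>X (m + r) t - X (m + r) 0\<bar>" by (simp only: abs_mult abs_numeral)
    finally have e: "\<bar>circle_norm (2 * (X (m + r) t + \<omega> (m + r))) - circle_norm (2 * (X (m + r) 0 + \<omega> (m + r)))\<bar> \<le> 2 * \<bar>X (m + r) t - X (m + r) 0\<bar>" .
    have "\<eta> \<le> c1" if "\<bar>c1 - c0\<bar> \<le> 2 * u" "u \<le> \<eta> / 2" "2 * \<eta> \<le> c0" for c0 c1 u :: real
      using that by linarith
    from this[OF e d a[OF r]] show ?thesis .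
  qed
  note st = step_expansion[OF \<eta> IH(1) av]
  have L: "0 \<le> 2 * L * \<eta>" "1 \<le> 2 * L * \<eta>" using \<eta> by auto
  have "2 * L * \<eta> * ?I r = integral {p..q} (\<lambda>t. 2 * L * \<eta> * norm (V (m + r) t))" by simp
  also have "\<dots> \<le> ?I (Suc r)"
    using st(3) integrable_norm_V[OF pq(3)] by (intro integral_le integrable_on_mult_right) auto
  finally have grow: "2 * L * \<eta> * ?I r \<le> ?I (Suc r)" .
  have I0: "0 \<le> ?I r" by (intro integral_nonneg integrable_norm_V pq) auto
  have "(2 * L * \<eta>) ^ Suc r * ?I 0 \<le> 2 * L * \<eta> * ?I r"
    using IH(2) L mult_left_mono[OF IH(2) L(1)] by (simp add: mult.assoc)
  then have "(2 * L * \<eta>) ^ Suc r * ?I 0 \<le> ?I (Suc r)" using grow by linarith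
  moreover have "?I r \<le> ?I (Suc r)" using grow I0 mult_right_mono[OF L(2) I0] by linarith
  then have "?I r' \<le> ?I (Suc r)" if "r' < Suc r" for r'
    using IH(3)[of r'] that by (cases "r' = r") auto
  ultimately show ?case using st(1,2) by auto
qed

text \<open>The parameter interval is shrunk by \<open>s\<close> towards the marked parameter 0.
  Prescribing the maximum of the lengths over all intermediate times, not just the last length,
  keeps every earlier image short enough for \<open>interval_expansion\<close>.\<close>

primrec max_length :: "nat \<Rightarrow> nat \<Rightarrow> real \<Rightarrow> real \<Rightarrow> real \<Rightarrow> real" where
  "max_length m 0 p q s = integral {s * p..s * q} (\<lambda>t. norm (V m t))"
| "max_length m (Suc n) p q s = max (max_length m n p q s) (integral {s * p..s * q} (\<lambda>t. norm (V (m + Suc n) t)))"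

lemma max_length_ge: "r \<le> n \<Longrightarrow> integral {s * p..s * q} (\<lambda>t. norm (V (m + r) t)) \<le> max_length m n p q s"
  by (induction n) (auto simp: le_Suc_eq le_max_iff_disj)

lemma max_length_attained: "\<exists>r\<le>n. max_length m n p q s = integral {s * p..s * q} (\<lambda>t. norm (V (m + r) t))"
proof (induction n)
  case 0 then show ?case by simp
next
  case (Suc n)
  then obtain r where r: "r \<le> n" "max_length m n p q s = integral {s * p..s * q} (\<lambda>t. norm (V (m + r) t))" by blast
  show ?case
  proof (cases "max_length m n p q s \<ge> integral {s * p..s * q} (\<lambda>t. norm (V (m + Suc n) t))")
    case True then show ?thesis using r by (intro exI[of _ r]) (simp add: max_def)
  next
    case False then show ?thesis by (intro exI[of _ "Suc n"]) (simp add: max_def)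
  qed
qed

lemma continuous_max_length:
  assumes pq: "p \<le> 0" "0 \<le> q" "{p..q} \<subseteq> {-l..l}"
  shows "continuous_on {0..1} (max_length m n p q)"
proof -
  have c: "continuous_on {0..1} (\<lambda>s. integral {s * p..s * q} (\<lambda>t. norm (V k t)))" for k
  proof -
    let ?G = "\<lambda>x. integral {p..x} (\<lambda>t. norm (V k t))"
    have G: "continuous_on {p..q} ?G" by (rule indefinite_integral_continuous_1[OF integrable_norm_V[OF pq(3)]])
    have b: "p \<le> s * p" "s * p \<le> 0" "0 \<le> s * q" "s * q \<le> q" if "s \<in> {0..1}" for s
      using that pq mult_right_mono_neg[of s 1 p] mult_right_mono[of s 1 q] by (auto simp: mult_nonneg_nonpos)
    have eq: "integral {s * p..s * q} (\<lambda>t. norm (V k t)) = ?G (s * q) - ?G (s * p)" if "s \<in> {0..1}" for s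
    proof -
      have "?G (s * p) + integral {s * p..s * q} (\<lambda>t. norm (V k t)) = ?G (s * q)"
        using b[OF that] pq by (intro Henstock_Kurzweil_Integration.integral_combine integrable_norm_V) auto
      then show ?thesis by linarith
    qed
    have "continuous_on {0..1} (\<lambda>s. ?G (s * q) - ?G (s * p))"
    proof (intro continuous_on_diff continuous_on_compose2[OF G] continuous_intros image_subsetI)
      show "s * q \<in> {p..q}" "s * p \<in> {p..q}" if "s \<in> {0..1}" for s
        unfolding atLeastAtMost_iff using b[OF that] pq(1,2) by linarith+
    qed
    then show ?thesis by (subst continuous_on_cong[OF refl eq])
  qed
  show ?thesis
  proof (induction n)
    case 0 then show ?case using c[of m] by (simp cong: continuous_on_cong)
  next
    case (Suc n)
    have "max_length m (Suc n) p q = (\<lambda>s. max (max_length m n p q s) (integral {s * p..s * q} (\<lambda>t. norm (V (m + Suc n) t))))"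
      by (simp add: fun_eq_iff)
    then show ?case using continuous_on_max[OF Suc c[of "m + Suc n"]] by simp
  qed
qed

text \<open>The intermediate value theorem in the shrinking factor fixes the maximal length at
  \<open>\<eta> / 2\<close>. Under this restriction the lengths do not decrease in time, so the
  final image has exactly this length.\<close>

lemma curve_expansion:
  assumes \<eta>: "0 < \<eta>" "1 \<le> L * \<eta>" and pq: "p \<le> 0" "0 \<le> q" "{p..q} \<subseteq> {-l..l}" and n: "0 < n"
    and c: "\<And>t. t \<in> {p..q} \<Longrightarrow> \<bar>snd (V m t)\<bar> \<le> \<bar>fst (V m t)\<bar>"
    and a: "\<And>r. r < n \<Longrightarrow> 2 * \<eta> \<le> circle_norm (2 * (X (m + r) 0 + \<omega> (m + r)))"
    and long: "\<eta> / 2 \<le> (2 * L * \<eta>) ^ n * integral {p..q} (\<lambda>t. norm (V m t))"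
  obtains p' q' where "p \<le> p'" "p' \<le> 0" "0 \<le> q'" "q' \<le> q" "integral {p'..q'} (\<lambda>t. norm (V (m + n) t)) = \<eta> / 2"
    "\<And>t. t \<in> {p'..q'} \<Longrightarrow> 5 * L * \<eta> * \<bar>snd (V (m + n) t)\<bar> \<le> \<bar>fst (V (m + n) t)\<bar>"
proof -
  have "\<exists>s\<in>{0..1}. max_length m n p q s = \<eta> / 2"
  proof -
    have "max_length m n p q 0 = 0" using max_length_attained[of n m p q 0] by auto
    \<comment> \<open>If the unshrunk piece stayed shorter than \<open>\<eta> / 2\<close>
      throughout, it would expand \<open>n\<close> times and contradict \<open>long\<close>.\<close>
    moreover have "\<eta> / 2 \<le> max_length m n p q 1"
    proof (rule ccontr)
      assume neg: "\<not> ?thesis"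
      have "integral {p..q} (\<lambda>t. norm (V (m + r) t)) \<le> \<eta> / 2" if "r \<le> n" for r
        using max_length_ge[OF that, of 1 p q m] neg by simp
      then have "(2 * L * \<eta>) ^ n * integral {p..q} (\<lambda>t. norm (V m t)) \<le> integral {p..q} (\<lambda>t. norm (V (m + n) t))"
        using interval_expansion[OF \<eta> pq c a, where n=n and r=n] by simp
      then have "\<eta> / 2 \<le> integral {p..q} (\<lambda>t. norm (V (m + n) t))" using long by linarith
      then show False using max_length_ge[OF order_refl, of 1 p q m n] neg by simp
    qed
    ultimately show ?thesis
      using IVT'[OF _ _ zero_le_one continuous_max_length[OF pq], of m n "\<eta> / 2"] \<eta>(1)
      by (simp add: Bex_def)
  qed
  then obtain s where s: "0 \<le> s" "s \<le> 1" "max_length m n p q s = \<eta> / 2" by auto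
  have b: "p \<le> s * p" "s * p \<le> 0" "0 \<le> s * q" "s * q \<le> q"
    using s pq mult_right_mono_neg[of s 1 p] mult_right_mono[of s 1 q] by (auto simp: mult_nonneg_nonpos)
  have le: "integral {s * p..s * q} (\<lambda>t. norm (V (m + r) t)) \<le> \<eta> / 2" if "r \<le> n" for r
    using max_length_ge[OF that, of s p q m] s by simp
  have sub: "{s * p..s * q} \<subseteq> {-l..l}" using b pq by auto
  have c': "\<And>t. t \<in> {s * p..s * q} \<Longrightarrow> \<bar>snd (V m t)\<bar> \<le> \<bar>fst (V m t)\<bar>" using c b by auto
  have exp: "(\<forall>t\<in>{s * p..s * q}. \<bar>snd (V (m + n) t)\<bar> \<le> \<bar>fst (V (m + n) t)\<bar> \<and> (0 < n \<longrightarrow> 5 * L * \<eta> * \<bar>snd (V (m + n) t)\<bar> \<le> \<bar>fst (V (m + n) t)\<bar>)) \<and>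
    (2 * L * \<eta>) ^ n * integral {s * p..s * q} (\<lambda>t. norm (V m t)) \<le> integral {s * p..s * q} (\<lambda>t. norm (V (m + n) t)) \<and>
    (\<forall>r'<n. integral {s * p..s * q} (\<lambda>t. norm (V (m + r') t)) \<le> integral {s * p..s * q} (\<lambda>t. norm (V (m + n) t)))"
    by (rule interval_expansion[OF \<eta> b(2,3) sub c' a]) (use le in auto)
  obtain r where r: "r \<le> n" "\<eta> / 2 = integral {s * p..s * q} (\<lambda>t. norm (V (m + r) t))"
    using max_length_attained[of n m p q s] s by auto
  have "\<eta> / 2 \<le> integral {s * p..s * q} (\<lambda>t. norm (V (m + n) t))"
    using r exp by (cases "r = n") auto
  then have "integral {s * p..s * q} (\<lambda>t. norm (V (m + n) t)) = \<eta> / 2" using le[of n] by simp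
  then show ?thesis using that[of "s * p" "s * q"] b exp n by blast
qed

end

lemma vector_derivative_bound_lipschitz:
  fixes f :: "real \<Rightarrow> 'a::real_normed_vector"
  assumes "\<And>t. t \<in> {a..b} \<Longrightarrow> (f has_vector_derivative f' t) (at t within {a..b})" "\<And>t. t \<in> {a..b} \<Longrightarrow> norm (f' t) \<le> B"
    and "x \<in> {a..b}" "y \<in> {a..b}"
  shows "norm (f x - f y) \<le> B * \<bar>x - y\<bar>"
proof -
  have "norm (f x - f y) \<le> B * norm (x - y)"
  proof (rule differentiable_bound[of "{a..b}" f "\<lambda>t h. h *\<^sub>R f' t"])
    show "(f has_derivative (\<lambda>h. h *\<^sub>R f' t)) (at t within {a..b})" if "t \<in> {a..b}" for t
      using assms(1)[OF that] by (simp add: has_vector_derivative_def)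
    show "onorm (\<lambda>h. h *\<^sub>R f' t) \<le> B" if "t \<in> {a..b}" for t
    proof (rule onorm_le)
      show "norm (h *\<^sub>R f' t) \<le> B * norm h" for h
        using mult_right_mono[OF assms(2)[OF that], of "norm h"] by (simp add: mult.commute)
    qed
  qed (use assms in auto)
  then show ?thesis by simp
qed

lemma cone_perturb:
  fixes u w :: "real \<times> real"
  assumes "norm u = 1" "\<bar>snd u\<bar> \<le> \<bar>fst u\<bar> / 2" "norm (w - u) \<le> 1/8"
  shows "\<bar>snd w\<bar> \<le> \<bar>fst w\<bar>"
proof -
  have n: "(fst u)\<^sup>2 + (snd u)\<^sup>2 = 1" using assms(1) by (simp add: norm_prod_def)
  have f: "1/2 \<le> \<bar>fst u\<bar>"
  proof (rule ccontr)
    assume "\<not> ?thesis"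
    then have "\<bar>fst u\<bar>\<^sup>2 \<le> (1/2)\<^sup>2" "\<bar>snd u\<bar>\<^sup>2 \<le> (1/4)\<^sup>2" using assms(2) by (intro power_mono; simp)+
    then show False using n by (simp add: power2_eq_square)
  qed
  have "\<bar>fst w - fst u\<bar> \<le> 1/8" "\<bar>snd w - snd u\<bar> \<le> 1/8"
    using dist_fst_le[of w u] dist_snd_le[of w u] assms(3) by (simp_all add: dist_norm)
  then show ?thesis using f assms(2) by linarith
qed

text \<open>Along the grown image the direction turns at rate at most \<kappa>, so a piece of length
  \<open>ls\<close> at the marked point, with \<open>\<kappa> * ls \<le> 1/8\<close>, inherits the
  cone from the marked tangent. This piece is then expanded through the \<open>3 * k1\<close> single
  steps.\<close>

lemma good_subcurve_of_growth:
  assumes adm: "admissible c \<gamma>" "ell0 c > 0" and L: "0 < \<eta>" "1 \<le> L * \<eta>" "L \<ge> 1" and k1: "k1 \<ge> 1"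
    and gr: "- ell0 c \<le> p0" "p0 \<le> 0" "0 \<le> q0" "q0 \<le> ell0 c" "l0 = curve_length (F_lift L \<omega> i \<circ> \<gamma>) p0 q0"
      "2 * ls \<le> l0" "arclength_C2 0 l0 \<kappa> \<beta>" "\<And>t. t \<in> {p0..q0} \<Longrightarrow> F_lift L \<omega> i (\<gamma> t) = \<beta> (curve_length (F_lift L \<omega> i \<circ> \<gamma>) p0 t)"
    and ls: "0 < ls" "\<kappa> * ls \<le> 1/8" "0 \<le> \<kappa>" "\<eta> / 2 \<le> (2 * L * \<eta>) ^ (3 * k1) * ls"
    and cone: "DF L \<omega> i (marked_point \<gamma>) (marked_tangent \<gamma>) \<in> horizontal_ball r" "r < 1/10"
    and avoid: "\<And>j. j < 3 * k1 \<Longrightarrow> 2 * \<eta> \<le> circle_norm (2 * (orbit_x L \<omega> (3 * i + j) (marked_point \<gamma>) + \<omega> (3 * i + j)))"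
    and hit: "F_iter L \<omega> (i + k1) (marked_point \<gamma>) \<in> I"
  shows "\<exists>p q. good_subcurve c L \<omega> \<gamma> (i + k1) I (\<eta> / 2) (1 / \<eta> / L) p q"
proof -
  define l where "l = ell0 c"
  obtain g' g'' where g: "\<forall>t\<in>{- l..l}. (\<gamma> has_vector_derivative g' t) (at t within {- l..l}) \<and>
      (g' has_vector_derivative g'' t) (at t within {- l..l}) \<and> norm (g' t) = 1 \<and> norm (g'' t) \<le> curv0 c"
    using adm(1) unfolding admissible_def arclength_C2_def l_def by blast
  interpret moving_curve L \<omega> l \<gamma> g'
  proof
    show "continuous_on {-l..l} g'" using g by (intro continuous_on_vector_derivative) blast
  qed (use g adm in \<open>auto simp: l_def\<close>)
  have "(\<gamma> has_vector_derivative g' 0) (at 0 within {-l..l})" using g l by auto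
  moreover have "at 0 within {-l..l} = at 0"
    using l by (intro at_within_interior) (simp add: interior_atLeastAtMost_real)
  ultimately have tangent: "marked_tangent \<gamma> = g' 0" unfolding marked_tangent_def by (auto intro: vector_derivative_at)
  have periodic: "fst (marked_point \<gamma>) - fst (\<gamma> 0) \<in> \<int>" "snd (marked_point \<gamma>) - snd (\<gamma> 0) \<in> \<int>"
    by (simp_all add: marked_point_def torus_proj_def frac_diff_Ints)
  define m where "m = 3 * i"
  have F: "F_lift L \<omega> i = lift_iter L \<omega> m" by (simp add: F_lift_def m_def fun_eq_iff)
  have V0: "V m 0 = DF L \<omega> i (marked_point \<gamma>) (marked_tangent \<gamma>)"
    unfolding V_def DF_eq m_def tangent using lift_deriv_periodic[OF periodic] by simp
  have cone0: "\<bar>snd (V m 0)\<bar> \<le> \<bar>fst (V m 0)\<bar> / 2"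
    using horizontal_ballD(2)[of "fst (V m 0)" "snd (V m 0)" r] cone V0 by simp
  have av: "2 * \<eta> \<le> circle_norm (2 * (X (m + j) 0 + \<omega> (m + j)))" if "j < 3 * k1" for j
  proof -
    obtain d :: int where d: "orbit_x L \<omega> (m + j) (marked_point \<gamma>) - orbit_x L \<omega> (m + j) (\<gamma> 0) = of_int d"
      using orbit_x_cos_cong(1)[OF periodic, of L \<omega> "m + j"] by (meson Ints_cases)
    then have "2 * (orbit_x L \<omega> (m + j) (marked_point \<gamma>) + \<omega> (m + j)) = 2 * (X (m + j) 0 + \<omega> (m + j)) + of_int (2 * d)"
      by (simp add: X_def)
    then have "circle_norm (2 * (orbit_x L \<omega> (m + j) (marked_point \<gamma>) + \<omega> (m + j))) = circle_norm (2 * (X (m + j) 0 + \<omega> (m + j)))"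
      by (simp only: circle_norm_add_Ints Ints_of_int)
    then show ?thesis using avoid[OF that] by (simp add: m_def)
  qed
  have pq0: "{p0..q0} \<subseteq> {-l..l}" using gr by (auto simp: l_def)
  define s where "s t = integral {p0..t} (\<lambda>t. norm (V m t))" for t
  have cl: "curve_length (F_lift L \<omega> i \<circ> \<gamma>) p0 t = s t" if "t \<in> {p0..q0}" for t
    unfolding F s_def using that pq0 by (intro curve_length_eq) auto
  have l0: "l0 = s q0" using gr cl[of q0] by auto
  have p0q0: "p0 < q0"
  proof (rule ccontr)
    assume "\<not> ?thesis"
    then have "p0 = q0" using gr by simp
    then have "l0 = 0" using l0 by (simp add: s_def)
    then show False using gr ls by simp
  qed
  have s_diff: "s t2 - s t1 = integral {t1..t2} (\<lambda>t. norm (V m t))" if "p0 \<le> t1" "t1 \<le> t2" "t2 \<le> q0" for t1 t2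
  proof -
    have "s t1 + integral {t1..t2} (\<lambda>t. norm (V m t)) = s t2"
      unfolding s_def using that pq0 by (intro Henstock_Kurzweil_Integration.integral_combine integrable_norm_V) auto
    then show ?thesis by simp
  qed
  have s_mono: "s t1 \<le> s t2" if "p0 \<le> t1" "t1 \<le> t2" "t2 \<le> q0" for t1 t2
  proof -
    have "{t1..t2} \<subseteq> {-l..l}" using that pq0 by auto
    then have "0 \<le> integral {t1..t2} (\<lambda>t. norm (V m t))" by (intro Henstock_Kurzweil_Integration.integral_nonneg integrable_norm_V) auto
    then show ?thesis using s_diff[OF that] by simp
  qed
  have s_p0: "s p0 = 0" by (simp add: s_def)
  have s_range: "s t \<in> {0..l0}" if "t \<in> {p0..q0}" for t
    using s_mono[of p0 t] s_mono[of t q0] that s_p0 l0 by auto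
  have s_cont: "continuous_on {p0..q0} s"
    unfolding s_def by (rule indefinite_integral_continuous_1[OF integrable_norm_V[OF pq0]])
  have s_deriv: "(s has_vector_derivative norm (V m t)) (at t within {p0..q0})" if "t \<in> {p0..q0}" for t
    unfolding s_def using that by (intro integral_has_vector_derivative continuous_norm_V pq0)
  obtain b' b'' where b: "\<forall>x\<in>{0..l0}. (\<beta> has_vector_derivative b' x) (at x within {0..l0}) \<and>
      (b' has_vector_derivative b'' x) (at x within {0..l0}) \<and> norm (b' x) = 1 \<and> norm (b'' x) \<le> \<kappa>"
    using gr(7) unfolding arclength_C2_def by blast
  have bD: "(\<beta> has_vector_derivative b' x) (at x within {0..l0})" "(b' has_vector_derivative b'' x) (at x within {0..l0})"
    "norm (b' x) = 1" "norm (b'' x) \<le> \<kappa>" if "x \<in> {0..l0}" for x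
    using b that by blast+
  \<comment> \<open>Differentiating the arclength reparametrization and comparing by uniqueness
    transfers the curvature bound of \<beta> to the directions of \<open>V\<close>.\<close>
  have V_b: "V m t = norm (V m t) *\<^sub>R b' (s t)" if t: "t \<in> {p0..q0}" for t
  proof -
    have "(\<beta> has_vector_derivative b' (s t)) (at (s t) within s ` {p0..q0})"
      by (rule has_vector_derivative_within_subset[OF bD(1)[OF s_range[OF t]]], rule image_subsetI, rule s_range)
    from vector_diff_chain_within[OF s_deriv[OF t] this]
    have 1: "((\<beta> \<circ> s) has_vector_derivative norm (V m t) *\<^sub>R b' (s t)) (at t within {p0..q0})" .
    have 2: "((\<beta> \<circ> s) has_vector_derivative V m t) (at t within {p0..q0})"
    proof (rule has_vector_derivative_transform[OF t _ curve_derivative[OF _ pq0, of t m]])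
      show "(\<beta> \<circ> s) t = (lift_iter L \<omega> m \<circ> \<gamma>) t" if "t \<in> {p0..q0}" for t
        using gr(8)[OF that] cl[OF that] by (simp add: F)
    qed (use t pq0 in auto)
    note unique = vector_derivative_within_cbox[of p0 q0 t "\<beta> \<circ> s", unfolded box_real, OF p0q0 t]
    show ?thesis using unique[OF 1] unique[OF 2] by simp
  qed
  have zero: "0 \<in> {p0..q0}" using gr by auto
  have nV0: "norm (V m 0) > 0" using V_nonzero[of 0 m] zero pq0 by auto
  have conej: "\<bar>snd (V m t)\<bar> \<le> \<bar>fst (V m t)\<bar>" if t: "t \<in> {p0..q0}" and d: "\<bar>s t - s 0\<bar> \<le> ls" for t
  proof -
    define u w N where "u = b' (s 0)" and "w = b' (s t)" and "N = norm (V m 0)"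
    have u1: "norm u = 1" using bD(3)[OF s_range[OF zero]] by (simp add: u_def)
    have Vu: "V m 0 = N *\<^sub>R u" using V_b[OF zero] by (simp only: u_def N_def)
    have "N > 0" using nV0 by (simp add: N_def)
    have "\<bar>snd u\<bar> \<le> \<bar>fst u\<bar> / 2" using cone0 \<open>N > 0\<close> by (simp add: Vu abs_mult)
    moreover have "norm (w - u) \<le> \<kappa> * \<bar>s t - s 0\<bar>"
      unfolding u_def w_def
      by (rule vector_derivative_bound_lipschitz[of 0 l0 b' b'', OF bD(2,4) s_range[OF t] s_range[OF zero]])
    then have "norm (w - u) \<le> \<kappa> * ls" using mult_left_mono[OF d ls(3)] by linarith
    then have "norm (w - u) \<le> 1/8" using ls(2) by linarith
    ultimately have "\<bar>snd w\<bar> \<le> \<bar>fst w\<bar>" using u1 by (intro cone_perturb[of u w])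
    then have "norm (V m t) * \<bar>snd w\<bar> \<le> norm (V m t) * \<bar>fst w\<bar>" by (intro mult_left_mono) auto
    moreover have "snd (V m t) = norm (V m t) * snd w" "fst (V m t) = norm (V m t) * fst w"
      using V_b[OF t] by (metis w_def snd_scaleR real_scaleR_def, metis w_def fst_scaleR real_scaleR_def)
    ultimately show ?thesis by (metis abs_mult abs_norm_cancel)
  qed
  \<comment> \<open>The piece lies on one side of the marked point: \<open>2 * ls \<le> l0\<close>
    leaves room for length \<open>ls\<close> on at least one side.\<close>
  obtain t1 t2 where t: "p0 \<le> t1" "t1 \<le> 0" "0 \<le> t2" "t2 \<le> q0" "s t2 - s t1 = ls"
    "\<And>t. t \<in> {t1..t2} \<Longrightarrow> \<bar>s t - s 0\<bar> \<le> ls"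
  proof (cases "s 0 + ls \<le> l0")
    case True
    have "\<exists>x\<ge>0. x \<le> q0 \<and> s x = s 0 + ls"
      using True gr l0 ls by (intro IVT' continuous_on_subset[OF s_cont]) auto
    then obtain x where x: "0 \<le> x" "x \<le> q0" "s x = s 0 + ls" by blast
    have "\<bar>s t - s 0\<bar> \<le> ls" if "t \<in> {0..x}" for t
      using s_mono[of 0 t] s_mono[of t x] that x gr by auto
    then show ?thesis using that[of 0 x] x gr by auto
  next
    case False
    then have "ls \<le> s 0" using gr(6) by linarith
    have "\<exists>x\<ge>p0. x \<le> 0 \<and> s x = s 0 - ls"
      using \<open>ls \<le> s 0\<close> s_p0 gr ls by (intro IVT' continuous_on_subset[OF s_cont]) auto
    then obtain x where x: "p0 \<le> x" "x \<le> 0" "s x = s 0 - ls" by blast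
    have "\<bar>s t - s 0\<bar> \<le> ls" if "t \<in> {x..0}" for t
      using s_mono[of t 0] s_mono[of x t] that x gr by auto
    then show ?thesis using that[of x 0] x gr by auto
  qed
  have sub: "{t1..t2} \<subseteq> {p0..q0}" "{t1..t2} \<subseteq> {-l..l}" using t pq0 by auto
  have int: "integral {t1..t2} (\<lambda>t. norm (V m t)) = ls" using s_diff[of t1 t2] t by simp
  obtain p q where pq: "t1 \<le> p" "p \<le> 0" "0 \<le> q" "q \<le> t2" "integral {p..q} (\<lambda>t. norm (V (m + 3 * k1) t)) = \<eta> / 2"
    "\<And>t. t \<in> {p..q} \<Longrightarrow> 5 * L * \<eta> * \<bar>snd (V (m + 3 * k1) t)\<bar> \<le> \<bar>fst (V (m + 3 * k1) t)\<bar>"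
  proof (rule curve_expansion[OF L(1,2) t(2,3) sub(2), of "3 * k1" m])
    show "0 < 3 * k1" using k1 by simp
    show "\<bar>snd (V m t)\<bar> \<le> \<bar>fst (V m t)\<bar>" if "t \<in> {t1..t2}" for t
      using that sub t by (intro conej) auto
    show "2 * \<eta> \<le> circle_norm (2 * (X (m + r) 0 + \<omega> (m + r)))" if "r < 3 * k1" for r by (rule av[OF that])
    show "\<eta> / 2 \<le> (2 * L * \<eta>) ^ (3 * k1) * integral {t1..t2} (\<lambda>t. norm (V m t))" unfolding int by (rule ls(4))
  qed blast
  have pq_sub: "{p..q} \<subseteq> {-l..l}" using pq sub by auto
  have "p < q"
  proof (rule ccontr)
    assume "\<not> p < q"
    then have "p = q" using pq by simp
    then show False using pq(5) L by simp
  qed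
  have F': "F_lift L \<omega> (i + k1) = lift_iter L \<omega> (m + 3 * k1)" by (simp add: F_lift_def m_def fun_eq_iff distrib_left)
  have "good_subcurve c L \<omega> \<gamma> (i + k1) I (\<eta> / 2) (1 / \<eta> / L) p q"
    unfolding good_subcurve_def
  proof (intro conjI ballI)
    show "- ell0 c \<le> p" "p \<le> 0" "0 \<le> q" "q \<le> ell0 c" using pq t gr by auto
    have "F_iter L \<omega> (i + k1) (marked_point \<gamma>) \<in> F_iter L \<omega> (i + k1) ` torus_proj ` \<gamma> ` {p..q}"
      using pq by (intro imageI) (auto simp: marked_point_def)
    then show "F_iter L \<omega> (i + k1) ` torus_proj ` \<gamma> ` {p..q} \<inter> I \<noteq> {}" using hit by blast
    show "curve_length (F_lift L \<omega> (i + k1) \<circ> \<gamma>) p q = \<eta> / 2"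
      unfolding F' using curve_length_eq[of p q "m + 3 * k1"] \<open>p < q\<close> pq_sub pq(5) by simp
    fix t assume t: "t \<in> {p..q}"
    define A B where "A = fst (V (m + 3 * k1) t)" and "B = snd (V (m + 3 * k1) t)"
    have le: "5 * L * \<eta> * \<bar>B\<bar> \<le> \<bar>A\<bar>" using pq(6)[OF t] by (simp add: A_def B_def)
    have L\<eta>: "0 < L * \<eta>" using L by linarith
    have "A \<noteq> 0"
    proof
      assume "A = 0"
      have "B = 0"
      proof (rule ccontr)
        assume "B \<noteq> 0"
        then have "0 < 5 * L * \<eta> * \<bar>B\<bar>" using L by (intro mult_pos_pos) auto
        then show False using le \<open>A = 0\<close> by simp
      qed
      then have "V (m + 3 * k1) t = 0" using \<open>A = 0\<close> by (simp add: A_def B_def prod_eq_iff)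
      then show False using V_nonzero[of t] t pq_sub by auto
    qed
    have "(A, B) \<in> horizontal_ball (1 / \<eta> / L)"
    proof (rule horizontal_ballI[OF \<open>A \<noteq> 0\<close>])
      show "\<bar>B\<bar> \<le> 1 / (5 * L * \<eta>) * \<bar>A\<bar>" using le L\<eta> L by (simp add: field_simps)
      show "1 / (5 * L * \<eta>) < 1 / \<eta> / L" using L L\<eta> by (simp add: field_simps)
    qed
    then show "vector_derivative (F_lift L \<omega> (i + k1) \<circ> \<gamma>) (at t within {p..q}) \<in> horizontal_ball (1 / \<eta> / L)"
      unfolding F' using vector_derivative_curve[OF \<open>p < q\<close> pq_sub t] by (simp add: A_def B_def)
  qed
  then show ?thesis by blast
qed

text \<open>The Young event speaks about shifted noise and the orbit restarted at time
  \<open>i\<close>; the cocycle identity \<open>std_iter_shift\<close> returns to the original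
  orbit.\<close>

lemma young_timeD:
  assumes young: "young_time \<delta> c P L \<omega> i" and c: "nmin c \<ge> 1"
  shows "hyperbolic_at c L \<omega> (curve1 P) i" "hyperbolic_at c L \<omega> (curve2 P) i" "orbit_ok P L \<omega> i"
    "F_iter L \<omega> (i + K1 P) (marked_point (curve1 P)) \<in> rect1 P" "F_iter L \<omega> (i + K1 P) (marked_point (curve2 P)) \<in> rect2 P"
    "j < 3 * K1 P \<Longrightarrow> \<gamma> \<in> {curve1 P, curve2 P} \<Longrightarrow> 2 * eta P \<le> circle_norm (2 * (orbit_x L \<omega> (3 * i + j) (marked_point \<gamma>) + \<omega> (3 * i + j)))"
proof -
  have "is_renewal c P L \<omega> i" using young by (simp add: young_time_def is_renewal_def)
  then show "hyperbolic_at c L \<omega> (curve1 P) i" "hyperbolic_at c L \<omega> (curve2 P) i" "orbit_ok P L \<omega> i"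
    using is_renewal_iff[OF c, of P L \<omega> i] by (auto simp: sim_hyperbolic_def)
  have ev: "shift (3 * i) \<omega> \<in> young_event \<delta> P L (F_iter L \<omega> i (marked_point (curve1 P))) (F_iter L \<omega> i (marked_point (curve2 P)))"
    using young by (simp add: young_time_def)
  have it: "std_iter L (shift (3 * i) \<omega>) n (F_iter L \<omega> i z) = std_iter L \<omega> (3 * i + n) z" for n z
    unfolding F_iter_def by (rule std_iter_shift)
  have it': "F_iter L (shift (3 * i) \<omega>) k (F_iter L \<omega> i z) = F_iter L \<omega> (i + k) z" for k z
    unfolding F_iter_def[of L "shift (3 * i) \<omega>"] it by (simp add: F_iter_def distrib_left)
  show "F_iter L \<omega> (i + K1 P) (marked_point (curve1 P)) \<in> rect1 P" "F_iter L \<omega> (i + K1 P) (marked_point (curve2 P)) \<in> rect2 P"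
  proof -
    have "F_iter L (shift (3 * i) \<omega>) (K1 P) (F_iter L \<omega> i (marked_point (curve1 P))) \<in> rect1 P \<and>
      F_iter L (shift (3 * i) \<omega>) (K1 P) (F_iter L \<omega> i (marked_point (curve2 P))) \<in> rect2 P"
      using ev by (simp add: young_event_def)
    then show "F_iter L \<omega> (i + K1 P) (marked_point (curve1 P)) \<in> rect1 P" "F_iter L \<omega> (i + K1 P) (marked_point (curve2 P)) \<in> rect2 P"
      unfolding it' by auto
  qed
  assume j: "j < 3 * K1 P" and \<gamma>: "\<gamma> \<in> {curve1 P, curve2 P}"
  have "j \<in> {3 * 0..<3 * (K1 P + K2 P)}" using j by simp
  then have "fst (std_iter L (shift (3 * i) \<omega>) j (F_iter L \<omega> i (marked_point \<gamma>))) + shift (3 * i) \<omega> j \<notin> crit_nbhd (eta P)"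
    using ev \<gamma> unfolding young_event_def avoid_event_def by blast
  then have notin: "fst (std_iter L \<omega> (3 * i + j) (marked_point \<gamma>)) + shift (3 * i) \<omega> j \<notin> crit_nbhd (eta P)"
    unfolding it .
  have fst_eq: "fst (std_iter L \<omega> (3 * i + j) (marked_point \<gamma>)) = frac (orbit_x L \<omega> (3 * i + j) (marked_point \<gamma>))"
    by (subst std_iter_eq[OF torus_proj_marked_point]) (simp add: torus_proj_def orbit_x_def)
  from notin have "2 * eta P \<le> circle_norm (2 * (frac (orbit_x L \<omega> (3 * i + j) (marked_point \<gamma>)) + shift (3 * i) \<omega> j))"
    unfolding fst_eq by (simp only: crit_nbhd_eq mem_Collect_eq not_less)
  then show "2 * eta P \<le> circle_norm (2 * (orbit_x L \<omega> (3 * i + j) (marked_point \<gamma>) + \<omega> (3 * i + j)))"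
    unfolding circle_norm_frac_mult by (simp add: shift_def add.commute)
qed

text \<open>The finitely many \<open>n < N\<close> are covered by the trivial bound 1, paid for by
  \<open>exp (c1 * N)\<close> in the constant.\<close>

lemma exp_tail_bound:
  fixes f :: "nat \<Rightarrow> real"
  assumes "c0 > 0" "b > 0" and le1: "\<And>n. f n \<le> 1"
    and tail: "\<And>n. N \<le> n \<Longrightarrow> f n \<le> exp (- 3 * real n) + (2 powr (- c0 * real n) + (2 powr (- c0 * real n) + exp (- b * real n)))"
  shows "f n \<le> (4 + exp (min (min 3 (c0 * ln 2)) b * real N)) * exp (- (min (min 3 (c0 * ln 2)) b) * real n)"
proof -
  define c1 where "c1 = min (min 3 (c0 * ln 2)) b"
  have c1: "c1 \<le> 3" "c1 \<le> c0 * ln 2" "c1 \<le> b" "0 < c1" using assms by (auto simp: c1_def)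
  show ?thesis
  proof (cases "N \<le> n")
    case True
    have le: "exp (- c * real n) \<le> exp (- c1 * real n)" if "c1 \<le> c" for c
      using that by (simp add: mult_right_mono)
    have p: "2 powr (- c0 * real n) = exp (- (c0 * ln 2) * real n)" by (simp add: powr_def mult_ac)
    have "f n \<le> exp (- c1 * real n) + (exp (- c1 * real n) + (exp (- c1 * real n) + exp (- c1 * real n)))"
      using tail[OF True] le[OF c1(1)] le[OF c1(2)] le[OF c1(3)] unfolding p by linarith
    also have "\<dots> = 4 * exp (- c1 * real n)" by simp
    also have "\<dots> \<le> (4 + exp (c1 * real N)) * exp (- c1 * real n)" by (intro mult_right_mono) auto
    finally show ?thesis by (simp add: c1_def)
  next
    case False
    have "1 \<le> exp (c1 * real N) * exp (- c1 * real n)"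
      using False c1 by (simp add: exp_add[symmetric] mult_left_mono)
    also have "\<dots> \<le> (4 + exp (c1 * real N)) * exp (- c1 * real n)" by (intro mult_right_mono) auto
    finally show ?thesis using le1[of n] by (simp add: c1_def)
  qed
qed

text \<open>The order of choices matters: the separation scale bounding \<open>\<eta>1\<close>
  depends on \<delta> only, the hit probability \<open>q\<close> and its radius \<open>hc2\<close>
  are found after \<open>\<eta>1\<close> and \<open>k1\<close>, these radii bound \<eta>, and
  \<open>L\<close> comes last. Hence the rates do not depend on \<open>L\<close>.\<close>

lemma young_times_tail:
  assumes \<delta>: "0 < \<delta>" "\<delta> < 1/100" and c: "consts_in_range c" and freq: "frequency_property \<delta> c"
    and I: "torus_rectangle I1" "torus_rectangle I2" "measure torus_measure I1 > 0" "measure torus_measure I2 > 0"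
    and adm: "admissible c \<gamma>1" "admissible c \<gamma>2" "marked_point \<gamma>1 \<noteq> marked_point \<gamma>2"
  shows "\<exists>h1>0. \<forall>\<eta>1 \<eta>2 k1 k2. 0 < \<eta>1 \<and> \<eta>1 < h1 \<and> 0 < \<eta>2 \<and> \<eta>2 < 1/10 \<and> k1 \<ge> 2 \<longrightarrow>
    (\<exists>h>0. \<forall>\<eta>. 0 < \<eta> \<and> \<eta> < h \<longrightarrow> (\<exists>b>0. \<exists>C1>0. \<exists>c1>0. \<forall>\<^sub>F L in at_top. \<forall>n. measure (noise \<delta> L)
        {\<omega>\<in>space (noise \<delta> L). real (card (young_times \<delta> c \<lparr>curve1 = \<gamma>1, curve2 = \<gamma>2, rect1 = I1, rect2 = I2,
            eta1 = \<eta>1, eta2 = \<eta>2, eta = \<eta>, K1 = k1, K2 = k2\<rparr> L \<omega> n)) \<le> b * real n} \<le> C1 * exp (- c1 * real n)))"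
proof -
  have c': "nmin c \<ge> 1" "ell0 c > 0" using c by (auto simp: consts_in_range_def)
  have v: "marked_tangent \<gamma>1 \<noteq> 0" "marked_tangent \<gamma>2 \<noteq> 0"
    using admissible_tangent(2)[OF adm(1) c'(2)] admissible_tangent(2)[OF adm(2) c'(2)] by auto
  define \<epsilon> :: real where "\<epsilon> = exp (- 600)"
  have \<epsilon>: "0 < \<epsilon>" "\<epsilon> \<le> 1" by (simp_all add: \<epsilon>_def)
  obtain h where h: "h > 0" "\<forall>\<^sub>F L in at_top. \<forall>x y x' y'. measure (unif (L powr -\<delta>)) {w. circle_norm (next_x L x y w - next_x L x' y' w)
        < min h (2 * L * \<bar>sin (pi * (x - x'))\<bar> * L powr (-1/4))} \<le> \<epsilon>/5"
    using eventually_separation[OF \<delta>, of "\<epsilon>/5"] \<epsilon> by auto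
  obtain hc1 where hc1: "hc1 > 0" "\<forall>\<^sub>F L in at_top. \<forall>x y. measure (unif (L powr -\<delta>)) {w. circle_norm (2 * next_x L x y w) \<le> hc1} \<le> \<epsilon>/5"
    using eventually_not_critical[OF \<delta>, of "\<epsilon>/5"] \<epsilon> by auto
  obtain p p' r \<kappa> where r: "0 < r" "r \<le> 1/2" "0 < \<kappa>" "4 * r + \<kappa> \<le> circle_norm (2 * (snd p - snd p'))"
    "\<And>x y. circle_norm (x - fst p) < 2 * r \<Longrightarrow> circle_norm (y - snd p) < 2 * r \<Longrightarrow> torus_proj (x, y) \<in> I1"
    "\<And>x y. circle_norm (x - fst p') < 2 * r \<Longrightarrow> circle_norm (y - snd p') < 2 * r \<Longrightarrow> torus_proj (x, y) \<in> I2"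
    using rectangle_targets[OF I(1) I(3) I(2) I(4)] by metis
  define D where "D = max (circle_norm (fst (marked_point \<gamma>1) - fst (marked_point \<gamma>2))) (circle_norm (snd (marked_point \<gamma>1) - snd (marked_point \<gamma>2)))"
  have D: "D > 0" unfolding D_def by (rule marked_points_separated[OF adm(3)])
  obtain d where d: "d > 0" "\<forall>\<delta>1. 0 < \<delta>1 \<and> \<delta>1 < d \<longrightarrow> (\<exists>c0>0. \<exists>L1>0. \<exists>n1>0. \<forall>L\<ge>L1. \<forall>n\<ge>n1. \<forall>\<gamma>. admissible c \<gamma> \<longrightarrow>
        measure (noise \<delta> L) {\<omega>\<in>space (noise \<delta> L). real (card {k. k \<ge> 1 \<and> tau c L \<omega> \<gamma> k \<le> enat n}) \<le> (1 - \<delta>1) * real n} \<le> L powr (- c0 * real n))"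
    using freq unfolding frequency_property_def by (elim exE conjE) (rule that)
  define \<delta>1 where "\<delta>1 = min (d/2) (1/10)"
  have \<delta>1: "0 < \<delta>1" "\<delta>1 < d" "\<delta>1 \<le> 1/10" using d(1) by (auto simp: \<delta>1_def)
  obtain c0 L1 n1 where f: "c0 > 0" and f_all: "\<forall>L\<ge>L1. \<forall>n\<ge>n1. \<forall>\<gamma>. admissible c \<gamma> \<longrightarrow>
        measure (noise \<delta> L) {\<omega>\<in>space (noise \<delta> L). real (card {k. k \<ge> 1 \<and> tau c L \<omega> \<gamma> k \<le> enat n}) \<le> (1 - \<delta>1) * real n} \<le> L powr (- c0 * real n)"
    using mp[OF spec[OF d(2)] conjI[OF \<delta>1(1,2)]] by (elim exE conjE) (rule that)
  show ?thesis
  proof (rule exI[of _ h], intro conjI[OF h(1)] allI impI, elim conjE)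
    fix \<eta>1 \<eta>2 :: real and k1 k2 :: nat
    assume e: "0 < \<eta>1" "\<eta>1 < h" "0 < \<eta>2" "\<eta>2 < 1/10" and k1: "k1 \<ge> 2"
    have h14: "\<forall>\<^sub>F L in at_top. \<forall>x y x' y'. measure (unif (L powr -\<delta>)) {w. circle_norm (next_x L x y w - next_x L x' y' w)
        < min h (2 * L * \<bar>sin (pi * (x - x'))\<bar> * L powr (-1/4))} \<le> 1/4"
      using h(2)
    proof eventually_elim
      case (elim L)
      show ?case
      proof (intro allI)
        fix x y x' y'
        have "measure (unif (L powr -\<delta>)) {w. circle_norm (next_x L x y w - next_x L x' y' w)
          < min h (2 * L * \<bar>sin (pi * (x - x'))\<bar> * L powr (-1/4))} \<le> \<epsilon>/5" using elim by blast
        then show "measure (unif (L powr -\<delta>)) {w. circle_norm (next_x L x y w - next_x L x' y' w)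
          < min h (2 * L * \<bar>sin (pi * (x - x'))\<bar> * L powr (-1/4))} \<le> 1/4" using \<epsilon>(2) by linarith
      qed
    qed
    obtain q hc2 where q: "0 < q" "q \<le> 1" "hc2 > 0"
      "\<forall>\<^sub>F L in at_top. \<forall>z z' k j \<omega>. k \<le> j \<and> \<eta>1 / 2 \<le> sep L z z' \<omega> k \<and> (\<forall>i. k \<le> i \<and> i < j \<longrightarrow> chain_ok L z z' h hc2 (3 * k1) p p' r k i \<omega>) \<longrightarrow>
       q \<le> measure (noise_comp \<delta> L) {w \<in> space (noise_comp \<delta> L). chain_ok L z z' h hc2 (3 * k1) p p' r k j (fun_upd \<omega> j w)}"
      using eventually_chain_hit[OF \<delta> _ _ h(1) r(1,2,3,4) h14, of "3 * k1" "\<eta>1 / 2"] k1 e(1) by auto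
    define K where "K = k1 + k2"
    define b where "b = - ln (1 - (1 - exp (-1)) * q ^ (3 * K)) / (8 * (real K + 1))"
    define N where "N = max n1 (max 20 (8 * K))"
    define c1 where "c1 = min (min 3 (c0 * ln 2)) b"
    have b: "b > 0"
    proof -
      have qT: "0 < q ^ (3 * K)" "q ^ (3 * K) \<le> 1" using q by (auto intro: power_le_one)
      have "(1 - exp (-1 :: real)) * q ^ (3 * K) \<le> 1 - exp (-1)" using qT by (intro mult_left_le) auto
      moreover have "exp (-1 :: real) > 0" by simp
      ultimately have "0 < 1 - (1 - exp (-1)) * q ^ (3 * K)" by linarith
      moreover have "1 - (1 - exp (-1)) * q ^ (3 * K) < 1" using qT by simp
      ultimately have "ln (1 - (1 - exp (-1)) * q ^ (3 * K)) < 0" by simp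
      then show ?thesis unfolding b_def by (intro divide_pos_pos) auto
    qed
    have c1: "c1 > 0" using f b by (simp add: c1_def)
    show "\<exists>h>0. \<forall>\<eta>. 0 < \<eta> \<and> \<eta> < h \<longrightarrow> (\<exists>b>0. \<exists>C1>0. \<exists>c1>0. \<forall>\<^sub>F L in at_top. \<forall>n. measure (noise \<delta> L)
        {\<omega>\<in>space (noise \<delta> L). real (card (young_times \<delta> c \<lparr>curve1 = \<gamma>1, curve2 = \<gamma>2, rect1 = I1, rect2 = I2,
            eta1 = \<eta>1, eta2 = \<eta>2, eta = \<eta>, K1 = k1, K2 = k2\<rparr> L \<omega> n)) \<le> b * real n} \<le> C1 * exp (- c1 * real n))"
    proof (rule exI[of _ "min (hc1/4) (hc2/4)"], intro conjI allI impI)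
      show "0 < min (hc1/4) (hc2/4)" using hc1 q by simp
      fix \<eta> assume \<eta>: "0 < \<eta> \<and> \<eta> < min (hc1/4) (hc2/4)"
      define P where "P = \<lparr>curve1 = \<gamma>1, curve2 = \<gamma>2, rect1 = I1, rect2 = I2, eta1 = \<eta>1, eta2 = \<eta>2, eta = \<eta>, K1 = k1, K2 = k2\<rparr>"
      have P: "curve1 P = \<gamma>1" "curve2 P = \<gamma>2" "rect1 P = I1" "rect2 P = I2" "eta1 P = \<eta>1" "eta2 P = \<eta>2" "eta P = \<eta>" "K1 P = k1" "K2 P = k2"
        by (simp_all add: P_def)
      have rare: "\<forall>\<^sub>F L in at_top. \<forall>z z' v v' k \<omega>. measure (noise_comp \<delta> L) {w \<in> space (noise_comp \<delta> L). step_bad L z z' v v' h (\<eta>2/2) hc1 k (fun_upd \<omega> k w)} \<le> \<epsilon>"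
        using e by (intro eventually_step_bad_rare[OF \<delta> _ \<epsilon>(1) h(2) hc1(2)]) simp
      have ev_init: "\<forall>\<^sub>F L::real in at_top. h / sqrt L \<le> D"
      proof -
        have "((\<lambda>L::real. h * (1 / sqrt L)) \<longlongrightarrow> h * 0) at_top" by (intro tendsto_mult tendsto_const) real_asymp
        then have "\<forall>\<^sub>F L::real in at_top. h * (1 / sqrt L) < D" using D by (intro order_tendstoD) auto
        then show ?thesis by eventually_elim simp
      qed
      have ev_small: "\<forall>\<^sub>F L in at_top. L powr -\<delta> \<le> min \<eta> r"
        by (rule eventually_noise_small[OF \<delta>(1)]) (use \<eta> r(1) in auto)
      have tail: "\<forall>\<^sub>F L in at_top. \<forall>n. measure (noise \<delta> L)
        {\<omega>\<in>space (noise \<delta> L). real (card (young_times \<delta> c P L \<omega> n)) \<le> b * real n} \<le> (4 + exp (c1 * real N)) * exp (- c1 * real n)"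
        using rare q(4) ev_init eventually_ge_at_top[of 512] eventually_ge_at_top[of L1]
          ev_small
      proof (eventually_elim, intro allI)
        fix L :: real and n :: nat
        assume el: "\<forall>z z' v v' k \<omega>. measure (noise_comp \<delta> L) {w \<in> space (noise_comp \<delta> L). step_bad L z z' v v' h (\<eta>2/2) hc1 k (fun_upd \<omega> k w)} \<le> \<epsilon>"
          "\<forall>z z' k j \<omega>. k \<le> j \<and> \<eta>1 / 2 \<le> sep L z z' \<omega> k \<and> (\<forall>i. k \<le> i \<and> i < j \<longrightarrow> chain_ok L z z' h hc2 (3 * k1) p p' r k i \<omega>) \<longrightarrow>
       q \<le> measure (noise_comp \<delta> L) {w \<in> space (noise_comp \<delta> L). chain_ok L z z' h hc2 (3 * k1) p p' r k j (fun_upd \<omega> j w)}"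
          "h / sqrt L \<le> D" "512 \<le> L" "L1 \<le> L" "L powr -\<delta> \<le> min \<eta> r"
        have L0: "L > 0" using el by simp
        interpret N: prob_space "noise \<delta> L" by (rule prob_space_noise[OF L0])
        have sm: "L powr -\<delta> \<le> \<eta>" "L powr -\<delta> \<le> r" using el(6) \<eta> r(1) by auto
        show "measure (noise \<delta> L) {\<omega>\<in>space (noise \<delta> L). real (card (young_times \<delta> c P L \<omega> n)) \<le> b * real n} \<le> (4 + exp (c1 * real N)) * exp (- c1 * real n)"
          unfolding c1_def
        proof (rule exp_tail_bound[OF f b, where f="\<lambda>n. measure (noise \<delta> L) {\<omega>\<in>space (noise \<delta> L). real (card (young_times \<delta> c P L \<omega> n)) \<le> b * real n}"])
          show "measure (noise \<delta> L) {\<omega>\<in>space (noise \<delta> L). real (card (young_times \<delta> c P L \<omega> n)) \<le> b * real n} \<le> 1" for n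
            by simp
          fix n assume n: "N \<le> n"
          \<comment> \<open>Base 2 instead of \<open>L\<close> makes the rate independent of
            \<open>L\<close>.\<close>
          have F: "L powr (- c0 * real n) \<le> 2 powr (- c0 * real n)"
            using el f by (intro powr_mono2') auto
          have "measure (noise \<delta> L) {\<omega>\<in>space (noise \<delta> L). real (card (young_times \<delta> c P L \<omega> n)) \<le>
              - ln (1 - (1 - exp (-1)) * q ^ (3 * (K1 P + K2 P))) / (8 * (real (K1 P + K2 P) + 1)) * real n}
            \<le> exp (- 3 * real n) + (2 powr (- c0 * real n) + (2 powr (- c0 * real n) +
              exp (- (- ln (1 - (1 - exp (-1)) * q ^ (3 * (K1 P + K2 P))) / (8 * (real (K1 P + K2 P) + 1))) * real n)))"
          proof (rule few_young_times_bound[where ?h=h and ?hc1.0=hc1 and ?hc2.0=hc2 and ?r=r and ?p=p and ?p'=p' and ?\<delta>1.0=\<delta>1])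
            show "measure (noise_comp \<delta> L) {w \<in> space (noise_comp \<delta> L). step_bad L z z' v v' h (eta2 P / 2) hc1 k (fun_upd \<omega> k w)} \<le> exp (- 600)" for z z' v v' k \<omega>
              using el(1) unfolding P \<epsilon>_def by blast
            show "q \<le> measure (noise_comp \<delta> L) {w \<in> space (noise_comp \<delta> L). chain_ok L z z' h hc2 (3 * K1 P) p p' r k j (fun_upd \<omega> j w)}"
              if "k \<le> j" "eta1 P / 2 \<le> sep L z z' \<omega> k" "\<And>i. k \<le> i \<Longrightarrow> i < j \<Longrightarrow> chain_ok L z z' h hc2 (3 * K1 P) p p' r k i \<omega>" for z z' k j \<omega>
              using el(2) that unfolding P by blast
            show "h / sqrt L \<le> sep L (marked_point (curve1 P)) (marked_point (curve2 P)) \<omega> 0" for \<omega>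
              using el(3) unfolding P D_def sep_def orbit_x_def orbit_y_def by simp
            show "measure (noise \<delta> L) {\<omega>\<in>space (noise \<delta> L). real (card {k. k \<ge> 1 \<and> tau c L \<omega> \<gamma> k \<le> enat n}) \<le> (1 - \<delta>1) * real n} \<le> 2 powr (- c0 * real n)"
              if "\<gamma> \<in> {curve1 P, curve2 P}" for \<gamma>
            proof -
              have "admissible c \<gamma>" using that adm unfolding P by blast
              moreover have "n1 \<le> n" using n by (simp add: N_def)
              ultimately show ?thesis using f_all[rule_format, OF el(5)] F by (intro order_trans[OF _ F]) blast
            qed
            show "512 \<le> L" by fact
            show "2 \<le> K1 P" "0 < eta1 P" "eta1 P < h" "0 < eta2 P" "eta2 P < 1/10" using k1 e unfolding P by auto
            show "4 * eta P \<le> hc1" "4 * eta P \<le> hc2" using \<eta> unfolding P by auto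
            show "marked_tangent (curve1 P) \<noteq> 0" "marked_tangent (curve2 P) \<noteq> 0" using v unfolding P by auto
            show "L powr -\<delta> \<le> eta P" using sm unfolding P by auto
            show "torus_proj (x, y) \<in> rect1 P" if "circle_norm (x - fst p) < 2 * r" "circle_norm (y - snd p) < 2 * r" for x y
              using r(5)[OF that] unfolding P .
            show "torus_proj (x, y) \<in> rect2 P" if "circle_norm (x - fst p') < 2 * r" "circle_norm (y - snd p') < 2 * r" for x y
              using r(6)[OF that] unfolding P .
            show "20 \<le> n" "8 * (K1 P + K2 P) \<le> n" using n unfolding P by (auto simp: N_def K_def)
          qed (fact c' h(1) sm(2) r(1) q(1,2) \<delta>1(3))+
          then show "measure (noise \<delta> L) {\<omega>\<in>space (noise \<delta> L). real (card (young_times \<delta> c P L \<omega> n)) \<le> b * real n} \<le>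
              exp (- 3 * real n) + (2 powr (- c0 * real n) + (2 powr (- c0 * real n) + exp (- b * real n)))"
            unfolding b_def K_def P .
        qed
      qed
      have "0 < 4 + exp (c1 * real N)" by (simp add: add_pos_pos)
      with tail show "\<exists>b>0. \<exists>C1>0. \<exists>c1>0. \<forall>\<^sub>F L in at_top. \<forall>n. measure (noise \<delta> L)
        {\<omega>\<in>space (noise \<delta> L). real (card (young_times \<delta> c \<lparr>curve1 = \<gamma>1, curve2 = \<gamma>2, rect1 = I1, rect2 = I2,
            eta1 = \<eta>1, eta2 = \<eta>2, eta = \<eta>, K1 = k1, K2 = k2\<rparr> L \<omega> n)) \<le> b * real n} \<le> C1 * exp (- c1 * real n)"
        using b c1 unfolding P_def by blast
    qed
  qed
qed

text \<open>\<open>kmin\<close> depends only on the growth exponents of \<open>c\<close> and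
  \<delta>, so \<open>k1\<close> can be fixed before \<eta>; the power of \<eta> lost in the
  expansion is compensated by large \<open>L\<close>.\<close>

lemma young_times_curves:
  assumes c: "consts_in_range c" and gr: "growth_property \<delta> c"
  shows "\<exists>kmin. \<forall>\<gamma>1 \<gamma>2 I1 I2 \<eta>1 \<eta>2 \<eta> k1 k2.
    admissible c \<gamma>1 \<and> admissible c \<gamma>2 \<and> kmin \<le> k1 \<and> \<eta>2 < 1/10 \<and> 0 < \<eta> \<longrightarrow>
    (\<forall>\<^sub>F L in at_top. \<forall>\<omega>\<in>space (noise \<delta> L). \<forall>i. young_time \<delta> c \<lparr>curve1 = \<gamma>1, curve2 = \<gamma>2, rect1 = I1, rect2 = I2,
            eta1 = \<eta>1, eta2 = \<eta>2, eta = \<eta>, K1 = k1, K2 = k2\<rparr> L \<omega> i \<longrightarrow>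
      (\<exists>p q. good_subcurve c L \<omega> \<gamma>1 (i + k1) I1 (\<eta> / 2) (1 / \<eta> / L) p q) \<and>
      (\<exists>p q. good_subcurve c L \<omega> \<gamma>2 (i + k1) I2 (\<eta> / 2) (1 / \<eta> / L) p q))"
proof -
  have c': "nmin c \<ge> 1" "ell0 c > 0" using c by (auto simp: consts_in_range_def)
  obtain a b L2 where ab: "a > 0" "b > 0" and g: "\<forall>L\<ge>L2. \<forall>\<omega>\<in>space (noise \<delta> L). \<forall>\<gamma> N s u.
     admissible c \<gamma> \<and> N \<ge> nmin c \<and> rt_splitting c L \<omega> (marked_point \<gamma>) N s u \<and>
     line_angle (marked_tangent \<gamma>) s \<ge> L powr (- (eps_angle c) * real N) \<longrightarrow>
     (\<exists>p q l \<beta>. - ell0 c \<le> p \<and> p \<le> 0 \<and> 0 \<le> q \<and> q \<le> ell0 c \<and>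
        l = curve_length (F_lift L \<omega> N \<circ> \<gamma>) p q \<and> l \<ge> L powr (- b) \<and>
        arclength_C2 0 l (L powr a) \<beta> \<and>
        (\<forall>t\<in>{p..q}. F_lift L \<omega> N (\<gamma> t) = \<beta> (curve_length (F_lift L \<omega> N \<circ> \<gamma>) p t)))"
    using gr unfolding growth_property_def by (elim exE conjE) (rule that)
  define kmin where "kmin = max 1 (nat \<lceil>a + b + 2\<rceil>)"
  show ?thesis
  proof (rule exI[of _ kmin], intro allI impI, elim conjE)
    fix \<gamma>1 \<gamma>2 I1 I2 and \<eta>1 \<eta>2 \<eta> :: real and k1 k2 :: nat
    assume adm: "admissible c \<gamma>1" "admissible c \<gamma>2" and k1: "kmin \<le> k1" and \<eta>2: "\<eta>2 < 1/10" and \<eta>: "0 < \<eta>"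
    define P where "P = \<lparr>curve1 = \<gamma>1, curve2 = \<gamma>2, rect1 = I1, rect2 = I2, eta1 = \<eta>1, eta2 = \<eta>2, eta = \<eta>, K1 = k1, K2 = k2\<rparr>"
    have P: "curve1 P = \<gamma>1" "curve2 P = \<gamma>2" "rect1 P = I1" "rect2 P = I2" "eta1 P = \<eta>1" "eta2 P = \<eta>2" "eta P = \<eta>" "K1 P = k1" "K2 P = k2"
      by (simp_all add: P_def)
    define n where "n = 3 * k1"
    have k1': "1 \<le> k1" "a + b + 2 \<le> real n"
      using k1 unfolding kmin_def n_def by (simp, linarith)
    have "\<forall>\<^sub>F L in at_top. \<forall>\<omega>\<in>space (noise \<delta> L). \<forall>i. young_time \<delta> c P L \<omega> i \<longrightarrow>
      (\<exists>p q. good_subcurve c L \<omega> \<gamma>1 (i + k1) I1 (\<eta> / 2) (1 / \<eta> / L) p q) \<and>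
      (\<exists>p q. good_subcurve c L \<omega> \<gamma>2 (i + k1) I2 (\<eta> / 2) (1 / \<eta> / L) p q)"
      using eventually_ge_at_top[of L2] eventually_ge_at_top[of 4] eventually_ge_at_top[of "1/\<eta>"]
        eventually_ge_at_top[of "\<eta> / (2 * \<eta>) ^ n"]
    proof (eventually_elim, intro ballI allI impI)
      fix L \<omega> i assume L: "L2 \<le> L" "4 \<le> L" "1/\<eta> \<le> L" "\<eta> / (2 * \<eta>) ^ n \<le> L"
        and \<omega>: "\<omega> \<in> space (noise \<delta> L)" and y: "young_time \<delta> c P L \<omega> i"
      note D = young_timeD[OF y c'(1), unfolded P]
      \<comment> \<open>The exponent meets all demands: twice this length is below
        \<open>L powr (- b)\<close>, times the curvature \<open>L powr a\<close> it is at most 1/8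
        once \<open>L \<ge> 4\<close>, and \<open>n \<ge> a + b + 2\<close> steps still leave a full
        power of \<open>L\<close>.\<close>
      define ls where "ls = L powr (- (a + b + 1)) / 2"
      have L1: "1 \<le> L" "0 < L" using L by auto
      have L\<eta>: "1 \<le> L * \<eta>" using L \<eta> by (simp add: field_simps)
      have ls: "0 < ls" using L1 by (simp add: ls_def)
      have ls1: "2 * ls \<le> L powr (- b)"
        unfolding ls_def using L1 ab by (simp add: powr_mono)
      have ls2: "L powr a * ls \<le> 1/8"
      proof -
        have "L powr a * L powr (- (a + b + 1)) = L powr (- b - 1)" by (simp add: powr_add[symmetric])
        also have "\<dots> \<le> L powr (-1)" using L1 ab by (intro powr_mono) auto
        also have "\<dots> \<le> 1/4" using L L1 by (simp add: powr_minus field_simps)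
        finally show ?thesis by (simp add: ls_def)
      qed
      have ls3: "\<eta> / 2 \<le> (2 * L * \<eta>) ^ (3 * k1) * ls"
      proof -
        have "L powr 1 \<le> L powr (real n - (a + b + 1))" using L1 k1' by (intro powr_mono) auto
        also have "\<dots> = L ^ n * L powr (- (a + b + 1))" using L1 by (simp add: powr_realpow[symmetric] powr_add[symmetric] algebra_simps)
        finally have "(2 * \<eta>) ^ n * L \<le> (2 * \<eta>) ^ n * (L ^ n * L powr (- (a + b + 1)))"
          using L1 \<eta> by (intro mult_left_mono) auto
        moreover have "\<eta> \<le> (2 * \<eta>) ^ n * L" using L(4) \<eta> by (simp add: field_simps)
        ultimately have "\<eta> \<le> (2 * \<eta>) ^ n * (L ^ n * L powr (- (a + b + 1)))" by linarith
        also have "\<dots> = (2 * L * \<eta>) ^ n * L powr (- (a + b + 1))" by (simp add: power_mult_distrib)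
        finally show ?thesis by (simp add: ls_def n_def)
      qed
      have ex: "\<exists>p q. good_subcurve c L \<omega> \<gamma> (i + k1) I (\<eta> / 2) (1 / \<eta> / L) p q"
        if \<gamma>: "\<gamma> \<in> {\<gamma>1, \<gamma>2}" and hyp: "hyperbolic_at c L \<omega> \<gamma> i"
          and cone: "DF L \<omega> i (marked_point \<gamma>) (marked_tangent \<gamma>) \<in> horizontal_ball \<eta>2"
          and hit: "F_iter L \<omega> (i + k1) (marked_point \<gamma>) \<in> I" for \<gamma> I
      proof -
        have adm': "admissible c \<gamma>" using \<gamma> adm by auto
        obtain s u where su: "rt_splitting c L \<omega> (marked_point \<gamma>) i s u" "L powr (- eps_angle c * real i) \<le> line_angle (marked_tangent \<gamma>) s" "nmin c \<le> i"
          using hyp unfolding hyperbolic_at_def by blast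
        have su': "admissible c \<gamma> \<and> nmin c \<le> i \<and> rt_splitting c L \<omega> (marked_point \<gamma>) i s u \<and>
            L powr (- eps_angle c * real i) \<le> line_angle (marked_tangent \<gamma>) s"
          using adm' su by simp
        obtain p0 q0 l0 \<beta> where G: "- ell0 c \<le> p0" "p0 \<le> 0" "0 \<le> q0" "q0 \<le> ell0 c"
            "l0 = curve_length (F_lift L \<omega> i \<circ> \<gamma>) p0 q0" "l0 \<ge> L powr (- b)" "arclength_C2 0 l0 (L powr a) \<beta>"
            "\<forall>t\<in>{p0..q0}. F_lift L \<omega> i (\<gamma> t) = \<beta> (curve_length (F_lift L \<omega> i \<circ> \<gamma>) p0 t)"
          using mp[OF spec[OF spec[OF spec[OF spec[OF bspec[OF mp[OF spec[OF g] L(1)] \<omega>]]]]], OF su']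
          by (elim exE conjE) (rule that)
        show ?thesis
        proof (rule good_subcurve_of_growth[OF adm' c'(2) \<eta> L\<eta> L1(1) k1'(1) G(1-5) _ G(7) _ ls ls2 _ ls3 cone \<eta>2 _ hit])
          show "2 * ls \<le> l0" using ls1 G(6) by linarith
          show "F_lift L \<omega> i (\<gamma> t) = \<beta> (curve_length (F_lift L \<omega> i \<circ> \<gamma>) p0 t)" if "t \<in> {p0..q0}" for t
            using G(8) that by blast
          show "2 * \<eta> \<le> circle_norm (2 * (orbit_x L \<omega> (3 * i + j) (marked_point \<gamma>) + \<omega> (3 * i + j)))" if "j < 3 * k1" for j
            using D(6)[OF that \<gamma>] .
        qed simp
      qed
      have "DF L \<omega> i (marked_point \<gamma>1) (marked_tangent \<gamma>1) \<in> horizontal_ball \<eta>2"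
        "DF L \<omega> i (marked_point \<gamma>2) (marked_tangent \<gamma>2) \<in> horizontal_ball \<eta>2"
        using D(3) unfolding orbit_ok_def Let_def P by auto
      then show "(\<exists>p q. good_subcurve c L \<omega> \<gamma>1 (i + k1) I1 (\<eta> / 2) (1 / \<eta> / L) p q) \<and>
        (\<exists>p q. good_subcurve c L \<omega> \<gamma>2 (i + k1) I2 (\<eta> / 2) (1 / \<eta> / L) p q)"
        using ex[of \<gamma>1 I1] ex[of \<gamma>2 I2] D(1,2,4,5) by blast
    qed
    then show "\<forall>\<^sub>F L in at_top. \<forall>\<omega>\<in>space (noise \<delta> L). \<forall>i. young_time \<delta> c \<lparr>curve1 = \<gamma>1, curve2 = \<gamma>2, rect1 = I1, rect2 = I2,
            eta1 = \<eta>1, eta2 = \<eta>2, eta = \<eta>, K1 = k1, K2 = k2\<rparr> L \<omega> i \<longrightarrow>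
      (\<exists>p q. good_subcurve c L \<omega> \<gamma>1 (i + k1) I1 (\<eta> / 2) (1 / \<eta> / L) p q) \<and>
      (\<exists>p q. good_subcurve c L \<omega> \<gamma>2 (i + k1) I2 (\<eta> / 2) (1 / \<eta> / L) p q)"
      unfolding P_def .
  qed
qed

theorem proposition8p2:
  shows "\<exists>\<delta>\<^sub>m\<^sub>a\<^sub>x>0. \<forall>\<delta> c I\<^sub>1 I\<^sub>2 \<gamma>\<^sub>1 \<gamma>\<^sub>2.
    0 < \<delta> \<and> \<delta> < \<delta>\<^sub>m\<^sub>a\<^sub>x \<and>
    consts_in_range c \<and> growth_property \<delta> c \<and> frequency_property \<delta> c \<and>
    torus_rectangle I\<^sub>1 \<and> torus_rectangle I\<^sub>2 \<and> I\<^sub>1 \<inter> I\<^sub>2 = {} \<and>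
    measure torus_measure I\<^sub>1 * measure torus_measure I\<^sub>2 > 0 \<and>
    admissible c \<gamma>\<^sub>1 \<and> admissible c \<gamma>\<^sub>2 \<and> marked_point \<gamma>\<^sub>1 \<noteq> marked_point \<gamma>\<^sub>2 \<longrightarrow>
    (\<exists>h\<^sub>1>0. \<forall>\<eta>\<^sub>1 \<eta>\<^sub>2 k\<^sub>2. 0 < \<eta>\<^sub>1 \<and> \<eta>\<^sub>1 < h\<^sub>1 \<and> 0 < \<eta>\<^sub>2 \<and> \<eta>\<^sub>2 < 1/10 \<and> k\<^sub>2 \<ge> 1 \<longrightarrow>
      (\<exists>k\<^sub>m\<^sub>i\<^sub>n\<ge>1. \<forall>k\<^sub>1\<ge>k\<^sub>m\<^sub>i\<^sub>n. \<exists>h>0. \<forall>\<eta>. 0 < \<eta> \<and> \<eta> < h \<longrightarrow>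
        (let P = \<lparr>curve1 = \<gamma>\<^sub>1, curve2 = \<gamma>\<^sub>2, rect1 = I\<^sub>1, rect2 = I\<^sub>2,
                  eta1 = \<eta>\<^sub>1, eta2 = \<eta>\<^sub>2, eta = \<eta>, K1 = k\<^sub>1, K2 = k\<^sub>2\<rparr>
         in \<exists>L\<^sub>0>0. \<exists>b>0. \<exists>C\<^sub>1>0. \<exists>c\<^sub>1>0. \<exists>\<delta>\<^sub>0>0. \<exists>C\<^sub>\<eta>>0. \<forall>L\<ge>L\<^sub>0.
              (\<forall>n\<ge>1. measure (noise \<delta> L)
                 {\<omega>\<in>space (noise \<delta> L). real (card (young_times \<delta> c P L \<omega> n)) \<le> b * real n}
                 \<le> C\<^sub>1 * exp (- c\<^sub>1 * real n)) \<and>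
              (\<forall>\<omega>\<in>space (noise \<delta> L). \<forall>i. young_time \<delta> c P L \<omega> i \<longrightarrow>
                 (\<exists>p q. good_subcurve c L \<omega> \<gamma>\<^sub>1 (i + k\<^sub>1) I\<^sub>1 (2 * \<delta>\<^sub>0) (C\<^sub>\<eta> / L) p q) \<and>
                 (\<exists>p q. good_subcurve c L \<omega> \<gamma>\<^sub>2 (i + k\<^sub>1) I\<^sub>2 (2 * \<delta>\<^sub>0) (C\<^sub>\<eta> / L) p q)))))"
proof (rule exI[of _ "1/100"], (intro conjI allI impI; (elim conjE)?))
  show "0 < (1/100 :: real)" by simp
  fix \<delta> :: real and c I1 I2 \<gamma>1 \<gamma>2
  assume \<delta>: "0 < \<delta>" "\<delta> < 1/100" and c: "consts_in_range c" and gr: "growth_property \<delta> c" and freq: "frequency_property \<delta> c"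
    and I: "torus_rectangle I1" "torus_rectangle I2" "measure torus_measure I1 * measure torus_measure I2 > 0"
    and adm: "admissible c \<gamma>1" "admissible c \<gamma>2" "marked_point \<gamma>1 \<noteq> marked_point \<gamma>2"
  let ?P = "\<lambda>\<eta>1 \<eta>2 \<eta> k1 k2. \<lparr>curve1 = \<gamma>1, curve2 = \<gamma>2, rect1 = I1, rect2 = I2, eta1 = \<eta>1, eta2 = \<eta>2, eta = \<eta>, K1 = k1, K2 = k2\<rparr>"
  have I': "measure torus_measure I1 > 0" "measure torus_measure I2 > 0"
    using I(3) measure_nonneg[of torus_measure I1] measure_nonneg[of torus_measure I2] by (auto simp: zero_less_mult_iff)
  obtain h1 where h1: "h1 > 0" "\<forall>\<eta>1 \<eta>2 k1 k2. 0 < \<eta>1 \<and> \<eta>1 < h1 \<and> 0 < \<eta>2 \<and> \<eta>2 < 1/10 \<and> k1 \<ge> 2 \<longrightarrow>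
    (\<exists>h>0. \<forall>\<eta>. 0 < \<eta> \<and> \<eta> < h \<longrightarrow> (\<exists>b>0. \<exists>C1>0. \<exists>c1>0. \<forall>\<^sub>F L in at_top. \<forall>n. measure (noise \<delta> L)
        {\<omega>\<in>space (noise \<delta> L). real (card (young_times \<delta> c (?P \<eta>1 \<eta>2 \<eta> k1 k2) L \<omega> n)) \<le> b * real n} \<le> C1 * exp (- c1 * real n)))"
    using young_times_tail[OF \<delta> c freq I(1,2) I' adm] by (elim exE conjE) (rule that)
  obtain kmin where kmin: "\<forall>\<gamma>1 \<gamma>2 I1 I2 \<eta>1 \<eta>2 \<eta> k1 k2.
    admissible c \<gamma>1 \<and> admissible c \<gamma>2 \<and> kmin \<le> k1 \<and> \<eta>2 < 1/10 \<and> 0 < \<eta> \<longrightarrow>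
    (\<forall>\<^sub>F L in at_top. \<forall>\<omega>\<in>space (noise \<delta> L). \<forall>i. young_time \<delta> c \<lparr>curve1 = \<gamma>1, curve2 = \<gamma>2, rect1 = I1, rect2 = I2,
            eta1 = \<eta>1, eta2 = \<eta>2, eta = \<eta>, K1 = k1, K2 = k2\<rparr> L \<omega> i \<longrightarrow>
      (\<exists>p q. good_subcurve c L \<omega> \<gamma>1 (i + k1) I1 (\<eta> / 2) (1 / \<eta> / L) p q) \<and>
      (\<exists>p q. good_subcurve c L \<omega> \<gamma>2 (i + k1) I2 (\<eta> / 2) (1 / \<eta> / L) p q))"
    using young_times_curves[OF c gr] by (elim exE) (rule that)
  show "\<exists>h\<^sub>1>0. \<forall>\<eta>\<^sub>1 \<eta>\<^sub>2 k\<^sub>2. 0 < \<eta>\<^sub>1 \<and> \<eta>\<^sub>1 < h\<^sub>1 \<and> 0 < \<eta>\<^sub>2 \<and> \<eta>\<^sub>2 < 1/10 \<and> k\<^sub>2 \<ge> 1 \<longrightarrow>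
      (\<exists>k\<^sub>m\<^sub>i\<^sub>n\<ge>1. \<forall>k\<^sub>1\<ge>k\<^sub>m\<^sub>i\<^sub>n. \<exists>h>0. \<forall>\<eta>. 0 < \<eta> \<and> \<eta> < h \<longrightarrow>
        (let P = ?P \<eta>\<^sub>1 \<eta>\<^sub>2 \<eta> k\<^sub>1 k\<^sub>2
         in \<exists>L\<^sub>0>0. \<exists>b>0. \<exists>C\<^sub>1>0. \<exists>c\<^sub>1>0. \<exists>\<delta>\<^sub>0>0. \<exists>C\<^sub>\<eta>>0. \<forall>L\<ge>L\<^sub>0.
              (\<forall>n\<ge>1. measure (noise \<delta> L)
                 {\<omega>\<in>space (noise \<delta> L). real (card (young_times \<delta> c P L \<omega> n)) \<le> b * real n}
                 \<le> C\<^sub>1 * exp (- c\<^sub>1 * real n)) \<and>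
              (\<forall>\<omega>\<in>space (noise \<delta> L). \<forall>i. young_time \<delta> c P L \<omega> i \<longrightarrow>
                 (\<exists>p q. good_subcurve c L \<omega> \<gamma>1 (i + k\<^sub>1) I1 (2 * \<delta>\<^sub>0) (C\<^sub>\<eta> / L) p q) \<and>
                 (\<exists>p q. good_subcurve c L \<omega> \<gamma>2 (i + k\<^sub>1) I2 (2 * \<delta>\<^sub>0) (C\<^sub>\<eta> / L) p q))))"
  proof (rule exI[of _ h1], intro conjI[OF h1(1)] allI impI, elim conjE)
    fix \<eta>1 \<eta>2 :: real and k2 :: nat
    assume e: "0 < \<eta>1" "\<eta>1 < h1" "0 < \<eta>2" "\<eta>2 < 1/10"
    show "\<exists>k\<^sub>m\<^sub>i\<^sub>n\<ge>1. \<forall>k\<^sub>1\<ge>k\<^sub>m\<^sub>i\<^sub>n. \<exists>h>0. \<forall>\<eta>. 0 < \<eta> \<and> \<eta> < h \<longrightarrow>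
        (let P = ?P \<eta>1 \<eta>2 \<eta> k\<^sub>1 k2
         in \<exists>L\<^sub>0>0. \<exists>b>0. \<exists>C\<^sub>1>0. \<exists>c\<^sub>1>0. \<exists>\<delta>\<^sub>0>0. \<exists>C\<^sub>\<eta>>0. \<forall>L\<ge>L\<^sub>0.
              (\<forall>n\<ge>1. measure (noise \<delta> L)
                 {\<omega>\<in>space (noise \<delta> L). real (card (young_times \<delta> c P L \<omega> n)) \<le> b * real n}
                 \<le> C\<^sub>1 * exp (- c\<^sub>1 * real n)) \<and>
              (\<forall>\<omega>\<in>space (noise \<delta> L). \<forall>i. young_time \<delta> c P L \<omega> i \<longrightarrow>
                 (\<exists>p q. good_subcurve c L \<omega> \<gamma>1 (i + k\<^sub>1) I1 (2 * \<delta>\<^sub>0) (C\<^sub>\<eta> / L) p q) \<and>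
                 (\<exists>p q. good_subcurve c L \<omega> \<gamma>2 (i + k\<^sub>1) I2 (2 * \<delta>\<^sub>0) (C\<^sub>\<eta> / L) p q)))"
    proof (rule exI[of _ "max 2 kmin"], intro conjI allI impI)
      \<comment> \<open>At least two iterates of \<open>F\<close> make the chain at least six single
        steps long; \<open>kmin\<close> serves the curves.\<close>
      show "1 \<le> max 2 kmin" by simp
      fix k1 assume k1: "max 2 kmin \<le> k1"
      have k1_ge: "2 \<le> k1" using k1 by simp
      obtain h where h: "h > 0" "\<forall>\<eta>. 0 < \<eta> \<and> \<eta> < h \<longrightarrow> (\<exists>b>0. \<exists>C1>0. \<exists>c1>0. \<forall>\<^sub>F L in at_top. \<forall>n. measure (noise \<delta> L)
        {\<omega>\<in>space (noise \<delta> L). real (card (young_times \<delta> c (?P \<eta>1 \<eta>2 \<eta> k1 k2) L \<omega> n)) \<le> b * real n} \<le> C1 * exp (- c1 * real n))"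
        using mp[OF spec[OF spec[OF spec[OF spec[OF h1(2)]]]], OF conjI[OF e(1) conjI[OF e(2) conjI[OF e(3) conjI[OF e(4) k1_ge]]]], of k2]
        by (elim exE conjE) (rule that)
      show "\<exists>h>0. \<forall>\<eta>. 0 < \<eta> \<and> \<eta> < h \<longrightarrow>
        (let P = ?P \<eta>1 \<eta>2 \<eta> k1 k2
         in \<exists>L\<^sub>0>0. \<exists>b>0. \<exists>C\<^sub>1>0. \<exists>c\<^sub>1>0. \<exists>\<delta>\<^sub>0>0. \<exists>C\<^sub>\<eta>>0. \<forall>L\<ge>L\<^sub>0.
              (\<forall>n\<ge>1. measure (noise \<delta> L)
                 {\<omega>\<in>space (noise \<delta> L). real (card (young_times \<delta> c P L \<omega> n)) \<le> b * real n}
                 \<le> C\<^sub>1 * exp (- c\<^sub>1 * real n)) \<and>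
              (\<forall>\<omega>\<in>space (noise \<delta> L). \<forall>i. young_time \<delta> c P L \<omega> i \<longrightarrow>
                 (\<exists>p q. good_subcurve c L \<omega> \<gamma>1 (i + k1) I1 (2 * \<delta>\<^sub>0) (C\<^sub>\<eta> / L) p q) \<and>
                 (\<exists>p q. good_subcurve c L \<omega> \<gamma>2 (i + k1) I2 (2 * \<delta>\<^sub>0) (C\<^sub>\<eta> / L) p q)))"
      proof (rule exI[of _ h], intro conjI[OF h(1)] allI impI)
        fix \<eta> assume \<eta>: "0 < \<eta> \<and> \<eta> < h"
        obtain b C1 c1 where b: "b > 0" "C1 > 0" "c1 > 0" and ev1: "\<forall>\<^sub>F L in at_top. \<forall>n. measure (noise \<delta> L)
          {\<omega>\<in>space (noise \<delta> L). real (card (young_times \<delta> c (?P \<eta>1 \<eta>2 \<eta> k1 k2) L \<omega> n)) \<le> b * real n} \<le> C1 * exp (- c1 * real n)"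
          using mp[OF spec[OF h(2)] \<eta>] by (elim exE conjE) (rule that)
        have ev2: "\<forall>\<^sub>F L in at_top. \<forall>\<omega>\<in>space (noise \<delta> L). \<forall>i. young_time \<delta> c (?P \<eta>1 \<eta>2 \<eta> k1 k2) L \<omega> i \<longrightarrow>
          (\<exists>p q. good_subcurve c L \<omega> \<gamma>1 (i + k1) I1 (\<eta> / 2) (1 / \<eta> / L) p q) \<and>
          (\<exists>p q. good_subcurve c L \<omega> \<gamma>2 (i + k1) I2 (\<eta> / 2) (1 / \<eta> / L) p q)"
          by (rule kmin[rule_format]) (use k1 e \<eta> adm in simp)
        obtain L0 where L0: "\<forall>L\<ge>L0. (\<forall>n. measure (noise \<delta> L)
          {\<omega>\<in>space (noise \<delta> L). real (card (young_times \<delta> c (?P \<eta>1 \<eta>2 \<eta> k1 k2) L \<omega> n)) \<le> b * real n} \<le> C1 * exp (- c1 * real n)) \<and>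
          (\<forall>\<omega>\<in>space (noise \<delta> L). \<forall>i. young_time \<delta> c (?P \<eta>1 \<eta>2 \<eta> k1 k2) L \<omega> i \<longrightarrow>
          (\<exists>p q. good_subcurve c L \<omega> \<gamma>1 (i + k1) I1 (\<eta> / 2) (1 / \<eta> / L) p q) \<and>
          (\<exists>p q. good_subcurve c L \<omega> \<gamma>2 (i + k1) I2 (\<eta> / 2) (1 / \<eta> / L) p q))"
          using eventually_conj[OF ev1 ev2] unfolding eventually_at_top_linorder by (elim exE) (rule that)
        show "let P = ?P \<eta>1 \<eta>2 \<eta> k1 k2
         in \<exists>L\<^sub>0>0. \<exists>b>0. \<exists>C\<^sub>1>0. \<exists>c\<^sub>1>0. \<exists>\<delta>\<^sub>0>0. \<exists>C\<^sub>\<eta>>0. \<forall>L\<ge>L\<^sub>0.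
              (\<forall>n\<ge>1. measure (noise \<delta> L)
                 {\<omega>\<in>space (noise \<delta> L). real (card (young_times \<delta> c P L \<omega> n)) \<le> b * real n}
                 \<le> C\<^sub>1 * exp (- c\<^sub>1 * real n)) \<and>
              (\<forall>\<omega>\<in>space (noise \<delta> L). \<forall>i. young_time \<delta> c P L \<omega> i \<longrightarrow>
                 (\<exists>p q. good_subcurve c L \<omega> \<gamma>1 (i + k1) I1 (2 * \<delta>\<^sub>0) (C\<^sub>\<eta> / L) p q) \<and>
                 (\<exists>p q. good_subcurve c L \<omega> \<gamma>2 (i + k1) I2 (2 * \<delta>\<^sub>0) (C\<^sub>\<eta> / L) p q))"
          unfolding Let_def
        proof (intro exI conjI allI impI)
          \<comment> \<open>The witnesses are \<eta>/4 for half the curve length, since the curves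
            are cut at length \<eta>/2, and 1/\<eta> for the cone constant.\<close>
          show "0 < max 1 L0" "0 < b" "0 < C1" "0 < c1" "0 < \<eta> / 4" "0 < 1 / \<eta>" using b \<eta> by auto
          fix L assume L: "max 1 L0 \<le> L"
          then have "L0 \<le> L" by simp
          note L0 = mp[OF spec[OF L0] this]
          show "measure (noise \<delta> L) {\<omega>\<in>space (noise \<delta> L). real (card (young_times \<delta> c (?P \<eta>1 \<eta>2 \<eta> k1 k2) L \<omega> n)) \<le> b * real n}
            \<le> C1 * exp (- c1 * real n)" for n using L0 by blast
          have half: "2 * (\<eta> / 4) = \<eta> / 2" by simp
          show "\<forall>\<omega>\<in>space (noise \<delta> L). \<forall>i. young_time \<delta> c (?P \<eta>1 \<eta>2 \<eta> k1 k2) L \<omega> i \<longrightarrow>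
                 (\<exists>p q. good_subcurve c L \<omega> \<gamma>1 (i + k1) I1 (2 * (\<eta> / 4)) (1 / \<eta> / L) p q) \<and>
                 (\<exists>p q. good_subcurve c L \<omega> \<gamma>2 (i + k1) I2 (2 * (\<eta> / 4)) (1 / \<eta> / L) p q)"
            unfolding half by (rule conjunct2[OF L0])
        qed
      qed
    qed
  qed
qed

end
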